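(* Fix $k\ge1$. For $n\ge k$ let $\mathbf{S_{n,n}}=(S_{1,n},\dots,S_{n,n})^T$ be uniformly distributed on $\mathcal{M}_n(\mathbb{R})$ and let $\mathbf{U_{k,n}}=(U_{1,n},\dots,U_{k,n})^T$ be its first $k$ symmetric canonical moments. Then $$\sqrt{4(p+1)n}\,(\mathbf{U_{k,n}}-\mathbf{U^0_k})\xrightarrow[n\to\infty]{\mathcal{D}}\mathbf{G_k},$$ where $\mathbf{U^0_k}=\tfrac12(I_p,\dots,I_p)^T$ and $\mathbf{G_k}$ consists of $k$ independent GOE matrices.
   Context: A real matrix measure on $[0,1]$: $p\times p$ matrix of signed Borel measures with $\mu(B)$ symmetric nonnegative definite, $\mu([0,1])=I_p$; moments $S_k=\int_0^1x^kd\mu$, $S_0=I_p$; $\mathcal{M}_n(\mathbb{R})\subset(\mathcal{S}_p(\mathbb{R}))^n$ is the set of moment vectors, with uniform distribution of density $\mathcal{V}(\mathcal{M}_n(\mathbb{R}))^{-1}\mathbf{1}_{\mathcal{M}_n(\mathbb{R})}$ with respect to Lebesgue measure ($dX=\prod_{i\le j}dx_{i,j}$ on each factor). With block Hankel matrices $\underline H_{2m}=(S_{i+j})_{i,j=0}^m$, $\overline H_{2m}=(S_{i+j+1}-S_{i+j+2})_{i,j=0}^{m-1}$, $\underline H_{2m+1}=(S_{i+j+1})_{i,j=0}^m$, $\overline H_{2m+1}=(S_{i+j}-S_{i+j+1})_{i,j=0}^m$ and block vectors $\underline h_{2m}=(S_{m+1},\dots,S_{2m})^T$, $\underline h_{2m-1}=(S_m,\dots,S_{2m-1})^T$,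 $\bar h_{2m}=(S_m-S_{m+1},\dots,S_{2m-1}-S_{2m})^T$, $\bar h_{2m-1}=(S_m-S_{m+1},\dots,S_{2m-2}-S_{2m-1})^T$, set $S_1^-=0_p$, $S_1^+=I_p$, $S_2^+=S_1$, $S^-_{n+1}=\underline h_n^T\underline H_{n-1}^{-1}\underline h_n$, $S^+_{n+1}=S_n-\bar h_n^T\overline H_{n-1}^{-1}\bar h_n$; on the interior, $S_k^-<S_k<S_k^+$ and the symmetric canonical moments are $U_k=(S_k^+-S_k^-)^{-1/2}(S_k-S_k^-)(S_k^+-S_k^-)^{-1/2}$. GOE: density $(2\pi)^{-p/2}\pi^{-p(p-1)/4}e^{-\frac12\operatorname{tr}X^2}$ with respect to $dX$. *)

theory Defs
  imports "Jordan_Normal_Form.Matrix" "HOL-Probability.Probability"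
begin

definition sym_mat :: "nat \<Rightarrow> real mat \<Rightarrow> bool" where
  "sym_mat p A \<longleftrightarrow> A \<in> carrier_mat p p \<and> transpose_mat A = A"

definition psd_mat :: "nat \<Rightarrow> real mat \<Rightarrow> bool" where
  "psd_mat p A \<longleftrightarrow> sym_mat p A \<and> (\<forall>v \<in> carrier_vec p. 0 \<le> v \<bullet> (A *\<^sub>v v))"

definition pd_mat :: "nat \<Rightarrow> real mat \<Rightarrow> bool" where
  "pd_mat p A \<longleftrightarrow> sym_mat p A \<and> (\<forall>v \<in> carrier_vec p. v \<noteq> 0\<^sub>v p \<longrightarrow> 0 < v \<bullet> (A *\<^sub>v v))"

definition minv :: "nat \<Rightarrow> real mat \<Rightarrow> real mat" where
  "minv d A = (SOME B. B \<in> carrier_mat d d \<and> A * B = 1\<^sub>m d \<and> B * A = 1\<^sub>m d)"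

definition msqrt :: "nat \<Rightarrow> real mat \<Rightarrow> real mat" where
  "msqrt p A = (THE B. psd_mat p B \<and> B * B = A)"

definition block_hankel :: "nat \<Rightarrow> nat \<Rightarrow> (nat \<Rightarrow> real mat) \<Rightarrow> real mat" where
  "block_hankel p r f = Matrix.mat (r*p) (r*p) (\<lambda>(a,b). f (a div p + b div p) $$ (a mod p, b mod p))"

definition block_vec :: "nat \<Rightarrow> nat \<Rightarrow> (nat \<Rightarrow> real mat) \<Rightarrow> real mat" where
  "block_vec p r f = Matrix.mat (r*p) p (\<lambda>(a,b). f (a div p) $$ (a mod p, b))"

text \<open>A signed finite Borel measure on [0,1] is represented by a pair (P,N) of finite
  Borel measures on [0,1] (Jordan decomposition); its value is P(B) - N(B) and the
  integral of f is the difference of the integrals.\<close>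
definition borel01 :: "real measure" where
  "borel01 = restrict_space borel {0..1}"

definition fin_borel01 :: "real measure \<Rightarrow> bool" where
  "fin_borel01 M \<longleftrightarrow> sets M = sets borel01 \<and> finite_measure M"

definition matrix_measure ::
  "nat \<Rightarrow> (nat \<Rightarrow> nat \<Rightarrow> real measure) \<Rightarrow> (nat \<Rightarrow> nat \<Rightarrow> real measure) \<Rightarrow> bool" where
  "matrix_measure p P N \<longleftrightarrow>
     (\<forall>i<p. \<forall>j<p. fin_borel01 (P i j) \<and> fin_borel01 (N i j)) \<and>
     (\<forall>B \<in> sets borel01.
        psd_mat p (Matrix.mat p p (\<lambda>(i,j). measure (P i j) B - measure (N i j) B))) \<and>
     Matrix.mat p p (\<lambda>(i,j). measure (P i j) {0..1} - measure (N i j) {0..1}) = 1\<^sub>m p"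

definition mmoment ::
  "nat \<Rightarrow> (nat \<Rightarrow> nat \<Rightarrow> real measure) \<Rightarrow> (nat \<Rightarrow> nat \<Rightarrow> real measure) \<Rightarrow> nat \<Rightarrow> real mat" where
  "mmoment p P N k = Matrix.mat p p (\<lambda>(i,j). (\<integral>x. x ^ k \<partial>(P i j)) - (\<integral>x. x ^ k \<partial>(N i j)))"

text \<open>Coordinates of (S_p(R))^n: the entries (m,i,j) with 1 \<le> m \<le> n, i \<le> j < p.\<close>
definition sym_idx :: "nat \<Rightarrow> nat \<Rightarrow> (nat \<times> nat \<times> nat) set" where
  "sym_idx p n = {(m,i,j). 1 \<le> m \<and> m \<le> n \<and> i \<le> j \<and> j < p}"

definition leb_sym :: "nat \<Rightarrow> nat \<Rightarrow> (nat \<times> nat \<times> nat \<Rightarrow> real) measure" where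
  "leb_sym p n = PiM (sym_idx p n) (\<lambda>_. lborel)"

definition Smat :: "nat \<Rightarrow> (nat \<times> nat \<times> nat \<Rightarrow> real) \<Rightarrow> nat \<Rightarrow> real mat" where
  "Smat p x m = (if m = 0 then 1\<^sub>m p else Matrix.mat p p (\<lambda>(i,j). x (m, min i j, max i j)))"

definition moment_space :: "nat \<Rightarrow> nat \<Rightarrow> (nat \<times> nat \<times> nat \<Rightarrow> real) set" where
  "moment_space p n = {x \<in> PiE (sym_idx p n) (\<lambda>_. UNIV).
     \<exists>P N. matrix_measure p P N \<and> (\<forall>m \<in> {1..n}. Smat p x m = mmoment p P N m)}"

definition Sminus :: "nat \<Rightarrow> (nat \<times> nat \<times> nat \<Rightarrow> real) \<Rightarrow> nat \<Rightarrow> real mat" where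
  "Sminus p x k =
    (let S = Smat p x in
     if k \<le> 1 then 0\<^sub>m p p
     else let n = k - 1 in
       if even n then
         (let m = n div 2; h = block_vec p m (\<lambda>i. S (m + 1 + i));
              H = block_hankel p m (\<lambda>t. S (t + 1))
          in transpose_mat h * minv (m*p) H * h)
       else
         (let m = (n + 1) div 2; h = block_vec p m (\<lambda>i. S (m + i));
              H = block_hankel p m (\<lambda>t. S t)
          in transpose_mat h * minv (m*p) H * h))"

definition Splus :: "nat \<Rightarrow> (nat \<times> nat \<times> nat \<Rightarrow> real) \<Rightarrow> nat \<Rightarrow> real mat" where
  "Splus p x k =
    (let S = Smat p x in
     if k \<le> 1 then 1\<^sub>m p
     else if k = 2 then S 1
     else let n = k - 1 in
       if even n then
         (let m = n div 2; h = block_vec p m (\<lambda>i. S (m + i) - S (m + i + 1));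
              H = block_hankel p m (\<lambda>t. S t - S (t + 1))
          in S n - transpose_mat h * minv (m*p) H * h)
       else
         (let m = (n + 1) div 2; h = block_vec p (m - 1) (\<lambda>i. S (m + i) - S (m + i + 1));
              H = block_hankel p (m - 1) (\<lambda>t. S (t + 1) - S (t + 2))
          in S n - transpose_mat h * minv ((m - 1)*p) H * h))"

definition Ucan :: "nat \<Rightarrow> (nat \<times> nat \<times> nat \<Rightarrow> real) \<Rightarrow> nat \<Rightarrow> real mat" where
  "Ucan p x k =
    (let D = minv p (msqrt p (Splus p x k - Sminus p x k))
     in D * (Smat p x k - Sminus p x k) * D)"

definition scaled_U :: "nat \<Rightarrow> nat \<Rightarrow> nat \<Rightarrow> (nat \<times> nat \<times> nat \<Rightarrow> real) \<Rightarrow> (nat \<times> nat \<times> nat \<Rightarrow> real)" where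
  "scaled_U p k n x = (\<lambda>(m,i,j). if (m,i,j) \<in> sym_idx p k then
      sqrt (4 * (real p + 1) * real n) * (Ucan p x m $$ (i,j) - (if i = j then 1/2 else 0))
    else undefined)"

definition goe_density :: "nat \<Rightarrow> real mat \<Rightarrow> real" where
  "goe_density p X = (2*pi) powr (- real p / 2) * pi powr (- real p * (real p - 1) / 4)
      * exp (- 1/2 * (\<Sum>i<p. (X * X) $$ (i,i)))"

definition goe_k :: "nat \<Rightarrow> nat \<Rightarrow> (nat \<times> nat \<times> nat \<Rightarrow> real) measure" where
  "goe_k p k = density (leb_sym p k) (\<lambda>x. ennreal (\<Prod>m\<in>{1..k}. goe_density p (Smat p x m)))"

definition conv_distr :: "(nat \<Rightarrow> 'a::topological_space measure) \<Rightarrow> 'a measure \<Rightarrow> bool" where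
  "conv_distr Ms M \<longleftrightarrow> (\<forall>f :: 'a \<Rightarrow> real. continuous_on UNIV f \<and> bounded (range f) \<longrightarrow>
      (\<lambda>n. \<integral>x. f x \<partial>(Ms n)) \<longlonglongrightarrow> (\<integral>x. f x \<partial>M))"

end

theory Submission
  imports Defs "Jordan_Normal_Form.Determinant"
begin

text \<open>The range \<open>S\<^sup>-\<^sub>m < S\<^sub>m < S\<^sup>+\<^sub>m\<close> of the \<open>m\<close>-th moment depends on the previous moments only, and its width
  \<open>D\<^sub>m = S\<^sup>+\<^sub>m - S\<^sup>-\<^sub>m\<close> satisfies \<open>det D\<^sub>m\<^sub>+\<^sub>1 = det D\<^sub>m det U\<^sub>m det (1 - U\<^sub>m)\<close>. Hence the map from moments to canonical
  moments is triangular, and since the congruence with \<open>D\<^sub>m\<close> to the power \<open>1/2\<close> has Jacobian \<open>det D\<^sub>m\<close> to the power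
  \<open>(p+1)/2\<close>, the canonical moments of a uniform point are independent, with density proportional to
  \<open>det (U\<^sub>m (1 - U\<^sub>m))\<close> to the power \<open>(p+1)(n-m)/2\<close>. With \<open>U\<^sub>m = 1/2 + Z/s\<close> and \<open>s\<^sup>2 = 4(p+1)n\<close> this is a constant
  times \<open>det (1 - 4Z\<^sup>2/s\<^sup>2)\<close> to that power, which converges to \<open>exp (- tr Z\<^sup>2 / 2)\<close> and is dominated by
  \<open>exp (- tr Z\<^sup>2 / 4)\<close> for large \<open>n\<close>.\<close>

hide_type (open) Finite_Cartesian_Product.vec
hide_const (open) Finite_Cartesian_Product.vec Finite_Cartesian_Product.mat Finite_Cartesian_Product.row
  Determinants.det Finite_Cartesian_Product.transpose Finite_Cartesian_Product.vector_matrix_mult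
unbundle no inner_syntax and no vec_syntax

subsection \<open>Quadratic forms and the spectral theorem\<close>

text \<open>The recursion lives on strict Hankel inequalities, whereas the uniform law lives on a
  set defined through measures. The bridge is the truncated matrix moment problem: the closed Hankel
  inequalities characterize the moment space (quadrature in the interior, compactness at the
  boundary), and the strict ones lose no volume, because a contraction towards an interior point
  pushes the whole moment space into them while changing volume by a factor close to 1. The
  determinant identity telescopes: \<open>det D_m\<close> is the product of
  \<open>det U_j det (1 - U_j)\<close> over j < m. Every moment after the j-th therefore contributes
  one Jacobian factor in \<open>U_j\<close>, which is why the exponent counts n - j. The scale is
  forced by ((p+1) n / 2) (4 / s^2) = 1/2. The Jacobian of a congruence is reduced to
  one-dimensional affine substitutions by splitting the matrix into triangular factors. Normalizing
  constants of the canonical moments are never evaluated: one unknown constant per n is fixed by the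
  total mass, once this is positive and finite, and positivity is read off the Gaussian
  limit.\<close>

lemma quad_expand:
  fixes A :: "real mat"
  assumes "A \<in> carrier_mat n n" "v \<in> carrier_vec n"
  shows "v \<bullet> (A *\<^sub>v v) = (\<Sum>i<n. \<Sum>j<n. v $ i * A $$ (i,j) * v $ j)"
  using assms by (auto simp: scalar_prod_def sum_distrib_left lessThan_atLeast0 mult.assoc intro!: sum.cong)

lemma sym_matD:
  assumes "sym_mat n A"
  shows "A \<in> carrier_mat n n" "transpose_mat A = A"
    "\<And>i j. i < n \<Longrightarrow> j < n \<Longrightarrow> A $$ (i,j) = A $$ (j,i)"
proof -
  show A: "A \<in> carrier_mat n n" and T: "transpose_mat A = A" using assms by (auto simp: sym_mat_def)
  show "A $$ (i,j) = A $$ (j,i)" if "i < n" "j < n" for i j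
    using arg_cong[OF T, of "\<lambda>M. M $$ (i,j)"] A that by auto
qed

lemma psd_matD:
  assumes "psd_mat n A"
  shows "sym_mat n A" "A \<in> carrier_mat n n" "transpose_mat A = A"
    "\<And>v. v \<in> carrier_vec n \<Longrightarrow> 0 \<le> v \<bullet> (A *\<^sub>v v)"
  using assms by (auto simp: psd_mat_def sym_mat_def)

lemma pd_matD:
  assumes "pd_mat n A"
  shows "sym_mat n A" "A \<in> carrier_mat n n" "transpose_mat A = A"
    "\<And>v. v \<in> carrier_vec n \<Longrightarrow> v \<noteq> 0\<^sub>v n \<Longrightarrow> 0 < v \<bullet> (A *\<^sub>v v)"
  using assms by (auto simp: pd_mat_def sym_mat_def)

lemma pd_imp_psd: "pd_mat n A \<Longrightarrow> psd_mat n A"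
  unfolding pd_mat_def psd_mat_def sym_mat_def
  by (metis less_eq_real_def mult_mat_vec_carrier scalar_prod_left_zero)

lemma scalar_prod_self_real: "(v :: real vec) \<in> carrier_vec n \<Longrightarrow> v \<bullet> v = (\<Sum>i<n. (v $ i)\<^sup>2)"
  by (auto simp: scalar_prod_def lessThan_atLeast0 power2_eq_square)

lemma scalar_prod_self_eq_0:
  assumes "(v :: real vec) \<in> carrier_vec n" "v \<bullet> v = 0" shows "v = 0\<^sub>v n"
proof (rule eq_vecI)
  have "(\<Sum>i<n. (v $ i)\<^sup>2) = 0" using assms scalar_prod_self_real[OF assms(1)] by simp
  then have "\<forall>i<n. (v $ i)\<^sup>2 = 0" by (subst (asm) sum_nonneg_eq_0_iff) auto
  then show "\<And>i. i < dim_vec (0\<^sub>v n) \<Longrightarrow> v $ i = 0\<^sub>v n $ i" using assms by auto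
qed (use assms in auto)

lemma scalar_prod_mat_adjoint:
  fixes A :: "real mat"
  assumes "A \<in> carrier_mat n m" "v \<in> carrier_vec n" "w \<in> carrier_vec m"
  shows "v \<bullet> (A *\<^sub>v w) = (transpose_mat A *\<^sub>v v) \<bullet> w"
  using transpose_vec_mult_scalar[of A n m w v] assms by auto

text \<open>At a zero of a nonnegative form the gradient must vanish: moving from \<open>v\<close>
  by \<open>t u\<close> with \<open>u = B v\<close> changes the form by
  \<open>2 t |u|^2 + O(t^2)\<close>, which is negative for some negative \<open>t\<close> unless
  \<open>u = 0\<close>.\<close>

lemma psd_kernel:
  assumes B: "psd_mat n B" and v: "v \<in> carrier_vec n" and 0: "v \<bullet> (B *\<^sub>v v) = 0"
  shows "B *\<^sub>v v = 0\<^sub>v n"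
proof -
  note D = psd_matD[OF B]
  define u where "u = B *\<^sub>v v"
  have u: "u \<in> carrier_vec n" using D v by (auto simp: u_def)
  define b where "b = u \<bullet> (B *\<^sub>v v)"
  define c where "c = u \<bullet> (B *\<^sub>v u)"
  have bs: "v \<bullet> (B *\<^sub>v u) = b"
    using scalar_prod_mat_adjoint[OF D(2) v u] D(3) comm_scalar_prod[of u n "B *\<^sub>v v"] u v D(2) by (simp add: b_def)
  have q: "0 \<le> 2 * t * b + t\<^sup>2 * c" for t
  proof -
    have "0 \<le> (v + t \<cdot>\<^sub>v u) \<bullet> (B *\<^sub>v (v + t \<cdot>\<^sub>v u))" using D(4) u v by auto
    also have "B *\<^sub>v (v + t \<cdot>\<^sub>v u) = B *\<^sub>v v + t \<cdot>\<^sub>v (B *\<^sub>v u)"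
      using D(2) u v by (simp add: mult_add_distrib_mat_vec[of _ n n] mult_mat_vec[of _ n n])
    also have "(v + t \<cdot>\<^sub>v u) \<bullet> \<dots> = v \<bullet> (B *\<^sub>v v) + t * (v \<bullet> (B *\<^sub>v u)) + t * (u \<bullet> (B *\<^sub>v v)) + t * (t * (u \<bullet> (B *\<^sub>v u)))"
      using D(2) u v by (simp add: add_scalar_prod_distrib[of _ n] scalar_prod_add_distrib[of _ n] algebra_simps)
    finally show ?thesis using 0 bs by (simp add: b_def[symmetric] c_def[symmetric] power2_eq_square algebra_simps)
  qed
  have c0: "c \<ge> 0" using D(4)[OF u] by (simp add: c_def)
  have "b = 0"
  proof (rule ccontr)
    assume "b \<noteq> 0"
    \<comment> \<open>The step is \<open>t = -b/(c+1)\<close> rather than the minimizer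
      \<open>-b/c\<close>, since \<open>c\<close> may be 0.\<close>
    define d where "d = c + 1"
    have d: "d > 0" "c = d - 1" using c0 by (auto simp: d_def)
    have "2 * (- b / d) * b + (- b / d)\<^sup>2 * c = - (b\<^sup>2 * (d + 1)) / d\<^sup>2"
      using d(1) unfolding d(2) by (simp add: field_simps power2_eq_square)
    also have "\<dots> < 0" using \<open>b \<noteq> 0\<close> d by (simp add: divide_neg_pos)
    finally show False using q[of "- b / d"] by linarith
  qed
  then have "u \<bullet> u = 0" by (simp add: b_def u_def)
  then show ?thesis using scalar_prod_self_eq_0[OF u] by (simp add: u_def)
qed

text \<open>Tychonoff's theorem. Both compactness arguments, for unit vectors and for atomic
  measures, run on functions on an index set.\<close>

lemma compact_Pi_UNIV:
  fixes S :: "'a \<Rightarrow> 'b::topological_space set"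
  assumes "\<And>i. compact (S i)" shows "compact (PiE UNIV S)"
  using compactin_PiE[of "\<lambda>_. euclidean" UNIV S] assms
  by (simp add: euclidean_product_topology)

text \<open>Rayleigh quotient: if the form attains its maximum \<open>l\<close> over the unit sphere
  at \<open>v\<close>, then \<open>l - A\<close> is semidefinite and its form vanishes at
  \<open>v\<close>, so \<open>psd_kernel\<close> gives \<open>(l - A) v = 0\<close>.\<close>

lemma symmetric_eigenvector:
  assumes A: "sym_mat n A" and n: "0 < n"
  obtains v l where "v \<in> carrier_vec n" "v \<bullet> v = 1" "A *\<^sub>v v = l \<cdot>\<^sub>v v"
proof -
  note D = sym_matD[OF A]
  \<comment> \<open>The unit sphere as a compact set of functions on all of \<open>nat\<close>:
    coordinates from \<open>n\<close> on are pinned to 0.\<close>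
  define K where "K = PiE UNIV (\<lambda>i. if i < n then {-1..1::real} else {0}) \<inter> {f. (\<Sum>i<n. (f i)\<^sup>2) = 1}"
  have "compact K" unfolding K_def
    by (intro compact_Int_closed compact_Pi_UNIV closed_Collect_eq continuous_intros) (auto intro!: continuous_intros continuous_on_product_coordinates)
  moreover have "(\<lambda>i. if i = 0 then 1 else 0) \<in> K"
    using n by (auto simp: K_def if_distrib[of "\<lambda>x. x^2"] cong: if_cong)
  moreover have "continuous_on K (\<lambda>f. \<Sum>i<n. \<Sum>j<n. f i * A $$ (i,j) * f j)"
    by (intro continuous_intros continuous_on_subset[OF continuous_on_product_coordinates]) auto
  ultimately obtain f where f: "f \<in> K" and
    fmax: "\<And>g. g \<in> K \<Longrightarrow> (\<Sum>i<n. \<Sum>j<n. g i * A $$ (i,j) * g j) \<le> (\<Sum>i<n. \<Sum>j<n. f i * A $$ (i,j) * f j)"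
    using continuous_attains_sup[of K "\<lambda>f. \<Sum>i<n. \<Sum>j<n. f i * A $$ (i,j) * f j"] by blast
  define l where "l = (\<Sum>i<n. \<Sum>j<n. f i * A $$ (i,j) * f j)"
  define v where "v = vec n f"
  have v: "v \<in> carrier_vec n" by (simp add: v_def)
  have vv: "v \<bullet> v = 1" using f by (subst scalar_prod_self_real[OF v]) (simp add: K_def v_def)
  have qv: "v \<bullet> (A *\<^sub>v v) = l" unfolding quad_expand[OF D(1) v] l_def by (simp add: v_def)
  have bound: "w \<bullet> (A *\<^sub>v w) \<le> l * (w \<bullet> w)" if w: "w \<in> carrier_vec n" for w
  proof (cases "w \<bullet> w = 0")
    case True
    then show ?thesis using scalar_prod_self_eq_0[OF w] D(1) by simp
  next
    case False
    define r where "r = sqrt (w \<bullet> w)"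
    have ww: "w \<bullet> w > 0" using False scalar_prod_self_real[OF w] by (metis less_eq_real_def sum_nonneg zero_le_power2)
    then have r: "r > 0" "r\<^sup>2 = w \<bullet> w" by (auto simp: r_def)
    define g where "g = (\<lambda>i. if i < n then w $ i / r else 0)"
    have s1: "(\<Sum>i<n. (g i)\<^sup>2) = 1"
      using ww r scalar_prod_self_real[OF w] by (simp add: g_def power_divide sum_divide_distrib[symmetric])
    have "(g i)\<^sup>2 \<le> 1" for i
    proof (cases "i < n")
      case True
      then have "(g i)\<^sup>2 \<le> (\<Sum>i<n. (g i)\<^sup>2)" by (intro member_le_sum) auto
      then show ?thesis using s1 by simp
    qed (simp add: g_def)
    then have "\<bar>g i\<bar> \<le> 1" for i by (simp add: abs_square_le_1)
    then have "g i \<in> (if i < n then {-1..1} else {0})" for i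
      using abs_le_iff[of "g i" 1] by (auto simp: g_def)
    then have "g \<in> K" using s1 by (auto simp: K_def)
    from fmax[OF this] have "(\<Sum>i<n. \<Sum>j<n. g i * A $$ (i,j) * g j) \<le> l" by (simp add: l_def)
    moreover have "(\<Sum>i<n. \<Sum>j<n. g i * A $$ (i,j) * g j) = (w \<bullet> (A *\<^sub>v w)) / r\<^sup>2"
      unfolding quad_expand[OF D(1) w] sum_divide_distrib by (simp add: g_def power2_eq_square)
    ultimately have "(w \<bullet> (A *\<^sub>v w)) / r\<^sup>2 \<le> l" by simp
    then show ?thesis using r ww by (simp add: pos_divide_le_eq)
  qed
  define B where "B = l \<cdot>\<^sub>m 1\<^sub>m n - A"
  have Bc: "B \<in> carrier_mat n n" using D by (auto simp: B_def)
  have Bw: "B *\<^sub>v w = l \<cdot>\<^sub>v w - A *\<^sub>v w" if w: "w \<in> carrier_vec n" for w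
  proof -
    have "row (l \<cdot>\<^sub>m 1\<^sub>m n) i = l \<cdot>\<^sub>v unit_vec n i" if "i < n" for i
      using that by (intro eq_vecI) auto
    then have "(l \<cdot>\<^sub>m 1\<^sub>m n) *\<^sub>v w = l \<cdot>\<^sub>v w" using w by (intro eq_vecI) auto
    then show ?thesis using w D(1) by (simp add: B_def minus_mult_distrib_mat_vec[of _ n n])
  qed
  have "psd_mat n B" unfolding psd_mat_def sym_mat_def
  proof (intro conjI ballI)
    show "transpose_mat B = B" using D by (intro eq_matI) (auto simp: B_def)
    fix w :: "real vec" assume w: "w \<in> carrier_vec n"
    show "0 \<le> w \<bullet> (B *\<^sub>v w)" unfolding Bw[OF w]
      using bound[OF w] w D(1) by (simp add: scalar_prod_minus_distrib[of _ n])
  qed (use Bc in auto)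
  moreover have "v \<bullet> (B *\<^sub>v v) = 0" unfolding Bw[OF v] using v D(1) qv vv
    by (simp add: scalar_prod_minus_distrib[of _ n])
  ultimately have B0: "B *\<^sub>v v = 0\<^sub>v n" using psd_kernel v by blast
  have "A *\<^sub>v v = l \<cdot>\<^sub>v v"
  proof (rule eq_vecI)
    fix i assume "i < dim_vec (l \<cdot>\<^sub>v v)"
    then have i: "i < n" using v by simp
    have "(l \<cdot>\<^sub>v v - A *\<^sub>v v) $ i = 0" using B0 Bw[OF v] i by simp
    then show "(A *\<^sub>v v) $ i = (l \<cdot>\<^sub>v v) $ i" using i v D(1) by auto
  qed (use v D(1) in auto)
  then show ?thesis using that v vv by blast
qed

lemma square_assoc:
  fixes A B C :: "real mat"
  shows "A \<in> carrier_mat n n \<Longrightarrow> B \<in> carrier_mat n n \<Longrightarrow> C \<in> carrier_mat n n \<Longrightarrow> (A * B) * C = A * (B * C)"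
  by (rule assoc_mult_mat)

lemma square_carrier [simp]:
  "A \<in> carrier_mat n n \<Longrightarrow> B \<in> carrier_mat n n \<Longrightarrow> A * B \<in> carrier_mat n n"
  by (rule mult_carrier_mat)

definition orth_mat :: "nat \<Rightarrow> real mat \<Rightarrow> bool" where
  "orth_mat n Q \<longleftrightarrow> Q \<in> carrier_mat n n \<and> transpose_mat Q * Q = 1\<^sub>m n \<and> Q * transpose_mat Q = 1\<^sub>m n"

lemma orth_mat_mult:
  assumes "orth_mat n P" "orth_mat n Q" shows "orth_mat n (P * Q)"
proof -
  have c: "P \<in> carrier_mat n n" "Q \<in> carrier_mat n n" "transpose_mat P \<in> carrier_mat n n" "transpose_mat Q \<in> carrier_mat n n"
   and P: "transpose_mat P * P = 1\<^sub>m n" "P * transpose_mat P = 1\<^sub>m n"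
   and Q: "transpose_mat Q * Q = 1\<^sub>m n" "Q * transpose_mat Q = 1\<^sub>m n"
    using assms by (auto simp: orth_mat_def)
  have "transpose_mat Q * transpose_mat P * (P * Q) = transpose_mat Q * ((transpose_mat P * P) * Q)"
    using c by (simp add: square_assoc[of _ n])
  also have "\<dots> = 1\<^sub>m n" unfolding P using c Q by simp
  finally have 1: "transpose_mat Q * transpose_mat P * (P * Q) = 1\<^sub>m n" .
  have "P * Q * (transpose_mat Q * transpose_mat P) = P * ((Q * transpose_mat Q) * transpose_mat P)"
    using c by (simp add: square_assoc[of _ n])
  also have "\<dots> = 1\<^sub>m n" unfolding Q using c P by simp
  finally show ?thesis using 1 c by (simp add: orth_mat_def transpose_mult[of _ n n _ n])
qed

text \<open>\<open>H\<close> is the Householder reflection that exchanges \<open>v\<close> and the first unit vector.\<close>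

lemma orth_mat_first_column:
  assumes v: "v \<in> carrier_vec n" and vv: "v \<bullet> v = (1::real)" and n: "0 < n"
  obtains H where "orth_mat n H" "transpose_mat H = H" "col H 0 = v"
proof (cases "v = unit_vec n 0")
  case True
  show ?thesis by (rule that[of "1\<^sub>m n"]) (use n True in \<open>auto simp: orth_mat_def\<close>)
next
  case False
  define w where "w = v - unit_vec n 0"
  have w: "w \<in> carrier_vec n" using v by (simp add: w_def)
  define c where "c = w \<bullet> w"
  have c0: "c \<noteq> 0"
  proof
    assume "c = 0"
    then have w0: "w = 0\<^sub>v n" using scalar_prod_self_eq_0[OF w] by (simp add: c_def)
    have "v = unit_vec n 0"
    proof (rule eq_vecI)
      fix i assume "i < dim_vec (unit_vec n 0 :: real vec)"
      then show "v $ i = unit_vec n 0 $ i" using arg_cong[OF w0, of "\<lambda>x. x $ i"] v by (simp add: w_def)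
    qed (use v in auto)
    then show False using False by simp
  qed
  have cs: "c = (\<Sum>k<n. w $ k * w $ k)" using scalar_prod_self_real[OF w] by (simp add: c_def power2_eq_square)
  have "c = v \<bullet> v - v \<bullet> unit_vec n 0 - (unit_vec n 0 \<bullet> v - unit_vec n 0 \<bullet> unit_vec n 0)"
    unfolding c_def w_def using v n by (simp add: minus_scalar_prod_distrib[of _ n] scalar_prod_minus_distrib[of _ n])
  then have c2: "c = 2 - 2 * v $ 0" using v n vv by simp
  define H where "H = mat n n (\<lambda>(i,j). (if i = j then 1 else 0) - 2 / c * w $ i * w $ j)"
  have H: "H \<in> carrier_mat n n" and HT: "transpose_mat H = H" by (auto simp: H_def)
  have HH: "H * H = 1\<^sub>m n"
  proof (rule eq_matI)
    fix i j assume "i < dim_row (1\<^sub>m n :: real mat)" "j < dim_col (1\<^sub>m n :: real mat)"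
    then have ij: "i < n" "j < n" by auto
    have "(H * H) $$ (i,j) = (\<Sum>k<n. H $$ (i,k) * H $$ (k,j))"
      using H ij by (auto simp: scalar_prod_def lessThan_atLeast0)
    also have "\<dots> = (\<Sum>k<n. (if i = k then (if k = j then 1 else 0) else 0) - (if i = k then 2 / c * w $ k * w $ j else 0)
       - (if k = j then 2 / c * w $ i * w $ k else 0) + (2 / c)\<^sup>2 * w $ i * w $ j * (w $ k * w $ k))"
      using ij by (intro sum.cong) (auto simp: H_def algebra_simps power2_eq_square)
    also have "\<dots> = (if i = j then 1 else 0) - 2 * (2 / c * w $ i * w $ j) + (2 / c)\<^sup>2 * w $ i * w $ j * c"
      using ij unfolding cs by (simp add: sum.distrib sum_subtractf sum_distrib_left[symmetric])
    also have "\<dots> = (if i = j then 1 else 0)" using c0 by (simp add: power2_eq_square field_simps)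
    finally show "(H * H) $$ (i,j) = 1\<^sub>m n $$ (i,j)" using ij by simp
  qed (use H in auto)
  have "col H 0 = v"
  proof (rule eq_vecI)
    fix i assume "i < dim_vec v"
    then have i: "i < n" using v by simp
    have w0: "w $ 0 = - c / 2" using n v c2 by (simp add: w_def)
    have "col H 0 $ i = (if i = 0 then 1 else 0) + w $ i" using i n c0 by (simp add: H_def w0)
    then show "col H 0 $ i = v $ i" using i v n by (simp add: w_def)
  qed (use H v in auto)
  then show ?thesis using that[of H] H HT HH by (simp add: orth_mat_def)
qed

text \<open>Deflation: reflecting a unit eigenvector to the first unit vector makes the first column
  of \<open>H A H\<close> a multiple of that vector. Symmetry clears the first row as well, and the
  remaining block is diagonalized by induction.\<close>

theorem spectral_theorem:
  "sym_mat n A \<Longrightarrow> \<exists>Q f. orth_mat n Q \<and> A = Q * mat_diag n f * transpose_mat Q"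
proof (induction n arbitrary: A)
  case 0
  then have "A \<in> carrier_mat 0 0" by (simp add: sym_mat_def)
  then show ?case by (intro exI[of _ "1\<^sub>m 0"] exI[of _ "\<lambda>_. 0"]) (auto simp: orth_mat_def)
next
  case (Suc n)
  note D = sym_matD[OF Suc.prems]
  obtain v l where v: "v \<in> carrier_vec (Suc n)" "v \<bullet> v = 1" and Av: "A *\<^sub>v v = l \<cdot>\<^sub>v v"
    using symmetric_eigenvector[OF Suc.prems] by auto
  obtain H where H: "orth_mat (Suc n) H" and HT: "transpose_mat H = H" and H0: "col H 0 = v"
    using orth_mat_first_column[OF v] by auto
  have Hc: "H \<in> carrier_mat (Suc n) (Suc n)" and HH: "H * H = 1\<^sub>m (Suc n)"
    using H HT by (auto simp: orth_mat_def)
  define B where "B = H * A * H"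
  have Bc: "B \<in> carrier_mat (Suc n) (Suc n)" using Hc D by (simp add: B_def)
  have BT: "transpose_mat B = B" unfolding B_def using Hc D HT by (simp add: transpose_mult[of _ "Suc n" "Suc n" _ "Suc n"])
  have sB: "sym_mat (Suc n) B" using Bc BT by (simp add: sym_mat_def)
  have Hv: "H *\<^sub>v v = unit_vec (Suc n) 0"
  proof -
    have "col (H * H) 0 = H *\<^sub>v col H 0" using Hc by (intro eq_vecI) auto
    then show ?thesis using HH H0 by (simp)
  qed
  have "col B 0 = H *\<^sub>v (A *\<^sub>v col H 0)"
  proof -
    have "col B 0 = (H * A) *\<^sub>v col H 0" unfolding B_def using Hc D(1)
      by (intro col_mult2[of _ "Suc n" "Suc n" _ "Suc n"]) auto
    also have "\<dots> = H *\<^sub>v (A *\<^sub>v col H 0)" using Hc D v H0 by simp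
    finally show ?thesis .
  qed
  then have cB: "col B 0 = l \<cdot>\<^sub>v unit_vec (Suc n) 0" using Hc v unfolding H0 Av Hv[symmetric]
    by (simp add: mult_mat_vec[of _ "Suc n" "Suc n"])
  have B0: "B $$ (i,0) = (if i = 0 then l else 0)" if "i < Suc n" for i
    using arg_cong[OF cB, of "\<lambda>x. x $ i"] that Bc by auto
  have B0': "B $$ (0,i) = (if i = 0 then l else 0)" if "i < Suc n" for i
    using B0[OF that] sym_matD(3)[OF sB that, of 0] by simp
  define C where "C = mat n n (\<lambda>(i,j). B $$ (Suc i, Suc j))"
  have sC: "sym_mat n C" using sym_matD(3)[OF sB] by (auto simp: sym_mat_def C_def)
  obtain Q f where Q: "orth_mat n Q" and C: "C = Q * mat_diag n f * transpose_mat Q" using Suc.IH[OF sC] by auto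
  have Qc: "Q \<in> carrier_mat n n" "transpose_mat Q * Q = 1\<^sub>m n" "Q * transpose_mat Q = 1\<^sub>m n" using Q by (auto simp: orth_mat_def)
  define E where "E = four_block_mat (1\<^sub>m 1) (0\<^sub>m 1 n) (0\<^sub>m n 1) Q"
  define g where "g = (\<lambda>i. case i of 0 \<Rightarrow> l | Suc i \<Rightarrow> f i)"
  have Ec: "E \<in> carrier_mat (Suc n) (Suc n)" using Qc by (auto simp: E_def)
  have ET: "transpose_mat E = four_block_mat (1\<^sub>m 1) (0\<^sub>m 1 n) (0\<^sub>m n 1) (transpose_mat Q)"
    unfolding E_def using Qc by (subst transpose_four_block_mat) auto
  have one: "four_block_mat (1\<^sub>m 1) (0\<^sub>m 1 n) (0\<^sub>m n 1) (1\<^sub>m n) = (1\<^sub>m (Suc n) :: real mat)"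
    by (intro eq_matI) auto
  have "transpose_mat E * E = 1\<^sub>m (Suc n)" unfolding ET unfolding E_def
    by (subst mult_four_block_mat[of _ 1 1 _ n _ n]) (use Qc one in auto)
  moreover have "E * transpose_mat E = 1\<^sub>m (Suc n)" unfolding ET unfolding E_def
    by (subst mult_four_block_mat[of _ 1 1 _ n _ n]) (use Qc one in auto)
  ultimately have oE: "orth_mat (Suc n) E" using Ec by (simp add: orth_mat_def)
  have dg: "mat_diag (Suc n) g = four_block_mat (l \<cdot>\<^sub>m 1\<^sub>m 1) (0\<^sub>m 1 n) (0\<^sub>m n 1) (mat_diag n f)"
    by (intro eq_matI) (auto simp: mat_diag_def g_def split: nat.splits)
  have "B = four_block_mat (l \<cdot>\<^sub>m 1\<^sub>m 1) (0\<^sub>m 1 n) (0\<^sub>m n 1) C"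
  proof (rule eq_matI)
    fix i j assume "i < dim_row (four_block_mat (l \<cdot>\<^sub>m 1\<^sub>m 1) (0\<^sub>m 1 n) (0\<^sub>m n 1) C)" "j < dim_col (four_block_mat (l \<cdot>\<^sub>m 1\<^sub>m 1) (0\<^sub>m 1 n) (0\<^sub>m n 1) C)"
    then have ij: "i < Suc n" "j < Suc n" by (auto simp: C_def)
    then show "B $$ (i,j) = four_block_mat (l \<cdot>\<^sub>m 1\<^sub>m 1) (0\<^sub>m 1 n) (0\<^sub>m n 1) C $$ (i,j)"
      using B0[of i] B0'[of j] by (cases i; cases j) (auto simp: C_def)
  qed (use Bc in \<open>auto simp: C_def\<close>)
  also have "\<dots> = four_block_mat (l \<cdot>\<^sub>m 1\<^sub>m 1) (0\<^sub>m 1 n) (0\<^sub>m n 1) (Q * mat_diag n f) * transpose_mat E"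
    unfolding ET C by (subst mult_four_block_mat[of _ 1 1 _ n _ n])
      (use Qc right_mult_zero_mat[OF square_carrier[OF Qc(1) mat_diag_dim[of n f]], of 1] in auto)
  also have "four_block_mat (l \<cdot>\<^sub>m 1\<^sub>m 1) (0\<^sub>m 1 n) (0\<^sub>m n 1) (Q * mat_diag n f) = E * mat_diag (Suc n) g"
    unfolding dg E_def by (subst mult_four_block_mat[of _ 1 1 _ n _ n]) (use Qc carrier_matD[OF mat_diag_dim[of n f]] in auto)
  finally have BE: "B = E * mat_diag (Suc n) g * transpose_mat E" .
  have "H * B * H = (H * H) * A * (H * H)" unfolding B_def using Hc D(1) by (simp add: square_assoc[of _ "Suc n"])
  then have "A = H * B * H" using HH Hc D by simp
  also have "\<dots> = (H * E) * mat_diag (Suc n) g * transpose_mat (H * E)"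
    unfolding BE using Hc Ec HT by (simp add: transpose_mult[of _ "Suc n" "Suc n" _ "Suc n"] mat_diag_dim assoc_mult_mat[of _ "Suc n" "Suc n" _ "Suc n" _ "Suc n"])
  finally show ?case using orth_mat_mult[OF H oE] by blast
qed

subsection \<open>Congruence, definiteness and determinants\<close>

lemma quad_congruence:
  fixes A :: "real mat"
  assumes "A \<in> carrier_mat n n" "P \<in> carrier_mat n m" "v \<in> carrier_vec m"
  shows "v \<bullet> ((transpose_mat P * A * P) *\<^sub>v v) = (P *\<^sub>v v) \<bullet> (A *\<^sub>v (P *\<^sub>v v))"
proof -
  have "(transpose_mat P * A * P) *\<^sub>v v = transpose_mat P *\<^sub>v (A *\<^sub>v (P *\<^sub>v v))"
    using assms by (simp add: assoc_mult_mat_vec[of _ m n _ m] assoc_mult_mat_vec[of _ m n _ n])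
  then show ?thesis using scalar_prod_mat_adjoint[of "transpose_mat P" m n v "A *\<^sub>v (P *\<^sub>v v)"] assms
    by simp
qed

lemma sym_congruence:
  assumes "sym_mat n A" "P \<in> carrier_mat n m"
  shows "sym_mat m (transpose_mat P * A * P)"
proof -
  note D = sym_matD[OF assms(1)]
  have "transpose_mat (transpose_mat P * A * P) = transpose_mat P * (transpose_mat A * P)"
    using D(1) assms(2) by (simp add: transpose_mult[of "transpose_mat P" m n "A * P" m] transpose_mult[of A n n P m])
  also have "\<dots> = transpose_mat P * A * P"
    using D(1,2) assms(2) by (simp add: assoc_mult_mat[of _ m n _ n _ m])
  finally show ?thesis using D(1) assms(2) by (simp add: sym_mat_def)
qed

lemma psd_congruence:
  assumes "psd_mat n A" "P \<in> carrier_mat n m"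
  shows "psd_mat m (transpose_mat P * A * P)"
  using sym_congruence[OF psd_matD(1)[OF assms(1)] assms(2)] psd_matD[OF assms(1)] assms(2)
  by (auto simp: psd_mat_def quad_congruence simp del: assoc_mult_mat)

lemma pd_congruence:
  assumes "pd_mat n A" "P \<in> carrier_mat n m" "\<And>v. v \<in> carrier_vec m \<Longrightarrow> P *\<^sub>v v = 0\<^sub>v n \<Longrightarrow> v = 0\<^sub>v m"
  shows "pd_mat m (transpose_mat P * A * P)"
  unfolding pd_mat_def
proof (intro conjI ballI impI)
  show "sym_mat m (transpose_mat P * A * P)" using sym_congruence[OF pd_matD(1)[OF assms(1)] assms(2)] .
  fix v :: "real vec" assume v: "v \<in> carrier_vec m" "v \<noteq> 0\<^sub>v m"
  then have "P *\<^sub>v v \<noteq> 0\<^sub>v n" using assms(3) by blast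
  then show "0 < v \<bullet> (transpose_mat P * A * P *\<^sub>v v)"
    using pd_matD[OF assms(1)] assms(2) v by (simp add: quad_congruence del: assoc_mult_mat)
qed

lemma pd_congruence_iff:
  assumes A: "A \<in> carrier_mat n n" and P: "P \<in> carrier_mat n n" and R: "R \<in> carrier_mat n n" "P * R = 1\<^sub>m n"
  shows "pd_mat n (transpose_mat P * A * P) \<longleftrightarrow> pd_mat n A"
proof -
  have RP: "R * P = 1\<^sub>m n" by (rule mat_mult_left_right_inverse[OF P R])
  have inj: "v = 0\<^sub>v n" if "X \<in> carrier_mat n n" "Y \<in> carrier_mat n n" "Y * X = 1\<^sub>m n" "v \<in> carrier_vec n" "X *\<^sub>v v = 0\<^sub>v n"
    for X Y :: "real mat" and v
  proof -
    have "v = (Y * X) *\<^sub>v v" using that by simp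
    also have "\<dots> = Y *\<^sub>v (X *\<^sub>v v)" by (rule assoc_mult_mat_vec[OF that(2,1,4)])
    also have "\<dots> = 0\<^sub>v n" using that by (intro eq_vecI) auto
    finally show ?thesis .
  qed
  have "transpose_mat R * (transpose_mat P * A * P) * R = transpose_mat (P * R) * A * (P * R)"
    using A P R(1) by (simp add: transpose_mult[of _ n n _ n] square_assoc[of _ n])
  then have "transpose_mat R * (transpose_mat P * A * P) * R = A" using R A by simp
  then show ?thesis
    using pd_congruence[of n A P n] pd_congruence[of n "transpose_mat P * A * P" R n] inj[OF P R(1) RP] inj[OF R(1) P R(2)] P R
    by metis
qed

lemma quad_mat_diag:
  "v \<in> carrier_vec n \<Longrightarrow> v \<bullet> (mat_diag n f *\<^sub>v v) = (\<Sum>i<n. f i * (v $ i)\<^sup>2)" for f :: "nat \<Rightarrow> real"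
  by (subst quad_expand[of _ n])
    (auto simp: mat_diag_def if_distrib if_distribR power2_eq_square mult.commute mult.left_commute cong: if_cong intro!: sum.cong)

lemma sym_mat_diag: "sym_mat n (mat_diag n f)"
  by (auto simp: sym_mat_def mat_diag_def)

lemma quad_mat_diag_unit:
  assumes "i < n"
  shows "unit_vec n i \<bullet> (mat_diag n f *\<^sub>v unit_vec n i) = (f i :: real)"
proof -
  have "(\<Sum>j<n. f j * (unit_vec n i $ j)\<^sup>2) = (\<Sum>j<n. if j = i then f j else 0)"
    using assms by (intro sum.cong) auto
  then show ?thesis using assms by (simp add: quad_mat_diag[of _ n])
qed

lemma psd_mat_diag_iff: "psd_mat n (mat_diag n f) \<longleftrightarrow> (\<forall>i<n. 0 \<le> f i)"
proof
  show "psd_mat n (mat_diag n f) \<Longrightarrow> \<forall>i<n. 0 \<le> f i"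
    using quad_mat_diag_unit[of _ n f] by (metis psd_matD(4) unit_vec_carrier)
qed (auto simp: psd_mat_def sym_mat_diag quad_mat_diag intro!: sum_nonneg)

lemma pd_mat_diag_iff: "pd_mat n (mat_diag n f) \<longleftrightarrow> (\<forall>i<n. 0 < f i)"
proof
  show "pd_mat n (mat_diag n f) \<Longrightarrow> \<forall>i<n. 0 < f i"
    using quad_mat_diag_unit[of _ n f] by (metis pd_matD(4) unit_vec_carrier unit_vec_nonzero)
  assume f: "\<forall>i<n. 0 < f i"
  show "pd_mat n (mat_diag n f)" unfolding pd_mat_def
  proof (intro conjI ballI impI sym_mat_diag)
    fix v :: "real vec" assume v: "v \<in> carrier_vec n" "v \<noteq> 0\<^sub>v n"
    then obtain i where i: "i < n" "v $ i \<noteq> 0"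
      by (metis carrier_vecD eq_vecI index_zero_vec(1) index_zero_vec(2))
    have "0 < f i * (v $ i)\<^sup>2" using f i by simp
    also have "\<dots> \<le> (\<Sum>i<n. f i * (v $ i)\<^sup>2)" using f i by (intro member_le_sum) (auto intro: mult_nonneg_nonneg less_imp_le)
    finally show "0 < v \<bullet> (mat_diag n f *\<^sub>v v)" using v by (simp add: quad_mat_diag)
  qed
qed

text \<open>Functional calculus in a fixed eigenbasis: for one orthogonal \<open>Q\<close> these
  matrices form a commutative algebra, so squares, roots, definiteness, determinant and trace reduce
  to the numbers \<open>f i\<close>.\<close>

definition spec :: "nat \<Rightarrow> real mat \<Rightarrow> (nat \<Rightarrow> real) \<Rightarrow> real mat" where
  "spec n Q f = Q * mat_diag n f * transpose_mat Q"

lemma orth_matD: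
  assumes "orth_mat n Q"
  shows "Q \<in> carrier_mat n n" "transpose_mat Q \<in> carrier_mat n n"
    "transpose_mat Q * Q = 1\<^sub>m n" "Q * transpose_mat Q = 1\<^sub>m n" "orth_mat n (transpose_mat Q)"
  using assms by (auto simp: orth_mat_def)

lemma spec_carrier [simp]: "orth_mat n Q \<Longrightarrow> spec n Q f \<in> carrier_mat n n"
  unfolding spec_def using orth_matD[of n Q] by (auto intro!: square_carrier)

lemma spec_mult:
  assumes "orth_mat n Q" shows "spec n Q f * spec n Q g = spec n Q (\<lambda>i. f i * g i)"
proof -
  note D = orth_matD[OF assms]
  have "spec n Q f * spec n Q g = Q * mat_diag n f * (transpose_mat Q * Q) * mat_diag n g * transpose_mat Q"
    unfolding spec_def using D(1,2) by (simp add: square_assoc[of _ n])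
  also have "\<dots> = Q * (mat_diag n f * mat_diag n g) * transpose_mat Q"
    unfolding D(3) using D(1,2) by (simp add: square_assoc[of _ n] left_mult_one_mat[of _ n n] del: mat_diag_diag)
  finally show ?thesis by (simp add: spec_def)
qed

lemma spec_one: "orth_mat n Q \<Longrightarrow> spec n Q (\<lambda>_. 1) = 1\<^sub>m n"
  using orth_matD[of n Q] by (simp add: spec_def)

lemma spec_entry:
  assumes "orth_mat n Q" "i < n" "j < n"
  shows "spec n Q f $$ (i,j) = (\<Sum>k<n. f k * Q $$ (i,k) * Q $$ (j,k))"
  using assms orth_matD[OF assms(1)] unfolding spec_def
  by (subst mat_diag_mult_right[of _ n]) (auto simp: scalar_prod_def lessThan_atLeast0 mult.commute intro!: sum.cong)

lemma spec_linear:
  assumes "orth_mat n Q"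
  shows "a \<cdot>\<^sub>m spec n Q f + b \<cdot>\<^sub>m spec n Q g = spec n Q (\<lambda>i. a * f i + b * g i)"
proof (rule eq_matI)
  show "dim_row (a \<cdot>\<^sub>m spec n Q f + b \<cdot>\<^sub>m spec n Q g) = dim_row (spec n Q (\<lambda>i. a * f i + b * g i))"
    "dim_col (a \<cdot>\<^sub>m spec n Q f + b \<cdot>\<^sub>m spec n Q g) = dim_col (spec n Q (\<lambda>i. a * f i + b * g i))"
    using spec_carrier[OF assms] by (metis carrier_matD index_add_mat(2,3) index_smult_mat(2,3))+
  fix i j assume "i < dim_row (spec n Q (\<lambda>i. a * f i + b * g i))" "j < dim_col (spec n Q (\<lambda>i. a * f i + b * g i))"
  then have ij: "i < n" "j < n" using carrier_matD[OF spec_carrier[OF assms]] by auto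
  have "(a \<cdot>\<^sub>m spec n Q f + b \<cdot>\<^sub>m spec n Q g) $$ (i,j) = a * spec n Q f $$ (i,j) + b * spec n Q g $$ (i,j)"
    using ij carrier_matD[OF spec_carrier[OF assms]] by simp
  then show "(a \<cdot>\<^sub>m spec n Q f + b \<cdot>\<^sub>m spec n Q g) $$ (i,j) = spec n Q (\<lambda>i. a * f i + b * g i) $$ (i,j)"
    using ij assms by (simp add: spec_entry sum_distrib_left sum.distrib algebra_simps)
qed

lemma spec_conj:
  assumes "orth_mat n Q" shows "transpose_mat Q * spec n Q f * Q = mat_diag n f"
proof -
  note D = orth_matD[OF assms]
  have "transpose_mat Q * spec n Q f * Q = (transpose_mat Q * Q) * mat_diag n f * (transpose_mat Q * Q)"
    unfolding spec_def using D(1,2) by (simp add: square_assoc[of _ n])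
  then show ?thesis unfolding D(3) by (simp add: left_mult_one_mat[of _ n n] right_mult_one_mat[of _ n n])
qed

lemma spec_definite:
  assumes "orth_mat n Q"
  shows "sym_mat n (spec n Q f)" "psd_mat n (spec n Q f) \<longleftrightarrow> (\<forall>i<n. 0 \<le> f i)"
    "pd_mat n (spec n Q f) \<longleftrightarrow> (\<forall>i<n. 0 < f i)"
proof -
  note D = orth_matD[OF assms]
  have e: "spec n Q f = transpose_mat (transpose_mat Q) * mat_diag n f * transpose_mat Q" by (simp add: spec_def)
  show "sym_mat n (spec n Q f)" unfolding e by (rule sym_congruence[OF sym_mat_diag D(2)])
  show "psd_mat n (spec n Q f) \<longleftrightarrow> (\<forall>i<n. 0 \<le> f i)"
    using psd_congruence[of n "mat_diag n f" "transpose_mat Q" n, folded e] psd_congruence[of n "spec n Q f" Q n]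
      spec_conj[OF assms, of f] psd_mat_diag_iff D by metis
  show "pd_mat n (spec n Q f) \<longleftrightarrow> (\<forall>i<n. 0 < f i)"
    using pd_congruence_iff[of "mat_diag n f" n "transpose_mat Q" Q, folded e] D pd_mat_diag_iff mat_diag_dim by metis
qed

lemma sym_matE:
  assumes "sym_mat n A" obtains Q f where "orth_mat n Q" "A = spec n Q f"
  using spectral_theorem[OF assms] by (auto simp: spec_def)

lemma det_mat_diag: "det (mat_diag n f) = (\<Prod>i<n. f i)" for f :: "nat \<Rightarrow> real"
  by (subst det_upper_triangular[of _ n])
    (auto simp: mat_diag_def prod_list_diag_prod lessThan_atLeast0 upper_triangular_def intro!: prod.cong)

lemma det_spec:
  assumes "orth_mat n Q" shows "det (spec n Q f) = (\<Prod>i<n. f i)"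
proof -
  note D = orth_matD[OF assms]
  have "det Q * det (transpose_mat Q) = 1" using det_mult[OF D(1,2)] D(4) by simp
  moreover have "det (spec n Q f) = det Q * det (mat_diag n f) * det (transpose_mat Q)"
    unfolding spec_def using D by (simp add: det_mult[of _ n])
  ultimately show ?thesis by (simp add: det_mat_diag mult.commute mult.left_commute)
qed

lemma pd_det_pos: "pd_mat n A \<Longrightarrow> 0 < det A"
  by (metis det_spec lessThan_iff pd_matD(1) prod_pos spec_definite(3) sym_matE)

definition mtr :: "nat \<Rightarrow> real mat \<Rightarrow> real" where "mtr n A = (\<Sum>i<n. A $$ (i,i))"

lemma mtr_spec:
  assumes "orth_mat n Q" shows "mtr n (spec n Q f) = (\<Sum>k<n. f k)"
proof -
  note D = orth_matD[OF assms]
  have o: "(\<Sum>i<n. Q $$ (i,k) * Q $$ (i,k)) = 1" if "k < n" for k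
    using arg_cong[OF D(3), of "\<lambda>M. M $$ (k,k)"] that D(1) by (auto simp: scalar_prod_def lessThan_atLeast0)
  have "mtr n (spec n Q f) = (\<Sum>i<n. \<Sum>k<n. f k * Q $$ (i,k) * Q $$ (i,k))"
    unfolding mtr_def by (intro sum.cong) (auto simp: spec_entry[OF assms])
  also have "\<dots> = (\<Sum>k<n. f k * (\<Sum>i<n. Q $$ (i,k) * Q $$ (i,k)))"
    by (subst sum.swap) (simp add: sum_distrib_left mult.assoc)
  finally show ?thesis using o by simp
qed

section \<open>The inverse, and its value at singular matrices\<close>

lemma minv_eqI:
  assumes "A \<in> carrier_mat n n" "B \<in> carrier_mat n n" "A * B = 1\<^sub>m n"
  shows "minv n A = B"
proof -
  have BA: "B * A = 1\<^sub>m n" by (rule mat_mult_left_right_inverse[OF assms])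
  define C where "C = minv n A"
  have C: "C \<in> carrier_mat n n" "A * C = 1\<^sub>m n" "C * A = 1\<^sub>m n"
    unfolding C_def minv_def using someI_ex[of "\<lambda>B. B \<in> carrier_mat n n \<and> A * B = 1\<^sub>m n \<and> B * A = 1\<^sub>m n"] assms BA by blast+
  have "C = C * (A * B)" using assms C by simp
  also have "\<dots> = (C * A) * B" using assms C(1) by (simp add: square_assoc[of _ n])
  also have "\<dots> = B" using C assms by simp
  finally show ?thesis by (simp add: C_def)
qed

lemma minv_det:
  assumes A: "A \<in> carrier_mat n n" and d: "det A \<noteq> 0"
  shows "minv n A = (1 / det A) \<cdot>\<^sub>m adj_mat A" "minv n A \<in> carrier_mat n n" "A * minv n A = 1\<^sub>m n" "minv n A * A = 1\<^sub>m n"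
proof -
  note a = adj_mat[OF A]
  have 1: "A * ((1 / det A) \<cdot>\<^sub>m adj_mat A) = 1\<^sub>m n"
  proof -
    have "A * ((1 / det A) \<cdot>\<^sub>m adj_mat A) = (1 / det A) \<cdot>\<^sub>m (det A \<cdot>\<^sub>m 1\<^sub>m n)"
      using A a by (simp add: mult_smult_distrib[of _ n n _ n])
    also have "\<dots> = 1\<^sub>m n" using d by (intro eq_matI) auto
    finally show ?thesis .
  qed
  show e: "minv n A = (1 / det A) \<cdot>\<^sub>m adj_mat A" using minv_eqI[OF A _ 1] a by simp
  show c: "minv n A \<in> carrier_mat n n" "A * minv n A = 1\<^sub>m n" using a 1 unfolding e by auto
  show "minv n A * A = 1\<^sub>m n" by (rule mat_mult_left_right_inverse[OF A c])
qed

text \<open>The defining predicate is empty here, so all singular matrices share one fixed value.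
  This constancy is what makes \<open>minv\<close> measurable across the singular set.\<close>

lemma minv_singular:
  assumes A: "A \<in> carrier_mat n n" and d: "det A = 0"
  shows "minv n A = (SOME B. False)"
proof -
  have "\<not> (B \<in> carrier_mat n n \<and> A * B = 1\<^sub>m n \<and> B * A = 1\<^sub>m n)" for B
    using det_mult[OF A, of B] d by auto
  then show ?thesis unfolding minv_def by (intro arg_cong[of _ _ Eps] ext) blast
qed

lemma minv_pd:
  assumes "pd_mat n A"
  shows "minv n A \<in> carrier_mat n n" "A * minv n A = 1\<^sub>m n" "minv n A * A = 1\<^sub>m n" "transpose_mat (minv n A) = minv n A"
proof -
  note D = pd_matD[OF assms]
  show c: "minv n A \<in> carrier_mat n n" "A * minv n A = 1\<^sub>m n" "minv n A * A = 1\<^sub>m n"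
    using minv_det[OF D(2)] pd_det_pos[OF assms] by auto
  have "A * transpose_mat (minv n A) = transpose_mat (minv n A * A)"
    unfolding transpose_mult[OF c(1) D(2)] D(3) ..
  then have "A * transpose_mat (minv n A) = 1\<^sub>m n" unfolding c(3) by simp
  then show "transpose_mat (minv n A) = minv n A" by (intro minv_eqI[OF D(2), symmetric]) (use c in auto)
qed

subsection \<open>Schur complements\<close>

lemma pd_block_diag:
  assumes A: "A \<in> carrier_mat a a" and C: "C \<in> carrier_mat b b"
  shows "pd_mat (a + b) (four_block_mat A (0\<^sub>m a b) (0\<^sub>m b a) C) \<longleftrightarrow> pd_mat a A \<and> pd_mat b C" (is "pd_mat _ ?M \<longleftrightarrow> _")
proof -
  have z: "0\<^sub>m k l *\<^sub>v x = (0\<^sub>v k :: real vec)" if "x \<in> carrier_vec l" for k l and x :: "real vec"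
    using that by (intro eq_vecI) auto
  have q: "(v @\<^sub>v w) \<bullet> (?M *\<^sub>v (v @\<^sub>v w)) = v \<bullet> (A *\<^sub>v v) + w \<bullet> (C *\<^sub>v w)"
    if "v \<in> carrier_vec a" "w \<in> carrier_vec b" for v w
    using that A C
    by (subst four_block_mat_mult_vec[of _ a a _ b _ b]) (auto simp: z scalar_prod_append[of _ a _ b])
  have T: "transpose_mat ?M = four_block_mat (transpose_mat A) (0\<^sub>m a b) (0\<^sub>m b a) (transpose_mat C)"
    using A C by (subst transpose_four_block_mat[of _ a a _ b _ b]) auto
  have s: "sym_mat (a + b) ?M \<longleftrightarrow> sym_mat a A \<and> sym_mat b C"
  proof
    assume S: "sym_mat (a + b) ?M"
    have "A $$ (i,j) = A $$ (j,i)" if "i < a" "j < a" for i j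
      using sym_matD(3)[OF S, of i j] that A C by auto
    moreover have "C $$ (i,j) = C $$ (j,i)" if "i < b" "j < b" for i j
      using sym_matD(3)[OF S, of "a + i" "a + j"] that A C by auto
    ultimately show "sym_mat a A \<and> sym_mat b C" using A C by (auto simp: sym_mat_def intro!: eq_matI)
  qed (use A C T in \<open>auto simp: sym_mat_def\<close>)
  show ?thesis
  proof
    assume P: "pd_mat (a + b) ?M"
    have "0 < v \<bullet> (A *\<^sub>v v)" if "v \<in> carrier_vec a" "v \<noteq> 0\<^sub>v a" for v
    proof -
      have "v @\<^sub>v 0\<^sub>v b \<noteq> 0\<^sub>v (a + b)"
      proof
        assume "v @\<^sub>v 0\<^sub>v b = 0\<^sub>v (a + b)"
        then have "v @\<^sub>v 0\<^sub>v b = 0\<^sub>v a @\<^sub>v 0\<^sub>v b" by (simp only:) (auto intro!: eq_vecI)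
        then show False using that append_vec_eq[of v a "0\<^sub>v a"] by auto
      qed
      then show ?thesis using pd_matD(4)[OF P, of "v @\<^sub>v 0\<^sub>v b"] q[of v "0\<^sub>v b"] that C by auto
    qed
    moreover have "0 < w \<bullet> (C *\<^sub>v w)" if "w \<in> carrier_vec b" "w \<noteq> 0\<^sub>v b" for w
    proof -
      have "0\<^sub>v a @\<^sub>v w \<noteq> 0\<^sub>v (a + b)"
      proof
        assume "0\<^sub>v a @\<^sub>v w = 0\<^sub>v (a + b)"
        then have "0\<^sub>v a @\<^sub>v w = 0\<^sub>v a @\<^sub>v 0\<^sub>v b" by (simp only:) (auto intro!: eq_vecI)
        then show False using that append_vec_eq[of "0\<^sub>v a" a "0\<^sub>v a" w] by auto
      qed
      then show ?thesis using pd_matD(4)[OF P, of "0\<^sub>v a @\<^sub>v w"] q[of "0\<^sub>v a" w] that A by auto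
    qed
    ultimately show "pd_mat a A \<and> pd_mat b C" using s pd_matD(1)[OF P] by (simp add: pd_mat_def)
  next
    assume P: "pd_mat a A \<and> pd_mat b C"
    show "pd_mat (a + b) ?M" unfolding pd_mat_def
    proof (intro conjI ballI impI)
      show "sym_mat (a + b) ?M" using s P by (simp add: pd_mat_def)
      fix x :: "real vec" assume x: "x \<in> carrier_vec (a + b)" "x \<noteq> 0\<^sub>v (a + b)"
      define v w where "v = vec_first x a" and "w = vec_last x b"
      have xe: "x = v @\<^sub>v w" and v: "v \<in> carrier_vec a" and w: "w \<in> carrier_vec b"
        using x by (auto simp: v_def w_def)
      have nz: "v \<noteq> 0\<^sub>v a \<or> w \<noteq> 0\<^sub>v b" using x xe by (auto intro!: eq_vecI)
      have "0 \<le> v \<bullet> (A *\<^sub>v v)" "0 \<le> w \<bullet> (C *\<^sub>v w)"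
        using P v w pd_imp_psd psd_matD(4) by blast+
      moreover have "0 < v \<bullet> (A *\<^sub>v v) \<or> 0 < w \<bullet> (C *\<^sub>v w)" using nz P v w pd_matD(4) by blast
      ultimately show "0 < x \<bullet> (?M *\<^sub>v x)" unfolding xe q[OF v w] by linarith
    qed
  qed
qed

lemma det_block_diag:
  fixes A C :: "real mat"
  assumes "A \<in> carrier_mat a a" "C \<in> carrier_mat b b"
  shows "det (four_block_mat A (0\<^sub>m a b) (0\<^sub>m b a) C) = det A * det C"
  using assms by (intro det_four_block_mat_lower_left_zero[of _ a _ b]) auto

context
  fixes A B D :: "real mat" and a b :: nat
  assumes A: "pd_mat a A" and B: "B \<in> carrier_mat a b" and D: "D \<in> carrier_mat b b"
begin

abbreviation (input) "SC \<equiv> D - transpose_mat B * minv a A * B"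

lemma schur_carriers:
  shows "A \<in> carrier_mat a a" "minv a A * B \<in> carrier_mat a b" "SC \<in> carrier_mat b b"
    "transpose_mat (minv a A * B) = transpose_mat B * minv a A"
    "transpose_mat B * minv a A * A = transpose_mat B" "A * (minv a A * B) = B"
    "transpose_mat B * minv a A * B \<in> carrier_mat b b" "transpose_mat B * minv a A \<in> carrier_mat b a"
    "transpose_mat B \<in> carrier_mat b a"
proof -
  note M = minv_pd[OF A] and DA = pd_matD[OF A]
  show "A \<in> carrier_mat a a" by (rule DA(2))
  show "minv a A * B \<in> carrier_mat a b" "SC \<in> carrier_mat b b" "transpose_mat B * minv a A * B \<in> carrier_mat b b"
    "transpose_mat B * minv a A \<in> carrier_mat b a" "transpose_mat B \<in> carrier_mat b a"
    using M B D by auto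
  show "transpose_mat (minv a A * B) = transpose_mat B * minv a A"
    using M B by (simp add: transpose_mult[of _ a a _ b])
  have "transpose_mat B * minv a A * A = transpose_mat B * (minv a A * A)"
    using M DA B by (intro assoc_mult_mat[of _ b a _ a _ a]) auto
  then show "transpose_mat B * minv a A * A = transpose_mat B" using M B by simp
  have "A * (minv a A * B) = (A * minv a A) * B"
    using M DA B by (intro assoc_mult_mat[symmetric, of _ a a _ a _ b]) auto
  then show "A * (minv a A * B) = B" using M B by simp
qed

text \<open>Block elimination: the matrix is congruent, by a unipotent block triangular
  \<open>T\<close>, to the block diagonal matrix of \<open>A\<close> and the Schur complement. Since
  \<open>det T = 1\<close> and \<open>T\<close> is invertible, determinant and definiteness can be
  read off the blocks.\<close>

lemma schur_lower_right:
  "det (four_block_mat A B (transpose_mat B) D) = det A * det SC"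
  "pd_mat (a + b) (four_block_mat A B (transpose_mat B) D) \<longleftrightarrow> pd_mat b SC"
proof -
  note c = schur_carriers
  define X where "X = minv a A * B"
  define T where "T = four_block_mat (1\<^sub>m a) X (0\<^sub>m b a) (1\<^sub>m b)"
  define R where "R = four_block_mat (1\<^sub>m a) (- X) (0\<^sub>m b a) (1\<^sub>m b)"
  define E where "E = four_block_mat A (0\<^sub>m a b) (0\<^sub>m b a) SC"
  have X: "X \<in> carrier_mat a b" "transpose_mat X = transpose_mat B * minv a A" "A * X = B" using c by (auto simp: X_def)
  have Tc: "T \<in> carrier_mat (a+b) (a+b)" "R \<in> carrier_mat (a+b) (a+b)" "E \<in> carrier_mat (a+b) (a+b)"
    using X c unfolding T_def R_def E_def by auto
  have TT: "transpose_mat T = four_block_mat (1\<^sub>m a) (0\<^sub>m a b) (transpose_mat B * minv a A) (1\<^sub>m b)"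
    unfolding T_def using X by (subst transpose_four_block_mat[of _ a a _ b _ b]) auto
  have dT: "det T = 1" unfolding T_def using X by (subst det_four_block_mat_lower_left_zero[of _ a _ b]) auto
  have one: "four_block_mat (1\<^sub>m a) (0\<^sub>m a b) (0\<^sub>m b a) (1\<^sub>m b) = (1\<^sub>m (a + b) :: real mat)" by (intro eq_matI) auto
  have "- X + X = 0\<^sub>m a b" using X by (intro eq_matI) auto
  moreover have "- 0\<^sub>m b b = (0\<^sub>m b b :: real mat)" "- 0\<^sub>m a a = (0\<^sub>m a a :: real mat)" by (intro eq_matI; simp)+
  ultimately have TR: "T * R = 1\<^sub>m (a+b)" unfolding T_def R_def using X(1) one
    by (subst mult_four_block_mat[of _ a a _ b _ b _ _ a _ b]) auto
  have ET: "E * T = four_block_mat A B (0\<^sub>m b a) SC" unfolding E_def T_def using X c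
    by (subst mult_four_block_mat[of _ a a _ b _ b _ _ a _ b]) auto
  have "transpose_mat B * minv a A * B + SC = D" using c D by (intro eq_matI) auto
  then have M: "transpose_mat T * E * T = four_block_mat A B (transpose_mat B) D"
    using Tc by (subst square_assoc[of _ "a+b"]) (auto simp: ET TT, subst mult_four_block_mat[of _ a a _ b _ b _ _ a _ b], use B D c in auto)
  have "det (transpose_mat T * E * T) = det T * det E * det T"
    using Tc by (simp add: det_mult[of _ "a+b"] det_transpose)
  then show "det (four_block_mat A B (transpose_mat B) D) = det A * det SC"
    unfolding M dT using det_block_diag[OF c(1,3)] by (simp add: E_def)
  show "pd_mat (a + b) (four_block_mat A B (transpose_mat B) D) \<longleftrightarrow> pd_mat b SC"
    using pd_congruence_iff[OF Tc(3,1,2) TR, unfolded M] pd_block_diag[OF c(1,3), folded E_def] A by blast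
qed

text \<open>The same elimination with the pivot in the lower right corner. Both orders are needed
  because \<open>gram_two_ways\<close> reduces one Gram matrix from either end.\<close>

lemma schur_upper_left:
  "det (four_block_mat D (transpose_mat B) B A) = det A * det SC"
  "pd_mat (b + a) (four_block_mat D (transpose_mat B) B A) \<longleftrightarrow> pd_mat b SC"
proof -
  note c = schur_carriers
  define X where "X = minv a A * B"
  define T where "T = four_block_mat (1\<^sub>m b) (0\<^sub>m b a) X (1\<^sub>m a)"
  define R where "R = four_block_mat (1\<^sub>m b) (0\<^sub>m b a) (- X) (1\<^sub>m a)"
  define E where "E = four_block_mat SC (0\<^sub>m b a) (0\<^sub>m a b) A"
  have X: "X \<in> carrier_mat a b" "transpose_mat X = transpose_mat B * minv a A" "A * X = B" using c by (auto simp: X_def)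
  have Tc: "T \<in> carrier_mat (b+a) (b+a)" "R \<in> carrier_mat (b+a) (b+a)" "E \<in> carrier_mat (b+a) (b+a)"
    using X c unfolding T_def R_def E_def by auto
  have TT: "transpose_mat T = four_block_mat (1\<^sub>m b) (transpose_mat B * minv a A) (0\<^sub>m a b) (1\<^sub>m a)"
    unfolding T_def using X by (subst transpose_four_block_mat[of _ b b _ a _ a]) auto
  have dT: "det T = 1" unfolding T_def using X by (subst det_four_block_mat_upper_right_zero[of _ b _ a]) auto
  have one: "four_block_mat (1\<^sub>m b) (0\<^sub>m b a) (0\<^sub>m a b) (1\<^sub>m a) = (1\<^sub>m (b + a) :: real mat)" by (intro eq_matI) auto
  have "X + - X = 0\<^sub>m a b" using X by (intro eq_matI) auto
  moreover have "- 0\<^sub>m b b = (0\<^sub>m b b :: real mat)" "- 0\<^sub>m a a = (0\<^sub>m a a :: real mat)" by (intro eq_matI; simp)+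
  ultimately have TR: "T * R = 1\<^sub>m (b+a)" unfolding T_def R_def using X(1) one
    by (subst mult_four_block_mat[of _ b b _ a _ a _ _ b _ a]) auto
  have ET: "E * T = four_block_mat SC (0\<^sub>m b a) B A" unfolding E_def T_def using X c
    by (subst mult_four_block_mat[of _ b b _ a _ a _ _ b _ a]) auto
  have "SC + transpose_mat B * minv a A * B = D" using c D by (intro eq_matI) auto
  then have M: "transpose_mat T * E * T = four_block_mat D (transpose_mat B) B A"
    using Tc by (subst square_assoc[of _ "b+a"]) (auto simp: ET TT, subst mult_four_block_mat[of _ b b _ a _ a _ _ b _ a], use B D c in auto)
  have "det (transpose_mat T * E * T) = det T * det E * det T"
    using Tc by (simp add: det_mult[of _ "b+a"] det_transpose)
  then show "det (four_block_mat D (transpose_mat B) B A) = det A * det SC"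
    unfolding M dT using det_block_diag[OF c(3,1)] by (simp add: E_def)
  show "pd_mat (b + a) (four_block_mat D (transpose_mat B) B A) \<longleftrightarrow> pd_mat b SC"
    using pd_congruence_iff[OF Tc(3,1,2) TR, unfolded M] pd_block_diag[OF c(3,1), folded E_def] A by blast
qed

end

subsection \<open>Square roots and the Cholesky factorization\<close>

lemma spec_cong: "(\<And>i. i < n \<Longrightarrow> f i = g i) \<Longrightarrow> spec n Q f = spec n Q g"
proof -
  assume "\<And>i. i < n \<Longrightarrow> f i = g i"
  then have "mat_diag n f = mat_diag n g" by (intro eq_matI) (auto simp: mat_diag_def)
  then show ?thesis by (simp add: spec_def)
qed

lemma spec_absorb:
  assumes "orth_mat n Q"
  shows "spec n Q f * Q = Q * mat_diag n f" "transpose_mat Q * spec n Q f = mat_diag n f * transpose_mat Q"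
proof -
  note D = orth_matD[OF assms]
  have "spec n Q f * Q = Q * mat_diag n f * (transpose_mat Q * Q)"
    unfolding spec_def using D(1,2) by (simp add: square_assoc[of _ n])
  then show "spec n Q f * Q = Q * mat_diag n f"
    unfolding D(3) using D(1) by (simp add: right_mult_one_mat[of _ n n])
  have "transpose_mat Q * spec n Q f = (transpose_mat Q * Q) * (mat_diag n f * transpose_mat Q)"
    unfolding spec_def using D(1,2) by (simp add: square_assoc[of _ n])
  then show "transpose_mat Q * spec n Q f = mat_diag n f * transpose_mat Q"
    unfolding D(3) using D(2) by (simp add: left_mult_one_mat[of _ n n])
qed

text \<open>With eigenbases \<open>Q\<close> and \<open>P\<close> and \<open>W = P^T Q\<close>,
  equality of the squares says \<open>W_ij f_j^2 = g_i^2 W_ij\<close>. Wherever \<open>W_ij\<close>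
  is nonzero, nonnegativity yields \<open>f_j = g_i\<close>, so the unsquared relation holds for all
  entries. This makes the definite description in \<open>msqrt\<close> meaningful.\<close>

lemma psd_sqrt_unique:
  assumes B: "psd_mat n B" and C: "psd_mat n C" and BC: "B * B = C * C"
  shows "B = C"
proof -
  obtain Q f where Q: "orth_mat n Q" and Bf: "B = spec n Q f" using sym_matE[OF psd_matD(1)[OF B]] .
  obtain P g where P: "orth_mat n P" and Cg: "C = spec n P g" using sym_matE[OF psd_matD(1)[OF C]] .
  have f: "\<forall>i<n. 0 \<le> f i" and g: "\<forall>i<n. 0 \<le> g i"
    using spec_definite(2)[OF Q, of f] spec_definite(2)[OF P, of g] B C Bf Cg by auto
  note DQ = orth_matD[OF Q] and DP = orth_matD[OF P]
  define W where "W = transpose_mat P * Q"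
  have W: "W \<in> carrier_mat n n" unfolding W_def using DP DQ by simp
  have left: "transpose_mat P * (spec n Q h * Q) = Matrix.mat n n (\<lambda>(i,j). W $$ (i,j) * h j)" for h
    unfolding spec_absorb(1)[OF Q]
    using DP DQ W by (simp add: W_def mat_diag_mult_right[symmetric] square_assoc[of _ n])
  have right: "transpose_mat P * (spec n P h * Q) = Matrix.mat n n (\<lambda>(i,j). h i * W $$ (i,j))" for h
  proof -
    have "transpose_mat P * (spec n P h * Q) = (transpose_mat P * spec n P h) * Q"
      using DP DQ P by (intro square_assoc[symmetric]) auto
    also have "\<dots> = mat_diag n h * W" unfolding spec_absorb(2)[OF P] W_def
      using DP DQ by (intro square_assoc) auto
    finally show ?thesis using W by (simp add: mat_diag_mult_left)
  qed
  have "spec n Q (\<lambda>i. f i * f i) = spec n P (\<lambda>i. g i * g i)"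
    using BC Bf Cg spec_mult[OF Q] spec_mult[OF P] by simp
  then have e: "Matrix.mat n n (\<lambda>(i,j). W $$ (i,j) * (f j * f j)) = Matrix.mat n n (\<lambda>(i,j). (g i * g i) * W $$ (i,j))"
    using left[of "\<lambda>i. f i * f i"] right[of "\<lambda>i. g i * g i"] by simp
  have "W $$ (i,j) * f j = g i * W $$ (i,j)" if ij: "i < n" "j < n" for i j
  proof (cases "W $$ (i,j) = 0")
    case False
    have "W $$ (i,j) * (f j * f j) = (g i * g i) * W $$ (i,j)"
      using arg_cong[OF e, of "\<lambda>M. M $$ (i,j)"] ij by simp
    then have "(f j)\<^sup>2 = (g i)\<^sup>2" using False by (simp add: power2_eq_square)
    then show ?thesis using f g ij by (simp add: power2_eq_iff_nonneg)
  qed simp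
  then have "Matrix.mat n n (\<lambda>(i,j). W $$ (i,j) * f j) = Matrix.mat n n (\<lambda>(i,j). g i * W $$ (i,j))"
    by (intro eq_matI) auto
  then have "transpose_mat P * (B * Q) = transpose_mat P * (C * Q)" using left right Bf Cg by simp
  then have "P * (transpose_mat P * (B * Q)) * transpose_mat Q = P * (transpose_mat P * (C * Q)) * transpose_mat Q" by simp
  moreover have "P * (transpose_mat P * (X * Q)) * transpose_mat Q = X" if "X \<in> carrier_mat n n" for X
  proof -
    have "P * (transpose_mat P * (X * Q)) * transpose_mat Q = (P * transpose_mat P) * X * (Q * transpose_mat Q)"
      using that DP(1,2) DQ(1,2) by (simp add: square_assoc[of _ n])
    then show ?thesis unfolding DP(4) DQ(4) using that by simp
  qed
  ultimately show ?thesis using psd_matD(2)[OF B] psd_matD(2)[OF C] by metis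
qed

lemma msqrt_spec:
  assumes Q: "orth_mat n Q" and f: "\<And>i. i < n \<Longrightarrow> 0 \<le> f i"
  shows "msqrt n (spec n Q f) = spec n Q (\<lambda>i. sqrt (f i))"
  unfolding msqrt_def
proof (rule the_equality)
  show r: "psd_mat n (spec n Q (\<lambda>i. sqrt (f i))) \<and> spec n Q (\<lambda>i. sqrt (f i)) * spec n Q (\<lambda>i. sqrt (f i)) = spec n Q f"
    using f by (auto simp: spec_definite[OF Q] spec_mult[OF Q] intro!: spec_cong)
  show "B = spec n Q (\<lambda>i. sqrt (f i))" if "psd_mat n B \<and> B * B = spec n Q f" for B
    using psd_sqrt_unique[of n B "spec n Q (\<lambda>i. sqrt (f i))"] that r by simp
qed

lemma msqrt_psd:
  assumes "psd_mat n A" shows "psd_mat n (msqrt n A)" "msqrt n A * msqrt n A = A"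
proof -
  obtain Q f where Q: "orth_mat n Q" and A: "A = spec n Q f" using sym_matE[OF psd_matD(1)[OF assms]] .
  have f: "\<And>i. i < n \<Longrightarrow> 0 \<le> f i" using spec_definite(2)[OF Q, of f] assms A by simp
  show "psd_mat n (msqrt n A)" "msqrt n A * msqrt n A = A"
    using f msqrt_spec[of n Q f, OF Q f] unfolding A
    by (auto simp: spec_definite[OF Q] spec_mult[OF Q] intro!: spec_cong)
qed

lemma msqrt_pd:
  assumes "pd_mat n A" shows "pd_mat n (msqrt n A)"
proof -
  obtain Q f where Q: "orth_mat n Q" and A: "A = spec n Q f" using sym_matE[OF pd_matD(1)[OF assms]] .
  have f: "\<And>i. i < n \<Longrightarrow> 0 < f i" using spec_definite(3)[OF Q, of f] assms A by simp
  show ?thesis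
    unfolding A using f by (subst msqrt_spec[OF Q]) (auto simp: spec_definite[OF Q] less_imp_le)
qed

text \<open>Squares of semidefinite matrices are semidefinite, so for all other arguments the
  description is empty and its value is one fixed matrix.\<close>

lemma msqrt_not_psd:
  assumes "\<not> psd_mat n A" shows "msqrt n A = (THE B. False)"
proof -
  have "psd_mat n (B * B)" if B: "psd_mat n B" for B
  proof -
    obtain Q f where Q: "orth_mat n Q" and A: "B = spec n Q f" using sym_matE[OF psd_matD(1)[OF B]] .
    show ?thesis unfolding A by (simp add: spec_mult[OF Q] spec_definite[OF Q])
  qed
  then show ?thesis unfolding msqrt_def using assms by (intro arg_cong[of _ _ The] ext) blast
qed

text \<open>Serves the Jacobian of a congruence: a congruence by a triangular matrix is a triangular
  map of the matrix entries, one by a general matrix is not. The last row of the factor comes from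
  the Schur complement of the last diagonal entry.\<close>

lemma cholesky:
  "pd_mat n A \<Longrightarrow> \<exists>L \<in> carrier_mat n n. A = L * transpose_mat L \<and> (\<forall>i<n. 0 < L $$ (i,i)) \<and> (\<forall>i<n. \<forall>j<n. i < j \<longrightarrow> L $$ (i,j) = 0)"
proof (induction n arbitrary: A)
  case 0
  then show ?case using pd_matD(2)[OF 0] by (intro bexI[of _ "1\<^sub>m 0"]) auto
next
  case (Suc n)
  note D = pd_matD[OF Suc.prems] and S = sym_matD(3)[OF pd_matD(1)[OF Suc.prems]]
  \<comment> \<open>Inclusion of the first \<open>n\<close> coordinates; congruence with it cuts out
    the leading principal submatrix and keeps it positive definite.\<close>
  define P where "P = Matrix.mat (Suc n) n (\<lambda>(i,j). if i = j then 1 else 0 :: real)"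
  have Pc: "P \<in> carrier_mat (Suc n) n" by (simp add: P_def)
  have Pv: "(P *\<^sub>v v) $ i = v $ i" if "v \<in> carrier_vec n" "i < n" for v i
    using that by (simp add: P_def scalar_prod_def if_distrib if_distribR cong: if_cong)
  define A' where "A' = Matrix.mat n n (\<lambda>(i,j). A $$ (i,j))"
  have "transpose_mat P * A * P = A'"
  proof (rule eq_matI)
    fix i j assume "i < dim_row A'" "j < dim_col A'"
    then have ij: "i < n" "j < n" by (auto simp: A'_def)
    have "(transpose_mat P * A) $$ (i, k) = A $$ (i,k)" if "k < Suc n" for k
      using ij that D(2) by (simp add: P_def scalar_prod_def if_distrib if_distribR cong: if_cong)
    then have "(transpose_mat P * A * P) $$ (i,j) = (\<Sum>k<Suc n. A $$ (i,k) * P $$ (k,j))"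
      using ij Pc D(2) by (simp add: scalar_prod_def lessThan_atLeast0 del: sum.lessThan_Suc sum.op_ivl_Suc assoc_mult_mat)
    also have "\<dots> = (\<Sum>k<Suc n. if k = j then A $$ (i,k) else 0)"
      using ij by (intro sum.cong) (auto simp: P_def)
    also have "\<dots> = A $$ (i,j)" using ij by simp
    finally show "(transpose_mat P * A * P) $$ (i,j) = A' $$ (i,j)" using ij by (simp add: A'_def)
  qed (use D Pc in \<open>auto simp: A'_def\<close>)
  moreover have "v = 0\<^sub>v n" if "v \<in> carrier_vec n" "P *\<^sub>v v = 0\<^sub>v (Suc n)" for v
    using Pv[OF that(1)] that by (intro eq_vecI) auto
  ultimately have A': "pd_mat n A'" using pd_congruence[OF Suc.prems Pc] by auto
  define b where "b = Matrix.mat n 1 (\<lambda>(i,j). A $$ (i,n))"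
  define d where "d = Matrix.mat 1 1 (\<lambda>_. A $$ (n,n))"
  have b: "b \<in> carrier_mat n 1" and d: "d \<in> carrier_mat 1 1" by (auto simp: b_def d_def)
  have Ae: "A = four_block_mat A' b (transpose_mat b) d"
    using D(2) S by (intro eq_matI) (auto simp: A'_def b_def d_def less_Suc_eq)
  define C where "C = d - transpose_mat b * minv n A' * b"
  note sc = schur_carriers[OF A' b d]
  have C: "C \<in> carrier_mat 1 1" using sc(3) by (simp only: C_def)
  have "pd_mat (n + 1) A" using Suc.prems by simp
  then have "pd_mat 1 C" using schur_lower_right(2)[OF A' b d] unfolding C_def Ae[symmetric] by blast
  then have c0: "0 < C $$ (0,0)" using pd_det_pos[of 1 C] C by (simp add: det_single)
  obtain L where L: "L \<in> carrier_mat n n" "A' = L * transpose_mat L" "\<forall>i<n. 0 < L $$ (i,i)" "\<forall>i<n. \<forall>j<n. i < j \<longrightarrow> L $$ (i,j) = 0"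
    using Suc.IH[OF A'] by auto
  define s where "s = Matrix.mat 1 1 (\<lambda>_. sqrt (C $$ (0,0)))"
  define Y where "Y = transpose_mat b * minv n A' * L"
  have Y: "Y \<in> carrier_mat 1 n" using sc L by (auto simp: Y_def)
  have s: "s \<in> carrier_mat 1 1" by (simp add: s_def)
  define K where "K = four_block_mat L (0\<^sub>m n 1) Y s"
  have YT: "Y * transpose_mat L = transpose_mat b"
  proof -
    have "Y * transpose_mat L = transpose_mat b * minv n A' * (L * transpose_mat L)"
      unfolding Y_def using sc L(1) by (intro assoc_mult_mat[of _ 1 n _ n _ n]) auto
    then show ?thesis using L(2) sc by simp
  qed
  then have LY: "L * transpose_mat Y = b"
  proof -
    have "transpose_mat (Y * transpose_mat L) = L * transpose_mat Y"
      by (subst transpose_mult[OF Y]) (use L(1) in auto)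
    then show ?thesis unfolding YT by simp
  qed
  have YY: "Y * transpose_mat Y = transpose_mat b * minv n A' * b"
  proof -
    have "Y * transpose_mat Y = transpose_mat b * minv n A' * (L * transpose_mat Y)"
      unfolding Y_def using sc L(1) Y[unfolded Y_def] by (intro assoc_mult_mat[of _ 1 n _ n _ 1]) auto
    then show ?thesis using LY by simp
  qed
  have ss: "s * transpose_mat s = C" using C c0
    by (intro eq_matI) (auto simp: s_def scalar_prod_def)
  have "C + transpose_mat b * minv n A' * b = d" "transpose_mat b * minv n A' * b + C = d" unfolding C_def using sc d by (intro eq_matI; simp)+
  note dd = this
  have KT: "transpose_mat K = four_block_mat (transpose_mat L) (transpose_mat Y) (0\<^sub>m 1 n) (transpose_mat s)"
    unfolding K_def by (subst transpose_four_block_mat[of _ n n _ 1 _ 1]) (use L(1) Y s in auto)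
  have "K * transpose_mat K = four_block_mat (L * transpose_mat L + 0\<^sub>m n 1 * 0\<^sub>m 1 n) (L * transpose_mat Y + 0\<^sub>m n 1 * transpose_mat s)
     (Y * transpose_mat L + s * 0\<^sub>m 1 n) (Y * transpose_mat Y + s * transpose_mat s)"
    unfolding KT unfolding K_def by (rule mult_four_block_mat) (use L(1) Y s in auto)
  also have "\<dots> = A" unfolding YT LY YY ss L(2)[symmetric] dd(2) Ae
  proof (intro cong_four_block_mat)
    show "A' + 0\<^sub>m n 1 * 0\<^sub>m 1 n = A'" by (intro eq_matI) (auto simp: A'_def)
    show "b + 0\<^sub>m n 1 * transpose_mat s = b" using b s by (intro eq_matI) auto
    show "transpose_mat b + s * 0\<^sub>m 1 n = transpose_mat b" using b s by (intro eq_matI) auto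
  qed simp
  finally have "K * transpose_mat K = A" .
  moreover have "K \<in> carrier_mat (Suc n) (Suc n)" using L s by (auto simp: K_def)
  moreover have "\<forall>i<Suc n. 0 < K $$ (i,i)" using L s Y c0 by (auto simp: K_def s_def less_Suc_eq)
  moreover have "\<forall>i<Suc n. \<forall>j<Suc n. i < j \<longrightarrow> K $$ (i,j) = 0" using L s Y by (auto simp: K_def less_Suc_eq)
  ultimately show ?case by metis
qed

subsection \<open>Block Hankel matrices\<close>

text \<open>The lower Hankel matrix of order \<open>n\<close> for both parities: the Gram matrix of
  the weight 1 (even \<open>n\<close>) or t (odd \<open>n\<close>) on polynomials of degree up to
  \<open>n div 2\<close>.\<close>

definition Lo :: "nat \<Rightarrow> (nat \<Rightarrow> real mat) \<Rightarrow> nat \<Rightarrow> real mat" where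
  "Lo p S n = block_hankel p (n div 2 + 1) (if even n then S else (\<lambda>t. S (t + 1)))"

text \<open>Weight t(1-t) for even and 1-t for odd order. At order 0 this is the 0 by 0 matrix,
  which imposes no condition.\<close>

definition Up :: "nat \<Rightarrow> (nat \<Rightarrow> real mat) \<Rightarrow> nat \<Rightarrow> real mat" where
  "Up p S n = block_hankel p ((n + 1) div 2) (if even n then (\<lambda>t. S (t + 1) - S (t + 2)) else (\<lambda>t. S t - S (t + 1)))"

text \<open>The index is that of the moment being bounded: this is the vector of index
  \<open>n - 1\<close> in the definition of \<open>S_n^-\<close>, and equally the last block column
  of \<open>Lo p S n\<close> above its corner.\<close>

definition lo_vec :: "nat \<Rightarrow> (nat \<Rightarrow> real mat) \<Rightarrow> nat \<Rightarrow> real mat" where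
  "lo_vec p S n = block_vec p (n div 2) (\<lambda>i. S ((n + 1) div 2 + i))"

definition up_vec :: "nat \<Rightarrow> (nat \<Rightarrow> real mat) \<Rightarrow> nat \<Rightarrow> real mat" where
  "up_vec p S n = block_vec p ((n - 1) div 2) (\<lambda>i. S (n div 2 + i) - S (n div 2 + i + 1))"

definition Slow :: "nat \<Rightarrow> (nat \<Rightarrow> real mat) \<Rightarrow> nat \<Rightarrow> real mat" where
  "Slow p S n = (if n \<le> 1 then 0\<^sub>m p p
     else transpose_mat (lo_vec p S n) * minv (n div 2 * p) (Lo p S (n - 2)) * lo_vec p S n)"

text \<open>For \<open>n = 2\<close> the vector is empty and the formula gives \<open>S 1\<close>,
  which absorbs the separate clause for \<open>S_2^+\<close>.\<close>

definition Sup_mat :: "nat \<Rightarrow> (nat \<Rightarrow> real mat) \<Rightarrow> nat \<Rightarrow> real mat" where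
  "Sup_mat p S n = (if n \<le> 1 then 1\<^sub>m p
     else S (n - 1) - transpose_mat (up_vec p S n) * minv ((n - 1) div 2 * p) (Up p S (n - 2)) * up_vec p S n)"

definition Hpos :: "nat \<Rightarrow> (nat \<Rightarrow> real mat) \<Rightarrow> nat \<Rightarrow> bool" where
  "Hpos p S n \<longleftrightarrow> (\<forall>j\<le>n. pd_mat ((j div 2 + 1) * p) (Lo p S j) \<and> pd_mat ((j + 1) div 2 * p) (Up p S j))"

lemma block_hankel_carrier [simp]: "block_hankel p r f \<in> carrier_mat (r * p) (r * p)"
  by (simp add: block_hankel_def)

lemma block_vec_carrier [simp]: "block_vec p r f \<in> carrier_mat (r * p) p"
  by (simp add: block_vec_def)

lemma block_hankel_entry: "a < r * p \<Longrightarrow> b < r * p \<Longrightarrow>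
    block_hankel p r f $$ (a,b) = f (a div p + b div p) $$ (a mod p, b mod p)"
  by (simp add: block_hankel_def)

lemma block_vec_entry: "a < r * p \<Longrightarrow> b < p \<Longrightarrow> block_vec p r f $$ (a,b) = f (a div p) $$ (a mod p, b)"
  by (simp add: block_vec_def)

lemma quad_block_entry:
  fixes B M :: "real mat"
  assumes "B \<in> carrier_mat d e" "M \<in> carrier_mat d d" "a < e" "b < e"
  shows "(transpose_mat B * M * B) $$ (a,b) = col B a \<bullet> (M *\<^sub>v col B b)"
proof -
  have "(transpose_mat B * M * B) $$ (a,b) = (transpose_mat B * (M * B)) $$ (a,b)"
    using assms by (simp add: assoc_mult_mat[of _ e d _ d _ e])
  also have "\<dots> = col B a \<bullet> col (M * B) b" using assms by simp
  also have "col (M * B) b = M *\<^sub>v col B b" using assms by (intro col_mult2) auto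
  finally show ?thesis .
qed

text \<open>\<open>G^-1\<close> sends the column \<open>G e_r\<close> to \<open>e_r\<close>, so a
  column of \<open>B\<close> that is also a column of \<open>G\<close> turns the quadratic
  expression into a single entry of \<open>B\<close>. Hankel matrices and their shifts share most of
  their columns, which is how their Schur complements become explicit.\<close>

lemma minv_quad_entry:
  assumes G: "pd_mat d G" and B: "B \<in> carrier_mat d e" and ab: "a < e" "b < e" and r: "r < d"
  shows "col B a = col G r \<Longrightarrow> (transpose_mat B * minv d G * B) $$ (a,b) = B $$ (r,b)"
    "col B b = col G r \<Longrightarrow> (transpose_mat B * minv d G * B) $$ (a,b) = B $$ (r,a)"
proof -
  note M = minv_pd[OF G] and D = pd_matD[OF G] and S = sym_matD(3)[OF pd_matD(1)[OF G]]
  have rc: "row G r = col G r" using S D(2) r by (intro eq_vecI) auto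
  have 1: "col G r \<bullet> (minv d G *\<^sub>v y) = y $ r" if y: "y \<in> carrier_vec d" for y
  proof -
    have "col G r \<bullet> (minv d G *\<^sub>v y) = (G *\<^sub>v (minv d G *\<^sub>v y)) $ r" using D(2) r rc by simp
    also have "G *\<^sub>v (minv d G *\<^sub>v y) = (G * minv d G) *\<^sub>v y"
      using assoc_mult_mat_vec[OF D(2) M(1) y] by simp
    finally show ?thesis using M y by simp
  qed
  have 2: "minv d G *\<^sub>v col G r = unit_vec d r"
    using M(3) col_mult2[OF M(1) D(2) r] r by simp
  show "(transpose_mat B * minv d G * B) $$ (a,b) = B $$ (r,b)" if "col B a = col G r"
    unfolding quad_block_entry[OF B M(1) ab] that using 1[of "col B b"] B ab r by auto
  show "(transpose_mat B * minv d G * B) $$ (a,b) = B $$ (r,a)" if "col B b = col G r"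
    unfolding quad_block_entry[OF B M(1) ab] that 2 using B ab r by auto
qed

lemma minv_quad_cong:
  fixes B h M :: "real mat"
  assumes "M \<in> carrier_mat d d" "B \<in> carrier_mat d e" "a < e" "b < e" "h \<in> carrier_mat d e'" "a' < e'" "b' < e'"
    "col B a = col h a'" "col B b = col h b'"
  shows "(transpose_mat B * M * B) $$ (a,b) = (transpose_mat h * M * h) $$ (a',b')"
  using assms by (simp add: quad_block_entry del: assoc_mult_mat)

context
  fixes p :: nat and S :: "nat \<Rightarrow> real mat"
  assumes p: "0 < p" and symS: "\<And>i. sym_mat p (S i)" and S0: "S 0 = 1\<^sub>m p"
begin

lemma S_carrier [simp]: "S i \<in> carrier_mat p p" "dim_row (S i) = p" "dim_col (S i) = p"
  using sym_matD(1)[OF symS] by auto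

lemma S_sym: "a < p \<Longrightarrow> b < p \<Longrightarrow> S i $$ (a,b) = S i $$ (b,a)"
  using sym_matD(3)[OF symS] .

lemma index_block_cases:
  assumes "a < Suc m * p"
  obtains "a < m * p" "a div p < m" "a mod p < p" | c where "a = m * p + c" "c < p" "a div p = m" "a mod p = c"
proof (cases "a < m * p")
  case True
  then show ?thesis using that(1) p by (simp add: less_mult_imp_div_less)
next
  case False
  then obtain c where "a = m * p + c" by (metis le_add_diff_inverse not_less)
  then show ?thesis using that(2)[of c] assms by auto
qed

lemma block_hankel_Suc:
  assumes f: "\<And>i. sym_mat p (f i)"
  shows "block_hankel p (Suc m) f = four_block_mat (block_hankel p m f) (block_vec p m (\<lambda>i. f (m + i)))
     (transpose_mat (block_vec p m (\<lambda>i. f (m + i)))) (f (2 * m))"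
proof -
  note D = sym_matD(1)[OF f] sym_matD(3)[OF f]
  have dm: "dim_row (f i) = p" "dim_col (f i) = p" for i using D(1)[of i] by auto
  show ?thesis
  proof (rule eq_matI)
    fix a b assume "a < dim_row (four_block_mat (block_hankel p m f) (block_vec p m (\<lambda>i. f (m + i)))
     (transpose_mat (block_vec p m (\<lambda>i. f (m + i)))) (f (2 * m)))" "b < dim_col (four_block_mat (block_hankel p m f) (block_vec p m (\<lambda>i. f (m + i)))
     (transpose_mat (block_vec p m (\<lambda>i. f (m + i)))) (f (2 * m)))"
    then have ab: "a < Suc m * p" "b < Suc m * p"
      using dm by (auto simp: block_hankel_def block_vec_def)
    show "block_hankel p (Suc m) f $$ (a,b) = four_block_mat (block_hankel p m f) (block_vec p m (\<lambda>i. f (m + i)))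
     (transpose_mat (block_vec p m (\<lambda>i. f (m + i)))) (f (2 * m)) $$ (a,b)"
      using ab(1)
    proof (cases a rule: index_block_cases)
      case 1
      note a1 = this
      show ?thesis using ab(2) by (cases b rule: index_block_cases)
        (use a1 D(2) dm in \<open>auto simp: block_hankel_def block_vec_def add.commute\<close>)
    next
      case (2 c)
      note a1 = this
      show ?thesis using ab(2) by (cases b rule: index_block_cases)
        (use a1 D(2) dm in \<open>auto simp: block_hankel_def block_vec_def add.commute mult_2\<close>)
    qed
  qed (use dm in \<open>auto simp: block_hankel_def block_vec_def\<close>)
qed

lemma sym_diff: "sym_mat p (S i - S j)"
  using symS S_sym by (auto simp: sym_mat_def intro!: eq_matI)

lemma Up_carrier [simp]: "Up p S n \<in> carrier_mat ((n + 1) div 2 * p) ((n + 1) div 2 * p)"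
  unfolding Up_def by (rule block_hankel_carrier)

lemma lo_vec_carrier [simp]: "lo_vec p S n \<in> carrier_mat (n div 2 * p) p"
  unfolding lo_vec_def by (rule block_vec_carrier)

lemma up_vec_carrier [simp]: "up_vec p S n \<in> carrier_mat ((n - 1) div 2 * p) p"
  unfolding up_vec_def by (rule block_vec_carrier)

lemma Lo_block:
  assumes "2 \<le> n"
  shows "Lo p S n = four_block_mat (Lo p S (n - 2)) (lo_vec p S n) (transpose_mat (lo_vec p S n)) (S n)"
proof -
  obtain m where n: "n = m + 2" using assms by (metis le_add_diff_inverse2)
  define f where "f = (if even n then S else (\<lambda>t. S (t + 1)))"
  have "block_hankel p (Suc (n div 2)) f = four_block_mat (block_hankel p (n div 2) f) (block_vec p (n div 2) (\<lambda>i. f (n div 2 + i)))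
     (transpose_mat (block_vec p (n div 2) (\<lambda>i. f (n div 2 + i)))) (f (2 * (n div 2)))"
    by (rule block_hankel_Suc) (use symS in \<open>auto simp: f_def\<close>)
  moreover have "block_hankel p (Suc (n div 2)) f = Lo p S n" by (simp add: Lo_def f_def)
  moreover have "block_hankel p (n div 2) f = Lo p S (n - 2)" by (simp add: Lo_def f_def n)
  moreover have "block_vec p (n div 2) (\<lambda>i. f (n div 2 + i)) = lo_vec p S n"
    by (cases "even n") (auto simp: lo_vec_def f_def elim!: evenE oddE)
  moreover have "f (2 * (n div 2)) = S n" by (auto simp: f_def)
  ultimately show ?thesis by simp
qed

lemma Up_block:
  assumes "2 \<le> n"
  shows "Up p S n = four_block_mat (Up p S (n - 2)) (up_vec p S n) (transpose_mat (up_vec p S n)) (S (n - 1) - S n)"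
proof -
  obtain m where n: "n = m + 2" using assms by (metis le_add_diff_inverse2)
  define f where "f = (if even n then (\<lambda>t. S (t + 1) - S (t + 2)) else (\<lambda>t. S t - S (t + 1)))"
  define k where "k = (n - 1) div 2"
  have "block_hankel p (Suc k) f = four_block_mat (block_hankel p k f) (block_vec p k (\<lambda>i. f (k + i)))
     (transpose_mat (block_vec p k (\<lambda>i. f (k + i)))) (f (2 * k))"
    by (rule block_hankel_Suc) (use sym_diff in \<open>auto simp: f_def\<close>)
  moreover have "Suc k = (n + 1) div 2" by (simp add: k_def n)
  then have "block_hankel p (Suc k) f = Up p S n" by (simp add: Up_def f_def)
  moreover have "block_hankel p k f = Up p S (n - 2)" by (simp add: Up_def f_def n k_def)
  moreover have "block_vec p k (\<lambda>i. f (k + i)) = up_vec p S n"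
    by (cases "even n") (auto simp: up_vec_def f_def k_def n elim!: evenE oddE)
  moreover have "f (2 * k) = S (n - 1) - S n"
    by (cases "even n") (auto simp: f_def k_def n elim!: evenE oddE)
  ultimately show ?thesis by simp
qed

lemma Lo_Up_1: "Lo p S 1 = S 1" "Up p S 1 = S 0 - S 1" "Lo p S 0 = 1\<^sub>m p"
  using S0 by (auto simp: Lo_def Up_def block_hankel_def intro!: eq_matI)

lemma pd_one: "pd_mat n (1\<^sub>m n)"
  using pd_mat_diag_iff[of n "\<lambda>_. 1"] by simp

lemma pd_empty: "A \<in> carrier_mat 0 0 \<Longrightarrow> pd_mat 0 A"
  by (auto simp: pd_mat_def sym_mat_def intro!: eq_matI)

section \<open>Adding one moment at a time\<close>

lemma Hpos_0: "Hpos p S 0"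
  unfolding Hpos_def using Lo_Up_1 pd_one pd_empty[of "Up p S 0"] Up_carrier[of 0] by simp

lemma Hpos_mono: "Hpos p S n \<Longrightarrow> j \<le> n \<Longrightarrow> Hpos p S j"
  unfolding Hpos_def by auto

lemma HposD: "Hpos p S n \<Longrightarrow> j \<le> n \<Longrightarrow> pd_mat ((j div 2 + 1) * p) (Lo p S j)"
  "Hpos p S n \<Longrightarrow> j \<le> n \<Longrightarrow> pd_mat ((j + 1) div 2 * p) (Up p S j)"
  unfolding Hpos_def by auto

lemma Slow_Sup_carrier:
  assumes "Hpos p S n" shows "Slow p S (Suc n) \<in> carrier_mat p p \<and> Sup_mat p S (Suc n) \<in> carrier_mat p p"
proof (cases "n = 0")
  case False
  then have L: "pd_mat (Suc n div 2 * p) (Lo p S (n - 1))" and U: "pd_mat (n div 2 * p) (Up p S (n - 1))"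
    using HposD[OF assms, of "n - 1"] by (auto simp: Suc_diff_Suc) (cases n; simp)+
  show ?thesis
    using minv_pd(1)[OF L] minv_pd(1)[OF U] False lo_vec_carrier[of "Suc n"] up_vec_carrier[of "Suc n"]
    by (auto simp: Slow_def Sup_mat_def intro!: mult_carrier_mat minus_carrier_mat transpose_carrier_mat)
qed (auto simp: Slow_def Sup_mat_def)

text \<open>\<open>S^-\<close> and \<open>S^+\<close> are the values of the new moment at which the
  Schur complement of the last block vanishes in the lower and the upper Hankel matrix. The bordered
  matrix has order \<open>n - 1\<close>, because orders of equal parity are nested.\<close>

lemma Hpos_step:
  assumes "Hpos p S n"
  shows "pd_mat ((Suc n div 2 + 1) * p) (Lo p S (Suc n)) \<longleftrightarrow> pd_mat p (S (Suc n) - Slow p S (Suc n))"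
    "pd_mat ((Suc n + 1) div 2 * p) (Up p S (Suc n)) \<longleftrightarrow> pd_mat p (Sup_mat p S (Suc n) - S (Suc n))"
    "0 < n \<Longrightarrow> det (Lo p S (Suc n)) = det (Lo p S (n - 1)) * det (S (Suc n) - Slow p S (Suc n))"
    "0 < n \<Longrightarrow> det (Up p S (Suc n)) = det (Up p S (n - 1)) * det (Sup_mat p S (Suc n) - S (Suc n))"
proof -
  have "(pd_mat ((Suc n div 2 + 1) * p) (Lo p S (Suc n)) \<longleftrightarrow> pd_mat p (S (Suc n) - Slow p S (Suc n))) \<and>
    (pd_mat ((Suc n + 1) div 2 * p) (Up p S (Suc n)) \<longleftrightarrow> pd_mat p (Sup_mat p S (Suc n) - S (Suc n))) \<and>
    (0 < n \<longrightarrow> det (Lo p S (Suc n)) = det (Lo p S (n - 1)) * det (S (Suc n) - Slow p S (Suc n))) \<and>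
    (0 < n \<longrightarrow> det (Up p S (Suc n)) = det (Up p S (n - 1)) * det (Sup_mat p S (Suc n) - S (Suc n)))"
  proof (cases "n = 0")
    case True
    have "S 1 - 0\<^sub>m p p = S 1" by (intro eq_matI) auto
    then show ?thesis using True Lo_Up_1 S0 by (simp add: Slow_def Sup_mat_def)
  next
    case False
    have L: "pd_mat (Suc n div 2 * p) (Lo p S (n - 1))" and U: "pd_mat (n div 2 * p) (Up p S (n - 1))"
      using HposD[OF assms, of "n - 1"] False by (cases n; simp)+
    have lv: "lo_vec p S (Suc n) \<in> carrier_mat (Suc n div 2 * p) p" and uv: "up_vec p S (Suc n) \<in> carrier_mat (n div 2 * p) p"
      using lo_vec_carrier[of "Suc n"] up_vec_carrier[of "Suc n"] by simp_all
    have bl: "Lo p S (Suc n) = four_block_mat (Lo p S (n - 1)) (lo_vec p S (Suc n)) (transpose_mat (lo_vec p S (Suc n))) (S (Suc n))"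
     and bu: "Up p S (Suc n) = four_block_mat (Up p S (n - 1)) (up_vec p S (Suc n)) (transpose_mat (up_vec p S (Suc n))) (S n - S (Suc n))"
      using Lo_block[of "Suc n"] Up_block[of "Suc n"] False by simp_all
    have sl: "Slow p S (Suc n) = transpose_mat (lo_vec p S (Suc n)) * minv (Suc n div 2 * p) (Lo p S (n - 1)) * lo_vec p S (Suc n)"
      using False by (simp add: Slow_def)
    define V where "V = transpose_mat (up_vec p S (Suc n)) * minv (n div 2 * p) (Up p S (n - 1)) * up_vec p S (Suc n)"
    have V: "V \<in> carrier_mat p p" unfolding V_def by (rule schur_carriers(7)[OF U uv, of "S n"]) simp
    have su: "Sup_mat p S (Suc n) = S n - V" using False by (simp add: Sup_mat_def V_def)
    have e: "S n - S (Suc n) - V = Sup_mat p S (Suc n) - S (Suc n)" unfolding su using V by (intro eq_matI) auto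
    have d1: "(Suc n div 2 + 1) * p = Suc n div 2 * p + p" and d2: "(Suc n + 1) div 2 * p = n div 2 * p + p" by simp_all
    have sd: "S n - S (Suc n) \<in> carrier_mat p p" by (rule sym_matD(1)[OF sym_diff])
    show ?thesis unfolding d1 d2 bl bu sl
      using schur_lower_right[OF L lv S_carrier(1)] schur_lower_right[OF U uv sd] unfolding V_def[symmetric] e by blast
  qed
  then show "pd_mat ((Suc n div 2 + 1) * p) (Lo p S (Suc n)) \<longleftrightarrow> pd_mat p (S (Suc n) - Slow p S (Suc n))"
    "pd_mat ((Suc n + 1) div 2 * p) (Up p S (Suc n)) \<longleftrightarrow> pd_mat p (Sup_mat p S (Suc n) - S (Suc n))"
    "0 < n \<Longrightarrow> det (Lo p S (Suc n)) = det (Lo p S (n - 1)) * det (S (Suc n) - Slow p S (Suc n))"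
    "0 < n \<Longrightarrow> det (Up p S (Suc n)) = det (Up p S (n - 1)) * det (Sup_mat p S (Suc n) - S (Suc n))"
    by auto
qed

lemma Hpos_Suc:
  "Hpos p S (Suc n) \<longleftrightarrow> Hpos p S n \<and> pd_mat p (S (Suc n) - Slow p S (Suc n)) \<and> pd_mat p (Sup_mat p S (Suc n) - S (Suc n))"
  using Hpos_step(1,2)[of n] unfolding Hpos_def le_Suc_eq by (metis le_refl)

text \<open>For \<open>f\<close> and \<open>g\<close> of the same leading coefficient, substituting \<open>f = h + (1-t) k\<close> and \<open>g = h - t k\<close>
  turns \<open>\<langle>f,f\<rangle>\<^sub>t + \<langle>g,g\<rangle>\<^sub>1\<^sub>-\<^sub>t\<close> into \<open>\<langle>h,h\<rangle> + \<langle>k,k\<rangle>\<^sub>t\<^sub>(\<^sub>1\<^sub>-\<^sub>t\<^sub>)\<close>. The Gram matrix of this form therefore has two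
  Schur complements: one is the width of the next moment range, the other consists of the Hankel matrices
  of order \<open>n\<close>. Odd orders are similar.\<close>

lemma gram_two_ways:
  assumes "Hpos p S (Suc n)"
  shows "pd_mat p (Sup_mat p S (Suc (Suc n)) - Slow p S (Suc (Suc n)))"
    "det (Sup_mat p S (Suc (Suc n)) - Slow p S (Suc (Suc n))) * (det (Lo p S n) * det (Up p S n)) =
      det (Lo p S (Suc n)) * det (Up p S (Suc n))"
proof -
  let ?h = "lo_vec p S (Suc (Suc n))" and ?v = "up_vec p S (Suc (Suc n))"
  have "pd_mat p (Sup_mat p S (Suc (Suc n)) - Slow p S (Suc (Suc n))) \<and>
    det (Sup_mat p S (Suc (Suc n)) - Slow p S (Suc (Suc n))) * (det (Lo p S n) * det (Up p S n)) =
      det (Lo p S (Suc n)) * det (Up p S (Suc n))"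
  proof (cases "even n")
    case False
    then obtain m where n: "n = 2 * m + 1" by (auto elim: oddE)
    define N where "N = Lo p S (Suc n)"
    define A where "A = Lo p S n"
    define U where "U = Up p S n"
    have N: "N = block_hankel p (Suc (Suc m)) S" and A: "A = block_hankel p (Suc m) (\<lambda>t. S (t + 1))"
      and U: "U = block_hankel p (Suc m) (\<lambda>t. S t - S (t + 1))"
      and Up': "Up p S (Suc n) = block_hankel p (Suc m) (\<lambda>t. S (t + 1) - S (t + 2))"
      by (auto simp: N_def A_def U_def Lo_def Up_def n)
    have h: "?h = block_vec p (Suc m) (\<lambda>i. S (Suc (Suc m) + i))" and v: "?v = block_vec p (Suc m) (\<lambda>i. S (Suc m + i) - S (Suc m + i + 1))"
      by (auto simp: lo_vec_def up_vec_def n)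
    have pdN: "pd_mat (Suc (Suc m) * p) N" and pdA: "pd_mat (Suc m * p) A" and pdU: "pd_mat (Suc m * p) U"
      and pdU': "pd_mat (Suc m * p) (Up p S (Suc n))"
      using HposD[OF assms, of "Suc n"] HposD[OF assms, of n] by (auto simp: N_def A_def U_def n)
    \<comment> \<open>The mixed block of the Gram matrix: products with weight t of a polynomial of
      degree up to m+1 and one of degree up to m, hence its rectangular shape.\<close>
    define X where "X = Matrix.mat (Suc (Suc m) * p) (Suc m * p) (\<lambda>(a,b). S (a div p + b div p + 1) $$ (a mod p, b mod p))"
    have X: "X \<in> carrier_mat (Suc (Suc m) * p) (Suc m * p)" by (simp add: X_def)
    have XT: "transpose_mat X \<in> carrier_mat (Suc m * p) (Suc (Suc m) * p)" using X by simp
    have Ac: "A \<in> carrier_mat (Suc m * p) (Suc m * p)" and Nc: "N \<in> carrier_mat (Suc (Suc m) * p) (Suc (Suc m) * p)"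
      using pd_matD(2)[OF pdA] pd_matD(2)[OF pdN] .
    have mp: "a mod p < p" for a using p by simp
    \<comment> \<open>Every column of \<open>X\<close> is a column of \<open>N\<close> one block
      further on, so \<open>X^T N^-1 X\<close> is the Hankel matrix of the moments
      \<open>i + j + 2\<close>.\<close>
    have sc1: "A - transpose_mat X * minv (Suc (Suc m) * p) N * X = Up p S (Suc n)"
    proof (rule eq_matI)
      fix a b assume "a < dim_row (Up p S (Suc n))" "b < dim_col (Up p S (Suc n))"
      then have ab: "a < Suc m * p" "b < Suc m * p" by (auto simp: Up' block_hankel_def)
      have "col X a = col N (a + p)"
        using ab p by (intro eq_vecI) (auto simp: X_def N block_hankel_def)
      then have "(transpose_mat X * minv (Suc (Suc m) * p) N * X) $$ (a,b) = X $$ (a + p, b)"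
        using minv_quad_entry(1)[OF pdN X ab, of "a + p"] ab by auto
      also have "\<dots> = S (a div p + b div p + 2) $$ (a mod p, b mod p)" using ab p by (simp add: X_def)
      finally show "(A - transpose_mat X * minv (Suc (Suc m) * p) N * X) $$ (a,b) = Up p S (Suc n) $$ (a,b)"
        using ab carrier_matD[OF X] mp by (simp add: Up' A block_hankel_entry del: assoc_mult_mat)
    qed (use schur_carriers(3)[OF pdN X Ac] in \<open>auto simp: Up' block_hankel_def\<close>)
    define F where "F = S (Suc n) - Slow p S (Suc (Suc n))"
    have Sl: "Slow p S (Suc (Suc n)) = transpose_mat ?h * minv (Suc m * p) A * ?h" by (simp add: Slow_def n A_def)
    have hc: "?h \<in> carrier_mat (Suc m * p) p" and vc: "?v \<in> carrier_mat (Suc m * p) p" unfolding h v by (rule block_vec_carrier)+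
    have Slc: "Slow p S (Suc (Suc n)) \<in> carrier_mat p p" unfolding Sl by (rule schur_carriers(7)[OF pdA hc S_carrier(1)])
    have Fc: "F \<in> carrier_mat p p" unfolding F_def using Slc by (intro minus_carrier_mat)
    note c7 = schur_carriers(7)[OF pdA XT Nc]
    \<comment> \<open>All block columns of \<open>X^T\<close> but the last are columns of
      \<open>A\<close>, and the last one is \<open>?h\<close>. So the difference is Hankel with
      blocks \<open>S (i+j) - S (i+j+1)\<close>, except in the corner, where \<open>S^-\<close> of
      the next moment appears inside \<open>F\<close>.\<close>
    have sc2: "N - transpose_mat (transpose_mat X) * minv (Suc m * p) A * transpose_mat X = four_block_mat U ?v (transpose_mat ?v) F" (is "?l = ?r")
    proof (rule eq_matI)
      have r: "dim_row ?r = Suc (Suc m) * p" "dim_col ?r = Suc (Suc m) * p"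
        using Fc by (auto simp: U block_hankel_def)
      show "dim_row ?l = dim_row ?r" "dim_col ?l = dim_col ?r" using r c7 by auto
      fix a b assume "a < dim_row ?r" "b < dim_col ?r"
      then have ab: "a < Suc (Suc m) * p" "b < Suc (Suc m) * p" using r by auto
      have cl: "col (transpose_mat X) a = col A a" if "a < Suc m * p" for a
        using that mp by (intro eq_vecI) (auto simp: X_def A block_hankel_def add.commute S_sym)
      have ch: "col (transpose_mat X) (Suc m * p + c) = col ?h c" if "c < p" for c
      proof -
        have q: "c + (p + m * p) = c + Suc m * p" by simp
        have "(c + Suc m * p) div p = Suc m" by (subst div_mult_self1) (use that p in simp_all)
        moreover have "(c + Suc m * p) mod p = c" by (subst mod_mult_self1) (use that p in simp_all)
        ultimately have "(c + (p + m * p)) div p = Suc m" "(c + (p + m * p)) mod p = c"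
          unfolding q by (simp_all only:)
        then show ?thesis using that mp p by (intro eq_vecI) (auto simp: X_def h block_vec_def add.commute add.left_commute S_sym)
      qed
      have l: "?l $$ (a,b) = S (a div p + b div p) $$ (a mod p, b mod p) - (transpose_mat (transpose_mat X) * minv (Suc m * p) A * transpose_mat X) $$ (a,b)"
        using ab carrier_matD[OF XT] by (simp add: N block_hankel_entry del: assoc_mult_mat)
      show "?l $$ (a,b) = ?r $$ (a,b)"
        using ab(1)
      proof (cases a rule: index_block_cases)
        case 1
        have "(transpose_mat (transpose_mat X) * minv (Suc m * p) A * transpose_mat X) $$ (a,b) = transpose_mat X $$ (a,b)"
          using minv_quad_entry(1)[OF pdA XT ab 1(1) cl[OF 1(1)]] .
        also have "\<dots> = S (a div p + b div p + 1) $$ (a mod p, b mod p)"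
          using 1 ab mp by (simp add: X_def add.commute S_sym)
        finally have e: "(transpose_mat (transpose_mat X) * minv (Suc m * p) A * transpose_mat X) $$ (a,b) = S (a div p + b div p + 1) $$ (a mod p, b mod p)" .
        show ?thesis using ab(2)
        proof (cases b rule: index_block_cases)
          case 1
          then show ?thesis unfolding l e using \<open>a < Suc m * p\<close> mp Fc by (simp add: U block_hankel_def)
        next
          case (2 c)
          then show ?thesis unfolding l e using \<open>a < Suc m * p\<close> mp Fc by (simp add: U v block_hankel_def block_vec_def add.commute)
        qed
      next
        case (2 c)
        note a2 = 2
        show ?thesis using ab(2)
        proof (cases b rule: index_block_cases)
          case 1
          have "(transpose_mat (transpose_mat X) * minv (Suc m * p) A * transpose_mat X) $$ (a,b) = transpose_mat X $$ (b,a)"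
            using minv_quad_entry(2)[OF pdA XT ab 1(1) cl[OF 1(1)]] .
          also have "\<dots> = S (a div p + b div p + 1) $$ (a mod p, b mod p)"
            using 1 ab mp by (simp add: X_def add.commute S_sym)
          finally show ?thesis unfolding l using 1 a2 mp Fc by (simp add: U v block_hankel_def block_vec_def add.commute S_sym)
        next
          case (2 c')
          have "(transpose_mat (transpose_mat X) * minv (Suc m * p) A * transpose_mat X) $$ (a,b) = Slow p S (Suc (Suc n)) $$ (c,c')"
            unfolding Sl by (rule minv_quad_cong[OF minv_pd(1)[OF pdA] XT ab hc a2(2) 2(2)]) (use a2 2 ch in auto)
          then show ?thesis unfolding l using 2 a2 mp Fc Slc by (simp add: U F_def n block_hankel_def mult_2)
        qed
      qed
    qed
    \<comment> \<open>One matrix, two eliminations: the pivot \<open>N\<close> shows that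
      \<open>M\<close> is positive definite and gives \<open>det N * det (Up p S (Suc n))\<close>;
      the pivot \<open>A\<close>, followed by \<open>U\<close>, ends in the width of the next
      range.\<close>
    define M where "M = four_block_mat N X (transpose_mat X) A"
    have pM: "pd_mat (Suc (Suc m) * p + Suc m * p) M" and dM: "det M = det N * det (Up p S (Suc n))"
      using schur_lower_right[OF pdN X Ac] pdU' unfolding sc1 M_def by auto
    have M': "M = four_block_mat N (transpose_mat (transpose_mat X)) (transpose_mat X) A" by (simp add: M_def)
    have p2: "pd_mat (Suc (Suc m) * p) (four_block_mat U ?v (transpose_mat ?v) F)"
      and d2: "det M = det A * det (four_block_mat U ?v (transpose_mat ?v) F)"
      using schur_upper_left[OF pdA XT Nc] pM unfolding sc2 M'[symmetric] by auto
    define V where "V = transpose_mat ?v * minv (Suc m * p) U * ?v"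
    have V: "V \<in> carrier_mat p p" unfolding V_def by (rule schur_carriers(7)[OF pdU vc Fc])
    have Su: "Sup_mat p S (Suc (Suc n)) = S (Suc n) - V" by (simp add: Sup_mat_def V_def U_def n)
    have FV: "F - V = Sup_mat p S (Suc (Suc n)) - Slow p S (Suc (Suc n))"
      unfolding Su F_def using V Slc by (intro eq_matI) auto
    have ar: "Suc m * p + p = Suc (Suc m) * p" by simp
    have "pd_mat p (F - V)" "det (four_block_mat U ?v (transpose_mat ?v) F) = det U * det (F - V)"
      using schur_lower_right[OF pdU vc Fc] p2 unfolding V_def[symmetric] ar by auto
    then show ?thesis using dM d2 unfolding FV by (simp add: N_def A_def U_def mult_ac)
  next
    case True
    then obtain m where n: "n = 2 * m" by (auto elim: evenE)
    define N where "N = Lo p S n"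
    define A where "A = Lo p S (Suc n)"
    define U where "U = Up p S n"
    have N: "N = block_hankel p (Suc m) S" and A: "A = block_hankel p (Suc m) (\<lambda>t. S (t + 1))"
      and U: "U = block_hankel p m (\<lambda>t. S (t + 1) - S (t + 2))"
      and Up': "Up p S (Suc n) = block_hankel p (Suc m) (\<lambda>t. S t - S (t + 1))"
      by (auto simp: N_def A_def U_def Lo_def Up_def n)
    have h: "?h = block_vec p (Suc m) (\<lambda>i. S (Suc m + i))" and v: "?v = block_vec p m (\<lambda>i. S (Suc m + i) - S (Suc m + i + 1))"
      by (auto simp: lo_vec_def up_vec_def n)
    have pdN: "pd_mat (Suc m * p) N" and pdA: "pd_mat (Suc m * p) A" and pdU: "pd_mat (m * p) U"
      and pdU': "pd_mat (Suc m * p) (Up p S (Suc n))"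
      using HposD[OF assms, of "Suc n"] HposD[OF assms, of n] by (auto simp: N_def A_def U_def n)
    note Ac = pd_matD(2)[OF pdA] and Nc = pd_matD(2)[OF pdN] and AT = pd_matD(3)[OF pdA]
    have mp: "a mod p < p" for a using p by simp
    \<comment> \<open>For even order all four blocks have the same size and the mixed block is
      \<open>A\<close> itself, so the elimination of \<open>A\<close> is the plain difference
      \<open>N - A\<close>.\<close>
    have "A * minv (Suc m * p) A * A = A" using minv_pd[OF pdA] Ac by simp
    then have sc1: "N - transpose_mat A * minv (Suc m * p) A * A = Up p S (Suc n)"
      using mp Nc Ac unfolding AT by (intro eq_matI) (auto simp: N A Up' block_hankel_entry block_hankel_def)
    define F where "F = S (Suc n) - Slow p S (Suc (Suc n))"
    have Sl: "Slow p S (Suc (Suc n)) = transpose_mat ?h * minv (Suc m * p) N * ?h" by (simp add: Slow_def n N_def)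
    have hc: "?h \<in> carrier_mat (Suc m * p) p" and vc: "?v \<in> carrier_mat (m * p) p" unfolding h v by (rule block_vec_carrier)+
    have Slc: "Slow p S (Suc (Suc n)) \<in> carrier_mat p p" unfolding Sl by (rule schur_carriers(7)[OF pdN hc S_carrier(1)])
    have Fc: "F \<in> carrier_mat p p" unfolding F_def using Slc by (intro minus_carrier_mat)
    note c7 = schur_carriers(7)[OF pdN Ac Ac]
    have sc2: "A - transpose_mat A * minv (Suc m * p) N * A = four_block_mat U ?v (transpose_mat ?v) F" (is "?l = ?r")
    proof (rule eq_matI)
      have r: "dim_row ?r = Suc m * p" "dim_col ?r = Suc m * p"
        using Fc by (auto simp: U block_hankel_def)
      show "dim_row ?l = dim_row ?r" "dim_col ?l = dim_col ?r" using r c7 by auto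
      fix a b assume "a < dim_row ?r" "b < dim_col ?r"
      then have ab: "a < Suc m * p" "b < Suc m * p" using r by auto
      have cl: "col A a = col N (a + p)" if "a < m * p" for a
        using that p by (intro eq_vecI) (auto simp: N A block_hankel_def)
      have ch: "col A (m * p + c) = col ?h c" if "c < p" for c
        using that p by (intro eq_vecI) (auto simp: A h block_vec_def block_hankel_def add.commute add.left_commute)
      have l: "?l $$ (a,b) = S (a div p + b div p + 1) $$ (a mod p, b mod p) - (transpose_mat A * minv (Suc m * p) N * A) $$ (a,b)"
        using ab carrier_matD[OF Ac] by (simp add: A block_hankel_entry del: assoc_mult_mat)
      show "?l $$ (a,b) = ?r $$ (a,b)"
        using ab(1)
      proof (cases a rule: index_block_cases)
        case 1
        have "(transpose_mat A * minv (Suc m * p) N * A) $$ (a,b) = A $$ (a + p,b)"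
          using minv_quad_entry(1)[OF pdN Ac ab _ cl[OF 1(1)]] 1(1) by simp
        also have "\<dots> = S (a div p + b div p + 2) $$ (a mod p, b mod p)"
          using 1 ab p by (simp add: A block_hankel_entry)
        finally have e: "(transpose_mat A * minv (Suc m * p) N * A) $$ (a,b) = S (a div p + b div p + 2) $$ (a mod p, b mod p)" .
        show ?thesis using ab(2)
        proof (cases b rule: index_block_cases)
          case 1
          then show ?thesis unfolding l e using \<open>a < m * p\<close> mp Fc by (simp add: U block_hankel_def)
        next
          case (2 c)
          then show ?thesis unfolding l e using \<open>a < m * p\<close> mp Fc by (simp add: U v block_hankel_def block_vec_def add.commute)
        qed
      next
        case (2 c)
        note a2 = 2
        show ?thesis using ab(2)
        proof (cases b rule: index_block_cases)
          case 1
          have "(transpose_mat A * minv (Suc m * p) N * A) $$ (a,b) = A $$ (b + p,a)"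
            using minv_quad_entry(2)[OF pdN Ac ab _ cl[OF 1(1)]] 1(1) by simp
          also have "\<dots> = S (a div p + b div p + 2) $$ (a mod p, b mod p)"
            using 1 ab p mp by (simp add: A block_hankel_entry add.commute S_sym)
          finally show ?thesis unfolding l using 1 a2 mp Fc by (simp add: U v block_hankel_def block_vec_def add.commute S_sym)
        next
          case (2 c')
          have "(transpose_mat A * minv (Suc m * p) N * A) $$ (a,b) = Slow p S (Suc (Suc n)) $$ (c,c')"
            unfolding Sl by (rule minv_quad_cong[OF minv_pd(1)[OF pdN] Ac ab hc a2(2) 2(2)]) (use a2 2 ch in auto)
          then show ?thesis unfolding l using 2 a2 mp Fc Slc by (simp add: U F_def n block_hankel_def mult_2)
        qed
      qed
    qed
    define M where "M = four_block_mat N A A A"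
    have pM: "pd_mat (Suc m * p + Suc m * p) M" and dM: "det M = det A * det (Up p S (Suc n))"
      using schur_upper_left[OF pdA Ac Nc] pdU' unfolding sc1 unfolding M_def AT by auto
    have p2: "pd_mat (Suc m * p) (four_block_mat U ?v (transpose_mat ?v) F)"
      and d2: "det M = det N * det (four_block_mat U ?v (transpose_mat ?v) F)"
      using schur_lower_right[OF pdN Ac Ac] pM unfolding sc2 unfolding M_def AT by auto
    define V where "V = transpose_mat ?v * minv (m * p) U * ?v"
    have V: "V \<in> carrier_mat p p" unfolding V_def by (rule schur_carriers(7)[OF pdU vc Fc])
    have Su: "Sup_mat p S (Suc (Suc n)) = S (Suc n) - V" by (simp add: Sup_mat_def V_def U_def n)
    have FV: "F - V = Sup_mat p S (Suc (Suc n)) - Slow p S (Suc (Suc n))"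
      unfolding Su F_def using V Slc by (intro eq_matI) auto
    have ar: "m * p + p = Suc m * p" by simp
    have "pd_mat p (F - V)" "det (four_block_mat U ?v (transpose_mat ?v) F) = det U * det (F - V)"
      using schur_lower_right[OF pdU vc Fc] p2 unfolding V_def[symmetric] ar by auto
    then show ?thesis using dM d2 unfolding FV by (simp add: N_def A_def U_def mult_ac)
  qed
  then show "pd_mat p (Sup_mat p S (Suc (Suc n)) - Slow p S (Suc (Suc n)))"
    "det (Sup_mat p S (Suc (Suc n)) - Slow p S (Suc (Suc n))) * (det (Lo p S n) * det (Up p S n)) =
      det (Lo p S (Suc n)) * det (Up p S (Suc n))" by auto
qed

lemma range_width_pd:
  assumes "Hpos p S n" shows "pd_mat p (Sup_mat p S (Suc n) - Slow p S (Suc n))"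
proof (cases n)
  case 0
  have "1\<^sub>m p - 0\<^sub>m p p = (1\<^sub>m p :: real mat)" by (intro eq_matI) auto
  then show ?thesis using 0 pd_one by (simp add: Sup_mat_def Slow_def)
qed (use gram_two_ways(1) assms in auto)

text \<open>Two consecutive instances of \<open>gram_two_ways\<close> are multiplied; the Hankel
  determinants of order \<open>n + 1\<close> factor through those of order \<open>n - 1\<close> by
  \<open>Hpos_step\<close>, and the positive common factor cancels. Order 0 has no predecessor and
  is computed directly.\<close>

lemma range_width_det:
  assumes "Hpos p S (Suc n)"
  shows "det (Sup_mat p S (Suc (Suc n)) - Slow p S (Suc (Suc n))) * det (Sup_mat p S (Suc n) - Slow p S (Suc n)) =
     det (S (Suc n) - Slow p S (Suc n)) * det (Sup_mat p S (Suc n) - S (Suc n))"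
proof -
  have H: "Hpos p S n" using Hpos_mono[OF assms] by simp
  have pos: "0 < det (Lo p S j) \<and> 0 < det (Up p S j)" if "j \<le> Suc n" for j
    using HposD[OF assms that] pd_det_pos by blast
  note g = gram_two_ways(2)[OF assms]
  show ?thesis
  proof (cases n)
    case 0
    have 1: "1\<^sub>m p - 0\<^sub>m p p = (1\<^sub>m p :: real mat)" and 2: "S 1 - 0\<^sub>m p p = S 1" by (intro eq_matI; simp)+
    have "det (Up p S 0) = 1" using Up_carrier[of 0] by (simp add: det_dim_zero)
    then show ?thesis using g 0 1 2 S0 Lo_Up_1 by (simp add: Sup_mat_def Slow_def)
  next
    case (Suc k)
    note g' = gram_two_ways(2)[of k] and st = Hpos_step(3,4)[OF H]
    define x where "x = det (Lo p S k) * det (Up p S k)"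
    have "x > 0" using pos[of k] Suc by (simp add: x_def)
    have "(det (Sup_mat p S (Suc (Suc n)) - Slow p S (Suc (Suc n))) * det (Sup_mat p S (Suc n) - Slow p S (Suc n))) * x
      = det (Sup_mat p S (Suc (Suc n)) - Slow p S (Suc (Suc n))) * (det (Lo p S n) * det (Up p S n))"
      using g' H Suc by (simp add: x_def)
    also have "\<dots> = x * (det (S (Suc n) - Slow p S (Suc n)) * det (Sup_mat p S (Suc n) - S (Suc n)))"
      unfolding g using st Suc by (simp add: x_def)
    finally show ?thesis using \<open>x > 0\<close> by simp
  qed
qed

end

subsection \<open>The moment space\<close>

text \<open>Moments of the discrete matrix measure with rank-one mass \<open>v v^T\<close>,
  \<open>v = V l\<close>, at the node \<open>t l\<close>.\<close>

definition atoms :: "nat \<Rightarrow> nat \<Rightarrow> (nat \<Rightarrow> real) \<Rightarrow> (nat \<Rightarrow> nat \<Rightarrow> real) \<Rightarrow> nat \<Rightarrow> real mat" where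
  "atoms p N t V k = Matrix.mat p p (\<lambda>(i,j). \<Sum>l<N. t l ^ k * V l i * V l j)"

text \<open>\<open>G^(-1/2) K G^(-1/2)\<close> is diagonalized as \<open>Q diag(f) Q^T\<close>, and
  \<open>V = Q^T G^(1/2)\<close>, \<open>R = Q^T G^(-1/2)\<close>. The relations through
  \<open>R\<close> transfer any coincidence between a column of \<open>G\<close> and a column of
  \<open>K\<close> to the columns of \<open>V\<close> and \<open>diag(f) V\<close>.\<close>

lemma simultaneous_diagonalization:
  assumes G: "pd_mat n G" and K: "pd_mat n K" and GK: "pd_mat n (G - K)"
  obtains V f R where "V \<in> carrier_mat n n" "R \<in> carrier_mat n n" "G = transpose_mat V * V"
    "V = R * G" "mat_diag n f * V = R * K" "K = transpose_mat V * (mat_diag n f * V)" "\<forall>i<n. 0 < f i \<and> f i < 1"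
proof -
  define E where "E = msqrt n G"
  have E: "pd_mat n E" "E * E = G" using msqrt_pd[OF G] msqrt_psd(2)[OF pd_imp_psd[OF G]] by (auto simp: E_def)
  note DE = pd_matD[OF E(1)] and M = minv_pd[OF E(1)] and DK = pd_matD[OF K] and DG = pd_matD[OF G]
  define F where "F = minv n E"
  have F: "F \<in> carrier_mat n n" "E * F = 1\<^sub>m n" "F * E = 1\<^sub>m n" "transpose_mat F = F" using M by (auto simp: F_def)
  have "sym_mat n (transpose_mat F * K * F)" by (rule sym_congruence[OF DK(1) F(1)])
  then obtain Q f where Q: "orth_mat n Q" and T: "transpose_mat F * K * F = spec n Q f" by (rule sym_matE)
  note DQ = orth_matD[OF Q]
  define V where "V = transpose_mat Q * E"
  define R where "R = transpose_mat Q * F"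
  have V: "V \<in> carrier_mat n n" and R: "R \<in> carrier_mat n n" using DQ DE F by (auto simp: V_def R_def)
  have VT: "transpose_mat V = E * Q" unfolding V_def using DQ DE by (simp add: transpose_mult[of _ n n _ n])
  have "transpose_mat V * V = E * (Q * transpose_mat Q) * E" unfolding VT unfolding V_def
    using DQ(1,2) DE(2) by (simp add: square_assoc[of _ n])
  then have GV: "G = transpose_mat V * V" unfolding DQ(4) using DE E by simp
  have "R * G = transpose_mat Q * ((F * E) * E)" unfolding R_def E(2)[symmetric]
    using DQ(1,2) DE(2) F(1) by (simp add: square_assoc[of _ n])
  then have VR: "V = R * G" unfolding F(3) V_def using DE by simp
  have "E * (F * K * F) * E = (E * F) * K * (F * E)"
    using DE(2) DK(2) F(1) by (simp add: square_assoc[of _ n])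
  then have KF: "K = E * spec n Q f * E" using T F DK(2) by simp
  have KV: "K = transpose_mat V * (mat_diag n f * V)" unfolding KF VT unfolding V_def spec_def
    using DE(2) DQ(1,2) by (simp add: square_assoc[of _ n])
  have "R * K = transpose_mat Q * ((F * E) * (Q * (mat_diag n f * V)))"
    unfolding KV VT R_def using DE(2) DQ(1,2) F(1) V by (simp add: square_assoc[of _ n])
  also have "\<dots> = (transpose_mat Q * Q) * (mat_diag n f * V)" unfolding F(3)
    using DQ(1,2) V by (simp add: square_assoc[of _ n] left_mult_one_mat[of _ n n])
  finally have DV: "mat_diag n f * V = R * K" unfolding DQ(3) using V by (simp add: left_mult_one_mat[of _ n n])
  have "V * (F * Q) = transpose_mat Q * ((E * F) * Q)" unfolding V_def
    using DE(2) DQ(1,2) F(1) by (simp add: square_assoc[of _ n])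
  then have inv: "V * (F * Q) = 1\<^sub>m n" unfolding F(2) using DQ by simp
  have FQ: "F * Q \<in> carrier_mat n n" using F DQ by simp
  have "transpose_mat V * mat_diag n f * V = K" unfolding KV using V by (simp add: square_assoc[of _ n])
  then have f0: "\<forall>i<n. 0 < f i"
    using pd_congruence_iff[OF mat_diag_dim V FQ inv, of f] K pd_mat_diag_iff by simp
  have "1\<^sub>m n - mat_diag n f = mat_diag n (\<lambda>i. 1 - f i)" by (intro eq_matI) (auto simp: mat_diag_def)
  then have "transpose_mat V * mat_diag n (\<lambda>i. 1 - f i) * V = transpose_mat V * ((1\<^sub>m n - mat_diag n f) * V)"
    using V by (simp add: square_assoc[of _ n])
  also have "\<dots> = transpose_mat V * (V - mat_diag n f * V)"
    using V by (simp add: minus_mult_distrib_mat[of _ n n _ _ n])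
  also have "\<dots> = G - K" unfolding GV KV
    using V by (intro mult_minus_distrib_mat[of _ n n _ n]) auto
  finally have f1: "\<forall>i<n. 0 < 1 - f i"
    using pd_congruence_iff[OF mat_diag_dim V FQ inv, of "\<lambda>i. 1 - f i"] GK pd_mat_diag_iff[of n "\<lambda>i. 1 - f i"] by simp
  show ?thesis by (rule that[OF V R GV VR DV KV]) (use f0 f1 in auto)
qed

text \<open>Matrix Gauss quadrature: \<open>G\<close> is the Gram matrix and \<open>K\<close>
  represents multiplication by the variable. Diagonalizing both makes the eigenvalues
  \<open>f\<close> the nodes and the first \<open>p\<close> columns of \<open>V\<close> the weights.
  Nodes lie strictly between 0 and 1 because \<open>K\<close> and \<open>G - K\<close> are both
  positive definite.\<close>

lemma Hpos_atoms:
  assumes p: "0 < p" and symS: "\<And>i. sym_mat p (S i)" and S0: "S 0 = 1\<^sub>m p" and H: "Hpos p S (2 * m + 1)"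
  obtains t V where "\<And>l. l < Suc m * p \<Longrightarrow> 0 \<le> t l \<and> t l \<le> (1::real)" "\<And>k. k \<le> 2 * m + 1 \<Longrightarrow> S k = atoms p (Suc m * p) t V k"
proof -
  let ?N = "Suc m * p"
  note Sc = sym_matD(1)[OF symS]
  have Sd: "dim_row (S i) = p" "dim_col (S i) = p" for i using Sc[of i] by auto
  define G where "G = block_hankel p (Suc m) S"
  define K where "K = block_hankel p (Suc m) (\<lambda>t. S (t + 1))"
  have G: "pd_mat ?N G" using HposD(1)[OF p symS S0 H, of "2 * m"] by (simp add: G_def Lo_def)
  have K: "pd_mat ?N K" using HposD(1)[OF p symS S0 H, of "2 * m + 1"] by (simp add: K_def Lo_def)
  have "G - K = Up p S (2 * m + 1)" using Sd p by (intro eq_matI) (auto simp: G_def K_def Up_def block_hankel_def)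
  then have GK: "pd_mat ?N (G - K)" using HposD(2)[OF p symS S0 H, of "2 * m + 1"] by simp
  obtain V f R where V: "V \<in> carrier_mat ?N ?N" and R: "R \<in> carrier_mat ?N ?N" and GV: "G = transpose_mat V * V"
    and VR: "V = R * G" and DV: "mat_diag ?N f * V = R * K" and KV: "K = transpose_mat V * (mat_diag ?N f * V)" and f: "\<forall>i<?N. 0 < f i \<and> f i < 1"
    using simultaneous_diagonalization[OF G K GK] by metis
  have fV: "(mat_diag ?N f * V) $$ (l,a) = f l * V $$ (l,a)" if "l < ?N" "a < ?N" for l a
    using that V by (simp add: mat_diag_mult_left)
  have GKc: "G \<in> carrier_mat ?N ?N" "K \<in> carrier_mat ?N ?N" using G K pd_matD by auto
  \<comment> \<open>The shifted columns of \<open>G\<close> are columns of \<open>K\<close>; in the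
    coordinates \<open>V\<close> the block shift is multiplication by the node, so \<open>V\<close>
    has Vandermonde form.\<close>
  have step: "V $$ (l, a + p) = f l * V $$ (l, a)" if "l < ?N" "a < m * p" for l a
  proof -
    have a: "a + p < ?N" "a < ?N" using that p by auto
    have "col G (a + p) = col K a" using a p by (intro eq_vecI) (auto simp: G_def K_def block_hankel_def)
    then have "(R * G) $$ (l, a + p) = (R * K) $$ (l, a)" using R GKc that(1) a by simp
    then show ?thesis using VR DV fV[OF that(1) a(2)] by simp
  qed
  have pw: "V $$ (l, i * p + c) = f l ^ i * V $$ (l, c)" if "l < ?N" "i \<le> m" "c < p" for l i c
    using that(2)
  proof (induction i)
    case (Suc i)
    have "i * p + c < Suc i * p" using that by simp
    also have "\<dots> \<le> m * p" using Suc.prems by (intro mult_le_mono1)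
    finally have "V $$ (l, (i * p + c) + p) = f l * V $$ (l, i * p + c)" by (rule step[OF that(1)])
    then show ?case using Suc by (simp add: ac_simps)
  qed simp
  have lt: "i * p + c < ?N" if "i \<le> m" "c < p" for i c
  proof -
    have "i * p + c < Suc i * p" using that by simp
    also have "\<dots> \<le> ?N" using that by (intro mult_le_mono1) simp
    finally show ?thesis .
  qed
  have dm: "(i * p + c) div p = i" "(i * p + c) mod p = c" if "c < p" for i c using that by auto
  have mg: "S (i + j) $$ (a,b) = (\<Sum>l<?N. f l ^ (i + j) * V $$ (l,a) * V $$ (l,b))" if "i \<le> m" "j \<le> m" "a < p" "b < p" for i j a b
  proof -
    have "G $$ (i * p + a, j * p + b) = S (i + j) $$ (a,b)"
      unfolding G_def block_hankel_entry[OF lt[OF that(1,3)] lt[OF that(2,4)]] dm[OF that(3)] dm[OF that(4)] ..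
    moreover have "G $$ (i * p + a, j * p + b) = (\<Sum>l<?N. V $$ (l, i * p + a) * V $$ (l, j * p + b))"
      unfolding GV using V lt[OF that(1,3)] lt[OF that(2,4)] by (simp add: scalar_prod_def lessThan_atLeast0 del: mult_Suc)
    ultimately show ?thesis using pw[OF _ that(1,3)] pw[OF _ that(2,4)] by (simp add: power_add ac_simps)
  qed
  have mk: "S (2 * m + 1) $$ (a,b) = (\<Sum>l<?N. f l ^ (2 * m + 1) * V $$ (l,a) * V $$ (l,b))" if "a < p" "b < p" for a b
  proof -
    have "K $$ (m * p + a, m * p + b) = S (m + m + 1) $$ (a,b)"
      unfolding K_def block_hankel_entry[OF lt[OF le_refl that(1)] lt[OF le_refl that(2)]] dm[OF that(1)] dm[OF that(2)] ..
    moreover have "K $$ (m * p + a, m * p + b) = (\<Sum>l<?N. V $$ (l, m * p + a) * (f l * V $$ (l, m * p + b)))"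
    proof -
      have gen: "(transpose_mat V * D) $$ (x,y) = (\<Sum>l<?N. V $$ (l,x) * D $$ (l,y))"
        if "D \<in> carrier_mat ?N ?N" "x < ?N" "y < ?N" for D x y
        using that V by (simp add: scalar_prod_def lessThan_atLeast0 del: mult_Suc)
      have D: "mat_diag ?N f * V \<in> carrier_mat ?N ?N" using V by simp
      have "K $$ (m * p + a, m * p + b) = (\<Sum>l<?N. V $$ (l, m * p + a) * (mat_diag ?N f * V) $$ (l, m * p + b))"
        unfolding KV by (rule gen[OF D lt[OF le_refl that(1)] lt[OF le_refl that(2)]])
      then show ?thesis using fV lt[OF le_refl that(2)] by simp
    qed
    ultimately have "S (m + m + 1) $$ (a,b) = (\<Sum>l<?N. V $$ (l, m * p + a) * (f l * V $$ (l, m * p + b)))" by simp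
    also have "\<dots> = (\<Sum>l<?N. f l ^ (2 * m + 1) * V $$ (l,a) * V $$ (l,b))"
      using pw[OF _ le_refl that(1)] pw[OF _ le_refl that(2)]
      by (intro sum.cong) (simp_all add: power_mult power2_eq_square power_mult_distrib)
    finally show ?thesis by (simp add: mult_2)
  qed
  show ?thesis
  proof (rule that[of f "\<lambda>l i. V $$ (l,i)"])
    show "0 \<le> f l \<and> f l \<le> 1" if "l < ?N" for l using f that by force
    show "S k = atoms p ?N f (\<lambda>l i. V $$ (l, i)) k" if k: "k \<le> 2 * m + 1" for k
    proof (rule eq_matI)
      fix a b assume "a < dim_row (atoms p ?N f (\<lambda>l i. V $$ (l, i)) k)" "b < dim_col (atoms p ?N f (\<lambda>l i. V $$ (l, i)) k)"
      then have ab: "a < p" "b < p" by (auto simp: atoms_def)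
      show "S k $$ (a,b) = atoms p ?N f (\<lambda>l i. V $$ (l, i)) k $$ (a,b)"
      proof (cases "k = 2 * m + 1")
        case True
        then show ?thesis using mk[OF ab] ab by (simp add: atoms_def)
      next
        case False
        then have "min k m \<le> m" "k - min k m \<le> m" "min k m + (k - min k m) = k" using k by auto
        then show ?thesis using mg[of "min k m" "k - min k m", OF _ _ ab] ab by (simp add: atoms_def)
      qed
    qed (use Sd in \<open>auto simp: atoms_def\<close>)
  qed
qed

section \<open>Dependence on the initial moments\<close>

lemma Lo_cong: "(\<And>i. i \<le> n \<Longrightarrow> S i = T i) \<Longrightarrow> Lo p S n = Lo p T n"
proof -
  assume e: "\<And>i. i \<le> n \<Longrightarrow> S i = T i"
  have "a div p + b div p + (if even n then 0 else 1) \<le> n" if "a < (n div 2 + 1) * p" "b < (n div 2 + 1) * p" for a b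
    using less_mult_imp_div_less[OF that(1)] less_mult_imp_div_less[OF that(2)] by (cases "even n") (auto elim!: evenE oddE)
  then show ?thesis unfolding Lo_def block_hankel_def using e
    by (intro cong_mat) (auto split: if_splits)
qed

lemma Up_cong: "(\<And>i. i \<le> n \<Longrightarrow> S i = T i) \<Longrightarrow> Up p S n = Up p T n"
proof -
  assume e: "\<And>i. i \<le> n \<Longrightarrow> S i = T i"
  have le: "a div p + b div p + (if even n then 2 else 1) \<le> n" if "a < ((n + 1) div 2) * p" "b < ((n + 1) div 2) * p" for a b
    using less_mult_imp_div_less[OF that(1)] less_mult_imp_div_less[OF that(2)] by (cases "even n") (auto elim!: evenE oddE)
  have "S (a div p + b div p) = T (a div p + b div p) \<and> S (a div p + b div p + 1) = T (a div p + b div p + 1)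
      \<and> (even n \<longrightarrow> S (a div p + b div p + 2) = T (a div p + b div p + 2))"
    if "a < ((n + 1) div 2) * p" "b < ((n + 1) div 2) * p" for a b
    using le[OF that] e by (auto split: if_splits)
  then show ?thesis unfolding Up_def block_hankel_def
    by (intro cong_mat) auto
qed

lemma Hpos_cong: "(\<And>i. i \<le> n \<Longrightarrow> S i = T i) \<Longrightarrow> Hpos p S n \<longleftrightarrow> Hpos p T n"
proof -
  assume e: "\<And>i. i \<le> n \<Longrightarrow> S i = T i"
  have "Lo p S j = Lo p T j \<and> Up p S j = Up p T j" if "j \<le> n" for j
    using that e by (intro conjI Lo_cong Up_cong) auto
  then show ?thesis unfolding Hpos_def by simp
qed

lemma Slow_cong: "(\<And>i. i < n \<Longrightarrow> S i = T i) \<Longrightarrow> Slow p S n = Slow p T n"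
proof (cases "n \<le> 1")
  case False
  assume e: "\<And>i. i < n \<Longrightarrow> S i = T i"
  have "(n + 1) div 2 + a div p < n" if "a < (n div 2) * p" for a
    using less_mult_imp_div_less[OF that] by linarith
  then have "lo_vec p S n = lo_vec p T n" unfolding lo_vec_def block_vec_def using e
    by (intro cong_mat) auto
  moreover have "Lo p S (n - 2) = Lo p T (n - 2)" by (rule Lo_cong) (use e False in auto)
  ultimately show ?thesis by (simp add: Slow_def)
qed (simp add: Slow_def)

lemma Sup_cong: "(\<And>i. i < n \<Longrightarrow> S i = T i) \<Longrightarrow> Sup_mat p S n = Sup_mat p T n"
proof (cases "n \<le> 1")
  case False
  assume e: "\<And>i. i < n \<Longrightarrow> S i = T i"
  have "n div 2 + a div p + 1 < n" if "a < ((n - 1) div 2) * p" for a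
    using less_mult_imp_div_less[OF that] by linarith
  then have "up_vec p S n = up_vec p T n" unfolding up_vec_def block_vec_def using e
    by (intro cong_mat) force+
  moreover have "Up p S (n - 2) = Up p T (n - 2)" by (rule Up_cong) (use e False in auto)
  ultimately show ?thesis using e[of "n - 1"] False by (simp add: Sup_mat_def)
qed (simp add: Sup_mat_def)

section \<open>Necessity of the Hankel inequalities\<close>

definition Hpsd :: "nat \<Rightarrow> (nat \<Rightarrow> real mat) \<Rightarrow> nat \<Rightarrow> bool" where
  "Hpsd p S n \<longleftrightarrow> (\<forall>j\<le>n. psd_mat ((j div 2 + 1) * p) (Lo p S j) \<and> psd_mat ((j + 1) div 2 * p) (Up p S j))"

lemma Hpsd_cong: "(\<And>i. i \<le> n \<Longrightarrow> S i = T i) \<Longrightarrow> Hpsd p S n \<longleftrightarrow> Hpsd p T n"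
proof -
  assume e: "\<And>i. i \<le> n \<Longrightarrow> S i = T i"
  have "Lo p S j = Lo p T j \<and> Up p S j = Up p T j" if "j \<le> n" for j
    using that e by (intro conjI Lo_cong Up_cong) auto
  then show ?thesis unfolding Hpsd_def by simp
qed

text \<open>The block Hankel matrix of one atom \<open>W\<close> at \<open>t\<close> is
  \<open>E^T W E\<close> with the block row \<open>E = (1, t, t^2, ...)\<close>.\<close>

lemma psd_hankel_atom:
  assumes W: "psd_mat p W" and p: "0 < p"
  shows "psd_mat (r * p) (Matrix.mat (r * p) (r * p) (\<lambda>(a,b). t ^ (a div p + b div p) * W $$ (a mod p, b mod p)))"
proof -
  define E where "E = Matrix.mat p (r * p) (\<lambda>(i,a). if a mod p = i then t ^ (a div p) else 0)"
  have E: "E \<in> carrier_mat p (r * p)" by (simp add: E_def)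
  note D = psd_matD[OF W]
  have "transpose_mat E * W * E = Matrix.mat (r * p) (r * p) (\<lambda>(a,b). t ^ (a div p + b div p) * W $$ (a mod p, b mod p))" (is "?l = ?r")
  proof (rule eq_matI)
    fix a b assume "a < dim_row ?r" "b < dim_col ?r"
    then have ab: "a < r * p" "b < r * p" by auto
    have mp: "a mod p < p" "b mod p < p" using p by auto
    have WE: "(W *\<^sub>v col E b) $ i = t ^ (b div p) * W $$ (i, b mod p)" if "i < p" for i
    proof -
      have "(W *\<^sub>v col E b) $ i = (\<Sum>j<p. W $$ (i,j) * (if b mod p = j then t ^ (b div p) else 0))"
        using that D(2) ab by (simp add: scalar_prod_def lessThan_atLeast0 E_def)
      also have "\<dots> = (\<Sum>j<p. if j = b mod p then W $$ (i,j) * t ^ (b div p) else 0)"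
        by (intro sum.cong) auto
      finally have "(W *\<^sub>v col E b) $ i = (\<Sum>j<p. if j = b mod p then W $$ (i,j) * t ^ (b div p) else 0)" .
      then show ?thesis using mp by simp
    qed
    have "?l $$ (a,b) = col E a \<bullet> (W *\<^sub>v col E b)" by (rule quad_block_entry[OF E D(2) ab])
    also have "\<dots> = (\<Sum>i<p. (if a mod p = i then t ^ (a div p) else 0) * (W *\<^sub>v col E b) $ i)"
      using D(2) ab by (simp add: scalar_prod_def lessThan_atLeast0 E_def)
    also have "\<dots> = (\<Sum>i<p. if i = a mod p then t ^ (a div p) * (t ^ (b div p) * W $$ (i, b mod p)) else 0)"
      using WE by (intro sum.cong) auto
    finally show "?l $$ (a,b) = ?r $$ (a,b)" using mp ab by (simp add: power_add)
  qed (use E in auto)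
  then show ?thesis using psd_congruence[OF W E] by simp
qed

lemma psd_sum:
  assumes c: "\<And>l. l < N \<Longrightarrow> 0 \<le> c l" and M: "\<And>l. l < N \<Longrightarrow> psd_mat d (M l)"
  shows "psd_mat d (Matrix.mat d d (\<lambda>(a,b). \<Sum>l<(N::nat). c l * M l $$ (a,b)))"
  unfolding psd_mat_def
proof (intro conjI ballI)
  show "sym_mat d (Matrix.mat d d (\<lambda>(a,b). \<Sum>l<N. c l * M l $$ (a,b)))"
    using sym_matD(3)[OF psd_matD(1)[OF M]] by (auto simp: sym_mat_def intro!: eq_matI sum.cong)
  fix v :: "real vec" assume v: "v \<in> carrier_vec d"
  have "v \<bullet> (Matrix.mat d d (\<lambda>(a,b). \<Sum>l<N. c l * M l $$ (a,b)) *\<^sub>v v)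
    = (\<Sum>i<d. \<Sum>j<d. v $ i * (\<Sum>l<N. c l * M l $$ (i,j)) * v $ j)"
    by (subst quad_expand[OF _ v]) auto
  also have "\<dots> = (\<Sum>i<d. \<Sum>j<d. \<Sum>l<N. c l * (v $ i * M l $$ (i,j) * v $ j))"
    by (simp add: sum_distrib_left sum_distrib_right ac_simps)
  also have "\<dots> = (\<Sum>i<d. \<Sum>l<N. \<Sum>j<d. c l * (v $ i * M l $$ (i,j) * v $ j))"
    by (intro sum.cong refl sum.swap)
  also have "\<dots> = (\<Sum>l<N. \<Sum>i<d. \<Sum>j<d. c l * (v $ i * M l $$ (i,j) * v $ j))"
    by (rule sum.swap)
  also have "\<dots> = (\<Sum>l<N. c l * (v \<bullet> (M l *\<^sub>v v)))"
  proof (rule sum.cong)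
    fix l assume "l \<in> {..<N}"
    then show "(\<Sum>i<d. \<Sum>j<d. c l * (v $ i * M l $$ (i,j) * v $ j)) = c l * (v \<bullet> (M l *\<^sub>v v))"
      using quad_expand[OF psd_matD(2)[OF M] v] by (simp add: sum_distrib_left)
  qed simp
  also have "\<dots> \<ge> 0" using c psd_matD(4)[OF M] v by (intro sum_nonneg mult_nonneg_nonneg) auto
  finally show "0 \<le> v \<bullet> (Matrix.mat d d (\<lambda>(a,b). \<Sum>l<N. c l * M l $$ (a,b)) *\<^sub>v v)" .
qed

lemma psd_limit:
  assumes "\<And>n. psd_mat d (M n)" and A: "A \<in> carrier_mat d d"
    and lim: "\<And>a b. a < d \<Longrightarrow> b < d \<Longrightarrow> (\<lambda>n. M n $$ (a,b)) \<longlonglongrightarrow> A $$ (a,b)"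
  shows "psd_mat d A"
  unfolding psd_mat_def
proof (intro conjI ballI)
  note D = psd_matD[OF assms(1)]
  have "A $$ (a,b) = A $$ (b,a)" if "a < d" "b < d" for a b
    using LIMSEQ_unique[OF lim[OF that]] lim[OF that(2,1)] sym_matD(3)[OF D(1) that] by simp
  then show "sym_mat d A" using A by (auto simp: sym_mat_def intro!: eq_matI)
  fix v :: "real vec" assume v: "v \<in> carrier_vec d"
  have L: "(\<lambda>n. \<Sum>i<d. \<Sum>j<d. v $ i * M n $$ (i,j) * v $ j) \<longlonglongrightarrow> (\<Sum>i<d. \<Sum>j<d. v $ i * A $$ (i,j) * v $ j)"
    using lim by (intro tendsto_intros) auto
  moreover have "0 \<le> (\<Sum>i<d. \<Sum>j<d. v $ i * M n $$ (i,j) * v $ j)" for n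
    using D(4)[OF v, of n] quad_expand[OF D(2) v] by simp
  ultimately show "0 \<le> v \<bullet> (A *\<^sub>v v)" unfolding quad_expand[OF A v] using LIMSEQ_le_const[OF L, of 0] by blast
qed

text \<open>The Hankel matrices are sums over the atoms with the weights 1, t, t(1-t) and 1-t, all
  nonnegative on [0,1].\<close>

lemma Hpsd_atomic:
  assumes p: "0 < p" and t: "\<And>l. l < (N::nat) \<Longrightarrow> 0 \<le> t l \<and> t l \<le> (1::real)" and W: "\<And>l. l < N \<Longrightarrow> psd_mat p (W l)"
    and S: "\<And>k. S k = Matrix.mat p p (\<lambda>(i,j). \<Sum>l<N. t l ^ k * W l $$ (i,j))"
  shows "Hpsd p S n"
proof -
  have mp: "a mod p < p" for a using p by simp
  have psd: "psd_mat (r * p) (Matrix.mat (r * p) (r * p) (\<lambda>(a,b). \<Sum>l<N. c l * (t l ^ (a div p + b div p) * W l $$ (a mod p, b mod p))))"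
    if "\<And>l. l < N \<Longrightarrow> 0 \<le> c l" for c r
  proof -
    have "psd_mat (r * p) (Matrix.mat (r * p) (r * p) (\<lambda>(a,b). \<Sum>l<N. c l *
       Matrix.mat (r * p) (r * p) (\<lambda>(a,b). t l ^ (a div p + b div p) * W l $$ (a mod p, b mod p)) $$ (a,b)))"
      by (rule psd_sum[where M = "\<lambda>l. Matrix.mat (r * p) (r * p) (\<lambda>(a,b). t l ^ (a div p + b div p) * W l $$ (a mod p, b mod p))"])
        (use psd_hankel_atom[OF W p] that in auto)
    also have "Matrix.mat (r * p) (r * p) (\<lambda>(a,b). \<Sum>l<N. c l *
       Matrix.mat (r * p) (r * p) (\<lambda>(a,b). t l ^ (a div p + b div p) * W l $$ (a mod p, b mod p)) $$ (a,b))
      = Matrix.mat (r * p) (r * p) (\<lambda>(a,b). \<Sum>l<N. c l * (t l ^ (a div p + b div p) * W l $$ (a mod p, b mod p)))"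
      by (intro cong_mat) auto
    finally show ?thesis .
  qed
  have "psd_mat ((j div 2 + 1) * p) (Lo p S j)" for j
  proof -
    have "Lo p S j = Matrix.mat ((j div 2 + 1) * p) ((j div 2 + 1) * p) (\<lambda>(a,b). \<Sum>l<N. (if even j then 1 else t l) * (t l ^ (a div p + b div p) * W l $$ (a mod p, b mod p)))"
      unfolding Lo_def block_hankel_def using mp by (intro cong_mat) (auto simp: S ac_simps)
    then show ?thesis using psd[of "\<lambda>l. if even j then 1 else t l" "j div 2 + 1"] t by simp
  qed
  moreover have "psd_mat ((j + 1) div 2 * p) (Up p S j)" for j
  proof -
    have "Up p S j = Matrix.mat ((j + 1) div 2 * p) ((j + 1) div 2 * p) (\<lambda>(a,b). \<Sum>l<N. (if even j then t l * (1 - t l) else 1 - t l) * (t l ^ (a div p + b div p) * W l $$ (a mod p, b mod p)))"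
      unfolding Up_def block_hankel_def using mp by (intro cong_mat) (auto simp: S sum_subtractf[symmetric] algebra_simps intro!: sum.cong)
    then show ?thesis using psd[of "\<lambda>l. if even j then t l * (1 - t l) else 1 - t l" "(j + 1) div 2"] t by simp
  qed
  ultimately show ?thesis by (simp add: Hpsd_def)
qed

section \<open>Discrete and general matrix measures on [0,1]\<close>

lemma space_borel01 [simp]: "space borel01 = {0..1}"
  by (simp add: borel01_def space_restrict_space)

lemma sets_borel01: "B \<in> sets borel01 \<longleftrightarrow> B \<subseteq> {0..1} \<and> B \<in> sets borel"
  unfolding borel01_def by (subst sets_restrict_space_iff) auto

lemma discrete_measure:
  assumes t: "\<And>l. l < N \<Longrightarrow> 0 \<le> t l \<and> t l \<le> (1::real)" and w: "\<And>l. 0 \<le> w l"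
  obtains M where "fin_borel01 M" "\<And>B. B \<in> sets borel01 \<Longrightarrow> measure M B = (\<Sum>l<N. w l * indicator B (t l))"
    "\<And>k. (\<integral>x. x ^ k \<partial>M) = (\<Sum>l<(N::nat). w l * t l ^ k)"
proof -
  define D where "D = point_measure {..<N} (\<lambda>l. ennreal (w l))"
  define M where "M = distr D borel01 t"
  have tm: "t \<in> measurable D borel01" unfolding D_def using t by (simp add: Pi_iff)
  have "emeasure D (space D) = (\<Sum>l<N. ennreal (w l))"
    unfolding D_def by (subst emeasure_point_measure_finite) (auto simp: space_point_measure)
  also have "\<dots> = ennreal (\<Sum>l<N. w l)" by (rule sum_ennreal) (use w in auto)
  also have "\<dots> < \<infinity>" by simp
  finally interpret D: finite_measure D by (intro finite_measureI) auto
  interpret M: finite_measure M unfolding M_def by (rule D.finite_measure_distr[OF tm])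
  have i: "(\<integral>x. f x \<partial>M) = (\<Sum>l<N. w l * f (t l))" if "f \<in> borel_measurable borel01" for f :: "real \<Rightarrow> real"
    unfolding M_def using that tm w by (simp add: integral_distr) (simp add: D_def lebesgue_integral_point_measure_finite)
  have sM: "sets M = sets borel01" by (simp add: M_def)
  show ?thesis
  proof (rule that[of M])
    show "fin_borel01 M" by (simp add: fin_borel01_def sM M.finite_measure_axioms)
    show "measure M B = (\<Sum>l<N. w l * indicator B (t l))" if "B \<in> sets borel01" for B
      using i[of "indicator B"] that sM by simp
    show "(\<integral>x. x ^ k \<partial>M) = (\<Sum>l<N. w l * t l ^ k)" for k
      by (rule i) (simp add: borel01_def measurable_restrict_space1)
  qed
qed

lemma Smat_sym: "sym_mat p (Smat p x m)"
  by (auto simp: sym_mat_def Smat_def min.commute max.commute intro!: eq_matI)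

lemma Smat_0: "Smat p x 0 = 1\<^sub>m p"
  by (simp add: Smat_def)

lemma Smat_carrier [simp]: "Smat p x m \<in> carrier_mat p p" "dim_row (Smat p x m) = p" "dim_col (Smat p x m) = p"
  by (auto simp: Smat_def)

lemma atoms_moment_space:
  assumes x: "x \<in> PiE (sym_idx p n) (\<lambda>_. UNIV)" and t: "\<And>l. l < N \<Longrightarrow> 0 \<le> t l \<and> t l \<le> (1::real)"
    and S: "\<And>k. k \<le> n \<Longrightarrow> Smat p x k = atoms p N t V k"
  shows "x \<in> moment_space p n"
proof -
  \<comment> \<open>The weight \<open>max 0 (s * w)\<close> is the positive part of \<open>w\<close>
    for \<open>s = 1\<close> and the negative part for \<open>s = -1\<close>; the two measures form
    the required pair \<open>P\<close>, \<open>N\<close>.\<close>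
  have "\<exists>M. fin_borel01 M \<and> (\<forall>B\<in>sets borel01. measure M B = (\<Sum>l<N. max 0 (s * (V l i * V l j)) * indicator B (t l)))
    \<and> (\<forall>k. (\<integral>x. x ^ k \<partial>M) = (\<Sum>l<(N::nat). max 0 (s * (V l i * V l j)) * t l ^ k))" for s :: real and i j
  proof (rule discrete_measure[of N t "\<lambda>l. max 0 (s * (V l i * V l j))"])
    show "\<And>l. l < N \<Longrightarrow> 0 \<le> t l \<and> t l \<le> 1" by (rule t)
    show "\<And>l. 0 \<le> max 0 (s * (V l i * V l j))" by simp
  qed blast
  then obtain M where M: "\<And>s i j. fin_borel01 (M s i j)"
     "\<And>s i j B. B \<in> sets borel01 \<Longrightarrow> measure (M s i j) B = (\<Sum>l<N. max 0 (s * (V l i * V l j)) * indicator B (t l))"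
     "\<And>s i j k. (\<integral>x. x ^ k \<partial>(M s i j)) = (\<Sum>l<(N::nat). max 0 (s * (V l i * V l j)) * t l ^ k)" by metis
  have mx: "max 0 (1 * y) - max 0 ((-1) * y) = y" for y :: real by auto
  have dB: "measure (M 1 i j) B - measure (M (-1) i j) B = (\<Sum>l<N. V l i * V l j * indicator B (t l))"
    if "B \<in> sets borel01" for i j B
    unfolding M(2)[OF that] sum_subtractf[symmetric] left_diff_distrib[symmetric] mx ..
  have dk: "(\<integral>x. x ^ k \<partial>(M 1 i j)) - (\<integral>x. x ^ k \<partial>(M (-1) i j)) = (\<Sum>l<N. V l i * V l j * t l ^ k)" for i j k
    unfolding M(3) sum_subtractf[symmetric] left_diff_distrib[symmetric] mx ..
  have psd1: "psd_mat p (Matrix.mat p p (\<lambda>(i,j). V l i * V l j))" for l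
    unfolding psd_mat_def
  proof (intro conjI ballI)
    fix v :: "real vec" assume v: "v \<in> carrier_vec p"
    have "v \<bullet> (Matrix.mat p p (\<lambda>(i,j). V l i * V l j) *\<^sub>v v) = (\<Sum>i<p. v $ i * V l i) * (\<Sum>j<p. v $ j * V l j)"
      by (subst quad_expand[OF _ v]) (auto simp: sum_product ac_simps)
    then show "0 \<le> v \<bullet> (Matrix.mat p p (\<lambda>(i,j). V l i * V l j) *\<^sub>v v)" by simp
  qed (auto simp: sym_mat_def ac_simps intro!: eq_matI)
  have psd: "psd_mat p (Matrix.mat p p (\<lambda>(i,j). measure (M 1 i j) B - measure (M (-1) i j) B))" if "B \<in> sets borel01" for B
  proof -
    have "psd_mat p (Matrix.mat p p (\<lambda>(a,b). \<Sum>l<N. indicator B (t l) * Matrix.mat p p (\<lambda>(i,j). V l i * V l j) $$ (a,b)))"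
      by (rule psd_sum[where M = "\<lambda>l. Matrix.mat p p (\<lambda>(i,j). V l i * V l j)"]) (use psd1 in auto)
    also have "Matrix.mat p p (\<lambda>(a,b). \<Sum>l<N. indicator B (t l) * Matrix.mat p p (\<lambda>(i,j). V l i * V l j) $$ (a,b))
      = Matrix.mat p p (\<lambda>(i,j). measure (M 1 i j) B - measure (M (-1) i j) B)"
      by (intro cong_mat refl) (simp only: prod.case dB[OF that], intro sum.cong refl, simp)
    finally show ?thesis .
  qed
  have mk: "Smat p x k = mmoment p (M 1) (M (-1)) k" if "k \<le> n" for k
    unfolding S[OF that] atoms_def mmoment_def dk by (intro cong_mat) (auto simp: ac_simps)
  have "{0..1::real} \<in> sets borel01" by (simp add: sets_borel01)
  then have "Matrix.mat p p (\<lambda>(i,j). measure (M 1 i j) {0..1} - measure (M (-1) i j) {0..1}) = atoms p N t V 0"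
    unfolding atoms_def using t by (intro cong_mat) (auto simp: dB ac_simps intro!: sum.cong)
  also have "\<dots> = 1\<^sub>m p" using S[of 0] by (simp add: Smat_0)
  finally have "matrix_measure p (M 1) (M (-1))" using M(1) psd by (simp add: matrix_measure_def)
  then have "\<exists>P N. matrix_measure p P N \<and> (\<forall>m\<in>{1..n}. Smat p x m = mmoment p P N m)" using mk by auto
  then show ?thesis unfolding moment_space_def using x by blast
qed

text \<open>Dominated convergence for the step function that rounds \<open>x\<close> down to a
  multiple of \<open>1/(n+1)\<close>. There are \<open>n + 2\<close> cells since the value
  \<open>n + 1\<close> is attained at \<open>x = 1\<close>.\<close>

lemma riemann_moment:
  assumes "fin_borel01 M"
  shows "(\<lambda>n. \<Sum>l<n+2. (real l / real (Suc n)) ^ k * measure M {x\<in>{0..1}. \<lfloor>real (Suc n) * x\<rfloor> = int l}) \<longlonglongrightarrow> (\<integral>x. x ^ k \<partial>M)"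
proof -
  have sM: "sets M = sets borel01" and fM: "finite_measure M" using assms by (auto simp: fin_borel01_def)
  interpret finite_measure M by fact
  have spM: "space M = {0..1}" using sets_eq_imp_space_eq[OF sM] by simp
  define B where "B = (\<lambda>n l. {x\<in>{0..1::real}. \<lfloor>real (Suc n) * x\<rfloor> = int l})"
  have "B n l = {0..1} \<inter> ((\<lambda>x. \<lfloor>real (Suc n) * x\<rfloor>) -` {int l} \<inter> space borel)" for n l by (auto simp: B_def)
  also have "\<dots> n l \<in> sets borel" for n l
    by (intro sets.Int measurable_sets[of _ borel "count_space UNIV"]) auto
  finally have Bm: "B n l \<in> sets M" for n l unfolding sM sets_borel01 by (auto simp: B_def)
  define g where "g = (\<lambda>n x. \<Sum>l<n+2. (real l / real (Suc n)) ^ k * indicator (B n l) x)"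
  have gx: "g n x = (real_of_int \<lfloor>real (Suc n) * x\<rfloor> / real (Suc n)) ^ k" if x: "0 \<le> x" "x \<le> 1" for n x
  proof -
    define f where "f = nat \<lfloor>real (Suc n) * x\<rfloor>"
    have f: "int f = \<lfloor>real (Suc n) * x\<rfloor>" using x by (simp add: f_def)
    have "real (Suc n) * x \<le> real (Suc n) * 1" using x by (intro mult_left_mono) auto
    then have "\<lfloor>real (Suc n) * x\<rfloor> \<le> \<lfloor>real (Suc n) * 1\<rfloor>" by (rule floor_mono)
    then have "\<lfloor>real (Suc n) * x\<rfloor> \<le> int (Suc n)" by simp
    then have "f < n + 2" using f by linarith
    have "g n x = (\<Sum>l<n+2. if l = f then (real l / real (Suc n)) ^ k else 0)"
      unfolding g_def using x f by (intro sum.cong) (auto simp: B_def indicator_def f[symmetric])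
    also have "\<dots> = (real f / real (Suc n)) ^ k" using \<open>f < n + 2\<close> by (subst sum.delta) auto
    finally show ?thesis using f by (metis of_int_of_nat_eq)
  qed
  have "(\<lambda>n. \<integral>x. g n x \<partial>M) \<longlonglongrightarrow> (\<integral>x. x ^ k \<partial>M)"
  proof (rule integral_dominated_convergence[where w = "\<lambda>_. 1"])
    have "(\<lambda>x::real. x ^ k) \<in> borel_measurable borel01" by (simp add: borel01_def measurable_restrict_space1)
    then show "(\<lambda>x. x ^ k) \<in> borel_measurable M" using measurable_cong_sets[OF sM refl] by blast
    show "g n \<in> borel_measurable M" for n unfolding g_def using Bm by (intro borel_measurable_sum borel_measurable_times borel_measurable_indicator) auto
    show "AE x in M. (\<lambda>n. g n x) \<longlonglongrightarrow> x ^ k"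
    proof (rule AE_I2)
      fix x assume "x \<in> space M"
      then have x: "0 \<le> x" "x \<le> 1" by (auto simp: spM)
      have q: "x - 1 / c \<le> real_of_int \<lfloor>c * x\<rfloor> / c" "real_of_int \<lfloor>c * x\<rfloor> / c \<le> x" if "0 < c" for c :: real
      proof -
        have "(x - 1 / c) * c = c * x - 1" using that by (simp add: field_simps)
        also have "\<dots> \<le> real_of_int \<lfloor>c * x\<rfloor>" by linarith
        finally show "x - 1 / c \<le> real_of_int \<lfloor>c * x\<rfloor> / c" using that by (simp only: pos_le_divide_eq)
        show "real_of_int \<lfloor>c * x\<rfloor> / c \<le> x" using that by (simp add: pos_divide_le_eq mult.commute)
      qed
      have "(\<lambda>n. real_of_int \<lfloor>real (Suc n) * x\<rfloor> / real (Suc n)) \<longlonglongrightarrow> x"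
      proof (rule tendsto_sandwich[of "\<lambda>n. x - 1 / real (Suc n)" _ _ "\<lambda>_. x"])
        show "\<forall>\<^sub>F n in sequentially. x - 1 / real (Suc n) \<le> real_of_int \<lfloor>real (Suc n) * x\<rfloor> / real (Suc n)"
          by (intro always_eventually allI q) simp
        show "\<forall>\<^sub>F n in sequentially. real_of_int \<lfloor>real (Suc n) * x\<rfloor> / real (Suc n) \<le> x"
          by (intro always_eventually allI q) simp
        show "(\<lambda>n. x - 1 / real (Suc n)) \<longlonglongrightarrow> x"
          using tendsto_diff[OF tendsto_const lim_1_over_n[THEN LIMSEQ_Suc]] by simp
      qed simp
      then show "(\<lambda>n. g n x) \<longlonglongrightarrow> x ^ k" unfolding gx[OF x] by (rule tendsto_power)
    qed
    show "AE x in M. norm (g n x) \<le> 1" for n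
    proof (rule AE_I2)
      fix x assume "x \<in> space M"
      then have x: "0 \<le> x" "x \<le> 1" by (auto simp: spM)
      have "real_of_int \<lfloor>real (Suc n) * x\<rfloor> \<le> real (Suc n) * x" by linarith
      also have "\<dots> \<le> real (Suc n) * 1" using x by (intro mult_left_mono) auto
      finally have "real_of_int \<lfloor>real (Suc n) * x\<rfloor> / real (Suc n) \<le> 1" by simp
      moreover have "0 \<le> real_of_int \<lfloor>real (Suc n) * x\<rfloor> / real (Suc n)" using x by simp
      ultimately show "norm (g n x) \<le> 1" unfolding gx[OF x] by (simp add: power_le_one)
    qed
  qed simp
  moreover have "(\<integral>x. g n x \<partial>M) = (\<Sum>l<n+2. (real l / real (Suc n)) ^ k * measure M (B n l))" for n
    unfolding g_def using Bm by (subst Bochner_Integration.integral_sum) (auto simp: emeasure_eq_measure)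
  ultimately show ?thesis by (simp add: B_def)
qed

text \<open>Definiteness of a matrix measure is given only for its values on sets. Hence the measure
  is replaced by atoms at \<open>l/(n+1)\<close> that carry the masses of the cells,
  \<open>Hpsd_atomic\<close> is applied, and the semidefinite Hankel matrices pass to the
  limit.\<close>

lemma mmoment_Hpsd:
  assumes p: "0 < p" and mm: "matrix_measure p P N"
  shows "Hpsd p (mmoment p P N) n"
proof -
  define B where "B = (\<lambda>n l. {x\<in>{0..1::real}. \<lfloor>real (Suc n) * x\<rfloor> = int l})"
  have "B n l = {0..1} \<inter> ((\<lambda>x. \<lfloor>real (Suc n) * x\<rfloor>) -` {int l} \<inter> space borel)" for n l by (auto simp: B_def)
  also have "\<dots> n l \<in> sets borel" for n l
    by (intro sets.Int measurable_sets[of _ borel "count_space UNIV"]) auto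
  finally have Bm: "B n l \<in> sets borel01" for n l unfolding sets_borel01 by (auto simp: B_def)
  define W where "W = (\<lambda>n l. Matrix.mat p p (\<lambda>(i,j). measure (P i j) (B n l) - measure (N i j) (B n l)))"
  have W: "psd_mat p (W n l)" for n l using mm Bm by (simp add: W_def matrix_measure_def)
  have fin: "fin_borel01 (P i j) \<and> fin_borel01 (N i j)" if "i < p" "j < p" for i j
    using mm that by (simp add: matrix_measure_def)
  define S where "S = (\<lambda>n k. Matrix.mat p p (\<lambda>(i,j). \<Sum>l<n+2. (real l / real (Suc n)) ^ k * W n l $$ (i,j)))"
  \<comment> \<open>Capping the nodes at 1 puts them into [0,1] without a bound on the index; it
    changes no term, since a node beyond 1 has an empty cell.\<close>
  have HS: "Hpsd p (\<lambda>k. Matrix.mat p p (\<lambda>(i,j). \<Sum>l<n+2. (min 1 (real l / real (Suc n))) ^ k * W n l $$ (i,j))) m" for n m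
    by (rule Hpsd_atomic[OF p, where W = "W n" and N = "n+2" and t = "\<lambda>l. min 1 (real l / real (Suc n))"]) (use W in auto)
  have B0: "W n l = 0\<^sub>m p p" if "real l / real (Suc n) > 1" for n l
  proof -
    have "real l > real (Suc n)" using that by (simp add: field_simps)
    moreover have "real (Suc n) * x < real l" if "x \<le> 1" for x
    proof -
      have "real (Suc n) * x \<le> real (Suc n) * 1" using that by (intro mult_left_mono) auto
      also have "\<dots> < real l" using \<open>real l > real (Suc n)\<close> by simp
      finally show ?thesis .
    qed
    ultimately have "B n l = {}" by (auto simp: B_def floor_eq_iff) (smt (verit) of_int_of_nat_eq)
    then show ?thesis by (intro eq_matI) (auto simp: W_def)
  qed
  have Se: "S n k = Matrix.mat p p (\<lambda>(i,j). \<Sum>l<n+2. (min 1 (real l / real (Suc n))) ^ k * W n l $$ (i,j))" for n k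
    unfolding S_def
  proof (intro cong_mat refl, simp only: prod.case, intro sum.cong refl)
    fix i j l assume ij: "i < p" "j < p"
    show "(real l / real (Suc n)) ^ k * W n l $$ (i,j) = (min 1 (real l / real (Suc n))) ^ k * W n l $$ (i,j)"
    proof (cases "real l / real (Suc n) > 1")
      case True
      then show ?thesis using B0[OF True] ij by (simp only: index_zero_mat)
    next
      case False
      then have "min 1 (real l / real (Suc n)) = real l / real (Suc n)" by simp
      then show ?thesis by (simp only:)
    qed
  qed
  have H: "Hpsd p (S n) m" for n m using HS[of n m] unfolding Se[symmetric] .
  have lim: "(\<lambda>n. S n k $$ (i,j)) \<longlonglongrightarrow> mmoment p P N k $$ (i,j)" if "i < p" "j < p" for i j k
  proof -
    have e: "S n k $$ (i,j) = (\<Sum>l<n+2. (real l / real (Suc n)) ^ k * measure (P i j) (B n l)) - (\<Sum>l<n+2. (real l / real (Suc n)) ^ k * measure (N i j) (B n l))" for n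
      using that by (simp add: S_def W_def right_diff_distrib sum_subtractf del: sum.lessThan_Suc of_nat_Suc)
    have m: "mmoment p P N k $$ (i,j) = (\<integral>x. x ^ k \<partial>(P i j)) - (\<integral>x. x ^ k \<partial>(N i j))"
      using that by (simp add: mmoment_def)
    show ?thesis unfolding e m unfolding B_def using fin[OF that] by (intro tendsto_diff riemann_moment) auto
  qed
  have mp: "a mod p < p" for a using p by simp
  have d: "dim_row (S n k) = p" "dim_col (S n k) = p" "dim_row (mmoment p P N k) = p" "dim_col (mmoment p P N k) = p" for n k
    by (auto simp: S_def mmoment_def)
  show ?thesis unfolding Hpsd_def
  proof (intro allI impI conjI)
    fix j
    show "psd_mat ((j div 2 + 1) * p) (Lo p (mmoment p P N) j)"
    proof (rule psd_limit[where M = "\<lambda>n. Lo p (S n) j"])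
      show "psd_mat ((j div 2 + 1) * p) (Lo p (S n) j)" for n using H[of n j] unfolding Hpsd_def by blast
      show "Lo p (mmoment p P N) j \<in> carrier_mat ((j div 2 + 1) * p) ((j div 2 + 1) * p)" by (simp only: Lo_def block_hankel_carrier)
      fix a b assume "a < (j div 2 + 1) * p" "b < (j div 2 + 1) * p"
      then show "(\<lambda>n. Lo p (S n) j $$ (a,b)) \<longlonglongrightarrow> Lo p (mmoment p P N) j $$ (a,b)"
        unfolding Lo_def using lim[OF mp mp] by (simp add: block_hankel_entry del: add_mult_distrib mult_Suc)
    qed
    show "psd_mat ((j + 1) div 2 * p) (Up p (mmoment p P N) j)"
    proof (rule psd_limit[where M = "\<lambda>n. Up p (S n) j"])
      show "psd_mat ((j + 1) div 2 * p) (Up p (S n) j)" for n using H[of n j] unfolding Hpsd_def by blast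
      show "Up p (mmoment p P N) j \<in> carrier_mat ((j + 1) div 2 * p) ((j + 1) div 2 * p)" by (simp only: Up_def block_hankel_carrier)
      fix a b assume "a < (j + 1) div 2 * p" "b < (j + 1) div 2 * p"
      then show "(\<lambda>n. Up p (S n) j $$ (a,b)) \<longlonglongrightarrow> Up p (mmoment p P N) j $$ (a,b)"
        unfolding Up_def using lim[OF mp mp] d mp by (auto simp: block_hankel_entry intro!: tendsto_diff)
    qed
  qed
qed

lemma moment_space_Hpsd:
  assumes p: "0 < p" and x: "x \<in> moment_space p n"
  shows "Hpsd p (Smat p x) n"
proof -
  obtain P N where mm: "matrix_measure p P N" and m: "\<forall>m\<in>{1..n}. Smat p x m = mmoment p P N m"
    using x by (auto simp: moment_space_def)
  have "mmoment p P N 0 = Matrix.mat p p (\<lambda>(i,j). measure (P i j) {0..1} - measure (N i j) {0..1})"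
    unfolding mmoment_def
  proof (intro cong_mat refl)
    fix i j assume ij: "i < p" "j < p"
    have s: "space M = {0..1}" if "fin_borel01 M" for M
      using that sets_eq_imp_space_eq[of M borel01] by (simp add: fin_borel01_def)
    have "fin_borel01 (P i j)" "fin_borel01 (N i j)" using mm ij by (auto simp: matrix_measure_def)
    then show "(case (i, j) of (i, j) \<Rightarrow> (LINT x|P i j. x ^ 0) - (LINT x|N i j. x ^ 0)) =
      (case (i, j) of (i, j) \<Rightarrow> measure (P i j) {0..1} - measure (N i j) {0..1})"
      using s[of "P i j"] s[of "N i j"] by simp
  qed
  then have "mmoment p P N 0 = 1\<^sub>m p" using mm by (simp add: matrix_measure_def)
  then have "Smat p x i = mmoment p P N i" if "i \<le> n" for i
    using m that by (cases "i = 0") (auto simp: Smat_0)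
  then show ?thesis using Hpsd_cong[of n "Smat p x" "mmoment p P N" p] mmoment_Hpsd[OF p mm] by blast
qed

section \<open>Sufficiency of the Hankel inequalities\<close>

lemma Slow_sym:
  assumes p: "0 < p" and symS: "\<And>i. sym_mat p (S i)" and S0: "S 0 = 1\<^sub>m p" and H: "Hpos p S n"
  shows "sym_mat p (Slow p S (Suc n))"
proof (cases "n = 0")
  case False
  then have "pd_mat (Suc n div 2 * p) (Lo p S (n - 1))"
    using HposD(1)[OF p symS S0 H, of "n - 1"] by (cases n) simp_all
  then have "sym_mat (Suc n div 2 * p) (minv (Suc n div 2 * p) (Lo p S (n - 1)))"
    using minv_pd by (simp add: sym_mat_def)
  from sym_congruence[OF this, of "lo_vec p S (Suc n)" p] show ?thesis
    using False by (simp add: Slow_def lo_vec_def del: assoc_mult_mat)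
qed (auto simp: Slow_def sym_mat_def)

lemma sym_lincomb:
  assumes "sym_mat p A" "sym_mat p B" shows "sym_mat p (a \<cdot>\<^sub>m A + b \<cdot>\<^sub>m B)"
  using sym_matD[OF assms(1)] sym_matD[OF assms(2)] by (auto simp: sym_mat_def intro!: eq_matI)

lemma quad_lincomb:
  fixes A B :: "real mat"
  assumes "A \<in> carrier_mat p p" "B \<in> carrier_mat p p" "v \<in> carrier_vec p"
  shows "v \<bullet> ((a \<cdot>\<^sub>m A + b \<cdot>\<^sub>m B) *\<^sub>v v) = a * (v \<bullet> (A *\<^sub>v v)) + b * (v \<bullet> (B *\<^sub>v v))"
proof -
  have c: "a \<cdot>\<^sub>m A + b \<cdot>\<^sub>m B \<in> carrier_mat p p" using assms by auto
  show ?thesis unfolding quad_expand[OF c assms(3)] quad_expand[OF assms(1,3)] quad_expand[OF assms(2,3)]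
    using assms by (simp add: sum_distrib_left sum.distrib[symmetric] algebra_simps)
qed

lemma pd_lincomb:
  assumes A: "psd_mat p A" and B: "pd_mat p B" and ab: "0 \<le> a" "0 < b"
  shows "pd_mat p (a \<cdot>\<^sub>m A + b \<cdot>\<^sub>m B)"
  using sym_lincomb[OF psd_matD(1)[OF A] pd_matD(1)[OF B]] psd_matD(2,4)[OF A] pd_matD(2,4)[OF B] ab
  by (auto simp: pd_mat_def quad_lincomb intro!: add_nonneg_pos)

lemma pd_scale: "pd_mat p B \<Longrightarrow> 0 < b \<Longrightarrow> pd_mat p (b \<cdot>\<^sub>m B)"
proof -
  assume B: "pd_mat p B" "0 < b"
  have "0 \<cdot>\<^sub>m B + b \<cdot>\<^sub>m B = b \<cdot>\<^sub>m B" using pd_matD(2)[OF B(1)] by (intro eq_matI) auto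
  then show ?thesis using pd_lincomb[OF pd_imp_psd[OF B(1)] B(1), of 0 b] B by simp
qed

text \<open>The next moment is placed at the midpoint of its range, which is interior because the
  width is positive definite.\<close>

lemma Hpos_extend:
  assumes p: "0 < p" and symS: "\<And>i. sym_mat p (S i)" and S0: "S 0 = 1\<^sub>m p" and H: "Hpos p S n"
  obtains T where "\<And>i. sym_mat p (T i)" "\<And>i. i \<le> n \<Longrightarrow> T i = S i" "Hpos p T (Suc n)"
proof -
  define L where "L = Slow p S (Suc n)"
  define U where "U = Sup_mat p S (Suc n)"
  have W: "pd_mat p (U - L)" using range_width_pd[OF p symS S0 H] by (simp add: U_def L_def)
  have L: "sym_mat p L" using Slow_sym[OF p symS S0 H] by (simp add: L_def)
  have Lc: "L \<in> carrier_mat p p" and Uc: "U \<in> carrier_mat p p"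
    using Slow_Sup_carrier[OF p symS S0 H] by (auto simp: L_def U_def)
  define M where "M = 1 \<cdot>\<^sub>m L + (1/2) \<cdot>\<^sub>m (U - L)"
  have M: "sym_mat p M" unfolding M_def by (rule sym_lincomb[OF L pd_matD(1)[OF W]])
  have UL: "M - L = (1/2) \<cdot>\<^sub>m (U - L)" "U - M = (1/2) \<cdot>\<^sub>m (U - L)"
    unfolding M_def using Lc Uc by (auto simp: field_simps intro!: eq_matI)
  define T where "T = S(Suc n := M)"
  have T: "\<And>i. sym_mat p (T i)" "\<And>i. i \<le> n \<Longrightarrow> T i = S i" "T 0 = 1\<^sub>m p" using symS M S0 by (auto simp: T_def)
  have "Hpos p T n" using H Hpos_cong[of n T S p] T(2) by blast
  moreover have "Slow p T (Suc n) = L" "Sup_mat p T (Suc n) = U"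
    unfolding L_def U_def by (intro Slow_cong Sup_cong; use T(2) in auto)+
  ultimately have "Hpos p T (Suc n)"
    using Hpos_Suc[of p T n, OF p T(1,3)] UL pd_scale[OF W, of "1/2"] by (simp add: T_def)
  then show ?thesis using that T by blast
qed

lemma Hpos_exists:
  assumes p: "0 < p"
  shows "\<exists>S. (\<forall>i. sym_mat p (S i)) \<and> S 0 = 1\<^sub>m p \<and> Hpos p S n"
proof (induction n)
  case 0
  have s: "sym_mat p ((1\<^sub>m p) :: real mat)" by (simp add: sym_mat_def)
  then show ?case using Hpos_0[OF p, of "\<lambda>_. 1\<^sub>m p"] by (intro exI[of _ "\<lambda>_. 1\<^sub>m p"]) auto
next
  case (Suc n)
  then obtain S where S: "\<And>i. sym_mat p (S i)" "S 0 = 1\<^sub>m p" "Hpos p S n" by blast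
  show ?case by (rule Hpos_extend[OF p S]) (metis S(2) le0)
qed

text \<open>The quadrature needs the shifted Hankel matrix of the same size, available for odd order
  only; for even order one more moment is chosen first.\<close>

lemma Hpos_atoms_any:
  assumes p: "0 < p" and symS: "\<And>i. sym_mat p (S i)" and S0: "S 0 = 1\<^sub>m p" and H: "Hpos p S n"
  obtains t V where "\<And>l. l < Suc (n div 2) * p \<Longrightarrow> 0 \<le> t l \<and> t l \<le> (1::real)" "\<And>k. k \<le> n \<Longrightarrow> S k = atoms p (Suc (n div 2) * p) t V k"
proof (cases "even n")
  case True
  then have n: "Suc n = 2 * (n div 2) + 1" by simp
  obtain T where T: "\<And>i. sym_mat p (T i)" "\<And>i. i \<le> n \<Longrightarrow> T i = S i" "Hpos p T (2 * (n div 2) + 1)"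
    using Hpos_extend[OF p symS S0 H] n by metis
  have "T 0 = 1\<^sub>m p" using T(2)[of 0] S0 by simp
  from Hpos_atoms[OF p T(1) this T(3)] obtain t V where
    "\<And>l. l < Suc (n div 2) * p \<Longrightarrow> 0 \<le> t l \<and> t l \<le> (1::real)" "\<And>k. k \<le> 2 * (n div 2) + 1 \<Longrightarrow> T k = atoms p (Suc (n div 2) * p) t V k"
    by blast
  then show ?thesis using that[of t V] T(2) n by (metis le_Suc_eq)
next
  case False
  then have n: "n = 2 * (n div 2) + 1" by simp
  show ?thesis using Hpos_atoms[of p S "n div 2", OF p symS S0] H n that by metis
qed

lemma Lo_lincomb:
  assumes "0 < p" "\<And>i. S i \<in> carrier_mat p p" "\<And>i. T i \<in> carrier_mat p p"
  shows "Lo p (\<lambda>i. a \<cdot>\<^sub>m S i + b \<cdot>\<^sub>m T i) n = a \<cdot>\<^sub>m Lo p S n + b \<cdot>\<^sub>m Lo p T n"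
    "Up p (\<lambda>i. a \<cdot>\<^sub>m S i + b \<cdot>\<^sub>m T i) n = a \<cdot>\<^sub>m Up p S n + b \<cdot>\<^sub>m Up p T n"
proof -
  have d: "dim_row (S i) = p" "dim_col (S i) = p" "dim_row (T i) = p" "dim_col (T i) = p" for i
    using assms(2,3)[of i] by auto
  have mp: "a mod p < p" for a using assms by simp
  show "Lo p (\<lambda>i. a \<cdot>\<^sub>m S i + b \<cdot>\<^sub>m T i) n = a \<cdot>\<^sub>m Lo p S n + b \<cdot>\<^sub>m Lo p T n"
    using d mp by (intro eq_matI) (auto simp: Lo_def block_hankel_def)
  show "Up p (\<lambda>i. a \<cdot>\<^sub>m S i + b \<cdot>\<^sub>m T i) n = a \<cdot>\<^sub>m Up p S n + b \<cdot>\<^sub>m Up p T n"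
    using d mp by (intro eq_matI) (auto simp: Up_def block_hankel_def algebra_simps)
qed

lemma Hpos_lincomb:
  assumes p: "0 < p" and "\<And>i. S i \<in> carrier_mat p p" "\<And>i. T i \<in> carrier_mat p p"
    and "Hpsd p S n" "Hpos p T n" "0 \<le> a" "0 < b"
  shows "Hpos p (\<lambda>i. a \<cdot>\<^sub>m S i + b \<cdot>\<^sub>m T i) n"
  using assms(4-7) unfolding Hpos_def Hpsd_def Lo_lincomb[OF assms(1-3)]
  by (auto intro!: pd_lincomb)

text \<open>Boundary points are approximated from the interior by convex combinations with
  \<open>C\<close>. The number of atoms depends on \<open>n\<close> only, the nodes lie in [0,1],
  and the zeroth moment bounds the weights because the squares \<open>(V l i)^2\<close> sum to 1
  over \<open>l\<close>. So a subsequence of the representations converges.\<close>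

lemma Hpsd_atoms:
  assumes p: "0 < p" and symS: "\<And>i. sym_mat p (S i)" and S0: "S 0 = 1\<^sub>m p" and H: "Hpsd p S n"
  obtains t V where "\<And>l. l < Suc (n div 2) * p \<Longrightarrow> 0 \<le> t l \<and> t l \<le> (1::real)" "\<And>k. k \<le> n \<Longrightarrow> S k = atoms p (Suc (n div 2) * p) t V k"
proof -
  let ?N = "Suc (n div 2) * p"
  obtain C where C: "\<And>i. sym_mat p (C i)" "C 0 = 1\<^sub>m p" "Hpos p C n" using Hpos_exists[OF p] by blast
  note Sc = sym_matD(1)[OF symS] and Cc = sym_matD(1)[OF C(1)]
  have d: "dim_row (S i) = p" "dim_col (S i) = p" "dim_row (C i) = p" "dim_col (C i) = p" for i
    using Sc[of i] Cc[of i] by auto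
  define e where "e = (\<lambda>j. 1 / real (j + 2))"
  have e: "0 < e j" "e j \<le> 1" for j by (auto simp: e_def field_simps)
  define T where "T = (\<lambda>j i. (1 - e j) \<cdot>\<^sub>m S i + e j \<cdot>\<^sub>m C i)"
  have T: "sym_mat p (T j i)" "T j 0 = 1\<^sub>m p" "Hpos p (T j) n" for i j
  proof -
    show "sym_mat p (T j i)" unfolding T_def by (rule sym_lincomb[OF symS C(1)])
    show "T j 0 = 1\<^sub>m p" unfolding T_def S0 C(2) by (intro eq_matI) auto
    show "Hpos p (T j) n" unfolding T_def by (rule Hpos_lincomb[OF p Sc Cc H C(3)]) (use e in auto)
  qed
  have "\<exists>t V. (\<forall>l<?N. 0 \<le> t l \<and> t l \<le> (1::real)) \<and> (\<forall>k\<le>n. T j k = atoms p ?N t V k)" for j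
    using Hpos_atoms_any[OF p T] by metis
  then obtain t V where tV: "\<And>j l. l < ?N \<Longrightarrow> 0 \<le> t j l \<and> t j l \<le> (1::real)" "\<And>j k. k \<le> n \<Longrightarrow> T j k = atoms p ?N (t j) (V j) k"
    by metis
  have V1: "V j l i \<in> {-1..1}" if "l < ?N" "i < p" for j l i
  proof -
    have "(V j l i)\<^sup>2 \<le> (\<Sum>l<?N. (V j l i)\<^sup>2)" using that by (intro member_le_sum) auto
    also have "\<dots> = atoms p ?N (t j) (V j) 0 $$ (i,i)" using that by (simp add: atoms_def power2_eq_square)
    also have "\<dots> = 1" using tV(2)[of 0 j, OF le0, symmetric] T(2)[of j] that by (simp only: index_one_mat) simp
    finally have "\<bar>V j l i\<bar> \<le> 1" by (simp add: abs_square_le_1)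
    then show ?thesis by auto
  qed
  \<comment> \<open>One function carries the whole representation: the vector of atom
    \<open>l\<close> in the coordinates below \<open>p\<close>, its node in coordinate
    \<open>p\<close>.\<close>
  define g where "g = (\<lambda>j (l,i). if l < ?N \<and> i < p then V j l i else if l < ?N \<and> i = p then t j l else 0)"
  define K where "K = PiE UNIV (\<lambda>(l::nat,i). if i = p then {0..1::real} else {-1..1})"
  have "compact K" unfolding K_def by (rule compact_Pi_UNIV) auto
  then have "seq_compact K" by (rule compact_imp_seq_compact)
  moreover have "g j \<in> K" for j using tV(1) V1 by (force simp: g_def K_def)
  ultimately obtain h r where h: "h \<in> K" and r: "strict_mono (r :: nat \<Rightarrow> nat)" and lim: "(g \<circ> r) \<longlonglongrightarrow> h"
    by (meson seq_compactE)
  have lim': "(\<lambda>j. g (r j) x) \<longlonglongrightarrow> h x" for x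
    using continuous_on_tendsto_compose[OF continuous_on_product_coordinates lim, of x] by simp
  have ev: "(\<lambda>j. e (r j)) \<longlonglongrightarrow> 0"
  proof -
    have "e \<longlonglongrightarrow> 0" unfolding e_def by (rule LIMSEQ_ignore_initial_segment[OF lim_1_over_n])
    then show ?thesis using LIMSEQ_subseq_LIMSEQ[OF _ r, of e 0] by (simp add: comp_def)
  qed
  show ?thesis
  proof (rule that[of "\<lambda>l. h (l,p)" "\<lambda>l i. h (l,i)"])
    show "0 \<le> h (l, p) \<and> h (l, p) \<le> 1" for l using PiE_mem[OF h[unfolded K_def], of "(l,p)"] by simp
    show "S k = atoms p ?N (\<lambda>l. h (l, p)) (\<lambda>l i. h (l, i)) k" if k: "k \<le> n" for k
    proof (rule eq_matI)
      fix a b assume "a < dim_row (atoms p ?N (\<lambda>l. h (l, p)) (\<lambda>l i. h (l, i)) k)" "b < dim_col (atoms p ?N (\<lambda>l. h (l, p)) (\<lambda>l i. h (l, i)) k)"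
      then have ab: "a < p" "b < p" by (auto simp: atoms_def)
      have "T (r j) k $$ (a,b) = (\<Sum>l<?N. g (r j) (l,p) ^ k * g (r j) (l,a) * g (r j) (l,b))" for j
        unfolding tV(2)[OF k] using ab by (simp add: atoms_def g_def)
      moreover have "(\<lambda>j. \<Sum>l<?N. g (r j) (l,p) ^ k * g (r j) (l,a) * g (r j) (l,b)) \<longlonglongrightarrow> (\<Sum>l<?N. h (l,p) ^ k * h (l,a) * h (l,b))"
        by (intro tendsto_intros lim')
      ultimately have 1: "(\<lambda>j. T (r j) k $$ (a,b)) \<longlonglongrightarrow> atoms p ?N (\<lambda>l. h (l, p)) (\<lambda>l i. h (l, i)) k $$ (a,b)"
        using ab by (simp add: atoms_def)
      have "(\<lambda>j. (1 - e (r j)) * S k $$ (a,b) + e (r j) * C k $$ (a,b)) \<longlonglongrightarrow> (1 - 0) * S k $$ (a,b) + 0 * C k $$ (a,b)"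
        by (intro tendsto_intros ev)
      then have "(\<lambda>j. T (r j) k $$ (a,b)) \<longlonglongrightarrow> S k $$ (a,b)" using ab d by (simp add: T_def)
      from LIMSEQ_unique[OF this 1] show "S k $$ (a,b) = atoms p ?N (\<lambda>l. h (l, p)) (\<lambda>l i. h (l, i)) k $$ (a,b)" .
    qed (use d in \<open>auto simp: atoms_def\<close>)
  qed
qed

text \<open>The truncated matrix moment problem on [0,1]. It replaces the existential over measures
  by finitely many matrix inequalities, which are measurable, convex and compatible with the
  recursion.\<close>

theorem moment_space_eq:
  assumes p: "0 < p"
  shows "moment_space p n = {x \<in> PiE (sym_idx p n) (\<lambda>_. UNIV). Hpsd p (Smat p x) n}"
proof (intro equalityI subsetI)
  fix x assume "x \<in> moment_space p n"
  then show "x \<in> {x \<in> PiE (sym_idx p n) (\<lambda>_. UNIV). Hpsd p (Smat p x) n}"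
    using moment_space_Hpsd[OF p, of x n] unfolding moment_space_def by blast
next
  fix x assume x: "x \<in> {x \<in> PiE (sym_idx p n) (\<lambda>_. UNIV). Hpsd p (Smat p x) n}"
  obtain t V where "\<And>l. l < Suc (n div 2) * p \<Longrightarrow> 0 \<le> t l \<and> t l \<le> (1::real)" "\<And>k. k \<le> n \<Longrightarrow> Smat p x k = atoms p (Suc (n div 2) * p) t V k"
    using Hpsd_atoms[of p "Smat p x" n, OF p Smat_sym Smat_0] x by blast
  then show "x \<in> moment_space p n" using atoms_moment_space x by blast
qed

subsection \<open>Measurability\<close>

text \<open>The definitions produce junk matrices of unspecified dimension at singular arguments, and \<open>scaled_U\<close> must be
  measurable there as well. Hence the dimensions are treated as measurable functions, and entries outside the
  dimensions are included.\<close>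

definition mat_measurable :: "'a measure \<Rightarrow> ('a \<Rightarrow> real mat) \<Rightarrow> bool" where
  "mat_measurable M f \<longleftrightarrow> (\<lambda>x. dim_row (f x)) \<in> measurable M (count_space UNIV) \<and>
     (\<lambda>x. dim_col (f x)) \<in> measurable M (count_space UNIV) \<and> (\<forall>i j. (\<lambda>x. f x $$ (i,j)) \<in> borel_measurable M)"

definition entries_measurable :: "'a measure \<Rightarrow> nat \<Rightarrow> nat \<Rightarrow> ('a \<Rightarrow> real mat) \<Rightarrow> bool" where
  "entries_measurable M r c f \<longleftrightarrow> (\<forall>x\<in>space M. f x \<in> carrier_mat r c) \<and> (\<forall>i<r. \<forall>j<c. (\<lambda>x. f x $$ (i,j)) \<in> borel_measurable M)"

text \<open>An index outside the dimensions reads a list beyond its end; the result depends on the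
  length of the list but not on its contents.\<close>

lemma undef_mat_const: "undef_mat nr nc f x = undef_mat nr nc g x" if "\<not> (fst x < nr \<and> snd x < nc)"
proof -
  have nth_ge: "\<not> i < length xs \<Longrightarrow> xs ! i = [] ! (i - length xs)" for i and xs :: "'b list"
    by (metis append_Nil2 nth_append)
  obtain i j where x: "x = (i,j)" by force
  show ?thesis
  proof (cases "i < nr")
    case True
    then have "\<not> j < nc" using that x by simp
    then show ?thesis unfolding undef_mat_def x using True
      by (simp add: nth_ge[of j "map _ [0..<nc]"])
  next
    case False
    then show ?thesis unfolding undef_mat_def x by (simp add: nth_ge[of i "map _ [0..<nr]"])
  qed
qed

lemma index_mat_general:
  "Matrix.mat nr nc F $$ (i,j) = (if i < nr \<and> j < nc then F (i,j) else undef_mat nr nc (\<lambda>_. 0) (i,j))"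
proof (cases "i < nr \<and> j < nc")
  case False
  have "Matrix.mat nr nc F $$ (i,j) = undef_mat nr nc F (i,j)"
    using False by (transfer, auto simp: mk_mat_def)
  then show ?thesis using False undef_mat_const[of "(i,j)" nr nc F "\<lambda>_. 0"] by auto
qed simp

text \<open>Dimensions take countably many values, so each may be treated as a constant and the
  pieces put together.\<close>

lemma nat_family_measurable:
  assumes "n \<in> measurable M (count_space (UNIV :: nat set))" "\<And>i. (\<lambda>x. f i x) \<in> borel_measurable M"
  shows "(\<lambda>x. f (n x) x) \<in> borel_measurable M"
  using measurable_compose_countable[of f M borel n] assms by blast

lemma mat_measurable_mat:
  assumes r: "r \<in> measurable M (count_space UNIV)" and c: "c \<in> measurable M (count_space UNIV)"
    and F: "\<And>i j. (\<lambda>x. F x (i,j)) \<in> borel_measurable M"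
  shows "mat_measurable M (\<lambda>x. Matrix.mat (r x) (c x) (F x))"
  unfolding mat_measurable_def
proof (intro conjI allI)
  fix i j
  have "(\<lambda>x. if i < a \<and> j < b then F x (i,j) else undef_mat a b (\<lambda>_. 0) (i,j)) \<in> borel_measurable M" for a b
    using F by (cases "i < a \<and> j < b") auto
  then have "(\<lambda>x. if i < a \<and> j < c x then F x (i,j) else undef_mat a (c x) (\<lambda>_. 0) (i,j)) \<in> borel_measurable M" for a
    by (rule nat_family_measurable[OF c])
  then have "(\<lambda>x. if i < r x \<and> j < c x then F x (i,j) else undef_mat (r x) (c x) (\<lambda>_. 0) (i,j)) \<in> borel_measurable M"
    by (rule nat_family_measurable[OF r])
  then show "(\<lambda>x. Matrix.mat (r x) (c x) (F x) $$ (i,j)) \<in> borel_measurable M" by (simp add: index_mat_general)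
qed (use r c in simp_all)

lemma mat_measurableD:
  assumes "mat_measurable M f"
  shows "(\<lambda>x. dim_row (f x)) \<in> measurable M (count_space UNIV)" "(\<lambda>x. dim_col (f x)) \<in> measurable M (count_space UNIV)"
    "(\<lambda>x. f x $$ (i,j)) \<in> borel_measurable M"
  using assms by (auto simp: mat_measurable_def)

lemma mat_measurable_cong: "(\<And>x. x \<in> space M \<Longrightarrow> f x = g x) \<Longrightarrow> mat_measurable M f \<longleftrightarrow> mat_measurable M g"
  unfolding mat_measurable_def
  by (intro conj_cong all_cong1 measurable_cong) auto

lemma mat_measurable_const: "mat_measurable M (\<lambda>_. A)"
  by (simp add: mat_measurable_def)

lemma mat_measurable_mult:
  assumes f: "mat_measurable M f" and g: "mat_measurable M g"
  shows "mat_measurable M (\<lambda>x. f x * g x)"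
proof -
  have row: "(\<lambda>x. Matrix.row (f x) i $ k) \<in> borel_measurable M" for i k
  proof -
    have e: "vec n h $ k = (if k < n then h k else undef_vec (k - n))" for n and h :: "nat \<Rightarrow> real"
      by (transfer, simp add: mk_vec_def)
    have "(\<lambda>x. if k < c then f x $$ (i,k) else undef_vec (k - c)) \<in> borel_measurable M" for c
      using mat_measurableD(3)[OF f] by (cases "k < c") auto
    then have "(\<lambda>x. if k < dim_col (f x) then f x $$ (i,k) else undef_vec (k - dim_col (f x))) \<in> borel_measurable M"
      by (rule nat_family_measurable[OF mat_measurableD(2)[OF f]])
    then show ?thesis by (simp add: Matrix.row_def e)
  qed
  have "(\<lambda>x. \<Sum>k<n. Matrix.row (f x) i $ k * g x $$ (k,j)) \<in> borel_measurable M" for i j n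
    by (intro borel_measurable_sum borel_measurable_times row mat_measurableD(3)[OF g])
  then have "(\<lambda>x. \<Sum>k<dim_row (g x). Matrix.row (f x) i $ k * g x $$ (k,j)) \<in> borel_measurable M" for i j
    by (rule nat_family_measurable[OF mat_measurableD(1)[OF g]])
  then have "mat_measurable M (\<lambda>x. Matrix.mat (dim_row (f x)) (dim_col (g x)) (\<lambda>(i,j). \<Sum>k<dim_row (g x). Matrix.row (f x) i $ k * g x $$ (k,j)))"
    by (intro mat_measurable_mat mat_measurableD[OF f] mat_measurableD[OF g]) simp
  moreover have "f x * g x = Matrix.mat (dim_row (f x)) (dim_col (g x)) (\<lambda>(i,j). \<Sum>k<dim_row (g x). Matrix.row (f x) i $ k * g x $$ (k,j))" for x
    unfolding times_mat_def by (intro cong_mat refl) (simp add: scalar_prod_def lessThan_atLeast0)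
  ultimately show ?thesis by simp
qed

lemma mat_measurable_minus:
  assumes f: "mat_measurable M f" and g: "mat_measurable M g"
  shows "mat_measurable M (\<lambda>x. f x - g x)"
  unfolding minus_mat_def
  by (intro mat_measurable_mat mat_measurableD[OF g] borel_measurable_diff mat_measurableD[OF f])

lemma mat_measurable_transpose:
  assumes f: "mat_measurable M f" shows "mat_measurable M (\<lambda>x. transpose_mat (f x))"
  unfolding transpose_mat_def
  by (intro mat_measurable_mat mat_measurableD[OF f]) (simp add: mat_measurableD[OF f])

lemma mat_measurable_if:
  assumes P: "{x\<in>space M. P x} \<in> sets M" and f: "mat_measurable M f" and g: "mat_measurable M g"
  shows "mat_measurable M (\<lambda>x. if P x then f x else g x)"
proof -
  have [measurable]: "Measurable.pred M P" using P by (simp add: pred_def)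
  have "(\<lambda>x. dim_row (if P x then f x else g x)) = (\<lambda>x. if P x then dim_row (f x) else dim_row (g x))"
    "(\<lambda>x. dim_col (if P x then f x else g x)) = (\<lambda>x. if P x then dim_col (f x) else dim_col (g x))"
    "(\<lambda>x. (if P x then f x else g x) $$ (i,j)) = (\<lambda>x. if P x then f x $$ (i,j) else g x $$ (i,j))" for i j by auto
  then show ?thesis using mat_measurableD[OF f] mat_measurableD[OF g] unfolding mat_measurable_def by simp
qed

lemma entries_measurableD:
  assumes "entries_measurable M r c f"
  shows "x \<in> space M \<Longrightarrow> f x \<in> carrier_mat r c" "i < r \<Longrightarrow> j < c \<Longrightarrow> (\<lambda>x. f x $$ (i,j)) \<in> borel_measurable M"
  using assms by (auto simp: entries_measurable_def)

lemma entries_measurable_imp: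
  assumes "entries_measurable M r c f" shows "mat_measurable M f"
proof -
  note D = entries_measurableD[OF assms]
  have "mat_measurable M (\<lambda>x. Matrix.mat r c (\<lambda>(i,j). if i < r \<and> j < c then f x $$ (i,j) else 0))"
  proof (intro mat_measurable_mat)
    fix i j show "(\<lambda>x. case (i,j) of (i,j) \<Rightarrow> if i < r \<and> j < c then f x $$ (i,j) else 0) \<in> borel_measurable M"
      using D(2)[of i j] by (cases "i < r \<and> j < c") auto
  qed auto
  moreover have "Matrix.mat r c (\<lambda>(i,j). if i < r \<and> j < c then f x $$ (i,j) else 0) = f x" if "x \<in> space M" for x
    using D(1)[OF that] by (intro eq_matI) auto
  ultimately show ?thesis
    using mat_measurable_cong[of M "\<lambda>x. Matrix.mat r c (\<lambda>(i,j). if i < r \<and> j < c then f x $$ (i,j) else 0)" f] by blast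
qed

lemma mat_measurable_imp:
  assumes "mat_measurable M f" "\<And>x. x \<in> space M \<Longrightarrow> f x \<in> carrier_mat r c"
  shows "entries_measurable M r c f"
  using assms by (auto simp: entries_measurable_def mat_measurable_def)

section \<open>Determinant, inverse, definiteness and square root\<close>

lemma det_measurable:
  assumes "entries_measurable M n n f" shows "(\<lambda>x. det (f x)) \<in> borel_measurable M"
proof -
  note D = entries_measurableD[OF assms]
  have "(\<lambda>x. \<Sum>p\<in>{p. p permutes {0..<n}}. signof p * (\<Prod>i=0..<n. f x $$ (i, p i))) \<in> borel_measurable M"
  proof (intro borel_measurable_sum borel_measurable_times borel_measurable_prod D(2) borel_measurable_const)
    fix p i assume "p \<in> {p. p permutes {0..<n}}" "i \<in> {0..<n}"
    then show "i < n" "p i < n" using permutes_in_image[of p "{0..<n}" i] by auto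
  qed
  also have "?this \<longleftrightarrow> ?thesis" by (intro measurable_cong) (use det_def'[OF D(1)] in auto)
  finally show ?thesis .
qed

text \<open>Cofactors divided by the determinant off the singular set, one fixed matrix on
  it.\<close>

lemma minv_measurable:
  assumes "entries_measurable M n n f" shows "mat_measurable M (\<lambda>x. minv n (f x))"
proof -
  note D = entries_measurableD[OF assms]
  have [measurable]: "(\<lambda>x. det (f x)) \<in> borel_measurable M" by (rule det_measurable[OF assms])
  have "entries_measurable M (n - 1) (n - 1) (\<lambda>x. mat_delete (f x) j i)" if "i < n" "j < n" for i j
    unfolding entries_measurable_def
  proof (intro conjI ballI allI impI)
    show "mat_delete (f x) j i \<in> carrier_mat (n - 1) (n - 1)" if "x \<in> space M" for x
      using D(1)[OF that] by (auto simp: mat_delete_def)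
    fix a b assume ab: "a < n - 1" "b < n - 1"
    have "(\<lambda>x. f x $$ (if a < j then a else Suc a, if b < i then b else Suc b)) \<in> borel_measurable M"
      using ab by (intro D(2)) auto
    also have "?this \<longleftrightarrow> (\<lambda>x. mat_delete (f x) j i $$ (a,b)) \<in> borel_measurable M"
      by (intro measurable_cong) (use D(1)[THEN carrier_matD(1)] D(1)[THEN carrier_matD(2)] ab in \<open>auto simp: mat_delete_def\<close>)
    finally show "(\<lambda>x. mat_delete (f x) j i $$ (a,b)) \<in> borel_measurable M" .
  qed
  then have c: "(\<lambda>x. cofactor (f x) j i) \<in> borel_measurable M" if "i < n" "j < n" for i j
    unfolding cofactor_def using that by (intro borel_measurable_times det_measurable) auto
  have "entries_measurable M n n (\<lambda>x. (1 / det (f x)) \<cdot>\<^sub>m adj_mat (f x))"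
    unfolding entries_measurable_def
  proof (intro conjI ballI allI impI)
    fix i j assume ij: "i < n" "j < n"
    have "(\<lambda>x. 1 / det (f x) * cofactor (f x) j i) \<in> borel_measurable M" using c[OF ij] by measurable
    also have "?this \<longleftrightarrow> (\<lambda>x. ((1 / det (f x)) \<cdot>\<^sub>m adj_mat (f x)) $$ (i,j)) \<in> borel_measurable M"
      by (intro measurable_cong) (use D(1)[THEN carrier_matD(1)] D(1)[THEN carrier_matD(2)] ij in \<open>auto simp: adj_mat_def\<close>)
    finally show "(\<lambda>x. ((1 / det (f x)) \<cdot>\<^sub>m adj_mat (f x)) $$ (i,j)) \<in> borel_measurable M" .
  qed (use adj_mat(1)[OF D(1)] in auto)
  then have "mat_measurable M (\<lambda>x. if det (f x) \<noteq> 0 then (1 / det (f x)) \<cdot>\<^sub>m adj_mat (f x) else (SOME B. False))"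
    by (intro mat_measurable_if entries_measurable_imp mat_measurable_const) (auto simp: measurable)
  also have "?this \<longleftrightarrow> ?thesis"
    using D(1) by (intro mat_measurable_cong) (simp add: minv_det(1) minv_singular)
  finally show ?thesis .
qed

text \<open>Vectors with rational entries are dense and the form is continuous, so countably many
  inequalities suffice. Lists of rationals serve as test vectors of any dimension; a list of
  unsuitable length still yields some real vector and hence a valid inequality.\<close>

lemma psd_mat_iff_rat:
  assumes A: "A \<in> carrier_mat n n"
  shows "psd_mat n A \<longleftrightarrow> (\<forall>i<n. \<forall>j<n. A $$ (i,j) = A $$ (j,i)) \<and>
    (\<forall>q :: rat list. 0 \<le> (\<Sum>i<n. \<Sum>j<n. of_rat (q ! i) * A $$ (i,j) * of_rat (q ! j)))"
proof
  assume P: "psd_mat n A"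
  have "0 \<le> (\<Sum>i<n. \<Sum>j<n. of_rat (q ! i) * A $$ (i,j) * of_rat (q ! j))" for q
    using psd_matD(4)[OF P, of "vec n (\<lambda>i. of_rat (q ! i))"] quad_expand[OF A, of "vec n (\<lambda>i. of_rat (q ! i))"] by simp
  then show "(\<forall>i<n. \<forall>j<n. A $$ (i,j) = A $$ (j,i)) \<and>
    (\<forall>q :: rat list. 0 \<le> (\<Sum>i<n. \<Sum>j<n. of_rat (q ! i) * A $$ (i,j) * of_rat (q ! j)))"
    using sym_matD(3)[OF psd_matD(1)[OF P]] by blast
next
  assume R: "(\<forall>i<n. \<forall>j<n. A $$ (i,j) = A $$ (j,i)) \<and>
    (\<forall>q :: rat list. 0 \<le> (\<Sum>i<n. \<Sum>j<n. of_rat (q ! i) * A $$ (i,j) * of_rat (q ! j)))"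
  show "psd_mat n A" unfolding psd_mat_def
  proof (intro conjI ballI)
    show "sym_mat n A" using R A by (auto simp: sym_mat_def intro!: eq_matI)
    fix v :: "real vec" assume v: "v \<in> carrier_vec n"
    have "\<exists>r. of_rat r \<in> {v $ i - 1 / real (Suc k)<..<v $ i}" for i k
      using Rats_dense_in_real[of "v $ i - 1 / real (Suc k)" "v $ i"] by (auto elim!: Rats_cases)
    then obtain r where r: "\<And>i k. of_rat (r i k) \<in> {v $ i - 1 / real (Suc k)<..<v $ i}" by metis
    have l: "(\<lambda>k. of_rat (r i k)) \<longlonglongrightarrow> v $ i" for i
    proof (rule tendsto_sandwich[of "\<lambda>k. v $ i - 1 / real (Suc k)" _ _ "\<lambda>_. v $ i"])
      show "(\<lambda>k. v $ i - 1 / real (Suc k)) \<longlonglongrightarrow> v $ i"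
        using tendsto_diff[OF tendsto_const lim_1_over_n[THEN LIMSEQ_Suc]] by simp
    qed (use r in \<open>auto intro!: always_eventually less_imp_le\<close>)
    have L: "(\<lambda>k. \<Sum>i<n. \<Sum>j<n. of_rat (r i k) * A $$ (i,j) * of_rat (r j k)) \<longlonglongrightarrow> (\<Sum>i<n. \<Sum>j<n. v $ i * A $$ (i,j) * v $ j)"
      by (intro tendsto_intros l)
    have "0 \<le> (\<Sum>i<n. \<Sum>j<n. of_rat (r i k) * A $$ (i,j) * of_rat (r j k))" for k
    proof -
      have "0 \<le> (\<Sum>i<n. \<Sum>j<n. of_rat (map (\<lambda>i. r i k) [0..<n] ! i) * A $$ (i,j) * of_rat (map (\<lambda>i. r i k) [0..<n] ! j))"
        using R by blast
      then show ?thesis by simp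
    qed
    then show "0 \<le> v \<bullet> (A *\<^sub>v v)" unfolding quad_expand[OF A v] using LIMSEQ_le_const[OF L, of 0] by blast
  qed
qed

lemma psd_measurable:
  assumes "entries_measurable M n n f" shows "{x\<in>space M. psd_mat n (f x)} \<in> sets M"
proof -
  note D = entries_measurableD[OF assms]
  define g where "g = (\<lambda>i j x. if i < n \<and> j < n then f x $$ (i,j) else 0)"
  have [measurable]: "g i j \<in> borel_measurable M" for i j
    using D(2)[of i j] by (cases "i < n \<and> j < n") (auto simp: g_def)
  have "{x\<in>space M. (\<forall>i\<in>{..<n}. \<forall>j\<in>{..<n}. g i j x = g j i x) \<and>
    (\<forall>q :: rat list. 0 \<le> (\<Sum>i<n. \<Sum>j<n. of_rat (q ! i) * g i j x * of_rat (q ! j)))} \<in> sets M"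
    by measurable
  also have "{x\<in>space M. (\<forall>i\<in>{..<n}. \<forall>j\<in>{..<n}. g i j x = g j i x) \<and>
    (\<forall>q :: rat list. 0 \<le> (\<Sum>i<n. \<Sum>j<n. of_rat (q ! i) * g i j x * of_rat (q ! j)))} = {x\<in>space M. psd_mat n (f x)}"
    using D(1) by (intro Collect_cong conj_cong refl) (simp add: psd_mat_iff_rat g_def Ball_def)
  finally show ?thesis .
qed

text \<open>Strict inequalities do not extend from a dense set of test vectors; the determinant
  supplies strictness instead, as a product of nonnegative eigenvalues.\<close>

lemma pd_iff_psd_det: "pd_mat n A \<longleftrightarrow> psd_mat n A \<and> det A \<noteq> 0"
proof
  assume P: "psd_mat n A \<and> det A \<noteq> 0"
  then obtain Q f where Q: "orth_mat n Q" "A = spec n Q f" using sym_matE psd_matD(1) by blast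
  then have "\<forall>i<n. 0 \<le> f i" "(\<Prod>i<n. f i) \<noteq> 0" using P spec_definite(2)[OF Q(1)] det_spec[OF Q(1)] by auto
  then have "\<forall>i<n. 0 < f i" by (auto simp: less_le)
  then show "pd_mat n A" using spec_definite(3)[OF Q(1)] Q(2) by simp
qed (use pd_imp_psd pd_det_pos in force)

lemma pd_measurable:
  assumes "entries_measurable M n n f" shows "{x\<in>space M. pd_mat n (f x)} \<in> sets M"
proof -
  have [measurable]: "(\<lambda>x. det (f x)) \<in> borel_measurable M" by (rule det_measurable[OF assms])
  have "{x\<in>space M. pd_mat n (f x)} = {x\<in>space M. psd_mat n (f x)} \<inter> {x\<in>space M. det (f x) \<noteq> 0}"
    by (auto simp: pd_iff_psd_det)
  then show ?thesis using psd_measurable[OF assms] by simp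
qed

lemma spec_pow: "orth_mat n Q \<Longrightarrow> spec n Q f ^\<^sub>m k = spec n Q (\<lambda>i. f i ^ k)"
  by (induction k) (auto simp: spec_one carrier_matD[OF spec_carrier] spec_mult mult.commute)

text \<open>Weierstrass approximation on \<open>[0,k]\<close> with error below
  \<open>1/(k+1)\<close>. Any fixed \<open>x\<close> lies in all but finitely many of these
  intervals, so a single sequence converges on the whole half-line.\<close>

lemma sqrt_polynomials:
  obtains a :: "nat \<Rightarrow> nat \<Rightarrow> real" and d :: "nat \<Rightarrow> nat"
  where "\<And>x. 0 \<le> x \<Longrightarrow> (\<lambda>k. \<Sum>i\<le>d k. a k i * x ^ i) \<longlonglongrightarrow> sqrt x"
proof -
  have "\<exists>a n. \<forall>x\<in>{0..real k}. \<bar>sqrt x - (\<Sum>i\<le>(n::nat). a i * x ^ i)\<bar> < 1 / real (Suc k)" for k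
  proof -
    have "continuous_on {0..real k} sqrt" by (intro continuous_intros)
    then obtain g where g: "real_polynomial_function g" "\<And>x. x \<in> {0..real k} \<Longrightarrow> \<bar>sqrt x - g x\<bar> < 1 / real (Suc k)"
      using Stone_Weierstrass_real_polynomial_function[of "{0..real k}" sqrt "1 / real (Suc k)"] by auto
    then show ?thesis using g(1)[unfolded real_polynomial_function_iff_sum] by fastforce
  qed
  then obtain a d where ad: "\<And>k x. x \<in> {0..real k} \<Longrightarrow> \<bar>sqrt x - (\<Sum>i\<le>(d k::nat). a k i * x ^ i)\<bar> < 1 / real (Suc k)"
    by metis
  show ?thesis
  proof (rule that)
    fix x :: real assume "0 \<le> x"
    obtain K where K: "x \<le> real K" using real_arch_simple by blast
    have "(\<lambda>k. sqrt x - (\<Sum>i\<le>d k. a k i * x ^ i)) \<longlonglongrightarrow> 0"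
    proof (rule Lim_null_comparison)
      show "\<forall>\<^sub>F k in sequentially. norm (sqrt x - (\<Sum>i\<le>d k. a k i * x ^ i)) \<le> 1 / real (Suc k)"
        using eventually_ge_at_top[of K]
      proof eventually_elim
        case (elim k)
        then have "x \<le> real k" using K by linarith
        then show ?case using ad[of x k] \<open>0 \<le> x\<close> by simp
      qed
      show "(\<lambda>k. 1 / real (Suc k)) \<longlonglongrightarrow> 0" using lim_1_over_n[THEN LIMSEQ_Suc] by simp
    qed
    then show "(\<lambda>k. \<Sum>i\<le>d k. a k i * x ^ i) \<longlonglongrightarrow> sqrt x"
      using tendsto_diff[OF tendsto_const[of "sqrt x"]] by fastforce
  qed
qed

text \<open>Evaluated at a semidefinite matrix, the polynomials from \<open>sqrt_polynomials\<close>
  converge entrywise to its root, since they act on the eigenvalues alone. Entries of matrix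
  polynomials are measurable, and so is their pointwise limit.\<close>

lemma msqrt_measurable:
  assumes f: "entries_measurable M n n f"
  shows "mat_measurable M (\<lambda>x. msqrt n (f x))"
proof -
  note D = entries_measurableD[OF f]
  obtain a :: "nat \<Rightarrow> nat \<Rightarrow> real" and d :: "nat \<Rightarrow> nat"
    where ad: "\<And>x. 0 \<le> x \<Longrightarrow> (\<lambda>k. \<Sum>i\<le>d k. a k i * x ^ i) \<longlonglongrightarrow> sqrt x" using sqrt_polynomials by blast
  have "entries_measurable M n n (\<lambda>x. f x ^\<^sub>m k)" for k
  proof (induction k)
    case 0
    have "f x ^\<^sub>m 0 = 1\<^sub>m n" if "x \<in> space M" for x using D(1)[OF that] by simp
    then have "mat_measurable M (\<lambda>x. f x ^\<^sub>m 0)"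
      using mat_measurable_cong[of M "\<lambda>x. f x ^\<^sub>m 0" "\<lambda>_. 1\<^sub>m n"] mat_measurable_const by blast
    then show ?case by (rule mat_measurable_imp) (use D(1)[THEN carrier_matD(1)] in auto)
  next
    case (Suc k)
    have "mat_measurable M (\<lambda>x. f x ^\<^sub>m k * f x)"
      by (rule mat_measurable_mult[OF entries_measurable_imp[OF Suc] entries_measurable_imp[OF f]])
    then have "mat_measurable M (\<lambda>x. f x ^\<^sub>m Suc k)" by simp
    then show ?case by (rule mat_measurable_imp) (use D(1) entries_measurableD(1)[OF Suc] in \<open>auto intro: square_carrier\<close>)
  qed
  note P = entries_measurableD(2)[OF this]
  have lim: "(\<lambda>k. \<Sum>m\<le>d k. a k m * (A ^\<^sub>m m) $$ (i,j)) \<longlonglongrightarrow> msqrt n A $$ (i,j)"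
    if A: "psd_mat n A" and ij: "i < n" "j < n" for A i j
  proof -
    obtain Q g where Q: "orth_mat n Q" and Ag: "A = spec n Q g" using sym_matE[OF psd_matD(1)[OF A]] .
    have g: "\<And>i. i < n \<Longrightarrow> 0 \<le> g i" using spec_definite(2)[OF Q, of g] A Ag by simp
    have "(\<Sum>m\<le>d k. a k m * (A ^\<^sub>m m) $$ (i,j)) = (\<Sum>l<n. (\<Sum>m\<le>d k. a k m * g l ^ m) * Q $$ (i,l) * Q $$ (j,l))" for k
    proof -
      have "(\<Sum>m\<le>d k. a k m * (A ^\<^sub>m m) $$ (i,j)) = (\<Sum>m\<le>d k. \<Sum>l<n. a k m * (g l ^ m * Q $$ (i,l) * Q $$ (j,l)))"
        unfolding Ag spec_pow[OF Q] spec_entry[OF Q ij] sum_distrib_left ..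
      also have "\<dots> = (\<Sum>l<n. \<Sum>m\<le>d k. a k m * (g l ^ m * Q $$ (i,l) * Q $$ (j,l)))" by (rule sum.swap)
      finally show ?thesis by (simp add: sum_distrib_right mult.assoc)
    qed
    moreover have "(\<lambda>k. \<Sum>l<n. (\<Sum>m\<le>d k. a k m * g l ^ m) * Q $$ (i,l) * Q $$ (j,l)) \<longlonglongrightarrow> (\<Sum>l<n. sqrt (g l) * Q $$ (i,l) * Q $$ (j,l))"
      using g by (intro tendsto_sum tendsto_mult_right ad) auto
    moreover have "msqrt n A = spec n Q (\<lambda>i. sqrt (g i))" unfolding Ag by (rule msqrt_spec[OF Q g])
    ultimately show ?thesis using spec_entry[OF Q ij] by simp
  qed
  have [measurable]: "{x\<in>space M. psd_mat n (f x)} \<in> sets M" by (rule psd_measurable[OF f])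
  have "entries_measurable M n n (\<lambda>x. if psd_mat n (f x) then msqrt n (f x) else 0\<^sub>m n n)"
    unfolding entries_measurable_def
  proof (intro conjI ballI allI impI)
    show "(if psd_mat n (f x) then msqrt n (f x) else 0\<^sub>m n n) \<in> carrier_mat n n" for x
      using psd_matD(2)[OF msqrt_psd(1)] by auto
    fix i j assume ij: "i < n" "j < n"
    let ?u = "\<lambda>k x. if psd_mat n (f x) then \<Sum>m\<le>d k. a k m * (f x ^\<^sub>m m) $$ (i,j) else 0"
    have 1: "?u k \<in> borel_measurable M" for k
      by (intro measurable_If borel_measurable_sum borel_measurable_times borel_measurable_const P ij) simp
    have 2: "(\<lambda>k. ?u k x) \<longlonglongrightarrow> (if psd_mat n (f x) then msqrt n (f x) else 0\<^sub>m n n) $$ (i,j)" for x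
      using lim[OF _ ij] ij by (cases "psd_mat n (f x)") auto
    show "(\<lambda>x. (if psd_mat n (f x) then msqrt n (f x) else 0\<^sub>m n n) $$ (i,j)) \<in> borel_measurable M"
      by (rule borel_measurable_LIMSEQ_real[where u = ?u, OF 2 1])
  qed
  then have "mat_measurable M (\<lambda>x. if psd_mat n (f x) then (if psd_mat n (f x) then msqrt n (f x) else 0\<^sub>m n n) else (THE B. False))"
    by (intro mat_measurable_if mat_measurable_const psd_measurable[OF f] entries_measurable_imp)
  also have "?this \<longleftrightarrow> ?thesis"
    by (intro mat_measurable_cong) (simp add: msqrt_not_psd)
  finally show ?thesis .
qed

text \<open>The default value of \<open>msqrt\<close> need not be an \<open>n\<close> by
  \<open>n\<close> matrix, as \<open>minv_measurable\<close> would require. It is replaced by the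
  zero matrix before inverting, and the constant result of the default branch is put back
  afterwards.\<close>

lemma minv_msqrt_measurable:
  assumes f: "entries_measurable M n n f"
  shows "mat_measurable M (\<lambda>x. minv n (msqrt n (f x)))"
proof -
  have P: "{x\<in>space M. psd_mat n (f x)} \<in> sets M" by (rule psd_measurable[OF f])
  have "entries_measurable M n n (\<lambda>x. if psd_mat n (f x) then msqrt n (f x) else 0\<^sub>m n n)"
    using psd_matD(2)[OF msqrt_psd(1)]
    by (intro mat_measurable_imp mat_measurable_if P msqrt_measurable[OF f] mat_measurable_const) auto
  then have "mat_measurable M (\<lambda>x. minv n (if psd_mat n (f x) then msqrt n (f x) else 0\<^sub>m n n))"
    by (rule minv_measurable)
  then have "mat_measurable M (\<lambda>x. if psd_mat n (f x) then minv n (if psd_mat n (f x) then msqrt n (f x) else 0\<^sub>m n n) else minv n (THE B. False))"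
    by (intro mat_measurable_if[OF P] mat_measurable_const)
  also have "?this \<longleftrightarrow> ?thesis"
    by (intro mat_measurable_cong) (simp add: msqrt_not_psd)
  finally show ?thesis .
qed

section \<open>Canonical moments as measurable functions\<close>

lemma Smat_measurable:
  assumes "m \<le> n" shows "entries_measurable (leb_sym p n) p p (\<lambda>x. Smat p x m)"
  unfolding entries_measurable_def
proof (intro conjI ballI allI impI)
  fix i j assume ij: "i < p" "j < p"
  show "(\<lambda>x. Smat p x m $$ (i,j)) \<in> borel_measurable (leb_sym p n)"
  proof (cases "m = 0")
    case False
    have "(m, min i j, max i j) \<in> sym_idx p n" using assms False ij by (auto simp: sym_idx_def)
    then have "(\<lambda>x. x (m, min i j, max i j)) \<in> borel_measurable (leb_sym p n)"
      unfolding leb_sym_def by measurable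
    then show ?thesis using False ij by (simp add: Smat_def)
  qed (use ij in \<open>simp add: Smat_def\<close>)
qed simp

lemma block_hankel_measurable:
  assumes "0 < p" "\<And>t. t < 2 * r - 1 \<Longrightarrow> entries_measurable M p p (\<lambda>x. F x t)"
  shows "entries_measurable M (r * p) (r * p) (\<lambda>x. block_hankel p r (F x))"
  unfolding entries_measurable_def
proof (intro conjI ballI allI impI block_hankel_carrier)
  fix i j assume ij: "i < r * p" "j < r * p"
  have "i div p + j div p < 2 * r - 1"
    using less_mult_imp_div_less[OF ij(1)] less_mult_imp_div_less[OF ij(2)] by linarith
  then show "(\<lambda>x. block_hankel p r (F x) $$ (i,j)) \<in> borel_measurable M"
    unfolding block_hankel_entry[OF ij] using assms(1) by (intro entries_measurableD(2)[OF assms(2)]) auto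
qed

lemma block_vec_measurable:
  assumes "0 < p" "\<And>t. t < r \<Longrightarrow> entries_measurable M p p (\<lambda>x. F x t)"
  shows "entries_measurable M (r * p) p (\<lambda>x. block_vec p r (F x))"
  unfolding entries_measurable_def
proof (intro conjI ballI allI impI block_vec_carrier)
  fix i j assume ij: "i < r * p" "j < p"
  have "i div p < r" using less_mult_imp_div_less[OF ij(1)] .
  then show "(\<lambda>x. block_vec p r (F x) $$ (i,j)) \<in> borel_measurable M"
    unfolding block_vec_entry[OF ij] using assms(1) ij by (intro entries_measurableD(2)[OF assms(2)]) auto
qed

lemma entries_measurable_minus:
  assumes "entries_measurable M r c f" "entries_measurable M r c g"
  shows "entries_measurable M r c (\<lambda>x. f x - g x)"
  using mat_measurable_minus[OF assms[THEN entries_measurable_imp]] entries_measurableD(1)[OF assms(2)]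
  by (intro mat_measurable_imp) (auto intro: minus_carrier_mat)

lemma Lo_measurable:
  assumes "0 < p" "j \<le> n" shows "entries_measurable (leb_sym p n) ((j div 2 + 1) * p) ((j div 2 + 1) * p) (\<lambda>x. Lo p (Smat p x) j)"
  unfolding Lo_def
proof (rule block_hankel_measurable[OF assms(1)])
  fix t assume t: "t < 2 * (j div 2 + 1) - 1"
  show "entries_measurable (leb_sym p n) p p (\<lambda>x. (if even j then Smat p x else (\<lambda>t. Smat p x (t + 1))) t)"
  proof (cases "even j")
    case True
    then have "t \<le> n" using t assms(2) by (auto elim!: evenE)
    then show ?thesis using True by (simp add: Smat_measurable)
  next
    case False
    then have "t + 1 \<le> n" using t assms(2) by (auto elim!: oddE)
    then show ?thesis using False by (simp add: Smat_measurable)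
  qed
qed

lemma Up_measurable:
  assumes "0 < p" "j \<le> n" shows "entries_measurable (leb_sym p n) ((j + 1) div 2 * p) ((j + 1) div 2 * p) (\<lambda>x. Up p (Smat p x) j)"
  unfolding Up_def
proof (rule block_hankel_measurable[OF assms(1)])
  fix t assume t: "t < 2 * ((j + 1) div 2) - 1"
  show "entries_measurable (leb_sym p n) p p (\<lambda>x. (if even j then (\<lambda>t. Smat p x (t + 1) - Smat p x (t + 2)) else (\<lambda>t. Smat p x t - Smat p x (t + 1))) t)"
  proof (cases "even j")
    case True
    then have "t + 2 \<le> n" using t assms(2) by (auto elim!: evenE)
    then show ?thesis using True by (simp add: Smat_measurable entries_measurable_minus)
  next
    case False
    then have "t + 1 \<le> n" using t assms(2) by (auto elim!: oddE)
    then show ?thesis using False by (simp add: Smat_measurable entries_measurable_minus)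
  qed
qed

text \<open>The part of the moment space with strict inequalities, where all inverses and square
  roots in \<open>Ucan\<close> up to order \<open>n\<close> are genuine.\<close>

definition Dset :: "nat \<Rightarrow> nat \<Rightarrow> (nat \<times> nat \<times> nat \<Rightarrow> real) set" where
  "Dset p n = {x \<in> PiE (sym_idx p n) (\<lambda>_. UNIV). Hpos p (Smat p x) n}"

lemma space_leb_sym: "space (leb_sym p n) = PiE (sym_idx p n) (\<lambda>_. UNIV)"
  by (simp add: leb_sym_def space_PiM)

lemma sets_moment_space:
  assumes p: "0 < p" shows "Dset p n \<in> sets (leb_sym p n)" "moment_space p n \<in> sets (leb_sym p n)"
proof -
  have 1: "Dset p n = (\<Inter>j\<in>{..n}. {x\<in>space (leb_sym p n). pd_mat ((j div 2 + 1) * p) (Lo p (Smat p x) j)} \<inter>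
      {x\<in>space (leb_sym p n). pd_mat ((j + 1) div 2 * p) (Up p (Smat p x) j)})"
    by (auto simp: Dset_def Hpos_def space_leb_sym)
  have 2: "moment_space p n = (\<Inter>j\<in>{..n}. {x\<in>space (leb_sym p n). psd_mat ((j div 2 + 1) * p) (Lo p (Smat p x) j)} \<inter>
      {x\<in>space (leb_sym p n). psd_mat ((j + 1) div 2 * p) (Up p (Smat p x) j)})"
    by (auto simp: moment_space_eq[OF p] Hpsd_def space_leb_sym)
  show "Dset p n \<in> sets (leb_sym p n)" unfolding 1
    by (rule sets.finite_INT, simp, simp, rule sets.Int)
      (rule pd_measurable, rule Lo_measurable[OF p], simp, rule pd_measurable, rule Up_measurable[OF p], simp)
  show "moment_space p n \<in> sets (leb_sym p n)" unfolding 2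
    by (rule sets.finite_INT, simp, simp, rule sets.Int)
      (rule psd_measurable, rule Lo_measurable[OF p], simp, rule psd_measurable, rule Up_measurable[OF p], simp)
qed

lemma Sminus_eq: "Sminus p x n = Slow p (Smat p x) n"
proof (cases "n \<le> 1")
  case True
  then show ?thesis by (simp add: Sminus_def Slow_def)
next
  case False
  show ?thesis
  proof (cases "even n")
    case True
    then obtain q where "n = 2 * q" by (rule evenE)
    then obtain r where "n = 2 * r + 2" using False by (cases q) auto
    then show ?thesis by (simp add: Sminus_def Slow_def lo_vec_def Lo_def Let_def)
  next
    case odd: False
    then obtain q where "n = 2 * q + 1" by (rule oddE)
    then obtain r where "n = 2 * r + 3" using False by (cases q) auto
    then show ?thesis by (simp add: Sminus_def Slow_def lo_vec_def Lo_def Let_def)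
  qed
qed

lemma Splus_eq:
  assumes "0 < p" shows "Splus p x n = Sup_mat p (Smat p x) n"
proof (cases "n \<le> 2")
  case True
  show ?thesis
  proof (cases "n = 2")
    case True
    have 1: "Smat p x 1 - 0\<^sub>m p p = Smat p x 1" by (intro eq_matI) auto
    \<comment> \<open>With an empty vector the quadratic term vanishes, provided that the inverse of
      the 0 by 0 matrix has the right dimension.\<close>
    have 2: "transpose_mat (block_vec p 0 F) * B * block_vec p 0 F' = 0\<^sub>m p p" if "B \<in> carrier_mat 0 0" for B F F'
      using that by (intro eq_matI) (auto simp: block_vec_def scalar_prod_def)
    have "pd_mat 0 (Up p (Smat p x) 0)"
      using HposD(2)[of p "Smat p x" 0, OF assms Smat_sym Smat_0 Hpos_0[of p "Smat p x", OF assms Smat_sym Smat_0] le0] by simp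
    then have "minv 0 (Up p (Smat p x) 0) \<in> carrier_mat 0 0" by (rule minv_pd)
    then have "Sup_mat p (Smat p x) 2 = Smat p x 1" using 1 2[of "minv 0 (Up p (Smat p x) 0)"]
      by (simp add: Sup_mat_def up_vec_def del: assoc_mult_mat)
    then show ?thesis using True by (simp add: Splus_def Let_def)
  next
    case False
    then have "n \<le> 1" using True by linarith
    then show ?thesis by (simp add: Splus_def Sup_mat_def)
  qed
next
  case False
  show ?thesis
  proof (cases "even n")
    case True
    then obtain q where "n = 2 * q" by (rule evenE)
    then obtain r where "n = 2 * r + 4" using False by (cases q; cases "q - 1") auto
    then show ?thesis by (simp add: Splus_def Sup_mat_def up_vec_def Up_def Let_def)
  next
    case odd: False
    then obtain q where "n = 2 * q + 1" by (rule oddE)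
    then obtain r where "n = 2 * r + 3" using False by (cases q) auto
    then show ?thesis by (simp add: Splus_def Sup_mat_def up_vec_def Up_def Let_def)
  qed
qed

lemma Slow_measurable:
  assumes p: "0 < p" and m: "m \<le> Suc n"
  shows "entries_measurable (leb_sym p n) p p (\<lambda>x. Slow p (Smat p x) m)"
proof (cases "m \<le> 1")
  case True
  then show ?thesis by (simp add: Slow_def entries_measurable_def)
next
  case False
  have "entries_measurable (leb_sym p n) (m div 2 * p) p (\<lambda>x. lo_vec p (Smat p x) m)"
    unfolding lo_vec_def
  proof (rule block_vec_measurable[OF p])
    fix t assume "t < m div 2"
    then show "entries_measurable (leb_sym p n) p p (\<lambda>x. Smat p x ((m + 1) div 2 + t))"
      using m by (intro Smat_measurable) linarith
  qed
  note 1 = entries_measurable_imp[OF this]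
  have e: "(m - 2) div 2 + 1 = m div 2" using False by simp
  have 2: "mat_measurable (leb_sym p n) (\<lambda>x. minv (m div 2 * p) (Lo p (Smat p x) (m - 2)))"
    by (rule minv_measurable, rule Lo_measurable[OF p, of "m - 2" n, unfolded e]) (use m in simp)
  have "mat_measurable (leb_sym p n) (\<lambda>x. transpose_mat (lo_vec p (Smat p x) m) * minv (m div 2 * p) (Lo p (Smat p x) (m - 2)) * lo_vec p (Smat p x) m)"
    by (rule mat_measurable_mult[OF mat_measurable_mult[OF mat_measurable_transpose[OF 1] 2] 1])
  then have "mat_measurable (leb_sym p n) (\<lambda>x. Slow p (Smat p x) m)" using False by (simp add: Slow_def del: assoc_mult_mat)
  \<comment> \<open>The outer factors alone fix the dimensions of the product, so these are right
    even where the inverse is a default value.\<close>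
  moreover have "dim_col (lo_vec p S m) = p" for S by (simp add: lo_vec_def block_vec_def)
  then have "Slow p S m \<in> carrier_mat p p" for S
    unfolding Slow_def using False by (intro carrier_matI) (simp_all del: assoc_mult_mat)
  ultimately show ?thesis by (rule mat_measurable_imp)
qed

lemma Sup_measurable:
  assumes p: "0 < p" and m: "m \<le> Suc n"
  shows "entries_measurable (leb_sym p n) p p (\<lambda>x. Sup_mat p (Smat p x) m)"
proof (cases "m \<le> 1")
  case True
  then show ?thesis by (simp add: Sup_mat_def entries_measurable_def)
next
  case False
  have "entries_measurable (leb_sym p n) ((m - 1) div 2 * p) p (\<lambda>x. up_vec p (Smat p x) m)"
    unfolding up_vec_def
  proof (rule block_vec_measurable[OF p])
    fix t assume "t < (m - 1) div 2"
    then show "entries_measurable (leb_sym p n) p p (\<lambda>x. Smat p x (m div 2 + t) - Smat p x (m div 2 + t + 1))"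
      using m by (intro entries_measurable_minus Smat_measurable) linarith+
  qed
  note 1 = entries_measurable_imp[OF this]
  have e: "((m - 2) + 1) div 2 = (m - 1) div 2" using False by (simp add: Suc_diff_Suc numeral_2_eq_2)
  have 2: "mat_measurable (leb_sym p n) (\<lambda>x. minv ((m - 1) div 2 * p) (Up p (Smat p x) (m - 2)))"
    by (rule minv_measurable, rule Up_measurable[OF p, of "m - 2" n, unfolded e]) (use m in simp)
  have "mat_measurable (leb_sym p n) (\<lambda>x. transpose_mat (up_vec p (Smat p x) m) * minv ((m - 1) div 2 * p) (Up p (Smat p x) (m - 2)) * up_vec p (Smat p x) m)"
    by (rule mat_measurable_mult[OF mat_measurable_mult[OF mat_measurable_transpose[OF 1] 2] 1])
  moreover have "mat_measurable (leb_sym p n) (\<lambda>x. Smat p x (m - 1))"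
    by (rule entries_measurable_imp, rule Smat_measurable) (use m in simp)
  ultimately have "mat_measurable (leb_sym p n) (\<lambda>x. Smat p x (m - 1) - transpose_mat (up_vec p (Smat p x) m) * minv ((m - 1) div 2 * p) (Up p (Smat p x) (m - 2)) * up_vec p (Smat p x) m)"
    by (intro mat_measurable_minus)
  then have "mat_measurable (leb_sym p n) (\<lambda>x. Sup_mat p (Smat p x) m)" using False by (simp add: Sup_mat_def del: assoc_mult_mat)
  moreover have "dim_col (up_vec p S m) = p" for S by (simp add: up_vec_def block_vec_def)
  then have "Sup_mat p S m \<in> carrier_mat p p" for S
    unfolding Sup_mat_def using False by (intro carrier_matI) (simp_all del: assoc_mult_mat)
  ultimately show ?thesis by (rule mat_measurable_imp)
qed

lemma Ucan_measurable:
  assumes p: "0 < p" and m: "m \<le> n"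
  shows "mat_measurable (leb_sym p n) (\<lambda>x. Ucan p x m)"
proof -
  have m': "m \<le> Suc n" using m by simp
  note 1 = Slow_measurable[OF p m'] and 2 = Sup_measurable[OF p m'] and 3 = Smat_measurable[OF m]
  note D = minv_msqrt_measurable[OF entries_measurable_minus[OF 2 1]]
  show ?thesis unfolding Ucan_def Let_def Sminus_eq Splus_eq[OF p]
    by (rule mat_measurable_mult[OF mat_measurable_mult[OF D mat_measurable_minus[OF entries_measurable_imp[OF 3] entries_measurable_imp[OF 1]]] D])
qed

lemma scaled_U_measurable:
  assumes "0 < p" "k \<le> n"
  shows "scaled_U p k n \<in> measurable (leb_sym p n) (PiM (sym_idx p k) (\<lambda>_. borel))"
proof (rule measurable_PiM_single')
  fix a assume a: "a \<in> sym_idx p k"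
  obtain m i j where e: "a = (m,i,j)" by (cases a)
  have "m \<le> n" using a e assms by (auto simp: sym_idx_def)
  then show "(\<lambda>x. scaled_U p k n x a) \<in> borel_measurable (leb_sym p n)"
    using a e mat_measurableD(3)[OF Ucan_measurable[OF assms(1), of m n]] by (simp add: scaled_U_def)
qed (auto simp: PiE_def extensional_def scaled_U_def)

subsection \<open>Changes of variables\<close>

text \<open>A coordinate of maximal rank \<open>r\<close> is integrated first: the remaining
  coordinates determine its translation, so the inner integral is a one-dimensional affine
  substitution, and induction handles the rest. Tonelli's theorem for nonnegative functions replaces
  any differentiability argument.\<close>

lemma triangular_change_of_variables:
  fixes I :: "'i set" and a :: "'i \<Rightarrow> real" and h :: "'i \<Rightarrow> ('i \<Rightarrow> real) \<Rightarrow> real" and r :: "'i \<Rightarrow> nat"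
  assumes "finite I" "\<And>i. i \<in> I \<Longrightarrow> a i \<noteq> 0" "\<And>i. i \<in> I \<Longrightarrow> h i \<in> borel_measurable (PiM I (\<lambda>_. lborel))"
    "\<And>i x y. i \<in> I \<Longrightarrow> (\<And>j. j \<in> I \<Longrightarrow> r j < r i \<Longrightarrow> x j = y j) \<Longrightarrow> h i x = h i y"
    "f \<in> borel_measurable (PiM I (\<lambda>_. lborel))"
  shows "(\<Prod>i\<in>I. ennreal \<bar>a i\<bar>) * (\<integral>\<^sup>+x. f (\<lambda>i\<in>I. a i * x i + h i x) \<partial>PiM I (\<lambda>_. lborel)) = (\<integral>\<^sup>+x. f x \<partial>PiM I (\<lambda>_. lborel))"
  using assms
proof (induction "card I" arbitrary: I f)
  case 0
  have I: "I = {}" using 0(1,2) by simp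
  have "(\<lambda>i\<in>I. a i * x i + h i x) = x" if "x \<in> space (PiM I (\<lambda>_. lborel :: real measure))" for x
    using that by (auto simp: I space_PiM)
  then have "(\<integral>\<^sup>+x. f (\<lambda>i\<in>I. a i * x i + h i x) \<partial>PiM I (\<lambda>_. lborel)) = (\<integral>\<^sup>+x. f x \<partial>PiM I (\<lambda>_. lborel))"
    by (intro nn_integral_cong) simp
  then show ?case by (simp only: I prod.empty mult_1_left)
next
  case (Suc n)
  interpret product_sigma_finite "\<lambda>_::'i. lborel :: real measure" by standard
  have "I \<noteq> {}" using Suc.hyps(2) by auto
  then have "Max (r ` I) \<in> r ` I" using Suc.prems(1) by (intro Max_in) auto
  then obtain k where k: "k \<in> I" "r k = Max (r ` I)" by auto
  have kmax: "r j \<le> r k" if "j \<in> I" for j unfolding k(2) using that Suc.prems(1) by (intro Max_ge) auto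
  define J where "J = I - {k}"
  have J: "finite J" "k \<notin> J" "I = insert k J" "n = card J" using Suc.prems(1) Suc.hyps(2) k(1) by (auto simp: J_def)
  have upd: "(\<lambda>(x, y). x(k := y)) \<in> measurable (PiM J (\<lambda>_. lborel) \<Otimes>\<^sub>M lborel) (PiM I (\<lambda>_. lborel :: real measure))"
    unfolding J(3) by (rule measurable_add_dim)
  have upd0: "(\<lambda>x. x(k := y)) \<in> measurable (PiM J (\<lambda>_. lborel)) (PiM I (\<lambda>_. lborel :: real measure))" for y
    using measurable_compose[OF measurable_Pair2'[of y lborel "PiM J (\<lambda>_. lborel)"] upd] by simp
  \<comment> \<open>Each \<open>h i\<close> sees only ranks below \<open>r i\<close>, and
    \<open>r i\<close> is at most \<open>r k\<close>; so coordinate \<open>k\<close> enters no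
    translation, not even its own.\<close>
  have hk: "h i (x(k := y)) = h i x" if "i \<in> I" for i x y
    by (rule Suc.prems(4)[OF that]) (use kmax[OF that] in auto)
  have hJ: "h i \<in> borel_measurable (PiM J (\<lambda>_. lborel))" if "i \<in> I" for i
    using measurable_compose[OF upd0[of 0] Suc.prems(3)[OF that]] unfolding hk[OF that] .
  define G where "G = (\<lambda>x. \<lambda>i\<in>I. a i * x i + h i x)"
  define G' where "G' = (\<lambda>x. \<lambda>i\<in>J. a i * x i + h i x)"
  have Gm: "G \<in> measurable (PiM I (\<lambda>_. lborel)) (PiM I (\<lambda>_. lborel))"
    unfolding G_def
  proof (rule measurable_restrict)
    fix i assume i: "i \<in> I"
    have "(\<lambda>x. x i) \<in> borel_measurable (PiM I (\<lambda>_. lborel :: real measure))" using i by measurable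
    then show "(\<lambda>x. a i * x i + h i x) \<in> measurable (PiM I (\<lambda>_. lborel)) lborel" using Suc.prems(3)[OF i] by simp
  qed
  have G'm: "G' \<in> measurable (PiM J (\<lambda>_. lborel)) (PiM J (\<lambda>_. lborel))"
    unfolding G'_def
  proof (rule measurable_restrict)
    fix i assume i: "i \<in> J"
    have "(\<lambda>x. x i) \<in> borel_measurable (PiM J (\<lambda>_. lborel :: real measure))" using i by measurable
    then show "(\<lambda>x. a i * x i + h i x) \<in> measurable (PiM J (\<lambda>_. lborel)) lborel" using hJ[of i] i J by simp
  qed
  have GG: "G (x(k := y)) = (G' x)(k := h k x + a k * y)" for x y
    unfolding G_def G'_def using hk J k(1) by (auto simp: fun_eq_iff)
  define F where "F = (\<lambda>x. \<integral>\<^sup>+y. f (x(k := y)) \<partial>lborel)"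
  have fu: "(\<lambda>(x,y). f (x(k := y))) \<in> borel_measurable (PiM J (\<lambda>_. lborel) \<Otimes>\<^sub>M lborel)"
    using measurable_compose[OF upd Suc.prems(5)] by (simp add: case_prod_beta')
  have Fm: "F \<in> borel_measurable (PiM J (\<lambda>_. lborel))"
    unfolding F_def by (rule lborel.borel_measurable_nn_integral[OF fu])
  have ak: "a k \<noteq> 0" using Suc.prems(2)[OF k(1)] .
  have inner: "(\<integral>\<^sup>+y. f (G (x(k := y))) \<partial>lborel) = ennreal (1 / \<bar>a k\<bar>) * F (G' x)" if x: "x \<in> space (PiM J (\<lambda>_. lborel))" for x
  proof -
    have sp: "G' x \<in> space (PiM J (\<lambda>_. lborel))" using measurable_space[OF G'm x] .
    then have "(\<lambda>y. f ((G' x)(k := y))) \<in> borel_measurable lborel"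
      using measurable_compose[OF measurable_Pair1'[OF sp] fu] by simp
    then have m: "(\<lambda>y. f ((G' x)(k := y))) \<in> borel_measurable borel" by simp
    have "F (G' x) = ennreal \<bar>a k\<bar> * (\<integral>\<^sup>+y. f (G (x(k := y))) \<partial>lborel)"
      unfolding F_def GG by (rule nn_integral_real_affine[OF m ak])
    then have "ennreal (1 / \<bar>a k\<bar>) * F (G' x) = (ennreal (1 / \<bar>a k\<bar>) * ennreal \<bar>a k\<bar>) * (\<integral>\<^sup>+y. f (G (x(k := y))) \<partial>lborel)"
      by (simp add: mult.assoc)
    also have "ennreal (1 / \<bar>a k\<bar>) * ennreal \<bar>a k\<bar> = 1" using ak by (simp add: ennreal_mult[symmetric])
    finally show ?thesis by (simp only: mult_1_left)
  qed
  have "(\<integral>\<^sup>+x. f (G x) \<partial>PiM I (\<lambda>_. lborel)) = (\<integral>\<^sup>+x. (\<integral>\<^sup>+y. f (G (x(k := y))) \<partial>lborel) \<partial>PiM J (\<lambda>_. lborel))"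
    unfolding J(3) by (rule product_nn_integral_insert[OF J(1,2)]) (use measurable_compose[OF Gm Suc.prems(5)] J(3) in simp)
  also have "\<dots> = (\<integral>\<^sup>+x. ennreal (1 / \<bar>a k\<bar>) * F (G' x) \<partial>PiM J (\<lambda>_. lborel))"
    by (intro nn_integral_cong inner)
  also have "\<dots> = ennreal (1 / \<bar>a k\<bar>) * (\<integral>\<^sup>+x. F (G' x) \<partial>PiM J (\<lambda>_. lborel))"
    by (rule nn_integral_cmult[OF measurable_compose[OF G'm Fm]])
  finally have e1: "(\<integral>\<^sup>+x. f (G x) \<partial>PiM I (\<lambda>_. lborel)) = ennreal (1 / \<bar>a k\<bar>) * (\<integral>\<^sup>+x. F (G' x) \<partial>PiM J (\<lambda>_. lborel))" .
  have IH: "(\<Prod>i\<in>J. ennreal \<bar>a i\<bar>) * (\<integral>\<^sup>+x. F (G' x) \<partial>PiM J (\<lambda>_. lborel)) = (\<integral>\<^sup>+x. F x \<partial>PiM J (\<lambda>_. lborel))"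
    unfolding G'_def
  proof (rule Suc.hyps(1)[OF J(4) J(1) _ _ _ Fm])
    show "a i \<noteq> 0" if "i \<in> J" for i using Suc.prems(2)[of i] that J by simp
    show "h i \<in> borel_measurable (PiM J (\<lambda>_. lborel))" if "i \<in> J" for i using hJ that J by simp
    show "h i x = h i y" if i: "i \<in> J" and e: "\<And>j. j \<in> J \<Longrightarrow> r j < r i \<Longrightarrow> x j = y j" for i x y
    proof (rule Suc.prems(4))
      show "i \<in> I" using i J by simp
      fix j assume "j \<in> I" "r j < r i"
      then show "x j = y j" using e[of j] kmax[of i] i J by auto
    qed
  qed
  have "(\<Prod>i\<in>I. ennreal \<bar>a i\<bar>) * (\<integral>\<^sup>+x. f (G x) \<partial>PiM I (\<lambda>_. lborel))
    = (ennreal \<bar>a k\<bar> * ennreal (1 / \<bar>a k\<bar>)) * ((\<Prod>i\<in>J. ennreal \<bar>a i\<bar>) * (\<integral>\<^sup>+x. F (G' x) \<partial>PiM J (\<lambda>_. lborel)))"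
    unfolding e1 using J by (simp add: ac_simps)
  also have "ennreal \<bar>a k\<bar> * ennreal (1 / \<bar>a k\<bar>) = 1" using ak by (simp add: ennreal_mult[symmetric])
  also have "1 * ((\<Prod>i\<in>J. ennreal \<bar>a i\<bar>) * (\<integral>\<^sup>+x. F (G' x) \<partial>PiM J (\<lambda>_. lborel))) = (\<integral>\<^sup>+x. f x \<partial>PiM I (\<lambda>_. lborel))"
    unfolding IH unfolding F_def J(3) by (subst product_nn_integral_insert[OF J(1,2)]) (use Suc.prems(5) J(3) in simp_all)
  finally show ?case unfolding G_def .
qed

section \<open>Congruences of symmetric matrices\<close>

definition blk :: "nat \<Rightarrow> nat \<Rightarrow> (nat \<times> nat \<times> nat) set" where
  "blk p m = {(m',i,j). m' = m \<and> i \<le> j \<and> j < p}"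

definition bmat :: "nat \<Rightarrow> nat \<Rightarrow> (nat \<times> nat \<times> nat \<Rightarrow> real) \<Rightarrow> real mat" where
  "bmat p m y = Matrix.mat p p (\<lambda>(i,j). y (m, min i j, max i j))"

definition bvec :: "nat \<Rightarrow> nat \<Rightarrow> real mat \<Rightarrow> (nat \<times> nat \<times> nat \<Rightarrow> real)" where
  "bvec p m X = (\<lambda>(m',i,j)\<in>blk p m. X $$ (i,j))"

abbreviation leb_blk :: "nat \<Rightarrow> nat \<Rightarrow> (nat \<times> nat \<times> nat \<Rightarrow> real) measure" where
  "leb_blk p m \<equiv> PiM (blk p m) (\<lambda>_. lborel)"

lemma blk_Suc: "blk (Suc p) m = blk p m \<union> (\<lambda>i. (m,i,p)) ` {..p}"
  by (auto simp: blk_def less_Suc_eq)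

lemma blk_0: "blk 0 m = {}"
  by (auto simp: blk_def)

lemma finite_blk [simp]: "finite (blk p m)"
  by (induction p) (auto simp: blk_Suc blk_0)

lemma blk_memI: "k < p \<Longrightarrow> l < p \<Longrightarrow> (m, min k l, max k l) \<in> blk p m"
  by (auto simp: blk_def)

lemma bmat_sym: "sym_mat p (bmat p m y)"
  by (auto simp: sym_mat_def bmat_def min.commute max.commute intro!: eq_matI)

lemma bmat_bvec:
  assumes "sym_mat p X" shows "bmat p m (bvec p m X) = X"
  using sym_matD[OF assms] by (intro eq_matI) (auto simp: bmat_def bvec_def blk_def min_def max_def)

text \<open>Among the pairs \<open>i \<le> j\<close> each index occurs \<open>p + 1\<close> times,
  the diagonal pair counting twice. This is the origin of the exponent \<open>p + 1\<close> in the
  Jacobian.\<close>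

lemma prod_blk: "(\<Prod>(m',i,j)\<in>blk p m. t i * t j) = (\<Prod>i<p. t i) ^ (p + 1)" for t :: "nat \<Rightarrow> 'a::comm_semiring_1"
proof (induction p)
  case 0
  then show ?case by (simp add: blk_0)
next
  case (Suc p)
  have "(\<Prod>(m',i,j)\<in>blk (Suc p) m. t i * t j) = (\<Prod>(m',i,j)\<in>blk p m. t i * t j) * (\<Prod>(m',i,j)\<in>(\<lambda>i. (m,i,p)) ` {..p}. t i * t j)"
    unfolding blk_Suc by (rule prod.union_disjoint) (simp, simp, auto simp: blk_def)
  also have "(\<Prod>(m',i,j)\<in>(\<lambda>i. (m,i,p)) ` {..p}. t i * t j) = (\<Prod>i\<le>p. t i * t p)"
    by (subst prod.reindex) (auto simp: inj_on_def)
  also have "\<dots> = (\<Prod>i<p. t i) * t p * t p ^ (p + 1)"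
    by (simp add: prod.distrib lessThan_Suc_atMost[symmetric])
  finally show ?case by (simp add: Suc.IH power_mult_distrib algebra_simps)
qed

lemma congruence_entry:
  fixes T Y :: "real mat"
  assumes "T \<in> carrier_mat p p" "Y \<in> carrier_mat p p" "i < p" "j < p"
  shows "(T * Y * transpose_mat T) $$ (i,j) = (\<Sum>(k,l)\<in>{..<p}\<times>{..<p}. T $$ (i,k) * T $$ (j,l) * Y $$ (k,l))"
proof -
  have "(T * Y * transpose_mat T) $$ (i,j) = (\<Sum>l<p. (\<Sum>k<p. T $$ (i,k) * Y $$ (k,l)) * T $$ (j,l))"
    using assms by (simp add: scalar_prod_def lessThan_atLeast0 del: assoc_mult_mat)
  also have "\<dots> = (\<Sum>l<p. \<Sum>k<p. T $$ (i,k) * T $$ (j,l) * Y $$ (k,l))"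
    by (simp add: sum_distrib_left sum_distrib_right ac_simps)
  also have "\<dots> = (\<Sum>k<p. \<Sum>l<p. T $$ (i,k) * T $$ (j,l) * Y $$ (k,l))" by (rule sum.swap)
  finally show ?thesis by (simp add: sum.cartesian_product)
qed

text \<open>If \<open>T\<close> is triangular for the ranking \<open>\<rho>\<close>, the congruence
  is triangular for the rank \<open>\<rho> i + \<rho> j\<close> of an entry, with diagonal
  coefficient \<open>T_ii T_jj\<close>. The swapped pair \<open>(j,i)\<close> does not interfere,
  since \<open>T_ij\<close> and \<open>T_ji\<close> cannot both be nonzero. A general ranking covers
  lower and upper triangular matrices at once.\<close>

lemma triangular_congruence:
  fixes \<rho> :: "nat \<Rightarrow> nat" and f :: "(nat \<times> nat \<times> nat \<Rightarrow> real) \<Rightarrow> ennreal"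
  assumes T: "T \<in> carrier_mat p p" and nz: "\<And>i. i < p \<Longrightarrow> T $$ (i,i) \<noteq> 0"
    and tri: "\<And>i k. i < p \<Longrightarrow> k < p \<Longrightarrow> k \<noteq> i \<Longrightarrow> T $$ (i,k) \<noteq> 0 \<Longrightarrow> \<rho> k < \<rho> i"
    and C: "C \<in> carrier_mat p p" and f: "f \<in> borel_measurable (leb_blk p m)"
  shows "ennreal ((\<Prod>i<p. \<bar>T $$ (i,i)\<bar>) ^ (p + 1)) * (\<integral>\<^sup>+y. f (bvec p m (C + T * bmat p m y * transpose_mat T)) \<partial>leb_blk p m) = (\<integral>\<^sup>+y. f y \<partial>leb_blk p m)"
proof -
  define a where "a = (\<lambda>(m'::nat,i,j). T $$ (i,i) * T $$ (j,j))"
  define h where "h = (\<lambda>(m'::nat,i,j) x. C $$ (i,j) + (\<Sum>(k,l)\<in>{..<p}\<times>{..<p}-{(i,j)}. T $$ (i,k) * T $$ (j,l) * x (m, min k l, max k l)))"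
  define r where "r = (\<lambda>(m'::nat,i,j). \<rho> i + \<rho> j)"
  have e: "bvec p m (C + T * bmat p m x * transpose_mat T) = (\<lambda>i\<in>blk p m. a i * x i + h i x)" for x
  proof (rule ext)
    fix b show "bvec p m (C + T * bmat p m x * transpose_mat T) b = (\<lambda>i\<in>blk p m. a i * x i + h i x) b"
    proof (cases "b \<in> blk p m")
      case True
      then obtain i j where b: "b = (m,i,j)" "i \<le> j" "j < p" by (auto simp: blk_def)
      then have ij: "i < p" "j < p" by auto
      have Yc: "bmat p m x \<in> carrier_mat p p" by (simp add: bmat_def)
      have "(C + T * bmat p m x * transpose_mat T) $$ (i,j) = C $$ (i,j) + (T * bmat p m x * transpose_mat T) $$ (i,j)"
        using ij C T by (simp del: assoc_mult_mat)
      also have "(T * bmat p m x * transpose_mat T) $$ (i,j) = (\<Sum>(k,l)\<in>{..<p}\<times>{..<p}. T $$ (i,k) * T $$ (j,l) * x (m, min k l, max k l))"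
        unfolding congruence_entry[OF T Yc ij] by (intro sum.cong) (auto simp: bmat_def)
      also have "\<dots> = T $$ (i,i) * T $$ (j,j) * x (m,i,j) + (\<Sum>(k,l)\<in>{..<p}\<times>{..<p}-{(i,j)}. T $$ (i,k) * T $$ (j,l) * x (m, min k l, max k l))"
        using ij b(2) by (subst sum.remove[of _ "(i,j)"]) auto
      finally show ?thesis using True b by (simp add: bvec_def a_def h_def)
    qed (simp add: bvec_def)
  qed
  have "(\<Prod>i\<in>blk p m. ennreal \<bar>a i\<bar>) = ennreal (\<Prod>i\<in>blk p m. \<bar>a i\<bar>)"
    by (rule prod_ennreal) simp
  also have "(\<Prod>i\<in>blk p m. \<bar>a i\<bar>) = (\<Prod>i<p. \<bar>T $$ (i,i)\<bar>) ^ (p + 1)"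
    unfolding prod_blk[symmetric, of _ _ m] by (intro prod.cong) (auto simp: a_def abs_mult)
  finally have pr: "(\<Prod>i\<in>blk p m. ennreal \<bar>a i\<bar>) = ennreal ((\<Prod>i<p. \<bar>T $$ (i,i)\<bar>) ^ (p + 1))" .
  have "(\<Prod>i\<in>blk p m. ennreal \<bar>a i\<bar>) * (\<integral>\<^sup>+x. f (\<lambda>i\<in>blk p m. a i * x i + h i x) \<partial>leb_blk p m) = (\<integral>\<^sup>+x. f x \<partial>leb_blk p m)"
  proof (rule triangular_change_of_variables[where r = r, OF finite_blk _ _ _ f])
    show "a i \<noteq> 0" if "i \<in> blk p m" for i using that nz by (auto simp: blk_def a_def)
    show "h b \<in> borel_measurable (leb_blk p m)" if "b \<in> blk p m" for b
    proof -
      have "(\<lambda>x. \<Sum>z\<in>{..<p}\<times>{..<p}-{(i,j)}. T $$ (i, fst z) * T $$ (j, snd z) * x (m, min (fst z) (snd z), max (fst z) (snd z)))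
        \<in> borel_measurable (leb_blk p m)" for i j
      proof (rule borel_measurable_sum)
        fix z assume "z \<in> {..<p}\<times>{..<p}-{(i,j)}"
        then have "(m, min (fst z) (snd z), max (fst z) (snd z)) \<in> blk p m" by (intro blk_memI) auto
        then have "(\<lambda>x. x (m, min (fst z) (snd z), max (fst z) (snd z))) \<in> borel_measurable (leb_blk p m)" by measurable
        then show "(\<lambda>x. T $$ (i, fst z) * T $$ (j, snd z) * x (m, min (fst z) (snd z), max (fst z) (snd z))) \<in> borel_measurable (leb_blk p m)"
          by (intro borel_measurable_times) simp_all
      qed
      then show ?thesis by (cases b) (simp add: h_def case_prod_beta')
    qed
    show "h b x = h b y" if b: "b \<in> blk p m" and xy: "\<And>c. c \<in> blk p m \<Longrightarrow> r c < r b \<Longrightarrow> x c = y c" for b x y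
    proof -
      obtain i j where b': "b = (m,i,j)" "i \<le> j" "j < p" using b by (auto simp: blk_def)
      have E: "T $$ (i,k) * T $$ (j,l) * x (m, min k l, max k l) = T $$ (i,k) * T $$ (j,l) * y (m, min k l, max k l)"
        if kl: "k < p" "l < p" "(k,l) \<noteq> (i,j)" for k l
      proof (cases "T $$ (i,k) * T $$ (j,l) = 0")
        case False
        then have "T $$ (i,k) \<noteq> 0" "T $$ (j,l) \<noteq> 0" by auto
        then have "k = i \<or> \<rho> k < \<rho> i" "l = j \<or> \<rho> l < \<rho> j" using tri[of i k] tri[of j l] kl(1,2) b'(2,3) by linarith+
        then have "\<rho> k + \<rho> l < \<rho> i + \<rho> j" using kl(3) by auto
        then have "r (m, min k l, max k l) < r b" by (auto simp: r_def b' min_def max_def)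
        then show ?thesis using xy[OF blk_memI[OF kl(1,2)]] by simp
      qed simp
      then have "(\<Sum>(k,l)\<in>{..<p}\<times>{..<p}-{(i,j)}. T $$ (i,k) * T $$ (j,l) * x (m, min k l, max k l))
        = (\<Sum>(k,l)\<in>{..<p}\<times>{..<p}-{(i,j)}. T $$ (i,k) * T $$ (j,l) * y (m, min k l, max k l))"
        by (intro sum.cong refl) (use E in force)
      then show ?thesis by (simp add: h_def b')
    qed
  qed
  then show ?thesis unfolding pr e .
qed

lemma mat_measurable_plus:
  assumes f: "mat_measurable M f" and g: "mat_measurable M g"
  shows "mat_measurable M (\<lambda>x. f x + g x)"
  unfolding plus_mat_def
  by (intro mat_measurable_mat mat_measurableD[OF g] borel_measurable_add mat_measurableD[OF f])

lemma bmat_measurable: "entries_measurable (leb_blk p m) p p (bmat p m)"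
  unfolding entries_measurable_def
proof (intro conjI ballI allI impI)
  fix i j assume ij: "i < p" "j < p"
  have "(m, min i j, max i j) \<in> blk p m" using ij by (rule blk_memI)
  then have "(\<lambda>x. x (m, min i j, max i j)) \<in> borel_measurable (leb_blk p m)" by measurable
  then show "(\<lambda>x. bmat p m x $$ (i,j)) \<in> borel_measurable (leb_blk p m)" using ij by (simp add: bmat_def)
qed (simp add: bmat_def)

lemma bvec_measurable:
  assumes "mat_measurable M F" shows "(\<lambda>x. bvec p m (F x)) \<in> measurable M (leb_blk p m)"
  unfolding bvec_def
proof (rule measurable_restrict)
  fix b show "(\<lambda>x. case b of (m', i, j) \<Rightarrow> F x $$ (i, j)) \<in> measurable M lborel"
    using mat_measurableD(3)[OF assms] by (cases b) simp
qed

text \<open>With \<open>A = L L^T\<close> the map is a congruence by \<open>L^T\<close> followed by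
  one by \<open>L\<close>. Each contributes the product of the diagonal of \<open>L\<close> to the
  power \<open>p + 1\<close>, which together give \<open>det A ^ (p + 1)\<close>.\<close>

lemma congruence_change_of_variables:
  fixes f :: "(nat \<times> nat \<times> nat \<Rightarrow> real) \<Rightarrow> ennreal"
  assumes A: "pd_mat p A" and C: "C \<in> carrier_mat p p" and f: "f \<in> borel_measurable (leb_blk p m)"
  shows "ennreal (det A ^ (p + 1)) * (\<integral>\<^sup>+y. f (bvec p m (C + A * bmat p m y * A)) \<partial>leb_blk p m) = (\<integral>\<^sup>+y. f y \<partial>leb_blk p m)"
proof -
  obtain L where L: "L \<in> carrier_mat p p" "A = L * transpose_mat L" "\<forall>i<p. 0 < L $$ (i,i)" "\<forall>i<p. \<forall>j<p. i < j \<longrightarrow> L $$ (i,j) = 0"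
    using cholesky[OF A] by blast
  define P where "P = (\<Prod>i<p. \<bar>L $$ (i,i)\<bar>) ^ (p + 1)"
  have dL: "det L = (\<Prod>i<p. L $$ (i,i))"
    using L by (subst det_lower_triangular[of p]) (auto simp: prod_list_diag_prod lessThan_atLeast0)
  have "det A = det L * det L" unfolding L(2) using L(1) by (simp add: det_mult[of _ p] det_transpose)
  moreover have "P = det L ^ (p + 1)" unfolding P_def dL using L(3) by (intro arg_cong[of _ _ "\<lambda>x. x ^ (p+1)"] prod.cong) auto
  ultimately have dA: "det A ^ (p + 1) = P * P" by (simp add: power_mult_distrib)
  have P0: "0 \<le> P" unfolding P_def by (intro zero_le_power prod_nonneg) auto
  define f1 where "f1 = (\<lambda>y. f (bvec p m (C + L * bmat p m y * transpose_mat L)))"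
  have f1: "f1 \<in> borel_measurable (leb_blk p m)"
    unfolding f1_def
    by (intro measurable_compose[OF bvec_measurable f] mat_measurable_plus mat_measurable_mult mat_measurable_const entries_measurable_imp[OF bmat_measurable])
  have 1: "ennreal P * (\<integral>\<^sup>+y. f1 y \<partial>leb_blk p m) = (\<integral>\<^sup>+y. f y \<partial>leb_blk p m)"
    unfolding P_def f1_def
    by (rule triangular_congruence[where \<rho> = "\<lambda>i. i", OF L(1) _ _ C f]) (use L in \<open>force+\<close>)
  \<comment> \<open>For the upper triangular factor the ranking is reversed to \<open>p - i\<close>.
    The translation by \<open>C\<close> has already been absorbed into \<open>f1\<close>.\<close>
  have LT: "transpose_mat L \<in> carrier_mat p p" using L(1) by simp
  have "ennreal ((\<Prod>i<p. \<bar>transpose_mat L $$ (i,i)\<bar>) ^ (p + 1)) * (\<integral>\<^sup>+y. f1 (bvec p m (0\<^sub>m p p + transpose_mat L * bmat p m y * transpose_mat (transpose_mat L))) \<partial>leb_blk p m) = (\<integral>\<^sup>+y. f1 y \<partial>leb_blk p m)"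
  proof (rule triangular_congruence[where \<rho> = "\<lambda>i. p - i", OF LT _ _ zero_carrier_mat f1])
    show "transpose_mat L $$ (i,i) \<noteq> 0" if "i < p" for i using that L(1,3) by force
    show "p - k < p - i" if "i < p" "k < p" "k \<noteq> i" "transpose_mat L $$ (i,k) \<noteq> 0" for i k
    proof -
      have "\<not> k < i" using that L(1,4) by auto
      then show ?thesis using that by auto
    qed
  qed
  moreover have "(\<Prod>i<p. \<bar>transpose_mat L $$ (i,i)\<bar>) ^ (p + 1) = P" unfolding P_def using L(1) by simp
  moreover have "f1 (bvec p m (0\<^sub>m p p + transpose_mat L * bmat p m y * transpose_mat (transpose_mat L))) = f (bvec p m (C + A * bmat p m y * A))" for y
  proof -
    note Y = sym_matD(1)[OF bmat_sym[of p m y]]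
    define X where "X = transpose_mat L * bmat p m y * L"
    have X: "sym_mat p X" unfolding X_def by (rule sym_congruence[OF bmat_sym L(1)])
    have TT: "transpose_mat (transpose_mat L) = L" by simp
    have "0\<^sub>m p p + transpose_mat L * bmat p m y * transpose_mat (transpose_mat L) = X"
      unfolding TT X_def[symmetric] by (rule left_add_zero_mat[OF sym_matD(1)[OF X]])
    moreover have "L * X * transpose_mat L = A * bmat p m y * A"
      unfolding X_def L(2) using L(1) LT Y by (simp add: square_assoc[of _ p])
    ultimately show ?thesis by (simp only: f1_def bmat_bvec[OF X])
  qed
  ultimately have 2: "ennreal P * (\<integral>\<^sup>+y. f (bvec p m (C + A * bmat p m y * A)) \<partial>leb_blk p m) = (\<integral>\<^sup>+y. f1 y \<partial>leb_blk p m)"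
    by simp
  show ?thesis unfolding 1[symmetric] 2[symmetric] dA using P0 by (simp add: ennreal_mult mult.assoc)
qed

section \<open>The boundary has no volume\<close>

lemma finite_sym_idx [simp]: "finite (sym_idx p n)"
  by (rule finite_subset[of _ "{..n} \<times> {..p} \<times> {..p}"]) (auto simp: sym_idx_def)

text \<open>The contraction towards the interior point \<open>c\<close> with factor
  \<open>1 - e\<close> maps the moment space into \<open>Dset\<close>, so the volume of
  \<open>Dset\<close> is at least \<open>(1 - e)^d\<close> times that of the moment space, where
  \<open>d\<close> is the number of coordinates. Then \<open>e\<close> tends to 0.\<close>

lemma emeasure_moment_space:
  assumes p: "0 < p"
  shows "emeasure (leb_sym p n) (moment_space p n) = emeasure (leb_sym p n) (Dset p n)"
proof (rule antisym)
  note [measurable] = sets_moment_space[OF p, of n]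
  let ?I = "sym_idx p n" and ?M = "leb_sym p n"
  obtain S where S: "\<And>i. sym_mat p (S i)" "S 0 = 1\<^sub>m p" "Hpos p S n" using Hpos_exists[OF p] by blast
  define c where "c = (\<lambda>(m,i,j). S m $$ (i,j))"
  have cS: "S k = Smat p c k" for k
  proof (rule eq_matI)
    fix i j assume "i < dim_row (Smat p c k)" "j < dim_col (Smat p c k)"
    then have "i < p" "j < p" by auto
    then show "S k $$ (i,j) = Smat p c k $$ (i,j)"
      using S(2) sym_matD(3)[OF S(1), of i j k] by (cases "k = 0") (auto simp: Smat_def c_def min_def max_def)
  qed (use sym_matD(1)[OF S(1), of k] in auto)
  have step: "ennreal ((1 - e) ^ card ?I) * emeasure ?M (moment_space p n) \<le> emeasure ?M (Dset p n)" if e: "0 < e" "e < 1" for e :: real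
  proof -
    define g where "g = (\<lambda>x. \<lambda>i\<in>?I. (1 - e) * x i + e * c i)"
    have g: "g x \<in> Dset p n" if x: "x \<in> moment_space p n" for x
    proof -
      have H: "Hpsd p (Smat p x) n" using x by (simp add: moment_space_eq[OF p])
      have E: "Smat p (g x) k = (1 - e) \<cdot>\<^sub>m Smat p x k + e \<cdot>\<^sub>m S k" if "k \<le> n" for k
      proof (rule eq_matI)
        fix i j assume "i < dim_row ((1 - e) \<cdot>\<^sub>m Smat p x k + e \<cdot>\<^sub>m S k)" "j < dim_col ((1 - e) \<cdot>\<^sub>m Smat p x k + e \<cdot>\<^sub>m S k)"
        then have ij: "i < p" "j < p" using cS[of k] by auto
        show "Smat p (g x) k $$ (i,j) = ((1 - e) \<cdot>\<^sub>m Smat p x k + e \<cdot>\<^sub>m S k) $$ (i,j)"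
        proof (cases "k = 0")
          case True
          then show ?thesis using ij by (simp add: Smat_0 S(2))
        next
          case False
          then have "(k, min i j, max i j) \<in> ?I" using ij that by (auto simp: sym_idx_def)
          then show ?thesis using ij False unfolding cS by (simp add: Smat_def g_def)
        qed
      qed (use cS[of k] in auto)
      have HP: "Hpos p (\<lambda>k. (1 - e) \<cdot>\<^sub>m Smat p x k + e \<cdot>\<^sub>m S k) n"
        by (rule Hpos_lincomb[OF p _ _ H S(3)]) (use sym_matD(1)[OF S(1)] e in auto)
      have "Hpos p (Smat p (g x)) n \<longleftrightarrow> Hpos p (\<lambda>k. (1 - e) \<cdot>\<^sub>m Smat p x k + e \<cdot>\<^sub>m S k) n"
        by (rule Hpos_cong[OF E])
      then have "Hpos p (Smat p (g x)) n" using HP by (rule iffD2)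
      then show ?thesis by (simp add: Dset_def g_def)
    qed
    have pe: "(\<Prod>i\<in>?I. ennreal \<bar>1 - e\<bar>) = ennreal ((1 - e) ^ card ?I)" using e by (simp add: ennreal_power)
    have "ennreal ((1 - e) ^ card ?I) * (\<integral>\<^sup>+x. indicator (Dset p n) (g x) \<partial>?M) = (\<integral>\<^sup>+x. indicator (Dset p n) x \<partial>?M)"
      unfolding pe[symmetric] g_def leb_sym_def
      by (rule triangular_change_of_variables[where r = "\<lambda>_. 0"]) (use e sets_moment_space(1)[OF p, of n] in \<open>auto simp: leb_sym_def\<close>)
    also have "\<dots> = emeasure ?M (Dset p n)" by simp
    finally have 1: "ennreal ((1 - e) ^ card ?I) * (\<integral>\<^sup>+x. indicator (Dset p n) (g x) \<partial>?M) = emeasure ?M (Dset p n)" .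
    have "emeasure ?M (moment_space p n) = (\<integral>\<^sup>+x. indicator (moment_space p n) x \<partial>?M)" by simp
    also have "\<dots> \<le> (\<integral>\<^sup>+x. indicator (Dset p n) (g x) \<partial>?M)"
      using g by (intro nn_integral_mono) (auto simp: indicator_def)
    finally show ?thesis unfolding 1[symmetric] by (rule mult_left_mono) simp
  qed
  have "(\<lambda>j. (1 - 1 / real (j + 2)) ^ card ?I) \<longlonglongrightarrow> (1 - 0) ^ card ?I"
    by (intro tendsto_power tendsto_diff tendsto_const LIMSEQ_ignore_initial_segment[OF lim_1_over_n])
  then have "(\<lambda>j. ennreal ((1 - 1 / real (j + 2)) ^ card ?I)) \<longlonglongrightarrow> ennreal ((1 - 0) ^ card ?I)" by (rule tendsto_ennrealI)
  then have l1: "(\<lambda>j. ennreal ((1 - 1 / real (j + 2)) ^ card ?I)) \<longlonglongrightarrow> 1" by (simp only: diff_zero power_one ennreal_1)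
  have le: "ennreal ((1 - 1 / real (j + 2)) ^ card ?I) * emeasure ?M (moment_space p n) \<le> emeasure ?M (Dset p n)" for j
    by (rule step) (simp_all add: field_simps)
  show "emeasure ?M (moment_space p n) \<le> emeasure ?M (Dset p n)"
  \<comment> \<open>The limit is taken for finite volume; for infinite volume a single contraction
    with a positive factor already makes the other side infinite.\<close>
  proof (cases "emeasure ?M (moment_space p n) = \<infinity>")
    case False
    then have fin: "emeasure ?M (moment_space p n) < \<infinity>" by (simp add: less_top)
    have L: "(\<lambda>j. emeasure ?M (moment_space p n) * ennreal ((1 - 1 / real (j + 2)) ^ card ?I)) \<longlonglongrightarrow> emeasure ?M (moment_space p n) * 1"
      by (rule ennreal_tendsto_cmult[OF fin[unfolded infinity_ennreal_def] l1])
    then have "emeasure ?M (moment_space p n) * 1 \<le> emeasure ?M (Dset p n)"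
      by (rule LIMSEQ_le_const2) (use le in \<open>auto simp only: mult.commute\<close>)
    then show ?thesis by (simp only: mult_1_right)
  next
    case True
    then show ?thesis using le[of 0] by (simp add: ennreal_mult_top)
  qed
  have "Hpsd p T n" if "Hpos p T n" for T using that pd_imp_psd by (auto simp: Hpos_def Hpsd_def)
  then show "emeasure ?M (Dset p n) \<le> emeasure ?M (moment_space p n)"
    by (intro emeasure_mono) (auto simp: Dset_def moment_space_eq[OF p] sets_moment_space(2)[OF p, unfolded moment_space_eq[OF p]])
qed

subsection \<open>The law of the canonical moments\<close>

definition canon :: "nat \<Rightarrow> (nat \<Rightarrow> real mat) \<Rightarrow> nat \<Rightarrow> real mat" where
  "canon p S m = minv p (msqrt p (Sup_mat p S m - Slow p S m)) * (S m - Slow p S m) * minv p (msqrt p (Sup_mat p S m - Slow p S m))"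

lemma Ucan_eq: "0 < p \<Longrightarrow> Ucan p x m = canon p (Smat p x) m"
  by (simp only: Ucan_def canon_def Let_def Sminus_eq Splus_eq)

lemma canon_cong: "(\<And>i. i \<le> m \<Longrightarrow> S i = T i) \<Longrightarrow> canon p S m = canon p T m"
  unfolding canon_def using Slow_cong[of m S T p] Sup_cong[of m S T p] by simp

context
  fixes p :: nat and L R A :: "real mat"
  assumes L: "L \<in> carrier_mat p p" and R: "R \<in> carrier_mat p p" and RL: "pd_mat p (R - L)" and A: "A = msqrt p (R - L)"
begin

lemma interval_sqrt:
  shows "pd_mat p A" "A \<in> carrier_mat p p" "transpose_mat A = A" "A * A = R - L" "minv p A \<in> carrier_mat p p"
    "A * minv p A = 1\<^sub>m p" "minv p A * A = 1\<^sub>m p" "det A = sqrt (det (R - L))"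
proof -
  show P: "pd_mat p A" unfolding A by (rule msqrt_pd[OF RL])
  show c: "A \<in> carrier_mat p p" "transpose_mat A = A" using pd_matD[OF P] by auto
  show AA: "A * A = R - L" unfolding A by (rule msqrt_psd(2)[OF pd_imp_psd[OF RL]])
  show "minv p A \<in> carrier_mat p p" "A * minv p A = 1\<^sub>m p" "minv p A * A = 1\<^sub>m p" using minv_pd[OF P] by auto
  have "det (R - L) = det A * det A" unfolding AA[symmetric] using c by (simp add: det_mult)
  then show "det A = sqrt (det (R - L))" using pd_det_pos[OF P] by simp
qed

text \<open>\<open>X -> L + A X A\<close> parametrizes the matrix interval from \<open>L\<close> to
  \<open>R\<close> by the interval from 0 to 1. Its distances to both ends are congruences by
  \<open>A\<close> of \<open>X\<close> and \<open>1 - X\<close>.\<close>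

lemma interval_point:
  assumes X: "X \<in> carrier_mat p p"
  shows "(L + A * X * A) - L = A * X * A" "R - (L + A * X * A) = A * (1\<^sub>m p - X) * A"
    "minv p A * (A * X * A) * minv p A = X" "pd_mat p (A * X * A) \<longleftrightarrow> pd_mat p X"
    "det (A * X * A) = det (R - L) * det X"
proof -
  note I = interval_sqrt
  have AXA: "A * X * A \<in> carrier_mat p p" using I X by simp
  have g: "(L + Z) - L = Z" "R - (L + Z) = (R - L) - Z" if "Z \<in> carrier_mat p p" for Z
    using that L R by (auto intro!: eq_matI)
  show "(L + A * X * A) - L = A * X * A" by (rule g(1)[OF AXA])
  have "A * (1\<^sub>m p - X) * A = (A - A * X) * A"
    using I(2) X by (simp add: mult_minus_distrib_mat[of _ p p _ p])
  also have "\<dots> = A * A - A * X * A" using I(2) X by (intro minus_mult_distrib_mat) auto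
  finally show "R - (L + A * X * A) = A * (1\<^sub>m p - X) * A"
    unfolding I(4) g(2)[OF AXA] by (rule sym)
  have "minv p A * (A * X * A) * minv p A = (minv p A * A) * X * (A * minv p A)"
    using I(2,5) X by (simp add: square_assoc[of _ p])
  then show "minv p A * (A * X * A) * minv p A = X" unfolding I(6,7) using X by simp
  show "pd_mat p (A * X * A) \<longleftrightarrow> pd_mat p X"
    using pd_congruence_iff[OF X I(2) I(5,6)] unfolding I(3) .
  show "det (A * X * A) = det (R - L) * det X" unfolding I(4)[symmetric] using I(2) X by (simp add: det_mult[of _ p])
qed

lemma interval_point_ex:
  assumes S: "S \<in> carrier_mat p p" shows "S = L + A * (minv p A * (S - L) * minv p A) * A"
proof -
  note I = interval_sqrt
  have SL: "S - L \<in> carrier_mat p p" using L by (rule minus_carrier_mat)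
  have "A * (minv p A * (S - L) * minv p A) * A = (A * minv p A) * (S - L) * (minv p A * A)"
    using I(2,5) SL by (simp add: square_assoc[of _ p])
  then have "A * (minv p A * (S - L) * minv p A) * A = S - L" unfolding I(6,7) left_mult_one_mat[OF SL] right_mult_one_mat[OF SL] .
  moreover have "S = L + (S - L)" using S L by (intro eq_matI) auto
  ultimately show ?thesis by (simp only:)
qed

end

definition cube :: "nat \<Rightarrow> real mat \<Rightarrow> bool" where
  "cube p X \<longleftrightarrow> pd_mat p X \<and> pd_mat p (1\<^sub>m p - X)"

text \<open>The density \<open>det (X (1 - X))\<close> to the power \<open>e (p + 1) / 2\<close> on
  the cube; the square root keeps the exponent a natural number. For \<open>e = 0\<close> it is the
  indicator of the cube.\<close>

definition cw :: "nat \<Rightarrow> nat \<Rightarrow> real mat \<Rightarrow> real" where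
  "cw p e X = (if cube p X then sqrt (det X * det (1\<^sub>m p - X)) ^ (e * (p + 1)) else 0)"

lemma cube_det_pos: "cube p X \<Longrightarrow> 0 < det X * det (1\<^sub>m p - X)"
  by (auto simp: cube_def intro!: mult_pos_pos pd_det_pos)

lemma cw_nonneg: "0 \<le> cw p e X"
proof (cases "cube p X")
  case True
  show ?thesis unfolding cw_def using real_sqrt_ge_zero[OF less_imp_le[OF cube_det_pos[OF True]]] True
    by (simp only: if_True zero_le_power)
qed (simp add: cw_def)

lemma cw_add: "cw p (a + b) X = cw p a X * cw p b X"
  by (simp add: cw_def power_add add_mult_distrib)

lemma cw_measurable:
  assumes "entries_measurable M p p F" shows "(\<lambda>x. cw p e (F x)) \<in> borel_measurable M"
proof -
  have "entries_measurable M p p (\<lambda>x. 1\<^sub>m p)" by (simp add: entries_measurable_def)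
  then have 1: "entries_measurable M p p (\<lambda>x. 1\<^sub>m p - F x)" by (rule entries_measurable_minus[OF _ assms])
  have [measurable]: "Measurable.pred M (\<lambda>x. pd_mat p (F x))" "Measurable.pred M (\<lambda>x. pd_mat p (1\<^sub>m p - F x))"
    using pd_measurable[OF assms] pd_measurable[OF 1] by (simp_all add: pred_def)
  have [measurable]: "(\<lambda>x. det (F x)) \<in> borel_measurable M" "(\<lambda>x. det (1\<^sub>m p - F x)) \<in> borel_measurable M"
    by (rule det_measurable[OF assms], rule det_measurable[OF 1])
  show ?thesis unfolding cw_def cube_def by measurable
qed

text \<open>Inserting \<open>S - S^- = A X A\<close> and \<open>S^+ - S = A (1 - X) A\<close> into
  \<open>range_width_det\<close> cancels one factor of the width and leaves a recursion that
  telescopes from the initial width 1.\<close>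

lemma canon_Hpos:
  assumes p: "0 < p" and S: "\<And>i. sym_mat p (S i)" "S 0 = 1\<^sub>m p" and H: "Hpos p S n"
  shows "det (Sup_mat p S (Suc n) - Slow p S (Suc n)) = (\<Prod>m\<in>{1..n}. det (canon p S m) * det (1\<^sub>m p - canon p S m))"
    "\<And>m. m \<in> {1..n} \<Longrightarrow> cube p (canon p S m)"
proof -
  have "det (Sup_mat p S (Suc n) - Slow p S (Suc n)) = (\<Prod>m\<in>{1..n}. det (canon p S m) * det (1\<^sub>m p - canon p S m))
    \<and> (\<forall>m\<in>{1..n}. cube p (canon p S m))" using H
  proof (induction n)
    case 0
    have "1\<^sub>m p - 0\<^sub>m p p = (1\<^sub>m p :: real mat)" by (intro eq_matI) auto
    then show ?case by (simp add: Sup_mat_def Slow_def)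
  next
    case (Suc n)
    have H: "Hpos p S n" using Hpos_mono[of p S "Suc n" n, OF p S Suc.prems] by simp
    let ?L = "Slow p S (Suc n)" and ?R = "Sup_mat p S (Suc n)"
    have LR: "?L \<in> carrier_mat p p" "?R \<in> carrier_mat p p" using Slow_Sup_carrier[of p S, OF p S H] by auto
    have pd: "pd_mat p (?R - ?L)" by (rule range_width_pd[of p S, OF p S H])
    define A where "A = msqrt p (?R - ?L)"
    define X where "X = canon p S (Suc n)"
    have Sc: "S (Suc n) \<in> carrier_mat p p" using sym_matD(1)[OF S(1)] .
    note I = interval_sqrt[OF LR pd A_def]
    have X: "X = minv p A * (S (Suc n) - ?L) * minv p A" by (simp only: X_def canon_def A_def)
    have Xc: "X \<in> carrier_mat p p" unfolding X using I(5) LR by (intro square_carrier minus_carrier_mat) auto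
    have X1: "1\<^sub>m p - X \<in> carrier_mat p p" by (rule minus_carrier_mat[OF Xc])
    have Se: "S (Suc n) = ?L + A * X * A" unfolding X by (rule interval_point_ex[OF LR pd A_def Sc])
    note J = interval_point[OF LR pd A_def Xc] and J1 = interval_point[OF LR pd A_def X1]
    have e: "S (Suc n) - ?L = A * X * A" "?R - S (Suc n) = A * (1\<^sub>m p - X) * A" using J(1,2) Se by simp_all
    have "pd_mat p (A * X * A) \<and> pd_mat p (A * (1\<^sub>m p - X) * A)"
      using Hpos_Suc[of p S n, OF p S] Suc.prems e by simp
    then have c: "cube p X" using J(4) J1(4) by (simp add: cube_def)
    have "det (Sup_mat p S (Suc (Suc n)) - Slow p S (Suc (Suc n))) * det (?R - ?L) = det (A * X * A) * det (A * (1\<^sub>m p - X) * A)"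
      unfolding e[symmetric] by (rule range_width_det[of p S, OF p S Suc.prems])
    also have "\<dots> = det (?R - ?L) * (det X * det (1\<^sub>m p - X)) * det (?R - ?L)"
      unfolding J(5) J1(5) by simp
    finally have "det (Sup_mat p S (Suc (Suc n)) - Slow p S (Suc (Suc n))) = det (?R - ?L) * (det X * det (1\<^sub>m p - X))"
      using pd_det_pos[OF pd] by simp
    then show ?case using Suc.IH[OF H] c by (auto simp: X_def atLeastAtMostSuc_conv)
  qed
  then show "det (Sup_mat p S (Suc n) - Slow p S (Suc n)) = (\<Prod>m\<in>{1..n}. det (canon p S m) * det (1\<^sub>m p - canon p S m))"
    "\<And>m. m \<in> {1..n} \<Longrightarrow> cube p (canon p S m)" by auto
qed

section \<open>The joint density of the canonical moments\<close>

definition Uvec :: "nat \<Rightarrow> nat \<Rightarrow> (nat \<times> nat \<times> nat \<Rightarrow> real) \<Rightarrow> (nat \<times> nat \<times> nat \<Rightarrow> real)" where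
  "Uvec p n x = (\<lambda>(m,i,j)\<in>sym_idx p n. Ucan p x m $$ (i,j))"

definition cweight :: "nat \<Rightarrow> (nat \<Rightarrow> nat) \<Rightarrow> nat \<Rightarrow> (nat \<times> nat \<times> nat \<Rightarrow> real) \<Rightarrow> real" where
  "cweight p e n u = (\<Prod>m\<in>{1..n}. cw p (e m) (Smat p u m))"

lemma Uvec_measurable:
  assumes "0 < p" shows "Uvec p n \<in> measurable (leb_sym p n) (leb_sym p n)"
proof -
  have "(\<lambda>x. \<lambda>b\<in>sym_idx p n. (case b of (m,i,j) \<Rightarrow> Ucan p x m $$ (i,j))) \<in> measurable (leb_sym p n) (PiM (sym_idx p n) (\<lambda>_. lborel))"
  proof (rule measurable_restrict)
    fix b assume b: "b \<in> sym_idx p n"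
    obtain m i j where e: "b = (m,i,j)" by (cases b)
    have "m \<le> n" using b e by (auto simp: sym_idx_def)
    then show "(\<lambda>x. case b of (m,i,j) \<Rightarrow> Ucan p x m $$ (i,j)) \<in> measurable (leb_sym p n) lborel"
      using mat_measurableD(3)[OF Ucan_measurable[OF assms, of m n]] by (simp add: e)
  qed
  then show ?thesis by (simp only: Uvec_def[abs_def] leb_sym_def)
qed

lemma cweight_measurable: "cweight p e n \<in> borel_measurable (leb_sym p n)"
  unfolding cweight_def[abs_def]
  by (intro borel_measurable_prod cw_measurable Smat_measurable) auto

lemma cweight_nonneg: "0 \<le> cweight p e n u"
  unfolding cweight_def by (intro prod_nonneg cw_nonneg ballI)

lemma sym_idx_Suc: "sym_idx p (Suc n) = sym_idx p n \<union> blk p (Suc n)" "sym_idx p n \<inter> blk p (Suc n) = {}"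
  by (auto simp: sym_idx_def blk_def le_Suc_eq)

lemma Smat_merge:
  shows "m \<le> n \<Longrightarrow> Smat p (merge (sym_idx p n) (blk p (Suc n)) (x,y)) m = Smat p x m"
    "Smat p (merge (sym_idx p n) (blk p (Suc n)) (x,y)) (Suc n) = bmat p (Suc n) y"
proof -
  show "Smat p (merge (sym_idx p n) (blk p (Suc n)) (x,y)) m = Smat p x m" if "m \<le> n"
  proof (cases "m = 0")
    case False
    then have "(m, min i j, max i j) \<in> sym_idx p n" if "i < p" "j < p" for i j
      using that \<open>m \<le> n\<close> by (auto simp: sym_idx_def)
    then show ?thesis using False unfolding Smat_def by (auto simp: merge_def intro!: cong_mat)
  qed (simp add: Smat_0)
  have "(Suc n, min i j, max i j) \<notin> sym_idx p n" "(Suc n, min i j, max i j) \<in> blk p (Suc n)" if "i < p" "j < p" for i j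
    using that by (auto simp: sym_idx_def blk_def)
  then show "Smat p (merge (sym_idx p n) (blk p (Suc n)) (x,y)) (Suc n) = bmat p (Suc n) y"
    unfolding Smat_def bmat_def by (auto simp: merge_def intro!: cong_mat)
qed

lemma nn_integral_sym_idx_Suc:
  assumes "f \<in> borel_measurable (leb_sym p (Suc n))"
  shows "(\<integral>\<^sup>+x. f x \<partial>leb_sym p (Suc n)) = (\<integral>\<^sup>+x. (\<integral>\<^sup>+y. f (merge (sym_idx p n) (blk p (Suc n)) (x,y)) \<partial>leb_blk p (Suc n)) \<partial>leb_sym p n)"
proof -
  interpret product_sigma_finite "\<lambda>_::nat\<times>nat\<times>nat. lborel :: real measure" by standard
  show ?thesis using assms unfolding leb_sym_def sym_idx_Suc(1)
    by (rule product_nn_integral_fold[OF sym_idx_Suc(2) finite_sym_idx finite_blk])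
qed

lemma merge_measurable_sym:
  "merge (sym_idx p n) (blk p (Suc n)) \<in> measurable (leb_sym p n \<Otimes>\<^sub>M leb_blk p (Suc n)) (leb_sym p (Suc n))"
  unfolding leb_sym_def sym_idx_Suc(1) by (rule measurable_merge)

lemma sigma_finite_leb_blk: "sigma_finite_measure (leb_blk p m)"
proof -
  interpret product_sigma_finite "\<lambda>_::nat\<times>nat\<times>nat. lborel :: real measure" by standard
  show ?thesis by (rule sigma_finite[OF finite_blk])
qed

text \<open>With the earlier moments fixed, the last one is substituted by \<open>L + A u A\<close>.
  The Jacobian does not depend on \<open>u\<close>, and by \<open>canon_Hpos\<close> it is a
  function of the earlier canonical moments alone, one factor \<open>cw p 1\<close> for
  each.\<close>

lemma inner_slice:
  fixes F :: "(nat \<times> nat \<times> nat \<Rightarrow> real) \<Rightarrow> ennreal"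
  assumes p: "0 < p" and F: "F \<in> borel_measurable (leb_sym p (Suc n))" and x: "x \<in> Dset p n"
  shows "(\<integral>\<^sup>+y. indicator (Dset p (Suc n)) (merge (sym_idx p n) (blk p (Suc n)) (x,y)) * F (Uvec p (Suc n) (merge (sym_idx p n) (blk p (Suc n)) (x,y))) \<partial>leb_blk p (Suc n))
    = ennreal (\<Prod>m\<in>{1..n}. cw p 1 (Smat p (Uvec p n x) m)) *
      (\<integral>\<^sup>+u. ennreal (cw p 0 (bmat p (Suc n) u)) * F (merge (sym_idx p n) (blk p (Suc n)) (Uvec p n x,u)) \<partial>leb_blk p (Suc n))"
proof -
  let ?m = "merge (sym_idx p n) (blk p (Suc n))"
  let ?S = "Smat p x"
  have H: "Hpos p ?S n" using x by (simp add: Dset_def)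
  have xs: "x \<in> space (leb_sym p n)" using x by (simp add: Dset_def space_leb_sym)
  define L where "L = Slow p ?S (Suc n)"
  define R where "R = Sup_mat p ?S (Suc n)"
  have LR: "L \<in> carrier_mat p p" "R \<in> carrier_mat p p" using Slow_Sup_carrier[of p ?S, OF p Smat_sym Smat_0 H] by (auto simp: L_def R_def)
  have pd: "pd_mat p (R - L)" unfolding L_def R_def by (rule range_width_pd[of p ?S, OF p Smat_sym Smat_0 H])
  have Ls: "sym_mat p L" unfolding L_def by (rule Slow_sym[of p ?S, OF p Smat_sym Smat_0 H])
  define A where "A = msqrt p (R - L)"
  note I = interval_sqrt[OF LR pd A_def]
  define g where "g = (\<lambda>y. indicator (Dset p (Suc n)) (?m (x,y)) * F (Uvec p (Suc n) (?m (x,y))))"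
  have [measurable]: "(\<lambda>z. F (Uvec p (Suc n) z)) \<in> borel_measurable (leb_sym p (Suc n))" "Dset p (Suc n) \<in> sets (leb_sym p (Suc n))"
    by (rule measurable_compose[OF Uvec_measurable[OF p] F], rule sets_moment_space(1)[OF p])
  have "(\<lambda>z. indicator (Dset p (Suc n)) z * F (Uvec p (Suc n) z)) \<in> borel_measurable (leb_sym p (Suc n))"
    by measurable
  then have gm: "g \<in> borel_measurable (leb_blk p (Suc n))" unfolding g_def
    by (rule measurable_compose[OF measurable_compose[OF measurable_Pair1'[OF xs] merge_measurable_sym]])
  have Un: "Smat p (Uvec p n x) m = canon p ?S m" if m: "m \<in> {1..n}" for m
  proof -
    have s: "sym_mat p (canon p ?S m)" using canon_Hpos(2)[of p ?S n, OF p Smat_sym Smat_0 H m] by (simp add: cube_def pd_matD(1))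
    have "(m, min i j, max i j) \<in> sym_idx p n" if "i < p" "j < p" for i j using that m by (auto simp: sym_idx_def)
    then show ?thesis using m sym_matD(1,3)[OF s]
      by (intro eq_matI) (auto simp: Smat_def Uvec_def Ucan_eq[OF p] min_def max_def)
  qed
  \<comment> \<open>In the parameter \<open>u\<close> the strict Hankel condition of order
    \<open>n + 1\<close> becomes membership in the cube, and \<open>u\<close> itself is the new
    canonical moment.\<close>
  have point: "g (bvec p (Suc n) (L + A * bmat p (Suc n) u * A)) = ennreal (cw p 0 (bmat p (Suc n) u)) * F (?m (Uvec p n x,u))"
    if u: "u \<in> space (leb_blk p (Suc n))" for u
  proof -
    define X where "X = bmat p (Suc n) u"
    have Xs: "sym_mat p X" unfolding X_def by (rule bmat_sym)
    note Xc = sym_matD(1)[OF Xs]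
    have X1: "1\<^sub>m p - X \<in> carrier_mat p p" by (rule minus_carrier_mat[OF Xc])
    note J = interval_point[OF LR pd A_def Xc] and J1 = interval_point[OF LR pd A_def X1]
    have "sym_mat p (A * X * A)" using sym_congruence[OF Xs I(2)] unfolding I(3) .
    then have "sym_mat p (L + A * X * A)" using Ls LR
      by (auto simp: sym_mat_def transpose_add[of _ p p] simp del: assoc_mult_mat)
    note bb = bmat_bvec[OF this, of "Suc n"]
    define z where "z = ?m (x, bvec p (Suc n) (L + A * X * A))"
    have zn: "Smat p z i = ?S i" if "i \<le> n" for i unfolding z_def by (rule Smat_merge(1)[OF that])
    have zS: "Smat p z (Suc n) = L + A * X * A" unfolding z_def Smat_merge(2) bb ..
    have zL: "Slow p (Smat p z) (Suc n) = L" "Sup_mat p (Smat p z) (Suc n) = R"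
      unfolding L_def R_def by (rule Slow_cong, simp add: zn, rule Sup_cong, simp add: zn)
    have "Hpos p (Smat p z) n" using H Hpos_cong[of n "Smat p z" ?S p] zn by blast
    then have "Hpos p (Smat p z) (Suc n) \<longleftrightarrow> cube p X"
      unfolding Hpos_Suc[of p "Smat p z", OF p Smat_sym Smat_0] zL unfolding zS J(1,2) J(4) J1(4) cube_def by blast
    moreover have "z \<in> PiE (sym_idx p (Suc n)) (\<lambda>_. UNIV)"
      by (auto simp: z_def sym_idx_Suc(1) merge_def PiE_def extensional_def)
    ultimately have D: "z \<in> Dset p (Suc n) \<longleftrightarrow> cube p X" by (simp add: Dset_def)
    have "canon p (Smat p z) (Suc n) = X" unfolding canon_def zL unfolding zS J(1) unfolding A_def[symmetric] by (rule J(3))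
    moreover have "canon p (Smat p z) m = canon p ?S m" if "m \<le> n" for m by (rule canon_cong) (use zn that in auto)
    moreover have "X $$ (i,j) = u (Suc n,i,j)" if "i \<le> j" "j < p" for i j using that by (simp add: X_def bmat_def)
    ultimately have "Uvec p (Suc n) z = ?m (Uvec p n x, u)"
      unfolding Uvec_def Ucan_eq[OF p] fun_eq_iff
      by (auto simp: merge_def sym_idx_def blk_def le_Suc_eq)
    then show ?thesis unfolding X_def[symmetric] g_def z_def[symmetric] using D by (simp add: cw_def indicator_def)
  qed
  have "(\<integral>\<^sup>+y. g y \<partial>leb_blk p (Suc n)) = ennreal (det A ^ (p + 1)) * (\<integral>\<^sup>+u. g (bvec p (Suc n) (L + A * bmat p (Suc n) u * A)) \<partial>leb_blk p (Suc n))"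
    by (rule congruence_change_of_variables[OF I(1) LR(1) gm, symmetric])
  also have "(\<integral>\<^sup>+u. g (bvec p (Suc n) (L + A * bmat p (Suc n) u * A)) \<partial>leb_blk p (Suc n))
    = (\<integral>\<^sup>+u. ennreal (cw p 0 (bmat p (Suc n) u)) * F (?m (Uvec p n x,u)) \<partial>leb_blk p (Suc n))"
    by (intro nn_integral_cong point)
  \<comment> \<open>\<open>A\<close> is the square root of the width, whose determinant is a product
    over the earlier canonical moments; taking the root inside the product gives
    \<open>cw p 1\<close> factor by factor.\<close>
  also have "det A ^ (p + 1) = (\<Prod>m\<in>{1..n}. cw p 1 (Smat p (Uvec p n x) m))"
  proof -
    have "sqrt (\<Prod>m\<in>{1..n}. f m) = (\<Prod>m\<in>{1..n}. sqrt (f m))" for f :: "nat \<Rightarrow> real"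
      by (induction n) (simp_all add: atLeastAtMostSuc_conv real_sqrt_mult)
    then have "det A = (\<Prod>m\<in>{1..n}. sqrt (det (canon p ?S m) * det (1\<^sub>m p - canon p ?S m)))"
      unfolding I(8) L_def R_def canon_Hpos(1)[of p ?S n, OF p Smat_sym Smat_0 H] by simp
    then have "det A ^ (p + 1) = (\<Prod>m\<in>{1..n}. sqrt (det (canon p ?S m) * det (1\<^sub>m p - canon p ?S m)) ^ (p + 1))"
      by (simp only: prod_power_distrib)
    also have "\<dots> = (\<Prod>m\<in>{1..n}. cw p 1 (Smat p (Uvec p n x) m))"
      by (intro prod.cong refl) (use Un canon_Hpos(2)[of p ?S n, OF p Smat_sym Smat_0 H] in \<open>simp add: cw_def\<close>)
    finally show ?thesis .
  qed
  finally show ?thesis unfolding g_def .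
qed

text \<open>The last moment is integrated first. Each moment leaves one factor \<open>cw p 1\<close>
  for every earlier canonical moment, so the exponent \<open>n - m\<close> counts the moments after
  the \<open>m\<close>-th. The identity is unnormalized.\<close>

theorem canonical_moments_density:
  fixes F :: "(nat \<times> nat \<times> nat \<Rightarrow> real) \<Rightarrow> ennreal"
  assumes p: "0 < p" and F: "F \<in> borel_measurable (leb_sym p n)"
  shows "(\<integral>\<^sup>+x. indicator (Dset p n) x * F (Uvec p n x) \<partial>leb_sym p n) = (\<integral>\<^sup>+u. ennreal (cweight p (\<lambda>m. n - m) n u) * F u \<partial>leb_sym p n)"
  using F
proof (induction n arbitrary: F)
  case 0
  have I: "sym_idx p 0 = {}" by (auto simp: sym_idx_def)
  have "indicator (Dset p 0) x * F (Uvec p 0 x) = ennreal (cweight p (\<lambda>m. 0 - m) 0 x) * F x" if "x \<in> space (leb_sym p 0)" for x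
  proof -
    have "x = (\<lambda>_. undefined)" using that by (auto simp: space_leb_sym I)
    moreover have "Hpos p (Smat p x) 0" by (rule Hpos_0[of p "Smat p x", OF p Smat_sym Smat_0])
    ultimately show ?thesis by (simp add: Dset_def I Uvec_def cweight_def restrict_def)
  qed
  then show ?case by (intro nn_integral_cong) blast
next
  case (Suc n)
  let ?m = "merge (sym_idx p n) (blk p (Suc n))"
  define G where "G = (\<lambda>v. \<integral>\<^sup>+u. ennreal (cw p 0 (bmat p (Suc n) u)) * F (?m (v,u)) \<partial>leb_blk p (Suc n))"
  define F' where "F' = (\<lambda>v. ennreal (\<Prod>m\<in>{1..n}. cw p 1 (Smat p v m)) * G v)"
  interpret B: sigma_finite_measure "leb_blk p (Suc n)" by (rule sigma_finite_leb_blk)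
  have cwm: "(\<lambda>u. cw p 0 (bmat p (Suc n) u)) \<in> borel_measurable (leb_blk p (Suc n))" by (rule cw_measurable[OF bmat_measurable])
  have Gi: "(\<lambda>(v,u). ennreal (cw p 0 (bmat p (Suc n) u)) * F (?m (v,u))) \<in> borel_measurable (leb_sym p n \<Otimes>\<^sub>M leb_blk p (Suc n))"
  proof -
    have [measurable]: "(\<lambda>z. F (?m z)) \<in> borel_measurable (leb_sym p n \<Otimes>\<^sub>M leb_blk p (Suc n))"
      by (rule measurable_compose[OF merge_measurable_sym Suc.prems])
    have [measurable]: "(\<lambda>z. cw p 0 (bmat p (Suc n) (snd z))) \<in> borel_measurable (leb_sym p n \<Otimes>\<^sub>M leb_blk p (Suc n))"
      by (rule measurable_compose[OF measurable_snd cwm])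
    have "(\<lambda>z. ennreal (cw p 0 (bmat p (Suc n) (snd z))) * F (?m z)) \<in> borel_measurable (leb_sym p n \<Otimes>\<^sub>M leb_blk p (Suc n))"
      by measurable
    then show ?thesis by (simp add: case_prod_beta')
  qed
  have Gm: "G \<in> borel_measurable (leb_sym p n)" unfolding G_def by (rule B.borel_measurable_nn_integral[OF Gi])
  have Pm: "(\<lambda>v. \<Prod>m\<in>{1..n}. cw p 1 (Smat p v m)) \<in> borel_measurable (leb_sym p n)"
    by (intro borel_measurable_prod cw_measurable Smat_measurable) auto
  have F'm: "F' \<in> borel_measurable (leb_sym p n)" unfolding F'_def using Gm Pm by measurable
  have m1: "(\<lambda>z. indicator (Dset p (Suc n)) z * F (Uvec p (Suc n) z)) \<in> borel_measurable (leb_sym p (Suc n))"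
    using measurable_compose[OF Uvec_measurable[OF p] Suc.prems] sets_moment_space(1)[OF p] by measurable
  have "(\<integral>\<^sup>+x. indicator (Dset p (Suc n)) x * F (Uvec p (Suc n) x) \<partial>leb_sym p (Suc n))
    = (\<integral>\<^sup>+x. (\<integral>\<^sup>+y. indicator (Dset p (Suc n)) (?m (x,y)) * F (Uvec p (Suc n) (?m (x,y))) \<partial>leb_blk p (Suc n)) \<partial>leb_sym p n)"
    by (rule nn_integral_sym_idx_Suc[OF m1])
  also have "\<dots> = (\<integral>\<^sup>+x. indicator (Dset p n) x * F' (Uvec p n x) \<partial>leb_sym p n)"
  proof (rule nn_integral_cong)
    fix x assume x: "x \<in> space (leb_sym p n)"
    show "(\<integral>\<^sup>+y. indicator (Dset p (Suc n)) (?m (x,y)) * F (Uvec p (Suc n) (?m (x,y))) \<partial>leb_blk p (Suc n)) = indicator (Dset p n) x * F' (Uvec p n x)"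
    proof (cases "x \<in> Dset p n")
      case True
      then show ?thesis using inner_slice[OF p Suc.prems True] by (simp add: F'_def G_def)
    next
      case False
      have "?m (x,y) \<notin> Dset p (Suc n)" for y
      proof
        assume "?m (x,y) \<in> Dset p (Suc n)"
        then have "Hpos p (Smat p (?m (x,y))) n"
          using Hpos_mono[of p "Smat p (?m (x,y))" "Suc n" n, OF p Smat_sym Smat_0] by (simp add: Dset_def)
        then have "Hpos p (Smat p x) n" using Hpos_cong[of n "Smat p (?m (x,y))" "Smat p x" p] Smat_merge(1)[of _ n p x y] by blast
        then show False using False x by (simp add: Dset_def space_leb_sym)
      qed
      then show ?thesis using False by simp
    qed
  qed
  also have "\<dots> = (\<integral>\<^sup>+v. ennreal (cweight p (\<lambda>m. n - m) n v) * F' v \<partial>leb_sym p n)" by (rule Suc.IH[OF F'm])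
  also have "\<dots> = (\<integral>\<^sup>+v. (\<integral>\<^sup>+u. ennreal (cweight p (\<lambda>m. Suc n - m) (Suc n) (?m (v,u))) * F (?m (v,u)) \<partial>leb_blk p (Suc n)) \<partial>leb_sym p n)"
  proof (rule nn_integral_cong)
    fix v assume v: "v \<in> space (leb_sym p n)"
    \<comment> \<open>Passing from \<open>n\<close> to \<open>n + 1\<close> raises every earlier
      exponent by 1, which is the Jacobian factor; the new canonical moment enters with exponent
      0.\<close>
    have "cweight p (\<lambda>m. Suc n - m) (Suc n) (?m (v,u)) = (cweight p (\<lambda>m. n - m) n v * (\<Prod>m\<in>{1..n}. cw p 1 (Smat p v m))) * cw p 0 (bmat p (Suc n) u)" for u
    proof -
      have "cweight p (\<lambda>m. Suc n - m) (Suc n) (?m (v,u)) = (\<Prod>m\<in>{1..n}. cw p (Suc n - m) (Smat p (?m (v,u)) m)) * cw p 0 (bmat p (Suc n) u)"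
        unfolding cweight_def by (simp add: atLeastAtMostSuc_conv Smat_merge(2) mult.commute)
      also have "(\<Prod>m\<in>{1..n}. cw p (Suc n - m) (Smat p (?m (v,u)) m)) = (\<Prod>m\<in>{1..n}. cw p (n - m) (Smat p v m) * cw p 1 (Smat p v m))"
        by (intro prod.cong refl) (simp add: Smat_merge(1) cw_add[symmetric] Suc_diff_le)
      finally show ?thesis by (simp add: cweight_def prod.distrib)
    qed
    then have "(\<integral>\<^sup>+u. ennreal (cweight p (\<lambda>m. Suc n - m) (Suc n) (?m (v,u))) * F (?m (v,u)) \<partial>leb_blk p (Suc n))
      = (\<integral>\<^sup>+u. ennreal (cweight p (\<lambda>m. n - m) n v * (\<Prod>m\<in>{1..n}. cw p 1 (Smat p v m))) * (ennreal (cw p 0 (bmat p (Suc n) u)) * F (?m (v,u))) \<partial>leb_blk p (Suc n))"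
      by (intro nn_integral_cong) (simp add: ennreal_mult cweight_nonneg prod_nonneg cw_nonneg mult.assoc)
    also have "\<dots> = ennreal (cweight p (\<lambda>m. n - m) n v * (\<Prod>m\<in>{1..n}. cw p 1 (Smat p v m))) * G v"
      unfolding G_def by (rule nn_integral_cmult) (use measurable_compose[OF measurable_Pair1'[OF v] Gi] in simp)
    finally show "ennreal (cweight p (\<lambda>m. n - m) n v) * F' v = (\<integral>\<^sup>+u. ennreal (cweight p (\<lambda>m. Suc n - m) (Suc n) (?m (v,u))) * F (?m (v,u)) \<partial>leb_blk p (Suc n))"
      by (simp add: F'_def ennreal_mult cweight_nonneg prod_nonneg cw_nonneg mult.assoc)
  qed
  also have "\<dots> = (\<integral>\<^sup>+u. ennreal (cweight p (\<lambda>m. Suc n - m) (Suc n) u) * F u \<partial>leb_sym p (Suc n))"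
    by (rule nn_integral_sym_idx_Suc[symmetric]) (use Suc.prems cweight_measurable in measurable)
  finally show ?case .
qed

text \<open>The weight is a product over blocks, so the blocks after \<open>k\<close> integrate to a
  constant, which is left unevaluated. The exponents \<open>e\<close> stay those of the full
  vector.\<close>

lemma marginal_weight:
  fixes F :: "(nat \<times> nat \<times> nat \<Rightarrow> real) \<Rightarrow> ennreal"
  assumes "k \<le> n" and F: "F \<in> borel_measurable (leb_sym p k)"
  shows "(\<integral>\<^sup>+u. ennreal (cweight p e n u) * F (restrict u (sym_idx p k)) \<partial>leb_sym p n)
    = (\<Prod>m\<in>{k<..n}. \<integral>\<^sup>+u. ennreal (cw p (e m) (bmat p m u)) \<partial>leb_blk p m) * (\<integral>\<^sup>+u. ennreal (cweight p e k u) * F u \<partial>leb_sym p k)"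
  using assms(1)
proof (induction n rule: dec_induct)
  case base
  have "restrict u (sym_idx p k) = u" if "u \<in> space (leb_sym p k)" for u
    using that by (auto simp: space_leb_sym PiE_def extensional_restrict)
  then have "(\<integral>\<^sup>+u. ennreal (cweight p e k u) * F (restrict u (sym_idx p k)) \<partial>leb_sym p k) = (\<integral>\<^sup>+u. ennreal (cweight p e k u) * F u \<partial>leb_sym p k)"
    by (intro nn_integral_cong) simp
  then show ?case by (simp only: order_refl greaterThanAtMost_empty prod.empty mult_1_left)
next
  case (step n)
  let ?m = "merge (sym_idx p n) (blk p (Suc n))"
  define C where "C = (\<integral>\<^sup>+u. ennreal (cw p (e (Suc n)) (bmat p (Suc n) u)) \<partial>leb_blk p (Suc n))"
  have sub: "sym_idx p k \<subseteq> sym_idx p j" if "k \<le> j" for j using that by (auto simp: sym_idx_def)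
  have rm: "(\<lambda>u. restrict u (sym_idx p k)) \<in> measurable (leb_sym p j) (leb_sym p k)" if "k \<le> j" for j
    unfolding leb_sym_def by (rule measurable_restrict_subset[OF sub[OF that]])
  have mm: "(\<lambda>u. ennreal (cweight p e j u) * F (restrict u (sym_idx p k))) \<in> borel_measurable (leb_sym p j)" if "k \<le> j" for j
    using measurable_compose[OF rm[OF that] F] cweight_measurable by measurable
  have "(\<integral>\<^sup>+u. ennreal (cweight p e (Suc n) u) * F (restrict u (sym_idx p k)) \<partial>leb_sym p (Suc n))
    = (\<integral>\<^sup>+v. (\<integral>\<^sup>+u. ennreal (cweight p e (Suc n) (?m (v,u))) * F (restrict (?m (v,u)) (sym_idx p k)) \<partial>leb_blk p (Suc n)) \<partial>leb_sym p n)"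
    using step(1) by (intro nn_integral_sym_idx_Suc mm) simp
  also have "\<dots> = (\<integral>\<^sup>+v. C * (ennreal (cweight p e n v) * F (restrict v (sym_idx p k))) \<partial>leb_sym p n)"
  proof (rule nn_integral_cong)
    fix v assume v: "v \<in> space (leb_sym p n)"
    have "cweight p e (Suc n) (?m (v,u)) = cw p (e (Suc n)) (bmat p (Suc n) u) * cweight p e n v" for u
      unfolding cweight_def by (simp add: atLeastAtMostSuc_conv Smat_merge)
    moreover have "restrict (?m (v,u)) (sym_idx p k) = restrict v (sym_idx p k)" for u
      by (rule restrict_ext) (use sub[OF step(1)] in \<open>auto simp: merge_def\<close>)
    ultimately have "(\<integral>\<^sup>+u. ennreal (cweight p e (Suc n) (?m (v,u))) * F (restrict (?m (v,u)) (sym_idx p k)) \<partial>leb_blk p (Suc n))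
      = (\<integral>\<^sup>+u. ennreal (cw p (e (Suc n)) (bmat p (Suc n) u)) * (ennreal (cweight p e n v) * F (restrict v (sym_idx p k))) \<partial>leb_blk p (Suc n))"
      by (intro nn_integral_cong) (simp add: ennreal_mult cweight_nonneg cw_nonneg mult.assoc)
    then show "(\<integral>\<^sup>+u. ennreal (cweight p e (Suc n) (?m (v,u))) * F (restrict (?m (v,u)) (sym_idx p k)) \<partial>leb_blk p (Suc n)) = C * (ennreal (cweight p e n v) * F (restrict v (sym_idx p k)))"
      unfolding C_def by (simp only:) (rule nn_integral_multc[OF measurable_compose[OF cw_measurable[OF bmat_measurable] measurable_ennreal]])
  qed
  also have "\<dots> = C * (\<integral>\<^sup>+v. ennreal (cweight p e n v) * F (restrict v (sym_idx p k)) \<partial>leb_sym p n)"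
    by (rule nn_integral_cmult[OF mm[OF step(1)]])
  finally have e: "(\<integral>\<^sup>+u. ennreal (cweight p e (Suc n) u) * F (restrict u (sym_idx p k)) \<partial>leb_sym p (Suc n))
    = C * (\<integral>\<^sup>+v. ennreal (cweight p e n v) * F (restrict v (sym_idx p k)) \<partial>leb_sym p n)" .
  have "{k<..Suc n} = insert (Suc n) {k<..n}" using step(1) by auto
  then have pr: "(\<Prod>m\<in>{k<..Suc n}. c m) = c (Suc n) * (\<Prod>m\<in>{k<..n}. c m)" for c :: "nat \<Rightarrow> ennreal" by simp
  show ?case unfolding e step.IH pr C_def by (simp only: mult.assoc)
qed

subsection \<open>The Gaussian limit\<close>

lemma one_minus_spec:
  assumes Q: "orth_mat n Q" shows "1\<^sub>m n - spec n Q g = spec n Q (\<lambda>i. 1 - g i)"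
proof -
  have "1 \<cdot>\<^sub>m spec n Q (\<lambda>_. 1) + (-1) \<cdot>\<^sub>m spec n Q g = spec n Q (\<lambda>i. 1 * 1 + (-1) * g i)" by (rule spec_linear[OF Q])
  moreover have "1 \<cdot>\<^sub>m spec n Q (\<lambda>_. 1) + (-1) \<cdot>\<^sub>m spec n Q g = 1\<^sub>m n - spec n Q g"
    unfolding spec_one[OF Q] using carrier_matD[OF spec_carrier[OF Q, of g]] by (intro eq_matI) auto
  ultimately show ?thesis by simp
qed

lemma sqrt_prod: "sqrt (\<Prod>i<(n::nat). f i) = (\<Prod>i<n. sqrt (f i))"
  by (induction n) (simp_all add: real_sqrt_mult)

definition affm :: "nat \<Rightarrow> real \<Rightarrow> real mat \<Rightarrow> real mat" where
  "affm p s Z = (1 / s) \<cdot>\<^sub>m Z + (1 / 2) \<cdot>\<^sub>m 1\<^sub>m p"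

text \<open>The factor \<open>2 ^ (p e (p+1))\<close> normalizes the value at the center of the cube to 1.\<close>

definition gw :: "nat \<Rightarrow> real \<Rightarrow> nat \<Rightarrow> real mat \<Rightarrow> real" where
  "gw p s e Z = cw p e (affm p s Z) * 2 ^ (p * (e * (p + 1)))"

text \<open>Per eigenvalue, (1/2 + f/s)(1/2 - f/s) = (1 - 4 f^2/s^2)/4; the \<open>p\<close> factors
  1/2 that leave the square root are cancelled by the normalization.\<close>

lemma gw_spec:
  assumes Q: "orth_mat p Q" and s: "0 < s"
  shows "gw p s e (spec p Q f) = (if \<forall>i<p. \<bar>f i\<bar> < s / 2 then (\<Prod>i<p. sqrt (1 - 4 * (f i)\<^sup>2 / s\<^sup>2)) ^ (e * (p + 1)) else 0)"
proof -
  have A: "affm p s (spec p Q f) = spec p Q (\<lambda>i. f i / s + 1 / 2)"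
    unfolding affm_def spec_one[OF Q, symmetric] spec_linear[OF Q] by simp
  have B: "1\<^sub>m p - spec p Q (\<lambda>i. f i / s + 1 / 2) = spec p Q (\<lambda>i. 1 / 2 - f i / s)"
    unfolding one_minus_spec[OF Q] by (rule spec_cong) simp
  have "0 < x / s + 1 / 2 \<and> 0 < 1 / 2 - x / s \<longleftrightarrow> \<bar>x\<bar> < s / 2" for x
    using s by (auto simp: field_simps abs_less_iff)
  then have c: "cube p (spec p Q (\<lambda>i. f i / s + 1 / 2)) \<longleftrightarrow> (\<forall>i<p. \<bar>f i\<bar> < s / 2)"
    unfolding cube_def B spec_definite(3)[OF Q] by metis
  have "(f i / s + 1 / 2) * (1 / 2 - f i / s) = (1 / 4) * (1 - 4 * (f i)\<^sup>2 / s\<^sup>2)" for i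
    using s by (simp add: field_simps power2_eq_square)
  then have "sqrt ((f i / s + 1 / 2) * (1 / 2 - f i / s)) = (1 / 2) * sqrt (1 - 4 * (f i)\<^sup>2 / s\<^sup>2)" for i
    by (simp only: real_sqrt_mult) (simp add: real_sqrt_divide)
  then have "sqrt (det (spec p Q (\<lambda>i. f i / s + 1 / 2)) * det (spec p Q (\<lambda>i. 1 / 2 - f i / s))) = (\<Prod>i<p. (1/2) * sqrt (1 - 4 * (f i)\<^sup>2 / s\<^sup>2))"
    by (simp only: det_spec[OF Q] prod.distrib[symmetric] sqrt_prod)
  also have "\<dots> = (1/2) ^ p * (\<Prod>i<p. sqrt (1 - 4 * (f i)\<^sup>2 / s\<^sup>2))" by (subst prod.distrib) simp
  finally have d: "sqrt (det (spec p Q (\<lambda>i. f i / s + 1 / 2)) * det (spec p Q (\<lambda>i. 1 / 2 - f i / s))) = (1/2) ^ p * (\<Prod>i<p. sqrt (1 - 4 * (f i)\<^sup>2 / s\<^sup>2))" .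
  have "((1/2) ^ p * x) ^ E * 2 ^ (p * E) = x ^ E" for x :: real and E
  proof -
    have "((1/2) ^ p * x) ^ E * 2 ^ (p * E) = ((1/2) ^ p * 2 ^ p) ^ E * x ^ E"
      by (subst power_mult) (simp only: power_mult_distrib mult_ac)
    also have "(1/2) ^ p * 2 ^ p = (1::real)" by (simp add: power_mult_distrib[symmetric])
    finally show ?thesis by (simp only: power_one mult_1_left)
  qed
  then have "(if b then ((1/2) ^ p * x) ^ E else 0) * 2 ^ (p * E) = (if b then x ^ E else 0)" for x :: real and E b
    by (cases b) (simp_all only: if_True if_False mult_zero_left)
  then show ?thesis unfolding gw_def A cw_def B c d .
qed

lemma gw_nonneg: "0 \<le> gw p s e Z"
  by (simp add: gw_def cw_nonneg)

lemma mtr_square_spec: "orth_mat p Q \<Longrightarrow> mtr p (spec p Q f * spec p Q f) = (\<Sum>i<p. (f i)\<^sup>2)"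
  by (simp add: spec_mult mtr_spec power2_eq_square)

text \<open>From 1 - x \<le> exp(-x) the exponent is at most -(N - m)/(2N) times the trace of
  \<open>Z^2\<close>, and \<open>2 m \<le> N\<close> makes this coefficient at least 1/4 in absolute
  value. Half of the Gaussian decay thus survives uniformly in \<open>N\<close>.\<close>

lemma gw_bound:
  assumes Z: "sym_mat p Z" and s: "s = sqrt (4 * (real p + 1) * real N)" and N: "0 < N" "2 * m \<le> N"
  shows "gw p s (N - m) Z \<le> exp (- mtr p (Z * Z) / 4)"
proof -
  obtain Q f where Q: "orth_mat p Q" and Zf: "Z = spec p Q f" using sym_matE[OF Z] .
  have s0: "0 < s" and s2: "s\<^sup>2 = 4 * (real p + 1) * real N" using N by (auto simp: s)
  show ?thesis
  proof (cases "\<forall>i<p. \<bar>f i\<bar> < s / 2")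
    case True
    define E where "E = (N - m) * (p + 1)"
    define S where "S = (\<Sum>i<p. (f i)\<^sup>2)"
    have S0: "0 \<le> S" by (simp add: S_def sum_nonneg)
    have r: "0 \<le> sqrt (1 - 4 * (f i)\<^sup>2 / s\<^sup>2) \<and> sqrt (1 - 4 * (f i)\<^sup>2 / s\<^sup>2) \<le> exp (- (2 * (f i)\<^sup>2 / s\<^sup>2))" if "i < p" for i
    proof -
      have "\<bar>2 * f i\<bar> < s" using True that by auto
      then have "(2 * f i)\<^sup>2 < s\<^sup>2" using power_strict_mono[of "\<bar>2 * f i\<bar>" s 2] by simp
      then have "4 * (f i)\<^sup>2 / s\<^sup>2 < 1" using s0 by (simp add: power_mult_distrib)
      then have 0: "0 \<le> 1 - 4 * (f i)\<^sup>2 / s\<^sup>2" by simp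
      have "1 - 4 * (f i)\<^sup>2 / s\<^sup>2 \<le> exp (- (4 * (f i)\<^sup>2 / s\<^sup>2))"
        using exp_ge_add_one_self[of "- (4 * (f i)\<^sup>2 / s\<^sup>2)"] by simp
      also have "\<dots> = (exp (- (2 * (f i)\<^sup>2 / s\<^sup>2)))\<^sup>2" by (simp add: power2_eq_square exp_add[symmetric])
      finally have "sqrt (1 - 4 * (f i)\<^sup>2 / s\<^sup>2) \<le> sqrt ((exp (- (2 * (f i)\<^sup>2 / s\<^sup>2)))\<^sup>2)" by (rule real_sqrt_le_mono)
      then show ?thesis using 0 by simp
    qed
    have "(\<Prod>i<p. sqrt (1 - 4 * (f i)\<^sup>2 / s\<^sup>2)) \<le> (\<Prod>i<p. exp (- (2 * (f i)\<^sup>2 / s\<^sup>2)))"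
      by (rule prod_mono) (use r in auto)
    also have "\<dots> = exp (- (2 * S / s\<^sup>2))"
      by (simp add: exp_sum[symmetric] S_def sum_negf sum_distrib_left sum_divide_distrib)
    finally have "(\<Prod>i<p. sqrt (1 - 4 * (f i)\<^sup>2 / s\<^sup>2)) ^ E \<le> exp (- (2 * S / s\<^sup>2)) ^ E"
      using r by (intro power_mono prod_nonneg) auto
    also have "\<dots> = exp (- (real E * (2 * S / s\<^sup>2)))" by (simp add: exp_of_nat_mult[symmetric])
    also have "\<dots> \<le> exp (- S / 4)"
    proof -
      have "real N \<le> 2 * real (N - m)" using N(2) by (simp add: of_nat_diff)
      then have "S * real N \<le> S * (2 * real (N - m))" using S0 by (rule mult_left_mono)
      then have "S / 4 \<le> S * real (N - m) / (2 * real N)" using N(1) by (simp add: field_simps)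
      moreover have "real E * (2 * S / s\<^sup>2) = S * real (N - m) / (2 * real N)"
      proof -
        define q where "q = real p + 1"
        have "real E = real (N - m) * q" "s\<^sup>2 = 4 * q * real N" "0 < q" by (simp_all add: E_def q_def s2 distrib_left)
        then show ?thesis using N(1) by (simp add: field_simps)
      qed
      ultimately have "S / 4 \<le> real E * (2 * S / s\<^sup>2)" by (simp only:)
      then show ?thesis by simp
    qed
    finally show ?thesis unfolding Zf gw_spec[OF Q s0] mtr_square_spec[OF Q] using True by (simp add: E_def S_def)
  next
    case False
    show ?thesis unfolding Zf gw_spec[OF Q s0] if_not_P[OF False] by simp
  qed
qed

text \<open>The standard limit of \<open>(1 + x/N)^N\<close>, raised to the power
  \<open>(p + 1)/2\<close>. The fixed \<open>m\<close> is split off as a quotient whose denominator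
  tends to 1.\<close>

lemma power_limit:
  fixes a c :: real
  assumes c: "c = real (p + 1)"
  shows "(\<lambda>N. sqrt (1 - a / (c * real N)) ^ ((N - m) * (p + 1))) \<longlonglongrightarrow> exp (- a / 2)"
proof -
  define g where "g = (\<lambda>N. 1 - a / (c * real N))"
  have c0: "c > 0" by (simp add: c)
  have "(\<lambda>N. (a / c) * (1 / real N)) \<longlonglongrightarrow> (a / c) * 0" by (intro tendsto_intros lim_1_over_n)
  then have "(\<lambda>N. 1 - (a / c) * (1 / real N)) \<longlonglongrightarrow> 1 - 0" by (intro tendsto_intros) simp
  then have g1: "g \<longlonglongrightarrow> 1" by (simp add: g_def)
  have gp: "\<forall>\<^sub>F N in sequentially. 0 < g N" using order_tendstoD(1)[OF g1, of 0] by simp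
  have "(\<lambda>N. (1 + (- a / c) / real N) ^ N) \<longlonglongrightarrow> exp (- a / c)" by (rule tendsto_exp_limit_sequentially)
  then have gN: "(\<lambda>N. g N ^ N) \<longlonglongrightarrow> exp (- a / c)" by (simp add: g_def divide_divide_eq_left)
  have e: "sqrt (exp (- a / c)) ^ (p + 1) = exp (- a / 2)"
  proof -
    have "exp (- a / c) = (exp (- a / (2 * c)))\<^sup>2" using c0 by (simp add: exp_double[symmetric] field_simps)
    then have "sqrt (exp (- a / c)) = exp (- a / (2 * c))" by simp
    then have "sqrt (exp (- a / c)) ^ (p + 1) = exp (real (p + 1) * (- a / (2 * c)))" by (simp only: exp_of_nat_mult)
    then show ?thesis using c0 unfolding c[symmetric] by simp
  qed
  have "(\<lambda>N. sqrt (g N ^ N) ^ (p + 1) / sqrt (g N) ^ (m * (p + 1))) \<longlonglongrightarrow> sqrt (exp (- a / c)) ^ (p + 1) / sqrt 1 ^ (m * (p + 1))"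
    by (intro tendsto_intros gN g1) simp
  then have "(\<lambda>N. sqrt (g N ^ N) ^ (p + 1) / sqrt (g N) ^ (m * (p + 1))) \<longlonglongrightarrow> exp (- a / 2)" using e by simp
  moreover have "\<forall>\<^sub>F N in sequentially. sqrt (g N ^ N) ^ (p + 1) / sqrt (g N) ^ (m * (p + 1)) = sqrt (g N) ^ ((N - m) * (p + 1))"
    using gp eventually_ge_at_top[of m]
  proof eventually_elim
    case (elim N)
    have "sqrt (g N) ^ ((N - m) * (p + 1)) * sqrt (g N) ^ (m * (p + 1)) = sqrt (g N) ^ (N * (p + 1))"
      using elim(2) by (simp add: power_add[symmetric] add_mult_distrib[symmetric])
    also have "\<dots> = sqrt (g N ^ N) ^ (p + 1)" by (simp only: power_mult real_sqrt_power)
    finally show ?case using elim(1) by (simp add: field_simps)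
  qed
  ultimately show ?thesis unfolding g_def by (rule Lim_transform_eventually)
qed

lemma gw_limit:
  assumes Z: "sym_mat p Z"
  shows "(\<lambda>N. gw p (sqrt (4 * (real p + 1) * real N)) (N - m) Z) \<longlonglongrightarrow> exp (- mtr p (Z * Z) / 2)"
proof -
  obtain Q f where Q: "orth_mat p Q" and Zf: "Z = spec p Q f" using sym_matE[OF Z] .
  define s where "s = (\<lambda>N. sqrt (4 * (real p + 1) * real N))"
  have "filterlim (\<lambda>N. s N / 2) at_top sequentially"
  proof -
    have "filterlim (\<lambda>N. (4 * (real p + 1)) * real N) at_top sequentially"
      by (intro filterlim_tendsto_pos_mult_at_top[OF tendsto_const] filterlim_real_sequentially) simp
    then have "filterlim s at_top sequentially" unfolding s_def by (rule filterlim_compose[OF sqrt_at_top])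
    then have "filterlim (\<lambda>N. (1/2) * s N) at_top sequentially"
      by (intro filterlim_tendsto_pos_mult_at_top[OF tendsto_const]) simp_all
    then show ?thesis by simp
  qed
  \<comment> \<open>For fixed \<open>Z\<close> all rescaled eigenvalues eventually lie inside the
    cube, so the case distinction of \<open>gw_spec\<close> disappears in the limit.\<close>
  then have "\<forall>\<^sub>F N in sequentially. (\<Sum>i<p. \<bar>f i\<bar>) < s N / 2" by (rule filterlim_at_top_dense[THEN iffD1, rule_format])
  then have ev: "\<forall>\<^sub>F N in sequentially. (\<Prod>i<p. sqrt (1 - (f i)\<^sup>2 / (real (p + 1) * real N)) ^ ((N - m) * (p + 1))) = gw p (s N) (N - m) Z"
    using eventually_gt_at_top[of 0]
  proof eventually_elim
    case (elim N)
    have s0: "0 < s N" and s2: "(s N)\<^sup>2 = 4 * (real p + 1) * real N" using elim(2) by (auto simp: s_def)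
    have b: "\<bar>f i\<bar> < s N / 2" if "i < p" for i
    proof -
      have "\<bar>f i\<bar> \<le> (\<Sum>i<p. \<bar>f i\<bar>)" using that by (intro member_le_sum) auto
      then show ?thesis using elim(1) by linarith
    qed
    have "4 * x / (4 * (real p + 1) * real N) = x / (real (p + 1) * real N)" for x
    proof -
      have "4 * (real p + 1) * real N = 4 * (real (p + 1) * real N)" by simp
      then show ?thesis by (simp only: mult_divide_mult_cancel_left[of 4])
    qed
    then show ?case unfolding Zf gw_spec[OF Q s0] s2 using b by (simp add: prod_power_distrib)
  qed
  have "(\<lambda>N. \<Prod>i<p. sqrt (1 - (f i)\<^sup>2 / (real (p + 1) * real N)) ^ ((N - m) * (p + 1))) \<longlonglongrightarrow> (\<Prod>i<p. exp (- (f i)\<^sup>2 / 2))"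
    by (rule tendsto_prod) (rule power_limit[OF refl])
  moreover have "(\<Prod>i<p. exp (- (f i)\<^sup>2 / 2)) = exp (- mtr p (Z * Z) / 2)"
    unfolding Zf mtr_square_spec[OF Q] by (simp add: exp_sum[symmetric] sum_negf sum_divide_distrib)
  ultimately have "(\<lambda>N. \<Prod>i<p. sqrt (1 - (f i)\<^sup>2 / (real (p + 1) * real N)) ^ ((N - m) * (p + 1))) \<longlonglongrightarrow> exp (- mtr p (Z * Z) / 2)"
    by (simp only:)
  then show ?thesis using ev unfolding s_def by (rule Lim_transform_eventually)
qed

section \<open>The Gaussian weight and its normalization\<close>

definition wt :: "nat \<times> nat \<times> nat \<Rightarrow> real" where
  "wt = (\<lambda>(m,i,j). if i = j then 1 else 2)"

lemma wt_pos: "0 < wt b"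
  by (cases b) (simp add: wt_def)

text \<open>An off-diagonal coordinate stands for two entries of the symmetric matrix, hence the
  weight 2 in \<open>wt\<close>.\<close>

lemma sum_sym_square:
  fixes q :: "nat \<Rightarrow> nat \<Rightarrow> real"
  shows "(\<Sum>k<p. \<Sum>l<p. q (min k l) (max k l)) = (\<Sum>(m',i,j)\<in>blk p m. wt (m',i,j) * q i j)"
proof (induction p)
  case 0
  then show ?case by (simp add: blk_0)
next
  case (Suc p)
  have "(\<Sum>(m',i,j)\<in>blk (Suc p) m. wt (m',i,j) * q i j) = (\<Sum>(m',i,j)\<in>blk p m. wt (m',i,j) * q i j) + (\<Sum>(m',i,j)\<in>(\<lambda>i. (m,i,p)) ` {..p}. wt (m',i,j) * q i j)"
    unfolding blk_Suc by (rule sum.union_disjoint) (simp, simp, auto simp: blk_def)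
  also have "(\<Sum>(m',i,j)\<in>(\<lambda>i. (m,i,p)) ` {..p}. wt (m',i,j) * q i j) = (\<Sum>i\<le>p. wt (m,i,p) * q i p)"
    by (subst sum.reindex) (auto simp: inj_on_def)
  also have "\<dots> = (\<Sum>i<p. 2 * q i p) + q p p"
    by (simp add: lessThan_Suc_atMost[symmetric] wt_def)
  finally show ?case using Suc.IH by (simp add: sum.distrib sum_distrib_left[symmetric])
qed

lemma mtr_Smat:
  assumes "1 \<le> m"
  shows "mtr p (Smat p z m * Smat p z m) = (\<Sum>b\<in>blk p m. wt b * (z b)\<^sup>2)"
proof -
  have "mtr p (Smat p z m * Smat p z m) = (\<Sum>k<p. \<Sum>l<p. (z (m, min k l, max k l))\<^sup>2)"
    unfolding mtr_def using assms
    by (intro sum.cong refl) (simp add: Smat_def scalar_prod_def lessThan_atLeast0 power2_eq_square min.commute max.commute)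
  also have "\<dots> = (\<Sum>(m',i,j)\<in>blk p m. wt (m',i,j) * (z (m,i,j))\<^sup>2)"
    by (rule sum_sym_square[of "\<lambda>i j. (z (m,i,j))\<^sup>2"])
  also have "\<dots> = (\<Sum>b\<in>blk p m. wt b * (z b)\<^sup>2)"
    by (intro sum.cong) (auto simp: blk_def)
  finally show ?thesis .
qed

lemma prod_blocks: "(\<Prod>m\<in>{1..k}. \<Prod>b\<in>blk p m. g b) = (\<Prod>b\<in>sym_idx p k. g b)" for g :: "nat \<times> nat \<times> nat \<Rightarrow> real"
proof (induction k)
  case 0
  have "sym_idx p 0 = {}" by (auto simp: sym_idx_def)
  then show ?case by simp
next
  case (Suc k)
  have "(\<Prod>b\<in>sym_idx p (Suc k). g b) = (\<Prod>b\<in>sym_idx p k. g b) * (\<Prod>b\<in>blk p (Suc k). g b)"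
    unfolding sym_idx_Suc(1) by (rule prod.union_disjoint[OF finite_sym_idx finite_blk sym_idx_Suc(2)])
  then show ?case using Suc.IH by (simp add: atLeastAtMostSuc_conv mult.commute)
qed

definition gauss :: "nat \<Rightarrow> nat \<Rightarrow> real \<Rightarrow> (nat \<times> nat \<times> nat \<Rightarrow> real) \<Rightarrow> real" where
  "gauss p k c z = (\<Prod>m\<in>{1..k}. exp (- c * mtr p (Smat p z m * Smat p z m)))"

lemma gauss_prod: "gauss p k c z = (\<Prod>b\<in>sym_idx p k. exp (- (c * wt b) * (z b)\<^sup>2))"
proof -
  have "exp (- c * mtr p (Smat p z m * Smat p z m)) = (\<Prod>b\<in>blk p m. exp (- (c * wt b) * (z b)\<^sup>2))" if "m \<in> {1..k}" for m
    using that by (simp add: mtr_Smat exp_sum[symmetric] sum_distrib_left sum_negf mult.assoc)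
  then show ?thesis unfolding gauss_def prod_blocks[symmetric] by (intro prod.cong) auto
qed

lemma gaussian_1d:
  assumes a: "0 < (a::real)"
  shows "integrable lborel (\<lambda>x. exp (- a * x\<^sup>2))" "(\<integral>x. exp (- a * x\<^sup>2) \<partial>lborel) = sqrt (pi / a)"
proof -
  define \<sigma> where "\<sigma> = sqrt (1 / (2 * a))"
  have s2: "\<sigma>\<^sup>2 = 1 / (2 * a)" using a by (simp add: \<sigma>_def)
  have e: "exp (- a * x\<^sup>2) = sqrt (pi / a) * normal_density 0 \<sigma> x" for x
    unfolding normal_density_def s2 using a by (simp add: real_sqrt_divide real_sqrt_mult)
  have s0: "0 < \<sigma>" using a by (simp add: \<sigma>_def)
  show "integrable lborel (\<lambda>x. exp (- a * x\<^sup>2))" unfolding e using s0 by (intro integrable_mult_right integrable_normal_density)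
  show "(\<integral>x. exp (- a * x\<^sup>2) \<partial>lborel) = sqrt (pi / a)" unfolding e using s0 by simp
qed

lemma gauss_integrable:
  assumes "0 < c"
  shows "integrable (leb_sym p k) (gauss p k c)" "(\<integral>z. gauss p k c z \<partial>leb_sym p k) = (\<Prod>b\<in>sym_idx p k. sqrt (pi / (c * wt b)))"
proof -
  interpret product_sigma_finite "\<lambda>_::nat\<times>nat\<times>nat. lborel :: real measure" by standard
  have c: "0 < c * wt b" for b using assms wt_pos by simp
  show "integrable (leb_sym p k) (gauss p k c)"
    unfolding gauss_prod[abs_def] leb_sym_def by (rule product_integrable_prod[OF finite_sym_idx]) (rule gaussian_1d(1)[OF c])
  have "(\<integral>z. gauss p k c z \<partial>leb_sym p k) = (\<Prod>b\<in>sym_idx p k. \<integral>x. exp (- (c * wt b) * x\<^sup>2) \<partial>lborel)"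
    unfolding gauss_prod leb_sym_def by (rule product_integral_prod[OF finite_sym_idx]) (rule gaussian_1d(1)[OF c])
  then show "(\<integral>z. gauss p k c z \<partial>leb_sym p k) = (\<Prod>b\<in>sym_idx p k. sqrt (pi / (c * wt b)))"
    unfolding gaussian_1d(2)[OF c] .
qed

text \<open>The one-dimensional integrals are \<open>sqrt (2 pi)\<close> for the \<open>p\<close>
  diagonal and \<open>sqrt pi\<close> for the p(p-1)/2 off-diagonal coordinates, the latter having
  half the variance. Induction on \<open>p\<close> adds one column.\<close>

lemma goe_normalization:
  "(\<Prod>b\<in>blk p m. sqrt (pi / ((1/2) * wt b))) = (2*pi) powr (real p / 2) * pi powr (real p * (real p - 1) / 4)"
proof (induction p)
  case 0
  then show ?case by (simp add: blk_0)
next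
  case (Suc p)
  have "(\<Prod>b\<in>blk (Suc p) m. sqrt (pi / ((1/2) * wt b))) = (\<Prod>b\<in>blk p m. sqrt (pi / ((1/2) * wt b))) * (\<Prod>b\<in>(\<lambda>i. (m,i,p)) ` {..p}. sqrt (pi / ((1/2) * wt b)))"
    unfolding blk_Suc by (rule prod.union_disjoint) (simp, simp, auto simp: blk_def)
  also have "(\<Prod>b\<in>(\<lambda>i. (m,i,p)) ` {..p}. sqrt (pi / ((1/2) * wt b))) = (\<Prod>i\<le>p. sqrt (pi / ((1/2) * wt (m,i,p))))"
    by (subst prod.reindex) (auto simp: inj_on_def)
  also have "\<dots> = sqrt pi ^ p * sqrt (2 * pi)"
    by (simp add: lessThan_Suc_atMost[symmetric] wt_def mult.commute)
  also have "sqrt pi ^ p = pi powr (real p / 2)"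
    by (simp add: powr_half_sqrt[symmetric] powr_realpow[symmetric] powr_powr)
  also have "sqrt (2 * pi) = (2 * pi) powr (1 / 2)" by (simp add: powr_half_sqrt)
  finally have "(\<Prod>b\<in>blk (Suc p) m. sqrt (pi / ((1/2) * wt b))) =
    ((2*pi) powr (real p / 2) * (2*pi) powr (1 / 2)) * (pi powr (real p * (real p - 1) / 4) * pi powr (real p / 2))"
    unfolding Suc.IH by (simp only: mult_ac)
  also have "\<dots> = (2*pi) powr (real (Suc p) / 2) * pi powr (real (Suc p) * (real (Suc p) - 1) / 4)"
    unfolding powr_add[symmetric] by (intro arg_cong2[of _ _ _ _ "(*)"] arg_cong2[of _ _ _ _ "(powr)"]) (simp_all add: field_simps)
  finally show ?case .
qed

text \<open>Writes the explicit GOE constant as an integral of the unnormalized weight, so that the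
  limit has the same quotient form as the laws for finite \<open>n\<close>.\<close>

lemma goe_gauss:
  "(\<Prod>m\<in>{1..k}. goe_density p (Smat p z m)) = gauss p k (1/2) z / (\<integral>z. gauss p k (1/2) z \<partial>leb_sym p k)"
proof -
  define K where "K = (2*pi) powr (real p / 2) * pi powr (real p * (real p - 1) / 4)"
  have K: "K > 0" by (simp add: K_def)
  have "goe_density p X = exp (- (1/2) * mtr p (X * X)) / K" for X
  proof -
    have "- real p / 2 = - (real p / 2)" "- real p * (real p - 1) / 4 = - (real p * (real p - 1) / 4)" by simp_all
    then show ?thesis unfolding goe_density_def mtr_def K_def by (simp only: powr_minus_divide) simp
  qed
  then have "(\<Prod>m\<in>{1..k}. goe_density p (Smat p z m)) = gauss p k (1/2) z / K ^ k"
    by (simp add: gauss_def prod_dividef)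
  moreover have "(\<integral>z. gauss p k (1/2) z \<partial>leb_sym p k) = (\<Prod>m\<in>{1..k}. \<Prod>b\<in>blk p m. sqrt (pi / ((1/2) * wt b)))"
    unfolding prod_blocks by (rule gauss_integrable(2)) simp
  then have "(\<integral>z. gauss p k (1/2) z \<partial>leb_sym p k) = K ^ k"
    unfolding goe_normalization K_def[symmetric] by simp
  ultimately show ?thesis by simp
qed

lemma gauss_integral_pos: "0 < (\<integral>z. gauss p k (1/2) z \<partial>leb_sym p k)"
  using gauss_integrable(2)[of "1/2" p k] wt_pos by (simp add: prod_pos)

section \<open>Rescaling around the center of the cube\<close>

definition shift :: "nat \<Rightarrow> nat \<Rightarrow> real \<Rightarrow> (nat \<times> nat \<times> nat \<Rightarrow> real) \<Rightarrow> (nat \<times> nat \<times> nat \<Rightarrow> real)" where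
  "shift p k s z = (\<lambda>(m,i,j)\<in>sym_idx p k. (1 / s) * z (m,i,j) + (if i = j then 1 / 2 else 0))"

definition unshift :: "nat \<Rightarrow> nat \<Rightarrow> real \<Rightarrow> (nat \<times> nat \<times> nat \<Rightarrow> real) \<Rightarrow> (nat \<times> nat \<times> nat \<Rightarrow> real)" where
  "unshift p k s u = (\<lambda>(m,i,j)\<in>sym_idx p k. s * (u (m,i,j) - (if i = j then 1 / 2 else 0)))"

definition gweight :: "nat \<Rightarrow> nat \<Rightarrow> real \<Rightarrow> (nat \<Rightarrow> nat) \<Rightarrow> (nat \<times> nat \<times> nat \<Rightarrow> real) \<Rightarrow> real" where
  "gweight p k s e z = (\<Prod>m\<in>{1..k}. gw p s (e m) (Smat p z m))"

lemma Smat_shift: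
  assumes "1 \<le> m" "m \<le> k" shows "Smat p (shift p k s z) m = affm p s (Smat p z m)"
proof (rule eq_matI)
  fix i j assume "i < dim_row (affm p s (Smat p z m))" "j < dim_col (affm p s (Smat p z m))"
  then have ij: "i < p" "j < p" by (auto simp: affm_def)
  then have "(m, min i j, max i j) \<in> sym_idx p k" using assms by (auto simp: sym_idx_def)
  moreover have "min i j = max i j \<longleftrightarrow> i = j" by auto
  ultimately show "Smat p (shift p k s z) m $$ (i,j) = affm p s (Smat p z m) $$ (i,j)"
    using ij assms by (simp add: Smat_def shift_def affm_def)
qed (use assms in \<open>auto simp: affm_def Smat_def\<close>)

lemma unshift_shift:
  assumes "s \<noteq> 0" "z \<in> extensional (sym_idx p k)" shows "unshift p k s (shift p k s z) = z"
proof
  fix b :: "nat \<times> nat \<times> nat"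
  obtain m i j where b: "b = (m,i,j)" by (cases b)
  show "unshift p k s (shift p k s z) b = z b"
    using assms by (cases "b \<in> sym_idx p k") (auto simp: b unshift_def shift_def extensional_def)
qed

lemma shift_measurable: "shift p k s \<in> measurable (leb_sym p k) (leb_sym p k)"
proof -
  have "(\<lambda>z. \<lambda>b\<in>sym_idx p k. (case b of (m,i,j) \<Rightarrow> (1 / s) * z (m,i,j) + (if i = j then 1 / 2 else 0))) \<in> measurable (leb_sym p k) (PiM (sym_idx p k) (\<lambda>_. lborel))"
  proof (rule measurable_restrict)
    fix b assume b: "b \<in> sym_idx p k"
    obtain m i j where e: "b = (m,i,j)" by (cases b)
    have "(\<lambda>z. z (m,i,j)) \<in> borel_measurable (leb_sym p k)" using b unfolding e leb_sym_def by measurable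
    then show "(\<lambda>z. case b of (m,i,j) \<Rightarrow> (1 / s) * z (m,i,j) + (if i = j then 1 / 2 else 0)) \<in> measurable (leb_sym p k) lborel"
      by (simp add: e)
  qed
  then show ?thesis by (simp only: shift_def[abs_def] leb_sym_def)
qed

lemma sets_leb_sym: "sets (leb_sym p k) = sets (PiM (sym_idx p k) (\<lambda>_. borel))"
  unfolding leb_sym_def by (rule sets_PiM_cong) auto

lemma unshift_measurable: "unshift p k s \<in> measurable (leb_sym p k) (leb_sym p k)"
proof -
  have "(\<lambda>z. \<lambda>b\<in>sym_idx p k. (case b of (m,i,j) \<Rightarrow> s * (z (m,i,j) - (if i = j then 1 / 2 else 0)))) \<in> measurable (leb_sym p k) (PiM (sym_idx p k) (\<lambda>_. lborel))"
  proof (rule measurable_restrict)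
    fix b assume b: "b \<in> sym_idx p k"
    obtain m i j where e: "b = (m,i,j)" by (cases b)
    have "(\<lambda>z. z (m,i,j)) \<in> borel_measurable (leb_sym p k)" using b unfolding e leb_sym_def by measurable
    then show "(\<lambda>z. case b of (m,i,j) \<Rightarrow> s * (z (m,i,j) - (if i = j then 1 / 2 else 0))) \<in> measurable (leb_sym p k) lborel"
      by (simp add: e)
  qed
  then show ?thesis by (simp only: unshift_def[abs_def] leb_sym_def)
qed

lemma gweight_shift: "gweight p k s e z = cweight p e k (shift p k s z) * (\<Prod>m\<in>{1..k}. 2 ^ (p * (e m * (p + 1))))"
  unfolding gweight_def cweight_def gw_def prod.distrib[symmetric]
  by (intro prod.cong refl) (simp add: Smat_shift)

lemma gweight_nonneg: "0 \<le> gweight p k s e z"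
  unfolding gweight_def by (intro prod_nonneg gw_nonneg ballI)

lemma gweight_measurable: "gweight p k s e \<in> borel_measurable (leb_sym p k)"
  unfolding gweight_shift[abs_def]
  by (intro borel_measurable_times measurable_compose[OF shift_measurable cweight_measurable] borel_measurable_const)

text \<open>The Jacobian of the affine map and the normalization of \<open>gw\<close> are collected
  in \<open>C\<close>, which depends on \<open>s\<close> and \<open>e\<close> but not on
  \<open>F\<close> and will cancel.\<close>

lemma shift_change_of_variables:
  assumes s: "0 < s"
  obtains C :: real where "0 < C"
    "\<And>F :: (nat \<times> nat \<times> nat \<Rightarrow> real) \<Rightarrow> ennreal. F \<in> borel_measurable (leb_sym p k) \<Longrightarrow>
      (\<integral>\<^sup>+u. ennreal (cweight p e k u) * F u \<partial>leb_sym p k) = ennreal C * (\<integral>\<^sup>+z. ennreal (gweight p k s e z) * F (shift p k s z) \<partial>leb_sym p k)"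
proof -
  define E :: real where "E = (\<Prod>m\<in>{1..k}. 2 ^ (p * (e m * (p + 1))))"
  define D :: real where "D = (\<Prod>b\<in>sym_idx p k. \<bar>1 / s\<bar>)"
  have E: "0 < E" unfolding E_def by (intro prod_pos) simp
  have D: "0 < D" unfolding D_def using s by (intro prod_pos) simp
  define h :: "nat \<times> nat \<times> nat \<Rightarrow> (nat \<times> nat \<times> nat \<Rightarrow> real) \<Rightarrow> real" where "h = (\<lambda>(m,i,j) _. if i = j then 1 / 2 else 0)"
  have hz: "(\<lambda>b\<in>sym_idx p k. (1 / s) * z b + h b z) = shift p k s z" for z
    unfolding shift_def h_def by (auto simp: fun_eq_iff restrict_def)
  show thesis
  proof (rule that[of "D / E"])
    show "0 < D / E" using D E by simp
    fix F :: "(nat \<times> nat \<times> nat \<Rightarrow> real) \<Rightarrow> ennreal" assume F: "F \<in> borel_measurable (leb_sym p k)"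
    note [measurable] = F cweight_measurable gweight_measurable
    have [measurable]: "(\<lambda>z. F (shift p k s z)) \<in> borel_measurable (leb_sym p k)"
      by (rule measurable_compose[OF shift_measurable F])
    have m: "(\<lambda>z. ennreal (gweight p k s e z) * F (shift p k s z)) \<in> borel_measurable (leb_sym p k)"
      by measurable
    have f: "(\<lambda>u. ennreal (cweight p e k u) * F u) \<in> borel_measurable (PiM (sym_idx p k) (\<lambda>_. lborel))"
      unfolding leb_sym_def[symmetric] by measurable
    have h: "h b \<in> borel_measurable (PiM (sym_idx p k) (\<lambda>_. lborel))" for b by (cases b) (simp add: h_def)
    have "(\<integral>\<^sup>+u. ennreal (cweight p e k u) * F u \<partial>leb_sym p k)
      = (\<Prod>b\<in>sym_idx p k. ennreal \<bar>1 / s\<bar>) * (\<integral>\<^sup>+z. ennreal (cweight p e k (\<lambda>b\<in>sym_idx p k. (1 / s) * z b + h b z)) * F (\<lambda>b\<in>sym_idx p k. (1 / s) * z b + h b z) \<partial>leb_sym p k)"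
      unfolding leb_sym_def
      by (rule triangular_change_of_variables[OF finite_sym_idx _ h _ f, of "\<lambda>_. 1 / s" "\<lambda>_. 0", symmetric])
        (use s in \<open>auto simp: h_def\<close>)
    also have "\<dots> = ennreal D * (\<integral>\<^sup>+z. ennreal (1 / E) * (ennreal (gweight p k s e z) * F (shift p k s z)) \<partial>leb_sym p k)"
    proof -
      have "ennreal (cweight p e k (shift p k s z)) = ennreal (1 / E) * ennreal (gweight p k s e z)" for z
        unfolding gweight_shift E_def[symmetric] using E by (simp add: ennreal_mult'[symmetric])
      then show ?thesis unfolding hz D_def by (simp only: prod_ennreal[OF abs_ge_zero] mult.assoc)
    qed
    also have "\<dots> = ennreal D * (ennreal (1 / E) * (\<integral>\<^sup>+z. ennreal (gweight p k s e z) * F (shift p k s z) \<partial>leb_sym p k))"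
      by (simp only: nn_integral_cmult[OF m])
    also have "\<dots> = ennreal (D / E) * (\<integral>\<^sup>+z. ennreal (gweight p k s e z) * F (shift p k s z) \<partial>leb_sym p k)"
      using D E by (simp add: mult.assoc[symmetric] ennreal_mult'[symmetric])
    finally show "(\<integral>\<^sup>+u. ennreal (cweight p e k u) * F u \<partial>leb_sym p k) = ennreal (D / E) * (\<integral>\<^sup>+z. ennreal (gweight p k s e z) * F (shift p k s z) \<partial>leb_sym p k)" .
  qed
qed

text \<open>For \<open>s = 1\<close> all eigenvalues in the cube are below 1/2 in absolute value, so
  the trace of \<open>Z^2\<close> is at most p/4 and the right side is at least 1. The bound holds
  for every exponent and serves only to make the total mass finite.\<close>

lemma gw_bound_crude:
  assumes Z: "sym_mat p Z" shows "gw p 1 e Z \<le> exp (real p / 4) * exp (- mtr p (Z * Z))"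
proof -
  obtain Q f where Q: "orth_mat p Q" and Zf: "Z = spec p Q f" using sym_matE[OF Z] .
  have one: "(0::real) < 1" by simp
  show ?thesis
  proof (cases "\<forall>i<p. \<bar>f i\<bar> < 1 / 2")
    case True
    have r: "4 * (f i)\<^sup>2 \<le> 1" if "i < p" for i
    proof -
      have "\<bar>2 * f i\<bar> \<le> 1" using True that by auto
      then have "(2 * f i)\<^sup>2 \<le> 1" by (simp only: abs_square_le_1)
      then show ?thesis by (simp add: power_mult_distrib)
    qed
    have "(\<Prod>i<p. sqrt (1 - 4 * (f i)\<^sup>2 / 1\<^sup>2)) ^ (e * (p + 1)) \<le> 1"
      using r by (intro power_le_one prod_nonneg prod_le_1) auto
    moreover have "(\<Sum>i<p. (f i)\<^sup>2) \<le> (\<Sum>i<p. 1 / 4)" by (intro sum_mono) (use r in force)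
    then have "1 \<le> exp (real p / 4 - (\<Sum>i<p. (f i)\<^sup>2))" by simp
    ultimately have "(\<Prod>i<p. sqrt (1 - 4 * (f i)\<^sup>2 / 1\<^sup>2)) ^ (e * (p + 1)) \<le> exp (real p / 4 + - (\<Sum>i<p. (f i)\<^sup>2))"
      by (simp only: diff_conv_add_uminus)
    then show ?thesis unfolding Zf gw_spec[OF Q one] mtr_square_spec[OF Q] exp_add[symmetric] if_P[OF True] .
  next
    case False
    show ?thesis unfolding Zf gw_spec[OF Q one] if_not_P[OF False] by simp
  qed
qed

lemma gauss_nonneg: "0 \<le> gauss p k c z"
  by (simp add: gauss_def prod_nonneg)

lemma cweight_integral_finite: "(\<integral>\<^sup>+u. ennreal (cweight p e n u) \<partial>leb_sym p n) < \<infinity>"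
proof -
  have "0 < (1::real)" by simp
  then obtain C where C: "\<And>F :: (nat \<times> nat \<times> nat \<Rightarrow> real) \<Rightarrow> ennreal. F \<in> borel_measurable (leb_sym p n) \<Longrightarrow>
      (\<integral>\<^sup>+u. ennreal (cweight p e n u) * F u \<partial>leb_sym p n) = ennreal C * (\<integral>\<^sup>+z. ennreal (gweight p n 1 e z) * F (shift p n 1 z) \<partial>leb_sym p n)"
    using shift_change_of_variables[of 1 p n e] by blast
  have "gweight p n 1 e z \<le> exp (real p / 4) ^ n * gauss p n 1 z" for z
  proof -
    have "gweight p n 1 e z \<le> (\<Prod>m\<in>{1..n}. exp (real p / 4) * exp (- 1 * mtr p (Smat p z m * Smat p z m)))"
      unfolding gweight_def by (intro prod_mono) (use gw_bound_crude[OF Smat_sym] gw_nonneg in auto)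
    then show ?thesis by (simp add: gauss_def prod.distrib)
  qed
  then have "(\<integral>\<^sup>+z. ennreal (gweight p n 1 e z) \<partial>leb_sym p n) \<le> (\<integral>\<^sup>+z. ennreal (exp (real p / 4) ^ n * gauss p n 1 z) \<partial>leb_sym p n)"
    by (intro nn_integral_mono ennreal_leI)
  also have "\<dots> < \<infinity>"
    using gauss_integrable(1)[of 1 p n]
    by (subst nn_integral_eq_integral) (auto simp: gauss_nonneg)
  finally show ?thesis using C[of "\<lambda>_. 1"] by (simp add: ennreal_mult_less_top)
qed

section \<open>Convergence of the rescaled densities\<close>

definition speed :: "nat \<Rightarrow> nat \<Rightarrow> real" where "speed p N = sqrt (4 * (real p + 1) * real N)"

lemma speed_pos: "0 < N \<Longrightarrow> 0 < speed p N"
  by (simp add: speed_def)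

definition gdens :: "nat \<Rightarrow> nat \<Rightarrow> nat \<Rightarrow> (nat \<times> nat \<times> nat \<Rightarrow> real) \<Rightarrow> real" where
  "gdens p k N = gweight p k (speed p N) (\<lambda>m. N - m)"

lemma gdens_bound:
  assumes "0 < N" "2 * k \<le> N" shows "gdens p k N z \<le> gauss p k (1/4) z"
  unfolding gdens_def gweight_def gauss_def
proof (intro prod_mono conjI gw_nonneg)
  fix m assume "m \<in> {1..k}"
  then have "2 * m \<le> N" using assms by auto
  then show "gw p (speed p N) (N - m) (Smat p z m) \<le> exp (- (1 / 4) * mtr p (Smat p z m * Smat p z m))"
    using gw_bound[OF Smat_sym[of p z m] speed_def assms(1)] by simp
qed

lemma gdens_measurable: "gdens p k N \<in> borel_measurable (leb_sym p k)"
  unfolding gdens_def by (rule gweight_measurable)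

lemma gdens_nonneg: "0 \<le> gdens p k N z"
  unfolding gdens_def by (rule gweight_nonneg)

lemma gdens_integrable:
  assumes "0 < N" "2 * k \<le> N" shows "integrable (leb_sym p k) (gdens p k N)"
  by (rule Bochner_Integration.integrable_bound[OF gauss_integrable(1)[of "1/4"] gdens_measurable])
    (auto simp: gdens_nonneg gauss_nonneg gdens_bound[OF assms])

lemma gdens_limit:
  assumes f: "f \<in> borel_measurable (leb_sym p k)" and B: "\<And>z. \<bar>f z\<bar> \<le> B"
  shows "(\<lambda>N. \<integral>z. gdens p k N z * f z \<partial>leb_sym p k) \<longlonglongrightarrow> (\<integral>z. gauss p k (1/2) z * f z \<partial>leb_sym p k)"
proof -
  \<comment> \<open>This offset makes every index positive and at least \<open>2 k\<close>, where
    the dominating function of \<open>gdens_bound\<close> is available.\<close>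
  define M where "M = 2 * k + 1"
  have "(\<lambda>N. gdens p k N z) \<longlonglongrightarrow> gauss p k (1/2) z" for z
  proof -
    have "(\<lambda>N. gw p (speed p N) (N - m) (Smat p z m)) \<longlonglongrightarrow> exp (- (1/2) * mtr p (Smat p z m * Smat p z m))" for m
      using gw_limit[OF Smat_sym[of p z m], of m] unfolding speed_def by simp
    then show ?thesis unfolding gdens_def gweight_def gauss_def by (intro tendsto_prod)
  qed
  then have "(\<lambda>N. gdens p k (N + M) z) \<longlonglongrightarrow> gauss p k (1/2) z" for z by (rule LIMSEQ_ignore_initial_segment)
  then have l: "(\<lambda>N. gdens p k (N + M) z * f z) \<longlonglongrightarrow> gauss p k (1/2) z * f z" for z by (intro tendsto_mult tendsto_const)
  have b: "norm (gdens p k (N + M) z * f z) \<le> gauss p k (1/4) z * B" for N z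
    unfolding real_norm_def abs_mult using gdens_bound[of "N + M" k p z] B[of z] gdens_nonneg[of p k "N + M" z]
    by (intro mult_mono) (auto simp: M_def)
  have "(\<lambda>N. \<integral>z. gdens p k (N + M) z * f z \<partial>leb_sym p k) \<longlonglongrightarrow> (\<integral>z. gauss p k (1/2) z * f z \<partial>leb_sym p k)"
  proof (rule integral_dominated_convergence)
    show "(\<lambda>z. gauss p k (1/2) z * f z) \<in> borel_measurable (leb_sym p k)"
      using f borel_measurable_integrable[OF gauss_integrable(1)[of "1/2" p k]] by simp
    show "(\<lambda>z. gdens p k (N + M) z * f z) \<in> borel_measurable (leb_sym p k)" for N
      using f gdens_measurable by simp
    show "integrable (leb_sym p k) (\<lambda>z. gauss p k (1/4) z * B)" using gauss_integrable(1)[of "1/4" p k] by simp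
    show "AE z in leb_sym p k. (\<lambda>N. gdens p k (N + M) z * f z) \<longlonglongrightarrow> gauss p k (1/2) z * f z" using l by simp
    show "AE z in leb_sym p k. norm (gdens p k (N + M) z * f z) \<le> gauss p k (1/4) z * B" for N using b by simp
  qed
  then show ?thesis by (rule LIMSEQ_offset)
qed

lemma cweight_eq_0_iff: "cweight p e n u = 0 \<longleftrightarrow> (\<exists>m\<in>{1..n}. \<not> cube p (Smat p u m))"
proof -
  have "cw p e X = 0 \<longleftrightarrow> \<not> cube p X" for e X
    using cube_det_pos[of p X] by (auto simp: cw_def)
  then show ?thesis unfolding cweight_def by (subst prod_zero_iff) auto
qed

text \<open>Where the weight vanishes does not depend on the exponents. If the total mass were 0 for
  one choice of \<open>e\<close>, it would be 0 for all, and every \<open>gdens\<close> would have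
  integral 0, contradicting the convergence of these integrals to a positive Gaussian
  integral.\<close>

lemma cweight_integral_pos: "0 < (\<integral>\<^sup>+u. ennreal (cweight p e n u) \<partial>leb_sym p n)"
proof (rule ccontr)
  assume "\<not> ?thesis"
  then have "(\<integral>\<^sup>+u. ennreal (cweight p e n u) \<partial>leb_sym p n) = 0" by simp
  then have "AE u in leb_sym p n. ennreal (cweight p e n u) = 0"
    using nn_integral_0_iff_AE[of "\<lambda>u. ennreal (cweight p e n u)" "leb_sym p n"] cweight_measurable by simp
  then have ae: "AE u in leb_sym p n. \<exists>m\<in>{1..n}. \<not> cube p (Smat p u m)"
  proof eventually_elim
    case (elim u)
    then have "cweight p e n u = 0" using cweight_nonneg[of p e n u] by (simp add: ennreal_eq_0_iff)
    then show ?case by (simp only: cweight_eq_0_iff)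
  qed
  have 0: "(\<integral>z. gdens p n N z \<partial>leb_sym p n) = 0" if N: "0 < N" for N
  proof -
    obtain C where C0: "0 < C" and C: "\<And>F :: (nat \<times> nat \<times> nat \<Rightarrow> real) \<Rightarrow> ennreal. F \<in> borel_measurable (leb_sym p n) \<Longrightarrow>
        (\<integral>\<^sup>+u. ennreal (cweight p (\<lambda>m. N - m) n u) * F u \<partial>leb_sym p n)
        = ennreal C * (\<integral>\<^sup>+z. ennreal (gdens p n N z) * F (shift p n (speed p N) z) \<partial>leb_sym p n)"
      unfolding gdens_def using shift_change_of_variables[OF speed_pos[OF N], of p n "\<lambda>m. N - m"] by blast
    have "AE u in leb_sym p n. ennreal (cweight p (\<lambda>m. N - m) n u) = 0"
      using ae by eventually_elim (simp add: cweight_eq_0_iff[of p "\<lambda>m. N - m" n, THEN iffD2])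
    then have "(\<integral>\<^sup>+u. ennreal (cweight p (\<lambda>m. N - m) n u) \<partial>leb_sym p n) = 0"
      using nn_integral_0_iff_AE[of "\<lambda>u. ennreal (cweight p (\<lambda>m. N - m) n u)" "leb_sym p n"] cweight_measurable by simp
    then have "(\<integral>\<^sup>+z. ennreal (gdens p n N z) \<partial>leb_sym p n) = 0" using C[of "\<lambda>_. 1"] C0 by simp
    then show ?thesis using integral_eq_nn_integral[OF gdens_measurable, of p n N] gdens_nonneg by simp
  qed
  have "(\<lambda>N. \<integral>z. gdens p n N z \<partial>leb_sym p n) \<longlonglongrightarrow> (\<integral>z. gauss p n (1/2) z \<partial>leb_sym p n)"
    using gdens_limit[of "\<lambda>_. 1" p n 1] by simp
  moreover have "\<forall>\<^sub>F N in sequentially. (\<integral>z. gdens p n N z \<partial>leb_sym p n) = 0"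
    using eventually_gt_at_top[of 0] by eventually_elim (rule 0)
  then have "(\<lambda>N. \<integral>z. gdens p n N z \<partial>leb_sym p n) \<longlonglongrightarrow> 0" by (rule tendsto_eventually)
  ultimately show False using LIMSEQ_unique gauss_integral_pos[where p=p and k=n] by (metis order_less_irrefl)
qed

section \<open>The law of the rescaled canonical moments\<close>

lemma emeasure_Dset:
  assumes "0 < p" shows "emeasure (leb_sym p n) (Dset p n) = (\<integral>\<^sup>+u. ennreal (cweight p (\<lambda>m. n - m) n u) \<partial>leb_sym p n)"
  using canonical_moments_density[OF assms, of "\<lambda>_. 1" n] sets_moment_space(1)[OF assms, of n] by simp

lemma scaled_U_unshift:
  assumes "k \<le> n" shows "scaled_U p k n x = unshift p k (speed p n) (restrict (Uvec p n x) (sym_idx p k))"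
proof
  fix b :: "nat \<times> nat \<times> nat"
  obtain m i j where b: "b = (m,i,j)" by (cases b)
  have "b \<in> sym_idx p k \<Longrightarrow> b \<in> sym_idx p n" using assms by (auto simp: sym_idx_def)
  then show "scaled_U p k n x b = unshift p k (speed p n) (restrict (Uvec p n x) (sym_idx p k)) b"
    by (auto simp: b scaled_U_def unshift_def Uvec_def speed_def)
qed

lemma restrict_sym_measurable:
  assumes "k \<le> n" shows "(\<lambda>u. restrict u (sym_idx p k)) \<in> measurable (leb_sym p n) (leb_sym p k)"
  unfolding leb_sym_def by (rule measurable_restrict_subset) (use assms in \<open>auto simp: sym_idx_def\<close>)

text \<open>Combines the joint density, the marginal and the rescaling. \<open>K\<close> gathers all
  constants; it depends on \<open>n\<close> but not on the event \<open>A\<close>, which is all that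
  normalization needs.\<close>

lemma scaled_U_mass:
  assumes p: "0 < p" and k: "k \<le> n" and n: "0 < n"
  obtains K :: ennreal where "\<And>A. A \<in> sets (leb_sym p k) \<Longrightarrow>
    emeasure (leb_sym p n) (Dset p n \<inter> scaled_U p k n -` A) = K * (\<integral>\<^sup>+z. ennreal (gdens p k n z) * indicator A z \<partial>leb_sym p k)"
proof -
  let ?I = "sym_idx p k" and ?s = "speed p n" and ?e = "\<lambda>m. n - m"
  note s = speed_pos[OF n, of p]
  define R :: ennreal where "R = (\<Prod>m\<in>{k<..n}. \<integral>\<^sup>+u. ennreal (cw p (?e m) (bmat p m u)) \<partial>leb_blk p m)"
  obtain C where C: "\<And>F :: (nat \<times> nat \<times> nat \<Rightarrow> real) \<Rightarrow> ennreal. F \<in> borel_measurable (leb_sym p k) \<Longrightarrow>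
      (\<integral>\<^sup>+u. ennreal (cweight p ?e k u) * F u \<partial>leb_sym p k) = ennreal C * (\<integral>\<^sup>+z. ennreal (gdens p k n z) * F (shift p k ?s z) \<partial>leb_sym p k)"
    unfolding gdens_def using shift_change_of_variables[OF s, of p k ?e] by blast
  show thesis
  proof (rule that[of "R * ennreal C"])
    fix A assume A: "A \<in> sets (leb_sym p k)"
    define F :: "(nat \<times> nat \<times> nat \<Rightarrow> real) \<Rightarrow> ennreal" where "F = (\<lambda>u. indicator A (unshift p k ?s u))"
    have F: "F \<in> borel_measurable (leb_sym p k)"
      unfolding F_def by (rule measurable_compose[OF unshift_measurable]) (use A in simp)
    have FR: "(\<lambda>u. F (restrict u ?I)) \<in> borel_measurable (leb_sym p n)"
      by (rule measurable_compose[OF restrict_sym_measurable[OF k] F])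
    have T: "scaled_U p k n \<in> measurable (leb_sym p n) (leb_sym p k)"
      using scaled_U_measurable[OF p k] by (simp cong: measurable_cong_sets add: sets_leb_sym)
    have "Dset p n \<inter> scaled_U p k n -` A = Dset p n \<inter> (scaled_U p k n -` A \<inter> space (leb_sym p n))"
      by (auto simp: Dset_def space_leb_sym)
    then have "Dset p n \<inter> scaled_U p k n -` A \<in> sets (leb_sym p n)"
      using sets_moment_space(1)[OF p, of n] measurable_sets[OF T A] by simp
    then have "emeasure (leb_sym p n) (Dset p n \<inter> scaled_U p k n -` A) = (\<integral>\<^sup>+x. indicator (Dset p n \<inter> scaled_U p k n -` A) x \<partial>leb_sym p n)"
      by simp
    also have "\<dots> = (\<integral>\<^sup>+x. indicator (Dset p n) x * F (restrict (Uvec p n x) ?I) \<partial>leb_sym p n)"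
      by (intro nn_integral_cong) (simp only: F_def scaled_U_unshift[OF k, symmetric], auto simp: indicator_def)
    also have "\<dots> = (\<integral>\<^sup>+u. ennreal (cweight p ?e n u) * F (restrict u ?I) \<partial>leb_sym p n)"
      by (rule canonical_moments_density[OF p FR])
    also have "\<dots> = R * (\<integral>\<^sup>+u. ennreal (cweight p ?e k u) * F u \<partial>leb_sym p k)"
      unfolding R_def by (rule marginal_weight[OF k F])
    also have "\<dots> = R * (ennreal C * (\<integral>\<^sup>+z. ennreal (gdens p k n z) * F (shift p k ?s z) \<partial>leb_sym p k))"
      unfolding C[OF F] ..
    also have "(\<integral>\<^sup>+z. ennreal (gdens p k n z) * F (shift p k ?s z) \<partial>leb_sym p k) = (\<integral>\<^sup>+z. ennreal (gdens p k n z) * indicator A z \<partial>leb_sym p k)"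
      using s by (intro nn_integral_cong) (simp add: F_def unshift_shift space_leb_sym PiE_def)
    finally show "emeasure (leb_sym p n) (Dset p n \<inter> scaled_U p k n -` A) = R * ennreal C * (\<integral>\<^sup>+z. ennreal (gdens p k n z) * indicator A z \<partial>leb_sym p k)"
      by (simp only: mult.assoc)
  qed
qed

lemma Dset_subset: "0 < p \<Longrightarrow> Dset p n \<subseteq> moment_space p n"
  by (auto simp: Dset_def moment_space_eq Hpos_def Hpsd_def pd_imp_psd)

text \<open>Numerator and denominator of the uniform probability carry the same constant
  \<open>K\<close>, so their quotient is the quotient of the integrals of \<open>gdens\<close> over
  the event and over the whole space.\<close>

lemma distr_scaled_U:
  assumes p: "0 < p" and n: "0 < n" "2 * k \<le> n"
  shows "distr (uniform_measure (leb_sym p n) (moment_space p n)) (PiM (sym_idx p k) (\<lambda>_. borel)) (scaled_U p k n)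
    = density (leb_sym p k) (\<lambda>z. ennreal (gdens p k n z / (\<integral>z. gdens p k n z \<partial>leb_sym p k)))"
proof -
  let ?L = "leb_sym p n" and ?M = "moment_space p n" and ?D = "Dset p n" and ?T = "scaled_U p k n"
  define J where "J = (\<integral>z. gdens p k n z \<partial>leb_sym p k)"
  have k: "k \<le> n" using n by simp
  have T: "?T \<in> measurable ?L (leb_sym p k)"
    using scaled_U_measurable[OF p k] by (simp cong: measurable_cong_sets add: sets_leb_sym)
  note sets = sets_moment_space[OF p, of n]
  obtain K where K: "\<And>A. A \<in> sets (leb_sym p k) \<Longrightarrow> emeasure ?L (?D \<inter> ?T -` A) = K * (\<integral>\<^sup>+z. ennreal (gdens p k n z) * indicator A z \<partial>leb_sym p k)"
    using scaled_U_mass[OF p k n(1)] by blast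
  have Jn: "(\<integral>\<^sup>+z. ennreal (gdens p k n z) \<partial>leb_sym p k) = ennreal J"
    unfolding J_def by (rule nn_integral_eq_integral[OF gdens_integrable[OF n]]) (simp add: gdens_nonneg)
  have J0: "0 \<le> J" unfolding J_def by (simp add: gdens_nonneg)
  have De: "emeasure ?L ?D = K * ennreal J"
  proof -
    have "?D = ?D \<inter> ?T -` space (leb_sym p k)"
      using measurable_space[OF T] sets.sets_into_space[OF sets(1)] by auto
    then have "emeasure ?L ?D = K * (\<integral>\<^sup>+z. ennreal (gdens p k n z) * indicator (space (leb_sym p k)) z \<partial>leb_sym p k)"
      using K[OF sets.top] by simp
    also have "(\<integral>\<^sup>+z. ennreal (gdens p k n z) * indicator (space (leb_sym p k)) z \<partial>leb_sym p k) = ennreal J"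
      unfolding Jn[symmetric] by (intro nn_integral_cong) simp
    finally show ?thesis .
  qed
  have fin: "K * ennreal J < \<infinity>" and pos: "0 < K * ennreal J"
    unfolding De[symmetric] emeasure_Dset[OF p] by (rule cweight_integral_finite, rule cweight_integral_pos)
  have J: "0 < J" using pos J0 by (cases "J = 0") auto
  \<comment> \<open>Cancelling \<open>K\<close> in an \<open>ennreal\<close> quotient requires both
    conditions; they follow from the positive finite total mass.\<close>
  have K0: "K \<noteq> 0" "K \<noteq> \<infinity>" using pos fin J by (auto simp: ennreal_top_mult)
  \<comment> \<open>The law is uniform on the whole moment space, the density formula is for
    \<open>Dset\<close>; the null difference makes them agree on every event.\<close>
  have null: "emeasure ?L (?M \<inter> B) = emeasure ?L (?D \<inter> B)" if B: "B \<in> sets ?L" for B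
  proof (rule antisym)
    have "emeasure ?L (?M - ?D) = 0"
      using emeasure_Diff[OF _ sets(2) sets(1) Dset_subset[OF p]] fin De emeasure_moment_space[OF p, of n] by simp
    moreover have "emeasure ?L (?M \<inter> B) \<le> emeasure ?L ((?D \<inter> B) \<union> (?M - ?D))"
      using sets B by (intro emeasure_mono) auto
    moreover have "\<dots> \<le> emeasure ?L (?D \<inter> B) + emeasure ?L (?M - ?D)"
      using sets B by (intro emeasure_subadditive) auto
    ultimately show "emeasure ?L (?M \<inter> B) \<le> emeasure ?L (?D \<inter> B)" by simp
    show "emeasure ?L (?D \<inter> B) \<le> emeasure ?L (?M \<inter> B)"
      using Dset_subset[OF p, of n] sets B by (intro emeasure_mono) auto
  qed
  show ?thesis unfolding J_def[symmetric]
  proof (rule measure_eqI)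
    show "sets (distr (uniform_measure ?L ?M) (PiM (sym_idx p k) (\<lambda>_. borel)) ?T) = sets (density (leb_sym p k) (\<lambda>z. ennreal (gdens p k n z / J)))"
      by (simp add: sets_leb_sym)
    fix A assume "A \<in> sets (distr (uniform_measure ?L ?M) (PiM (sym_idx p k) (\<lambda>_. borel)) ?T)"
    then have A: "A \<in> sets (leb_sym p k)" "A \<in> sets (PiM (sym_idx p k) (\<lambda>_. borel))" by (simp_all add: sets_leb_sym)
    note B = measurable_sets[OF T A(1)]
    let ?G = "\<integral>\<^sup>+z. ennreal (gdens p k n z) * indicator A z \<partial>leb_sym p k"
    have "emeasure (distr (uniform_measure ?L ?M) (PiM (sym_idx p k) (\<lambda>_. borel)) ?T) A = emeasure (uniform_measure ?L ?M) (?T -` A \<inter> space ?L)"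
      by (subst emeasure_distr[OF _ A(2)]) (use scaled_U_measurable[OF p k] in \<open>simp_all cong: measurable_cong_sets\<close>)
    also have "\<dots> = emeasure ?L (?M \<inter> (?T -` A \<inter> space ?L)) / emeasure ?L ?M"
      by (rule emeasure_uniform_measure[OF sets(2) B])
    also have "\<dots> = emeasure ?L (?D \<inter> (?T -` A \<inter> space ?L)) / emeasure ?L ?D"
      unfolding null[OF B] emeasure_moment_space[OF p] ..
    also have "?D \<inter> (?T -` A \<inter> space ?L) = ?D \<inter> ?T -` A"
      by (auto simp: Dset_def space_leb_sym)
    also have "emeasure ?L (?D \<inter> ?T -` A) / emeasure ?L ?D = (K * ?G) / (K * ennreal J)"
      unfolding K[OF A(1)] De ..
    also have "\<dots> = ?G / ennreal J"
      unfolding mult.commute[of K] by (rule divide_mult_eq[OF K0])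
    also have "\<dots> = (\<integral>\<^sup>+z. ennreal (gdens p k n z) * indicator A z / ennreal J \<partial>leb_sym p k)"
      using gdens_measurable[of p k n] A(1) by (subst nn_integral_divide) simp_all
    also have "\<dots> = (\<integral>\<^sup>+z. ennreal (gdens p k n z / J) * indicator A z \<partial>leb_sym p k)"
      using J by (intro nn_integral_cong) (simp add: divide_ennreal[symmetric] gdens_nonneg indicator_def)
    also have "\<dots> = emeasure (density (leb_sym p k) (\<lambda>z. ennreal (gdens p k n z / J))) A"
      using gdens_measurable[of p k n] A(1) by (subst emeasure_density) simp_all
    finally show "emeasure (distr (uniform_measure ?L ?M) (PiM (sym_idx p k) (\<lambda>_. borel)) ?T) A = emeasure (density (leb_sym p k) (\<lambda>z. ennreal (gdens p k n z / J))) A" .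
  qed
qed

text \<open>Test functions live on functions over the full index type. That type is countable, so
  the Borel sets of the product topology are generated by coordinates, and the coordinates outside
  \<open>sym_idx\<close> are constant on the space in question.\<close>

lemma continuous_measurable_sym:
  fixes f :: "(nat \<times> nat \<times> nat \<Rightarrow> real) \<Rightarrow> real"
  assumes "continuous_on UNIV f" shows "f \<in> borel_measurable (leb_sym p k)"
proof -
  have "(\<lambda>z. z) \<in> measurable (leb_sym p k) (PiM UNIV (\<lambda>_. borel))"
  proof (rule measurable_PiM_single')
    fix b :: "nat \<times> nat \<times> nat"
    show "(\<lambda>z. z b) \<in> borel_measurable (leb_sym p k)"
    proof (cases "b \<in> sym_idx p k")
      case True
      then show ?thesis unfolding leb_sym_def by measurable
    next
      case False
      have "z b = undefined" if "z \<in> space (leb_sym p k)" for z :: "nat \<times> nat \<times> nat \<Rightarrow> real"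
        by (rule PiE_arb[OF that[unfolded space_leb_sym] False])
      then have "(\<lambda>z. z b) \<in> borel_measurable (leb_sym p k) \<longleftrightarrow> (\<lambda>_. undefined :: real) \<in> borel_measurable (leb_sym p k)"
        by (rule measurable_cong)
      then show ?thesis by simp
    qed
  qed simp
  then have "(\<lambda>z. z) \<in> measurable (leb_sym p k) (borel :: (nat \<times> nat \<times> nat \<Rightarrow> real) measure)"
    by (simp add: sets_PiM_equal_borel cong: measurable_cong_sets)
  then show ?thesis by (rule measurable_compose[OF _ borel_measurable_continuous_onI[OF assms]])
qed

theorem theorem4p3:
  fixes p k :: nat
  assumes "1 \<le> p" and "1 \<le> k"
  shows "conv_distr
     (\<lambda>n. distr (uniform_measure (leb_sym p n) (moment_space p n))
                 (PiM (sym_idx p k) (\<lambda>_. borel)) (scaled_U p k n))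
     (goe_k p k)"
  unfolding conv_distr_def
proof (intro allI impI)
  fix f :: "(nat \<times> nat \<times> nat \<Rightarrow> real) \<Rightarrow> real" assume f: "continuous_on UNIV f \<and> bounded (range f)"
  have p: "0 < p" using assms by simp
  let ?L = "leb_sym p k"
  have fm: "f \<in> borel_measurable ?L" using f continuous_measurable_sym by blast
  obtain B where B: "\<And>z. \<bar>f z\<bar> \<le> B" using f by (auto simp: bounded_iff)
  define J where "J = (\<lambda>n. \<integral>z. gdens p k n z \<partial>?L)"
  define G where "G = (\<integral>z. gauss p k (1/2) z \<partial>?L)"
  have J: "(\<integral>z. gdens p k n z \<partial>?L) = J n" for n by (simp add: J_def)
  have J0: "0 \<le> J n" for n unfolding J[symmetric] by (simp add: gdens_nonneg)
  have G0: "0 < G" unfolding G_def by (rule gauss_integral_pos)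
  have gm: "gauss p k (1/2) \<in> borel_measurable ?L" using borel_measurable_integrable[OF gauss_integrable(1)[of "1/2" p k]] by simp
  \<comment> \<open>The test function 1 shows that the normalizing integrals converge too, and
    \<open>G > 0\<close> permits division of the limits.\<close>
  have "J \<longlonglongrightarrow> G" unfolding J_def G_def using gdens_limit[of "\<lambda>_. 1" p k 1] by simp
  then have lim: "(\<lambda>n. (\<integral>z. gdens p k n z * f z \<partial>?L) / J n) \<longlonglongrightarrow> (\<integral>z. gauss p k (1/2) z * f z \<partial>?L) / G"
    using G0 by (intro tendsto_divide gdens_limit[OF fm B]) simp_all
  have "(\<integral>z. f z \<partial>goe_k p k) = (\<integral>z. (gauss p k (1/2) z / G) *\<^sub>R f z \<partial>?L)"
    unfolding goe_k_def goe_gauss G_def[symmetric]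
    by (rule integral_density[OF fm]) (use gm G0 in \<open>simp_all add: gauss_nonneg\<close>)
  then have lim_goe: "(\<integral>z. f z \<partial>goe_k p k) = (\<integral>z. gauss p k (1/2) z * f z \<partial>?L) / G" by simp
  \<comment> \<open>The density formula holds from \<open>n = 2 k\<close> on (and for positive
    \<open>n\<close>); smaller indices, including \<open>n < k\<close>, do not affect the
    limit.\<close>
  have "\<forall>\<^sub>F n in sequentially. (\<integral>z. gdens p k n z * f z \<partial>?L) / J n =
      (\<integral>x. f x \<partial>distr (uniform_measure (leb_sym p n) (moment_space p n)) (PiM (sym_idx p k) (\<lambda>_. borel)) (scaled_U p k n))"
    using eventually_gt_at_top[of 0] eventually_ge_at_top[of "2 * k"]
  proof eventually_elim
    case (elim n)
    have "(\<integral>x. f x \<partial>distr (uniform_measure (leb_sym p n) (moment_space p n)) (PiM (sym_idx p k) (\<lambda>_. borel)) (scaled_U p k n))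
      = (\<integral>z. (gdens p k n z / J n) *\<^sub>R f z \<partial>?L)"
      unfolding distr_scaled_U[OF p elim] J
      by (rule integral_density[OF fm]) (use gdens_measurable[of p k n] J0 in \<open>simp_all add: gdens_nonneg\<close>)
    then show ?case by simp
  qed
  with lim show "(\<lambda>n. \<integral>x. f x \<partial>distr (uniform_measure (leb_sym p n) (moment_space p n)) (PiM (sym_idx p k) (\<lambda>_. borel)) (scaled_U p k n))
      \<longlonglongrightarrow> (\<integral>x. f x \<partial>goe_k p k)"
    unfolding lim_goe by (rule Lim_transform_eventually)
qed

end
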